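(* Let $\Omega\subset\mathbb{R}^3$ be a connected open set containing $[0,1]^3$, let $\alpha,\beta,\gamma\in(0,1]$, and let $f:\Omega\to\mathbb{R}$ be a real analytic function such that none of $\partial_x f$, $\partial_y f$, $\partial_z f$ vanishes identically on $\Omega$. Then either $f$ is an analytic special form, or for all Borel sets $A,B,C\subset[0,1]$ with $\dim_H A=\alpha$, $\dim_H B=\beta$, $\dim_H C=\gamma$, the following hold: (i) If $\alpha+\beta+\gamma\le 2$, then $\dim_H f(A\times B\times C)\ge\max\{\alpha+\beta+\gamma-1,\,0\}$. (ii) If $\alpha+\beta+\gamma>2$, then $\mathcal{L}^1(f(A\times B\times C))>0$.
   Context: $\dim_H$ denotes Hausdorff dimension and $\mathcal{L}^1$ denotes Lebesgue measure on $\mathbb{R}$. $f(A\times B\times C)=\{f(x,y,z):x\in A,\ y\in B,\ z\in C\}$. Analytic special form (three variables): a real analytic function $f:\Omega\to\mathbb{R}$ is an analytic special form if on each connected region of $\Omega\setminus(\{\partial_x f=0\}\cup\{\partial_y f=0\}\cup\{\partial_z f=0\})$ there are univariate real analytic functions $g,h,k,l$ such that $f(x,y,z)=g(h(x)+k(y)+l(z))$. (The functions $g,h,k,l$ may depend on the region, and need only be defined where they are evaluated.) *)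

theory Defs
  imports "HOL-Analysis.Analysis"
begin

subsection \<open>Hausdorff dimension\<close>

text \<open>The conventions \<open>|{}|^s = 0\<close> and \<open>|U|^0 = 1\<close> for nonempty \<open>U\<close> have to be
  imposed by hand, because \<open>0 powr 0 = 0\<close>. With them the \<open>0\<close>-dimensional Hausdorff
  measure is counting measure.\<close>

definition diameter_powr :: "real \<Rightarrow> 'a::metric_space set \<Rightarrow> real" where
  "diameter_powr s U = (if U = {} then 0 else if s = 0 then 1 else diameter U powr s)"

text \<open>Boundedness of the covering sets is required because \<^const>\<open>diameter\<close> is
  unspecified on unbounded sets.\<close>

definition hausdorff_premeasure :: "real \<Rightarrow> real \<Rightarrow> 'a::metric_space set \<Rightarrow> ennreal" where
  "hausdorff_premeasure s \<delta> A =
     (INF U \<in> {U :: nat \<Rightarrow> 'a set. A \<subseteq> (\<Union>i. U i) \<and> (\<forall>i. bounded (U i) \<and> diameter (U i) \<le> \<delta>)}.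
        \<Sum>i. ennreal (diameter_powr s (U i)))"

definition hausdorff_measure :: "real \<Rightarrow> 'a::metric_space set \<Rightarrow> ennreal" where
  "hausdorff_measure s A = (SUP \<delta> \<in> {0<..}. hausdorff_premeasure s \<delta> A)"

definition hausdorff_dim :: "'a::metric_space set \<Rightarrow> ereal" where
  "hausdorff_dim A = Inf {ereal s | s. 0 \<le> s \<and> hausdorff_measure s A = 0}"

subsection \<open>Real analytic functions\<close>

text \<open>Multi-indices are the extensional functions from the coordinate directions to the
  naturals. The expansion has to represent \<open>f\<close> on a full ball around each point of
  \<open>S\<close>, so for a set \<open>S\<close> that is not open this is analyticity on a neighbourhood of
  \<open>S\<close>.\<close>

definition real_analytic_on :: "('a::euclidean_space \<Rightarrow> real) \<Rightarrow> 'a set \<Rightarrow> bool" where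
  "real_analytic_on f S \<longleftrightarrow>
     (\<forall>p\<in>S. \<exists>r>0. \<exists>c :: ('a \<Rightarrow> nat) \<Rightarrow> real. \<forall>x\<in>ball p r.
        ((\<lambda>m. c m * (\<Prod>b\<in>Basis. ((x - p) \<bullet> b) ^ m b)) has_sum f x) (Basis \<rightarrow>\<^sub>E UNIV))"

subsection \<open>Analytic special forms in three variables\<close>

definition partial_x :: "(real \<times> real \<times> real \<Rightarrow> real) \<Rightarrow> real \<times> real \<times> real \<Rightarrow> real" where
  "partial_x f = (\<lambda>(x, y, z). deriv (\<lambda>t. f (t, y, z)) x)"

definition partial_y :: "(real \<times> real \<times> real \<Rightarrow> real) \<Rightarrow> real \<times> real \<times> real \<Rightarrow> real" where
  "partial_y f = (\<lambda>(x, y, z). deriv (\<lambda>t. f (x, t, z)) y)"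

definition partial_z :: "(real \<times> real \<times> real \<Rightarrow> real) \<Rightarrow> real \<times> real \<times> real \<Rightarrow> real" where
  "partial_z f = (\<lambda>(x, y, z). deriv (\<lambda>t. f (x, y, t)) z)"

text \<open>The univariate functions may depend on the region, and each is required to be analytic
  only where it is evaluated.\<close>

definition analytic_special_form ::
    "(real \<times> real \<times> real \<Rightarrow> real) \<Rightarrow> (real \<times> real \<times> real) set \<Rightarrow> bool" where
  "analytic_special_form f \<Omega> \<longleftrightarrow>
     real_analytic_on f \<Omega> \<and>
     (\<forall>U \<in> components (\<Omega> - ({p. partial_x f p = 0} \<union> {p. partial_y f p = 0} \<union> {p. partial_z f p = 0})).
        \<exists>g h k l :: real \<Rightarrow> real.
          real_analytic_on h ((\<lambda>(x, y, z). x) ` U) \<and>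
          real_analytic_on k ((\<lambda>(x, y, z). y) ` U) \<and>
          real_analytic_on l ((\<lambda>(x, y, z). z) ` U) \<and>
          real_analytic_on g ((\<lambda>(x, y, z). h x + k y + l z) ` U) \<and>
          (\<forall>(x, y, z) \<in> U. f (x, y, z) = g (h x + k y + l z)))"

end

theory Submission
  imports Defs "HOL-Complex_Analysis.Complex_Analysis" "HOL-Real_Asymp.Real_Asymp" "HOL-Library.Nat_Bijection"
begin

text \<open>Consider \<open>f (\<cdot>, \<cdot>, z)\<close>, for \<open>z \<in> C\<close>, as a family of curved projections of the plane set \<open>A \<times> B\<close>. Where
  the direction of \<open>(f\<^sub>x, f\<^sub>y)\<close> turns as \<open>z\<close> varies, this family is transversal: for two points
  \<open>p, q\<close> of the plane either \<open>f (p, z) - f (q, z)\<close> or its \<open>z\<close>-derivative is comparable to \<open>p - q\<close>.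
  Take Frostman measures on compact parts of \<open>A\<close>, \<open>B\<close> and \<open>C\<close>. The energy at scale \<open>T\<close> of the
  image of the measure on \<open>A \<times> B\<close>, computed with the Poisson kernel, grows from scale to scale by a
  quantity whose Lebesgue average over \<open>z\<close> is controlled by transversality. Since this quantity
  is essentially constant in \<open>z\<close> at scale \<open>T\<close>, its average against the measure on \<open>C\<close> is
  controlled as well. By Cauchy-Schwarz the image of \<open>A \<times> B \<times> C\<close> is then large. The same holds
  after interchanging \<open>x\<close> and \<open>z\<close>.

  Sets of positive dimension have infinitely many points of positive local content. So if there is
  no such turning at any of these points, then by the identity theorem there is none in \<open>\<Omega>\<close>, which
  means that the quotients of two partial derivatives do not depend on the third variable. Hence on
  each component the gradient of \<open>f\<close> is parallel to some \<open>(h' x, k' y, l' z)\<close>, and \<open>f\<close> is a function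
  of \<open>h x + k y + l z\<close>.\<close>

subsection \<open>Analytic sets and capacitability\<close>

text \<open>Transversality controls Lebesgue averages in \<open>z\<close>, while \<open>C\<close>
  may be a null set. The passage to a measure on \<open>C\<close> needs an energy increment that is
  nonnegative and slowly varying in \<open>z\<close>. From scale \<open>2 * T\<close> to
  \<open>T\<close> the energy grows by at most \<open>T\<close> times the form of \<open>K1\<close>,
  minus the \<open>T\<close>-derivative of \<open>K0\<close>. \<open>K1\<close> changes sign, so
  integration by parts gives 1/d^2 instead of 1/(T d) for points at distance d; still its form is
  nonnegative, with a derivative controlled by similar forms, since its transform is
  \<open>\<xi> * exp (- T * \<xi>)\<close>. For exponents s, t, u and T = 2^-k the increment is
  about 2^((2-s-t-u)k): bounded energy and positive measure if s+t+u > 2, dimension s+t+u-1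
  otherwise. Exponents below the dimensions absorb logarithmic losses. No limit measures are built:
  finite weighted point sets, good down to scale 2^-n with constants independent of n, act as
  Frostman measures. Suslin sets serve twice: for compact subsets of positive content, and for the
  measurability of the image, which need not be Borel (\<open>emeasure\<close> is 0 off the
  measurable sets).\<close>

text \<open>Every analytic subset of the line is a projection of a closed subset of the Polish space of
  all real sequences.\<close>

definition suslin :: "real set \<Rightarrow> bool" where
  "suslin A \<longleftrightarrow> (\<exists>F :: (nat \<Rightarrow> real) set. closed F \<and> A = (\<lambda>\<sigma>. \<sigma> 0) ` F)"

lemma suslinI: "closed (F :: (nat \<Rightarrow> real) set) \<Longrightarrow> A = (\<lambda>\<sigma>. \<sigma> 0) ` F \<Longrightarrow> suslin A"
  unfolding suslin_def by (rule exI[of _ F]) simp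

lemma suslinE:
  assumes "suslin A"
  obtains F :: "(nat \<Rightarrow> real) set" where "closed F" "A = (\<lambda>\<sigma>. \<sigma> 0) ` F"
  using assms unfolding suslin_def by (elim exE conjE) (rule that)

lemma closed_coordinate_preimage:
  fixes C :: "'a::topological_space set" and u :: "('i \<Rightarrow> real) \<Rightarrow> 'a"
  assumes "closed C" "continuous_on UNIV u"
  shows "closed {\<sigma>. u \<sigma> \<in> C}"
  using closed_vimage[OF assms] by (simp add: vimage_def)

lemma continuous_on_reindex:
  "continuous_on UNIV (\<lambda>\<sigma> :: nat \<Rightarrow> real. (\<lambda>i. \<sigma> (u i)))"
  by (intro continuous_on_coordinatewise_then_product continuous_on_product_coordinates)

lemma suslin_closed: "closed A \<Longrightarrow> suslin A"
proof (rule suslinI)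
  assume "closed A"
  then show "closed {\<sigma> :: nat \<Rightarrow> real. \<sigma> 0 \<in> A}"
    by (rule closed_coordinate_preimage) simp
  show "A = (\<lambda>\<sigma>. \<sigma> 0) ` {\<sigma> :: nat \<Rightarrow> real. \<sigma> 0 \<in> A}"
  proof safe
    fix x assume "x \<in> A"
    then show "x \<in> (\<lambda>\<sigma>. \<sigma> 0) ` {\<sigma> :: nat \<Rightarrow> real. \<sigma> 0 \<in> A}"
      by (intro image_eqI[where x = "\<lambda>_. x"]) auto
  qed
qed

lemma suslin_sequenceE:
  assumes "\<And>n :: nat. suslin (A n)"
  obtains F :: "nat \<Rightarrow> (nat \<Rightarrow> real) set"
    where "\<And>n. closed (F n)" "\<And>n. A n = (\<lambda>\<sigma>. \<sigma> 0) ` F n"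
proof
  show "closed (SOME F :: (nat \<Rightarrow> real) set. closed F \<and> A n = (\<lambda>\<sigma>. \<sigma> 0) ` F)"
    and "A n = (\<lambda>\<sigma>. \<sigma> 0) ` (SOME F :: (nat \<Rightarrow> real) set. closed F \<and> A n = (\<lambda>\<sigma>. \<sigma> 0) ` F)" for n
    using someI_ex[OF assms[of n, unfolded suslin_def]] by (rule conjunct1, rule conjunct2)
qed

text \<open>One sequence stores countably many witnesses: coordinate 0 holds the common point,
  coordinate \<open>Suc (prod_encode (n, i))\<close> the entry \<open>i > 0\<close> of the
  \<open>n\<close>-th witness. Each condition concerns a subsequence only and stays closed.\<close>

lemma suslin_Inter:
  assumes "\<And>n :: nat. suslin (A n)"
  shows "suslin (\<Inter>n. A n)"
proof -
  obtain F :: "nat \<Rightarrow> (nat \<Rightarrow> real) set"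
    where F: "\<And>n. closed (F n)" "\<And>n. A n = (\<lambda>\<sigma>. \<sigma> 0) ` F n"
    using suslin_sequenceE[of A] assms by auto
  define w where "w n i = (if i = 0 then 0 else Suc (prod_encode (n, i)))" for n i :: nat
  show ?thesis
  proof (rule suslinI)
    show "closed (\<Inter>n. {\<sigma>. (\<lambda>i. \<sigma> (w n i)) \<in> F n})"
      by (intro closed_INT ballI closed_coordinate_preimage F continuous_on_reindex)
    show "(\<Inter>n. A n) = (\<lambda>\<sigma>. \<sigma> 0) ` (\<Inter>n. {\<sigma>. (\<lambda>i. \<sigma> (w n i)) \<in> F n})"
    proof safe
      fix x assume "x \<in> (\<Inter>n. A n)"
      then have "\<forall>n. \<exists>\<sigma>\<in>F n. x = \<sigma> 0" using F(2) by auto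
      then obtain s where s: "\<And>n. s n \<in> F n" "\<And>n. x = s n 0" by metis
      define \<sigma> where "\<sigma> j = (case j of 0 \<Rightarrow> x | Suc k \<Rightarrow> case prod_decode k of (n, i) \<Rightarrow> s n i)" for j
      have "(\<lambda>i. \<sigma> (w n i)) = s n" for n
        using s by (auto simp: \<sigma>_def w_def fun_eq_iff)
      moreover have "x = \<sigma> 0" by (simp add: \<sigma>_def)
      ultimately show "x \<in> (\<lambda>\<sigma>. \<sigma> 0) ` (\<Inter>n. {\<sigma>. (\<lambda>i. \<sigma> (w n i)) \<in> F n})"
        using s by auto
    next
      fix \<sigma> n assume "\<sigma> \<in> (\<Inter>n. {\<sigma>. (\<lambda>i. \<sigma> (w n i)) \<in> F n})"
      then have "(\<lambda>i. \<sigma> (w n i)) \<in> F n" by auto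
      then have "(\<lambda>i. \<sigma> (w n i)) 0 \<in> A n" unfolding F(2) by (rule imageI)
      then show "\<sigma> 0 \<in> A n" by (simp add: w_def)
    qed
  qed
qed

text \<open>Coordinate 1 holds the index of a set containing the point; the later entries of the
  witness are shifted past it.\<close>

lemma suslin_Union:
  assumes "\<And>n :: nat. suslin (A n)"
  shows "suslin (\<Union>n. A n)"
proof -
  obtain F :: "nat \<Rightarrow> (nat \<Rightarrow> real) set"
    where F: "\<And>n. closed (F n)" "\<And>n. A n = (\<lambda>\<sigma>. \<sigma> 0) ` F n"
    using suslin_sequenceE[of A] assms by auto
  define w where "w i = (if i = 0 then 0 else Suc i)" for i :: nat
  \<comment> \<open>A countable union of closed conditions need not be closed. But coordinate 1 is a
    natural number, and differing from \<open>n\<close> then means being at distance at least 1/2,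
    so the union can be written as an intersection of closed sets.\<close>
  define G where "G = {\<sigma> :: nat \<Rightarrow> real. \<sigma> 1 \<in> \<nat>} \<inter>
    (\<Inter>n. {\<sigma>. \<sigma> 1 \<in> {..real n - 1/2}} \<union> {\<sigma>. \<sigma> 1 \<in> {real n + 1/2..}} \<union> {\<sigma>. (\<lambda>i. \<sigma> (w i)) \<in> F n})"
  have G: "\<sigma> \<in> G \<longleftrightarrow> (\<exists>n. \<sigma> 1 = real n \<and> (\<lambda>i. \<sigma> (w i)) \<in> F n)" for \<sigma>
  proof
    assume *: "\<sigma> \<in> G"
    then obtain n where n: "\<sigma> 1 = real n" unfolding G_def Nats_def by auto
    from * have "\<sigma> 1 \<in> {..real n - 1/2} \<or> \<sigma> 1 \<in> {real n + 1/2..} \<or> (\<lambda>i. \<sigma> (w i)) \<in> F n"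
      unfolding G_def by blast
    with n show "\<exists>n. \<sigma> 1 = real n \<and> (\<lambda>i. \<sigma> (w i)) \<in> F n" by auto
  next
    assume "\<exists>n. \<sigma> 1 = real n \<and> (\<lambda>i. \<sigma> (w i)) \<in> F n"
    then obtain n where n: "\<sigma> 1 = real n" "(\<lambda>i. \<sigma> (w i)) \<in> F n" by blast
    have "m = n \<or> real n \<le> real m - 1/2 \<or> real n \<ge> real m + 1/2" for m by linarith
    then show "\<sigma> \<in> G" using n unfolding G_def by (auto, metis)
  qed
  show ?thesis
  proof (rule suslinI)
    show "closed G" unfolding G_def
      by (intro closed_Int closed_INT ballI closed_Un closed_coordinate_preimage F
          continuous_on_reindex closed_Nats) (auto intro!: closed_atMost closed_atLeast)
    show "(\<Union>n. A n) = (\<lambda>\<sigma>. \<sigma> 0) ` G"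
    proof safe
      fix x n assume "x \<in> A n"
      then obtain s where s: "s \<in> F n" "x = s 0" using F(2) by auto
      define \<sigma> where "\<sigma> j = (case j of 0 \<Rightarrow> x | Suc k \<Rightarrow> if k = 0 then real n else s k)" for j
      have "(\<lambda>i. \<sigma> (w i)) = s"
        using s by (auto simp: \<sigma>_def w_def fun_eq_iff)
      then have "\<sigma> \<in> G" using s G by (auto simp: \<sigma>_def)
      moreover have "x = \<sigma> 0" by (simp add: \<sigma>_def)
      ultimately show "x \<in> (\<lambda>\<sigma>. \<sigma> 0) ` G" by blast
    next
      fix \<sigma> assume "\<sigma> \<in> G"
      then obtain n where "(\<lambda>i. \<sigma> (w i)) \<in> F n" using G by auto
      then have "(\<lambda>i. \<sigma> (w i)) 0 \<in> A n" unfolding F(2) by (rule imageI)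
      then show "\<sigma> 0 \<in> (\<Union>n. A n)" by (auto simp: w_def)
    qed
  qed
qed

lemma suslin_open:
  assumes "open (A :: real set)" shows "suslin A"
proof -
  \<comment> \<open>\<open>infdist\<close> to the empty set is 0, so the whole line is treated
    apart.\<close>
  define C where "C n = (if A = UNIV then UNIV else {x. inverse (Suc n) \<le> infdist x (- A)})" for n
  have "closed (C n)" for n
    unfolding C_def by (auto intro!: closed_Collect_le continuous_intros)
  moreover have "A = (\<Union>n. C n)"
  proof (cases "A = UNIV")
    case False
    have "x \<in> A \<longleftrightarrow> 0 < infdist x (- A)" for x
      using infdist_pos_not_in_closed[of "- A" x] assms False infdist_zero[of x "- A"]
      by (cases "x \<in> A") (auto simp: closed_Compl)
    moreover have "inverse (Suc n) \<le> d \<Longrightarrow> 0 < d" for n and d :: real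
      using inverse_Suc[of n, where ?'a = real] by linarith
    moreover have "0 < d \<Longrightarrow> \<exists>n. inverse (Suc n) \<le> d" for d :: real
      using reals_Archimedean[of d] less_imp_le by blast
    ultimately have "x \<in> A \<longleftrightarrow> (\<exists>n. inverse (Suc n) \<le> infdist x (- A))" for x by metis
    then have "A = {x. \<exists>n. inverse (Suc n) \<le> infdist x (- A)}" by (intro set_eqI) (simp only: mem_Collect_eq)
    also have "\<dots> = (\<Union>n. C n)" unfolding C_def using False by (simp add: UNION_eq)
    finally show ?thesis .
  qed (auto simp: C_def)
  ultimately show ?thesis using suslin_Union[of C] suslin_closed by simp
qed

text \<open>The induction carries a set and its complement together, since Suslin sets are not
  closed under complement.\<close>

lemma suslin_borel:
  assumes "A \<in> sets borel" shows "suslin A"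
proof -
  have "A \<in> sigma_sets UNIV (Collect closed)"
    using assms unfolding borel_eq_closed by simp
  then have "suslin A \<and> suslin (- A)"
  proof induction
    case (Basic a) then show ?case using suslin_closed suslin_open by (auto simp: open_Compl)
  next
    case Empty then show ?case using suslin_closed by auto
  next
    case (Compl a) then show ?case by (simp only: Compl_eq_Diff_UNIV[symmetric] double_complement simp_thms)
  next
    case (Union a)
    then show ?case using suslin_Union[of a] suslin_Inter[of "\<lambda>n. - a n"] by simp
  qed
  then show ?thesis ..
qed

text \<open>The graph of \<open>f\<close> over the closed set \<open>Q\<close> is closed. The value
  sits in coordinate 0 and the three witnesses are interleaved after it, so coordinates 1, 2, 3 are
  the points of \<open>A\<close>, \<open>B\<close> and \<open>C\<close>.\<close>

lemma suslin_image:
  assumes A: "suslin A" and B: "suslin B" and C: "suslin C"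
    and Q: "closed Q" "A \<times> B \<times> C \<subseteq> Q" and f: "continuous_on Q f"
  shows "suslin (f ` (A \<times> B \<times> C))"
proof -
  obtain F :: "(nat \<Rightarrow> real) set" where F: "closed F" "A = (\<lambda>\<sigma>. \<sigma> 0) ` F"
    by (rule suslinE[OF A])
  obtain G :: "(nat \<Rightarrow> real) set" where G: "closed G" "B = (\<lambda>\<sigma>. \<sigma> 0) ` G"
    by (rule suslinE[OF B])
  obtain H :: "(nat \<Rightarrow> real) set" where H: "closed H" "C = (\<lambda>\<sigma>. \<sigma> 0) ` H"
    by (rule suslinE[OF C])
  define w where "w n i = Suc (3 * i + n)" for n i :: nat
  define D where "D = {(x, p). p \<in> Q \<and> x = f p}"
  have "D = (UNIV \<times> Q) \<inter> (\<lambda>q. fst q - f (snd q)) -` {0}"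
    by (auto simp: D_def)
  moreover have "closed \<dots>"
    by (intro continuous_closed_preimage continuous_on_diff continuous_on_fst continuous_on_id
        continuous_on_compose2[OF f continuous_on_snd[OF continuous_on_id]] closed_Times Q) auto
  ultimately have "closed D" by simp
  define L where "L = {\<sigma>. (\<lambda>i. \<sigma> (w 0 i)) \<in> F} \<inter> {\<sigma>. (\<lambda>i. \<sigma> (w 1 i)) \<in> G} \<inter> {\<sigma>. (\<lambda>i. \<sigma> (w 2 i)) \<in> H}
    \<inter> {\<sigma>. (\<sigma> 0, \<sigma> (Suc 0), \<sigma> (Suc (Suc 0)), \<sigma> (Suc (Suc (Suc 0)))) \<in> D}"
  show ?thesis
  proof (rule suslinI)
    show "closed L" unfolding L_def
      by (intro closed_Int closed_coordinate_preimage F G H continuous_on_reindex \<open>closed D\<close>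
          continuous_on_Pair continuous_on_product_coordinates)
    show "f ` (A \<times> B \<times> C) = (\<lambda>\<sigma>. \<sigma> 0) ` L"
    proof safe
      fix x y z assume "x \<in> A" "y \<in> B" "z \<in> C"
      then obtain s t u where s: "s \<in> F" "x = s 0" "t \<in> G" "y = t 0" "u \<in> H" "z = u 0"
        using F G H by auto
      define \<sigma> where "\<sigma> j = (case j of 0 \<Rightarrow> f (x, y, z) | Suc k \<Rightarrow>
         if k mod 3 = 0 then s (k div 3) else if k mod 3 = 1 then t (k div 3) else u (k div 3))" for j
      have "(3 * i) mod 3 = 0" "(3 * i + 1) mod 3 = 1" "(3 * i + 2) mod 3 = 2"
        "(3 * i) div 3 = i" "(3 * i + 1) div 3 = i" "(3 * i + 2) div 3 = i" for i :: nat
        by presburger+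
      then have "(\<lambda>i. \<sigma> (w 0 i)) = s" "(\<lambda>i. \<sigma> (w 1 i)) = t" "(\<lambda>i. \<sigma> (w 2 i)) = u"
        by (auto simp: \<sigma>_def w_def fun_eq_iff)
      moreover have "\<sigma> 0 = f (x, y, z)" "\<sigma> (Suc 0) = x" "\<sigma> (Suc (Suc 0)) = y"
          "\<sigma> (Suc (Suc (Suc 0))) = z"
        using s by (simp_all add: \<sigma>_def)
      ultimately have "\<sigma> \<in> L" unfolding L_def D_def
        using s Q(2) \<open>x \<in> A\<close> \<open>y \<in> B\<close> \<open>z \<in> C\<close> by auto
      then show "f (x, y, z) \<in> (\<lambda>\<sigma>. \<sigma> 0) ` L"
        by (intro image_eqI[where x = \<sigma>]) (simp_all only: \<open>\<sigma> 0 = f (x, y, z)\<close>)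
    next
      fix \<sigma> assume s: "\<sigma> \<in> L"
      then have "(\<lambda>i. \<sigma> (w 0 i)) 0 \<in> A" "(\<lambda>i. \<sigma> (w 1 i)) 0 \<in> B" "(\<lambda>i. \<sigma> (w 2 i)) 0 \<in> C"
        using s unfolding F(2) G(2) H(2) L_def by (intro imageI; simp)+
      then have "\<sigma> (Suc 0) \<in> A" "\<sigma> (Suc (Suc 0)) \<in> B" "\<sigma> (Suc (Suc (Suc 0))) \<in> C"
        by (simp_all add: w_def)
      moreover have "\<sigma> 0 = f (\<sigma> (Suc 0), \<sigma> (Suc (Suc 0)), \<sigma> (Suc (Suc (Suc 0))))"
        using s by (simp add: L_def D_def)
      ultimately show "\<sigma> 0 \<in> f ` (A \<times> B \<times> C)" by (simp add: image_eqI)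
    qed
  qed
qed

section \<open>Capacitability and Lebesgue measurability of Suslin sets\<close>

lemma compact_real_box: "compact {\<sigma> :: nat \<Rightarrow> real. \<forall>i. \<bar>\<sigma> i\<bar> \<le> b i}"
proof -
  have "{\<sigma> :: nat \<Rightarrow> real. \<forall>i. \<bar>\<sigma> i\<bar> \<le> b i} = PiE UNIV (\<lambda>i. {- b i..b i})"
    by (auto simp: PiE_def abs_le_iff minus_le_iff)
  moreover have "compactin (product_topology (\<lambda>i. euclidean) UNIV) (PiE UNIV (\<lambda>i. {- b i..b i}))"
    by (subst compactin_PiE) auto
  ultimately show ?thesis by (simp add: euclidean_product_topology)
qed

text \<open>Choquet's capacitability theorem: the coordinates of a point of the closed set \<open>F\<close> are
  bounded one after the other, keeping the capacity of the projection above the level \<open>t\<close>.\<close>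

theorem capacitability:
  fixes c :: "real set \<Rightarrow> ennreal"
  assumes mono: "\<And>A B. A \<subseteq> B \<Longrightarrow> c A \<le> c B"
    and up: "\<And>A :: nat \<Rightarrow> real set. incseq A \<Longrightarrow> c (\<Union>n. A n) \<le> (SUP n. c (A n))"
    and outer: "\<And>K t. compact K \<Longrightarrow> c K < t \<Longrightarrow> \<exists>U. open U \<and> K \<subseteq> U \<and> c U < t"
    and A: "suslin A" "t < c A"
  shows "\<exists>K. compact K \<and> K \<subseteq> A \<and> t \<le> c K"
proof -
  obtain F :: "(nat \<Rightarrow> real) set" where F: "closed F" "A = (\<lambda>\<sigma>. \<sigma> 0) ` F" by (rule suslinE[OF A(1)])
  define R where "R k b = {\<sigma> \<in> F. \<forall>i<k. \<bar>\<sigma> i\<bar> \<le> real (b i)}" for k :: nat and b :: "nat \<Rightarrow> nat"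
  have step: "\<exists>n. t < c ((\<lambda>\<sigma>. \<sigma> 0) ` R (Suc k) (b(k := n)))" if "t < c ((\<lambda>\<sigma>. \<sigma> 0) ` R k b)" for k b
  proof -
    have "(\<lambda>\<sigma>. \<sigma> 0) ` R k b \<subseteq> (\<Union>n. (\<lambda>\<sigma>. \<sigma> 0) ` R (Suc k) (b(k := n)))"
    proof safe
      fix \<sigma> assume s: "\<sigma> \<in> R k b"
      obtain n where "\<bar>\<sigma> k\<bar> \<le> real n" using real_arch_simple by blast
      then have "\<sigma> \<in> R (Suc k) (b(k := n))" using s by (auto simp: R_def less_Suc_eq)
      then show "\<sigma> 0 \<in> (\<Union>n. (\<lambda>\<sigma>. \<sigma> 0) ` R (Suc k) (b(k := n)))" by blast
    qed
    then have "t < c (\<Union>n. (\<lambda>\<sigma>. \<sigma> 0) ` R (Suc k) (b(k := n)))"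
      using that mono order.strict_trans2 by blast
    also have "\<dots> \<le> (SUP n. c ((\<lambda>\<sigma>. \<sigma> 0) ` R (Suc k) (b(k := n))))"
    proof (rule up, rule incseq_SucI, rule image_mono)
      show "R (Suc k) (b(k := n)) \<subseteq> R (Suc k) (b(k := Suc n))" for n
        unfolding R_def by (auto simp: less_Suc_eq intro: order_trans)
    qed
    finally show ?thesis by (auto simp: less_SUP_iff)
  qed
  have "\<exists>B. \<forall>k. t < c ((\<lambda>\<sigma>. \<sigma> 0) ` R k (B k)) \<and> (\<exists>n. B (Suc k) = (B k)(k := n))"
  proof (rule dependent_nat_choice)
    show "\<exists>b. t < c ((\<lambda>\<sigma>. \<sigma> 0) ` R 0 b)" using A F by (simp add: R_def)
  qed (use step in blast)
  then obtain B where B: "\<And>k. t < c ((\<lambda>\<sigma>. \<sigma> 0) ` R k (B k))" "\<And>k. \<exists>n. B (Suc k) = (B k)(k := n)"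
    by blast
  \<comment> \<open>Stage \<open>k + 1\<close> fixes the bound of coordinate \<open>k\<close> for
    good, so the successive choices form a single sequence of bounds.\<close>
  define b where "b k = B (Suc k) k" for k
  have eq: "B k i = b i" if "i < k" for i k
    using that
  proof (induction k)
    case (Suc k)
    obtain n where n: "B (Suc k) = (B k)(k := n)" using B(2) by blast
    show ?case using Suc n by (cases "i = k") (auto simp: b_def)
  qed simp
  have Rb: "t < c ((\<lambda>\<sigma>. \<sigma> 0) ` R k b)" for k
    using B(1)[of k] eq[of _ k] by (simp add: R_def cong: conj_cong)
  define L where "L = F \<inter> {\<sigma>. \<forall>i. \<bar>\<sigma> i\<bar> \<le> real (b i)}"
  have "compact L" unfolding L_def using F(1) compact_real_box[of "\<lambda>i. real (b i)"] by (rule closed_Int_compact)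
  define K where "K = (\<lambda>\<sigma>. \<sigma> 0) ` L"
  have K: "compact K" unfolding K_def
    by (rule compact_continuous_image[OF _ \<open>compact L\<close>])
      (rule continuous_on_subset[OF continuous_on_product_coordinates], simp)
  have "K \<subseteq> A" unfolding K_def L_def F by auto
  moreover have "t \<le> c K"
  proof (rule ccontr)
    assume "\<not> t \<le> c K"
    then obtain U where U: "open U" "K \<subseteq> U" "c U < t" using outer[OF K, of t] by (auto simp: not_le)
    \<comment> \<open>The capacity of each projection exceeds \<open>t\<close>, hence none lies in
      \<open>U\<close>. The points that stick out accumulate at a point of \<open>L\<close>, because
      \<open>b\<close> bounds more and more of their coordinates.\<close>
    have "\<not> (\<lambda>\<sigma>. \<sigma> 0) ` R k b \<subseteq> U" for k
      using Rb[of k] U(3) mono[of "(\<lambda>\<sigma>. \<sigma> 0) ` R k b" U] by (auto simp: not_le[symmetric] dest: order_trans)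
    then have "\<forall>k. \<exists>\<sigma>\<in>R k b. \<sigma> 0 \<notin> U" by blast
    then obtain s where s: "\<And>k. s k \<in> R k b" "\<And>k. s k 0 \<notin> U" by metis
    \<comment> \<open>Truncation puts the points into the compact box and leaves every fixed
      coordinate unchanged from some index on.\<close>
    define s' where "s' k i = (if i < k then s k i else 0)" for k i
    have "s' k \<in> {\<sigma>. \<forall>i. \<bar>\<sigma> i\<bar> \<le> real (b i)}" for k
      using s(1)[of k] by (auto simp: s'_def R_def)
    then obtain \<tau> r where \<tau>: "\<tau> \<in> {\<sigma>. \<forall>i. \<bar>\<sigma> i\<bar> \<le> real (b i)}" "strict_mono r" "(s' \<circ> r) \<longlonglongrightarrow> \<tau>"
      using compact_imp_seq_compact[OF compact_real_box[of "\<lambda>i. real (b i)"]] unfolding seq_compact_def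
      by meson
    have lim: "(\<lambda>n. s (r n) i) \<longlonglongrightarrow> \<tau> i" for i
    proof -
      have "(\<lambda>n. (s' \<circ> r) n i) \<longlonglongrightarrow> \<tau> i"
        using continuous_on_tendsto_compose[OF continuous_on_product_coordinates \<tau>(3), of i] by simp
      moreover have "\<forall>\<^sub>F n in sequentially. (s' \<circ> r) n i = s (r n) i"
        using eventually_gt_at_top[of i]
      proof eventually_elim
        case (elim n) then show ?case using seq_suble[OF \<tau>(2), of n] by (simp add: s'_def)
      qed
      ultimately show ?thesis by (rule Lim_transform_eventually)
    qed
    have "(\<lambda>n. s (r n)) \<longlonglongrightarrow> \<tau>"
      using lim unfolding limitin_canonical_iff[symmetric] euclidean_product_topology[symmetric]
        limitin_componentwise by simp
    then have "\<tau> \<in> F" using closed_sequentially[OF F(1), of "\<lambda>n. s (r n)" \<tau>] s(1) by (auto simp: R_def)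
    then have "\<tau> 0 \<in> U" using U(2) \<tau>(1) unfolding K_def L_def by auto
    moreover have "\<tau> 0 \<in> - U"
      using closed_sequentially[of "- U" "\<lambda>n. s (r n) 0"] lim[of 0] s(2) U(1) by (auto simp: closed_Compl)
    ultimately show False by simp
  qed
  ultimately show ?thesis using K by blast
qed

text \<open>Capacitability of Lebesgue outer measure yields compact subsets whose outer measure is
  arbitrarily close to that of \<open>E\<close>. Their union is a Borel set between which and a
  Borel hull of \<open>E\<close> only a null set remains, because the outer measure is
  finite.\<close>

lemma suslin_lebesgue_measurable:
  assumes "suslin E" "E \<subseteq> S" "emeasure lborel S < \<infinity>" "S \<in> sets borel"
  shows "E \<in> sets lebesgue"
proof -
  let ?c = "outer_measure_of lborel :: real set \<Rightarrow> ennreal"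
  obtain B where B: "B \<in> sets lborel" "E \<subseteq> B" "?c E = emeasure lborel B"
    using outer_measure_of_attain[of E lborel] by auto
  have fin: "?c E < \<infinity>"
    using outer_measure_of_mono[OF assms(2), of lborel] assms(3,4) by (simp add: outer_measure_of_eq)
  have cap: "\<exists>K. compact K \<and> K \<subseteq> E \<and> t \<le> ?c K" if "t < ?c E" for t
  proof (rule capacitability[where c = ?c and A = E and t = t])
    show "?c A \<le> ?c B" if "A \<subseteq> B" for A B using that by (rule outer_measure_of_mono)
    show "?c (\<Union>n. A n) \<le> (SUP n. ?c (A n))" if "incseq A" for A :: "nat \<Rightarrow> real set"
      using SUP_outer_measure_of_incseq[of A lborel] that by simp
    show "suslin E" "t < ?c E" by (fact assms that)+
    fix K :: "real set" and t assume K: "compact K" "?c K < t"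
    obtain m where m: "?c K < m" "m < t" using dense[OF K(2)] by blast
    define e where "e = enn2real (m - ?c K)"
    have "m < \<infinity>" using order.strict_trans2[OF m(2) top_greatest] by simp
    then have e: "0 < e" "?c K + ennreal e = m"
      using m by (auto simp: e_def enn2real_positive_iff diff_gt_0_iff_gt_ennreal ennreal_enn2real_if
          diff_add_cancel_ennreal add.commute[of "?c K"] order_less_imp_le less_top[symmetric])
    have Kb: "K \<in> sets borel" using K(1) by (rule borel_compact)
    obtain U where U: "open U" "K \<subseteq> U" "emeasure lborel (U - K) < e"
      using outer_regular_lborel[OF Kb e(1)] by blast
    have "?c U = emeasure lborel (K \<union> (U - K))" using U by (simp add: Un_absorb1)
    also have "\<dots> \<le> emeasure lborel K + emeasure lborel (U - K)"
      using U Kb by (intro emeasure_subadditive) auto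
    also have "\<dots> \<le> m" using U(3) e(2) Kb by (auto intro: add_left_mono less_imp_le)
    finally show "\<exists>U. open U \<and> K \<subseteq> U \<and> ?c U < t" using U m by auto
  qed
  have "\<exists>K. compact K \<and> K \<subseteq> E \<and> ?c E - ennreal (1 / Suc n) \<le> ?c K" for n :: nat
  proof (cases "?c E = 0")
    case False
    then have "?c E - ennreal (1 / Suc n) < ?c E"
      using fin by (intro ennreal_between) (auto simp: zero_less_iff_neq_zero)
    then show ?thesis by (rule cap)
  qed (auto intro!: exI[of _ "{}"])
  then obtain K where K: "\<And>n. compact (K n)" "\<And>n. K n \<subseteq> E"
      "\<And>n. ?c E - ennreal (1 / Suc n) \<le> ?c (K n)" by metis
  define L where "L = (\<Union>n. K n)"
  have L: "L \<in> sets borel" "L \<subseteq> E" using K by (auto simp: L_def borel_compact)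
  have "?c E \<le> emeasure lborel L"
  proof (rule ennreal_le_epsilon)
    fix e :: real assume "0 < e"
    then obtain n where n: "1 / Suc n < e" using reals_Archimedean by (auto simp: inverse_eq_divide)
    have "?c E \<le> ?c (K n) + ennreal (1 / Suc n)"
      using K(3)[of n] by (simp add: ennreal_minus_le_iff add.commute)
    also have "\<dots> \<le> ?c L + ennreal e"
      using n by (intro add_mono outer_measure_of_mono ennreal_leI) (auto simp: L_def)
    finally show "?c E \<le> emeasure lborel L + ennreal e" using L by simp
  qed
  then have "emeasure lborel (B - L) = 0"
    using B L fin emeasure_mono[of L B lborel] emeasure_Diff[of lborel L B] by simp
  then have "B - L \<in> null_sets lborel" using B L by auto
  then have "E - L \<in> null_sets lebesgue"
    using B(2) by (intro null_sets_completion_subset[of "E - L" "B - L"] null_sets_completionI Diff_mono) auto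
  then have "L \<union> (E - L) \<in> sets lebesgue" using L by (intro sets.Un) (auto simp: sets_completionI_sets)
  moreover have "L \<union> (E - L) = E" using L by blast
  ultimately show ?thesis by simp
qed

subsection \<open>Dyadic Hausdorff content\<close>

text \<open>Half-open intervals make each level a partition of the line; membership becomes an
  equation of floors, and two intervals that meet are nested.\<close>

definition dyad :: "nat \<times> int \<Rightarrow> real set" where
  "dyad p = {of_int (snd p) / 2 ^ fst p ..< (of_int (snd p) + 1) / 2 ^ fst p}"

definition dyad_cost :: "real \<Rightarrow> (nat \<times> int) measure" where
  "dyad_cost s = density (count_space UNIV) (\<lambda>p. ennreal (2 powr (- s * real (fst p))))"

text \<open>A content and not a limit over fine covers. For \<open>s > 0\<close> it has the same
  null sets as Hausdorff measure, and it has the outer regularity that capacitability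
  requires.\<close>

definition net_content :: "real \<Rightarrow> real set \<Rightarrow> ennreal" where
  "net_content s A = (INF S \<in> {S. A \<subseteq> (\<Union>p\<in>S. dyad p)}. emeasure (dyad_cost s) S)"

lemma sets_dyad_cost [simp]: "S \<in> sets (dyad_cost s)"
  by (simp add: dyad_cost_def)

lemma emeasure_dyad_cost_singleton [simp]:
  "emeasure (dyad_cost s) {p} = ennreal (2 powr (- s * real (fst p)))"
  by (simp add: dyad_cost_def emeasure_density nn_integral_count_space_indicator[symmetric]
      nn_integral_count_space_finite)

lemma mem_dyad: "x \<in> dyad p \<longleftrightarrow> \<lfloor>x * 2 ^ fst p\<rfloor> = snd p"
  by (auto simp: dyad_def floor_eq_iff field_simps)

lemma left_mem_dyad: "of_int (snd p) / 2 ^ fst p \<in> dyad p"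
  by (simp add: mem_dyad)

text \<open>The floor at the coarser scale is the integer quotient of the floor at the finer scale
  by a power of two.\<close>

lemma floor_scale:
  fixes x y :: real
  assumes "\<lfloor>x * 2 ^ k\<rfloor> = \<lfloor>y * 2 ^ k\<rfloor>" "l \<le> k"
  shows "\<lfloor>x * 2 ^ l\<rfloor> = \<lfloor>y * 2 ^ l\<rfloor>"
proof -
  have "\<lfloor>z * 2 ^ l\<rfloor> = \<lfloor>z * 2 ^ k\<rfloor> div 2 ^ (k - l)" for z :: real
  proof -
    have "(2 :: real) ^ k = 2 ^ l * 2 ^ (k - l)" using assms(2) by (simp flip: power_add)
    then have "z * 2 ^ l = z * 2 ^ k / of_int (2 ^ (k - l))" by simp
    then show ?thesis by (simp only: floor_divide_real_eq_div[symmetric] zero_le_power zero_le_numeral)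
  qed
  then show ?thesis using assms(1) by simp
qed

lemma dyad_nested:
  assumes "x \<in> dyad p" "x \<in> dyad q" "fst p \<le> fst q"
  shows "dyad q \<subseteq> dyad p"
proof
  fix y assume "y \<in> dyad q"
  then have "\<lfloor>y * 2 ^ fst q\<rfloor> = \<lfloor>x * 2 ^ fst q\<rfloor>" using assms(2) unfolding mem_dyad by simp
  then have "\<lfloor>y * 2 ^ fst p\<rfloor> = \<lfloor>x * 2 ^ fst p\<rfloor>" using assms(3) by (rule floor_scale)
  then show "y \<in> dyad p" using assms(1) unfolding mem_dyad by simp
qed

lemma diameter_dyad: "diameter (dyad p) = (1 / 2) ^ fst p"
proof -
  have "of_int (snd p) / 2 ^ fst p < (of_int (snd p) + 1) / (2 :: real) ^ fst p"
    by (simp add: divide_strict_right_mono)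
  then have "closure (dyad p) = {of_int (snd p) / 2 ^ fst p .. (of_int (snd p) + 1) / 2 ^ fst p}"
    by (simp add: dyad_def closure_atLeastLessThan)
  then show ?thesis using diameter_closure[of "dyad p"]
    by (simp add: dyad_def divide_simps)
qed

lemma bounded_dyad: "bounded (dyad p)"
  by (simp add: dyad_def)

lemma dyad_subset_level:
  assumes "dyad p \<subseteq> dyad q" shows "fst q \<le> fst p"
proof -
  have "(1 / 2 :: real) ^ fst p \<le> (1 / 2) ^ fst q"
    using diameter_subset[OF assms bounded_dyad] by (simp add: diameter_dyad)
  then show ?thesis by simp
qed

lemma dyad_same_level:
  assumes "x \<in> dyad p" "x \<in> dyad q" "fst p = fst q" shows "p = q"
  using assms by (auto simp: mem_dyad prod_eq_iff)

definition dyad_max :: "(nat \<times> int) set \<Rightarrow> (nat \<times> int) set" where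
  "dyad_max S = {p \<in> S. \<forall>q\<in>S. dyad p \<subseteq> dyad q \<longrightarrow> q = p}"

text \<open>Among the members containing \<open>dyad p\<close> there is one of least level, and
  intervals of equal level that meet coincide.\<close>

lemma dyad_max_above:
  assumes "p \<in> S" shows "\<exists>q\<in>dyad_max S. dyad p \<subseteq> dyad q"
proof -
  define P where "P q \<longleftrightarrow> q \<in> S \<and> dyad p \<subseteq> dyad q" for q
  have "P p" using assms by (simp add: P_def)
  define q where "q = arg_min fst P"
  have q: "P q" "\<And>r. P r \<Longrightarrow> fst q \<le> fst r"
    using arg_min_natI[of P p fst] arg_min_nat_le[of P _ fst] \<open>P p\<close> unfolding q_def by blast+
  have "r = q" if "r \<in> S" "dyad q \<subseteq> dyad r" for r
  proof -
    have "P r" using that q(1) by (auto simp: P_def)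
    then have "fst q = fst r" using q(2) dyad_subset_level[OF that(2)] by (simp add: le_antisym)
    then show ?thesis using dyad_same_level left_mem_dyad[of q] that(2) by (metis subsetD)
  qed
  then show ?thesis using q(1) by (intro bexI[of _ q]) (simp_all add: P_def dyad_max_def)
qed

lemma dyad_max_cover: "(\<Union>p\<in>dyad_max S. dyad p) = (\<Union>p\<in>S. dyad p)"
proof
  show "(\<Union>p\<in>S. dyad p) \<subseteq> (\<Union>p\<in>dyad_max S. dyad p)"
    using dyad_max_above[of _ S] by blast
qed (auto simp: dyad_max_def)

section \<open>Subadditivity and continuity of the content along increasing sequences\<close>

lemma net_content_le:
  "A \<subseteq> (\<Union>p\<in>S. dyad p) \<Longrightarrow> net_content s A \<le> emeasure (dyad_cost s) S"
  unfolding net_content_def by (rule INF_lower) simp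

lemma net_content_mono: "A \<subseteq> B \<Longrightarrow> net_content s A \<le> net_content s B"
  unfolding net_content_def by (rule INF_superset_mono) auto

lemma net_content_less:
  "net_content s A < t \<longleftrightarrow> (\<exists>S. A \<subseteq> (\<Union>p\<in>S. dyad p) \<and> emeasure (dyad_cost s) S < t)"
  unfolding net_content_def by (auto simp: INF_less_iff)

lemma net_content_near_optimal:
  assumes "net_content s A \<noteq> \<infinity>" "0 < e"
  shows "\<exists>S. A \<subseteq> (\<Union>p\<in>S. dyad p) \<and> emeasure (dyad_cost s) S \<le> net_content s A + ennreal e"
proof -
  have "net_content s A < net_content s A + ennreal e"
    using assms ennreal_add_left_cancel_less[of "net_content s A" 0 "ennreal e"] by simp
  then show ?thesis by (auto simp: net_content_less intro: less_imp_le)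
qed

lemma suminf_ennreal_halves: "0 \<le> e \<Longrightarrow> (\<Sum>n. ennreal (e / 2 ^ Suc n)) = ennreal e"
  using power_half_series sums_mult[of "\<lambda>n. (1/2)^Suc n" 1 e]
  by (intro suminf_ennreal_eq) (auto simp: field_simps)

lemma net_content_countably_subadditive:
  "net_content s (\<Union>n. A n) \<le> (\<Sum>n. net_content s (A n))"
proof (cases "\<exists>n. net_content s (A n) = \<infinity>")
  case True
  then obtain n where "net_content s (A n) = \<infinity>" by blast
  then have "(\<Sum>n. net_content s (A n)) = \<infinity>"
    using sum_le_suminf[of "\<lambda>n. net_content s (A n)" "{n}"] by (simp add: top_unique)
  then show ?thesis by simp
next
  case False
  show ?thesis
  proof (rule ennreal_le_epsilon)
    fix e :: real assume "0 < e"
    have "\<exists>S. A n \<subseteq> (\<Union>p\<in>S. dyad p) \<and>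
      emeasure (dyad_cost s) S \<le> net_content s (A n) + ennreal (e / 2 ^ Suc n)" for n
      using False \<open>0 < e\<close> by (intro net_content_near_optimal) auto
    then obtain S where S: "\<And>n. A n \<subseteq> (\<Union>p\<in>S n. dyad p)"
      "\<And>n. emeasure (dyad_cost s) (S n) \<le> net_content s (A n) + ennreal (e / 2 ^ Suc n)" by metis
    have "net_content s (\<Union>n. A n) \<le> emeasure (dyad_cost s) (\<Union>n. S n)"
      using S(1) by (intro net_content_le) blast
    also have "\<dots> \<le> (\<Sum>n. emeasure (dyad_cost s) (S n))"
      by (intro emeasure_subadditive_countably) auto
    also have "\<dots> \<le> (\<Sum>n. net_content s (A n) + ennreal (e / 2 ^ Suc n))"
      by (intro suminf_le S) auto
    also have "\<dots> = (\<Sum>n. net_content s (A n)) + (\<Sum>n. ennreal (e / 2 ^ Suc n))"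
      by (rule suminf_add[symmetric]) auto
    also have "(\<Sum>n. ennreal (e / 2 ^ Suc n)) = ennreal e"
      using \<open>0 < e\<close> by (intro suminf_ennreal_halves) simp
    finally show "net_content s (\<Union>n. A n) \<le> (\<Sum>n. net_content s (A n)) + ennreal e" .
  qed
qed

lemma net_content_empty [simp]: "net_content s {} = 0"
  using net_content_le[of "{}" "{}" s] by simp

lemma net_content_Un: "net_content s (A \<union> B) \<le> net_content s A + net_content s B"
proof -
  have "net_content s (\<Union>n. binaryset A B n) \<le> (\<Sum>n. net_content s (binaryset A B n))"
    by (rule net_content_countably_subadditive)
  also have "\<dots> = net_content s A + net_content s B"
    by (intro suminf_binaryset_eq) simp
  finally show ?thesis by (simp add: UN_binaryset_eq)
qed

lemma emeasure_submodular:
  assumes "X \<in> sets M" "Y \<in> sets M" "S \<in> sets M" "T \<in> sets M"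
    and "X \<union> Y \<subseteq> S \<union> T" "X \<inter> Y \<subseteq> S \<inter> T"
  shows "emeasure M X + emeasure M Y \<le> emeasure M S + emeasure M T"
proof -
  have "emeasure M X + emeasure M Y = emeasure M (X \<union> Y) + emeasure M (X \<inter> Y)"
    using assms by (intro emeasure_Un_Int)
  also have "\<dots> \<le> emeasure M (S \<union> T) + emeasure M (S \<inter> T)"
    using assms by (intro add_mono emeasure_mono) auto
  also have "\<dots> = emeasure M S + emeasure M T"
    using assms by (intro emeasure_Un_Int[symmetric])
  finally show ?thesis .
qed

text \<open>Replacing nested pairs of intervals by their larger, respectively smaller member shows that
  the content is strongly subadditive, which yields continuity along increasing sequences.\<close>

lemma dyad_join_cost:
  assumes "A \<subseteq> (\<Union>p\<in>S. dyad p)" "A \<subseteq> (\<Union>p\<in>T. dyad p)"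
  shows "emeasure (dyad_cost s) (dyad_max (S \<union> T)) + net_content s A
    \<le> emeasure (dyad_cost s) S + emeasure (dyad_cost s) T"
proof -
  \<comment> \<open>The smaller members of nested pairs. A member of \<open>Y\<close> that is also
    maximal in \<open>S \<union> T\<close> equals the interval above it, hence lies in both
    \<open>S\<close> and \<open>T\<close>; this is the intersection condition of
    submodularity.\<close>
  define Y where "Y = {p \<in> S. \<exists>q\<in>T. dyad p \<subseteq> dyad q} \<union> {p \<in> T. \<exists>q\<in>S. dyad p \<subseteq> dyad q}"
  have "A \<subseteq> (\<Union>p\<in>Y. dyad p)"
  proof
    fix x assume "x \<in> A"
    then obtain p q where pq: "p \<in> S" "x \<in> dyad p" "q \<in> T" "x \<in> dyad q" using assms by blast
    show "x \<in> (\<Union>p\<in>Y. dyad p)"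
    proof (cases "fst p \<le> fst q")
      case True then have "q \<in> Y" using pq dyad_nested[of x p q] by (auto simp: Y_def)
      then show ?thesis using pq by blast
    next
      case False then have "p \<in> Y" using pq dyad_nested[of x q p] by (auto simp: Y_def)
      then show ?thesis using pq by blast
    qed
  qed
  then have "emeasure (dyad_cost s) (dyad_max (S \<union> T)) + net_content s A
      \<le> emeasure (dyad_cost s) (dyad_max (S \<union> T)) + emeasure (dyad_cost s) Y"
    by (intro add_left_mono net_content_le)
  also have "\<dots> \<le> emeasure (dyad_cost s) S + emeasure (dyad_cost s) T"
    by (rule emeasure_submodular) (auto simp: Y_def dyad_max_def)
  finally show ?thesis .
qed

text \<open>Near-optimal covers are merged one after the other. The merged cover and the next one
  both cover \<open>A n\<close>, so by strong subadditivity the excess of cost over content grows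
  only by the error \<open>e / 2 ^ Suc (Suc n)\<close> of the next cover.\<close>

lemma net_content_incseq:
  assumes A: "incseq A"
  shows "net_content s (\<Union>n. A n) \<le> (SUP n. net_content s (A n))"
proof (cases "(SUP n. net_content s (A n)) = \<infinity>")
  case False
  have le: "net_content s (A n) \<le> (SUP n. net_content s (A n))" for n by (rule SUP_upper) simp
  have fin: "net_content s (A n) \<noteq> \<infinity>" for n
    using le[of n] False by (metis neq_top_trans infinity_ennreal_def)
  show ?thesis
  proof (rule ennreal_le_epsilon)
    fix e :: real assume "0 < e"
    have "\<exists>S. A n \<subseteq> (\<Union>p\<in>S. dyad p) \<and>
      emeasure (dyad_cost s) S \<le> net_content s (A n) + ennreal (e / 2 ^ Suc n)" for n
      using fin[of n] \<open>0 < e\<close> by (intro net_content_near_optimal) auto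
    then obtain S where S: "\<And>n. A n \<subseteq> (\<Union>p\<in>S n. dyad p)"
      "\<And>n. emeasure (dyad_cost s) (S n) \<le> net_content s (A n) + ennreal (e / 2 ^ Suc n)" by metis
    define W where "W n = dyad_max (\<Union>i\<le>n. S i)" for n
    have W: "emeasure (dyad_cost s) (W n) \<le> net_content s (A n) + ennreal (\<Sum>i\<le>n. e / 2 ^ Suc i)" for n
    proof (induction n)
      case 0
      have "emeasure (dyad_cost s) (W 0) \<le> emeasure (dyad_cost s) (S 0)"
        by (rule emeasure_mono) (auto simp: W_def dyad_max_def)
      then show ?case using S(2)[of 0] by simp
    next
      case (Suc n)
      have "W (Suc n) \<subseteq> dyad_max (W n \<union> S (Suc n))"
        by (auto simp: W_def dyad_max_def le_Suc_eq)
      then have "emeasure (dyad_cost s) (W (Suc n)) + net_content s (A n)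
          \<le> emeasure (dyad_cost s) (dyad_max (W n \<union> S (Suc n))) + net_content s (A n)"
        by (intro add_right_mono emeasure_mono) auto
      also have "\<dots> \<le> emeasure (dyad_cost s) (W n) + emeasure (dyad_cost s) (S (Suc n))"
      proof (rule dyad_join_cost)
        show "A n \<subseteq> \<Union> (dyad ` W n)" using S(1)[of n] unfolding W_def dyad_max_cover by auto
        show "A n \<subseteq> \<Union> (dyad ` S (Suc n))" using S(1)[of "Suc n"] incseq_SucD[OF A, of n] by auto
      qed
      also have "\<dots> \<le> (net_content s (A n) + ennreal (\<Sum>i\<le>n. e / 2 ^ Suc i)) +
          (net_content s (A (Suc n)) + ennreal (e / 2 ^ Suc (Suc n)))"
        by (intro add_mono Suc.IH S)
      also have "\<dots> = (net_content s (A (Suc n)) + ennreal (\<Sum>i\<le>Suc n. e / 2 ^ Suc i)) + net_content s (A n)"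
        using \<open>0 < e\<close> by (simp add: ennreal_plus sum_nonneg add_ac del: power_Suc)
      finally show ?case 
        using fin[of n] by (simp only: add.commute[of _ "net_content s (A n)"] ennreal_add_left_cancel_le) simp
    qed
    \<comment> \<open>An interval maximal in the whole family is maximal among the first covers as
      well, so \<open>V n \<subseteq> W n\<close>, while the \<open>V n\<close> exhaust the final
      cover.\<close>
    define V where "V n = dyad_max (\<Union>i. S i) \<inter> (\<Union>i\<le>n. S i)" for n
    have "(\<Union>n. A n) \<subseteq> (\<Union>p\<in>dyad_max (\<Union>i. S i). dyad p)"
      using S(1) unfolding dyad_max_cover by blast
    then have "net_content s (\<Union>n. A n) \<le> emeasure (dyad_cost s) (dyad_max (\<Union>i. S i))"
      by (rule net_content_le)
    also have "dyad_max (\<Union>i. S i) = (\<Union>n. V n)"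
      by (auto simp: V_def dyad_max_def)
    also have "emeasure (dyad_cost s) \<dots> = (SUP n. emeasure (dyad_cost s) (V n))"
      by (rule SUP_emeasure_incseq[symmetric]) (auto simp: V_def incseq_def intro: order_trans)
    also have "\<dots> \<le> (SUP n. net_content s (A n)) + ennreal e"
    proof (rule SUP_least)
      fix n
      have "V n \<subseteq> W n" by (auto simp: V_def W_def dyad_max_def)
      then have "emeasure (dyad_cost s) (V n) \<le> emeasure (dyad_cost s) (W n)" by (intro emeasure_mono) auto
      also have "\<dots> \<le> net_content s (A n) + ennreal (\<Sum>i\<le>n. e / 2 ^ Suc i)" by (rule W)
      also have "(\<Sum>i\<le>n. e / 2 ^ Suc i) \<le> e"
      proof -
        have "(\<Sum>i\<le>n. e / 2 ^ Suc i) = e - e / 2 ^ Suc n" by (induction n) (auto simp: field_simps)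
        then show ?thesis using \<open>0 < e\<close> by simp
      qed
      then have "net_content s (A n) + ennreal (\<Sum>i\<le>n. e / 2 ^ Suc i) \<le> (SUP n. net_content s (A n)) + ennreal e"
        by (intro add_mono le ennreal_leI)
      finally show "emeasure (dyad_cost s) (V n) \<le> (SUP n. net_content s (A n)) + ennreal e" .
    qed
    finally show "net_content s (\<Union>n. A n) \<le> (SUP n. net_content s (A n)) + ennreal e" .
  qed
next
  case True
  show ?thesis unfolding True by simp
qed

section \<open>Null sets and outer regularity of the content\<close>

lemma half_powr: "2 powr (- s * real k) = ((1 / 2) ^ k) powr s"
  by (simp add: powr_realpow[symmetric] powr_powr powr_divide powr_minus_divide mult.commute)

lemma ex_small_level:
  assumes "0 < s" "0 < (e :: real)"
  shows "\<exists>k\<ge>m. 2 powr (- s * real k) < e"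
proof -
  have "(\<lambda>k. 2 powr (- s * real k)) \<longlonglongrightarrow> 0"
    using assms(1) by real_asymp
  then have "\<forall>\<^sub>F k in sequentially. 2 powr (- s * real k) < e"
    using assms(2) by (rule order_tendstoD)
  then obtain N where "\<And>k. N \<le> k \<Longrightarrow> 2 powr (- s * real k) < e"
    unfolding eventually_sequentially by blast
  then show ?thesis by (intro exI[of _ "max N m"]) simp
qed

lemma net_content_singleton:
  assumes "0 < s" shows "net_content s {a} = 0"
proof -
  have "net_content s {a} \<le> 0 + ennreal e" if e: "0 < e" for e
  proof -
    obtain k :: nat where k: "2 powr (- s * real k) < e" using ex_small_level[OF assms e, of 0] by blast
    have "net_content s {a} \<le> emeasure (dyad_cost s) {(k, \<lfloor>a * 2 ^ k\<rfloor>)}"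
      by (intro net_content_le) (auto simp: mem_dyad)
    also have "\<dots> \<le> ennreal e" using k by (simp add: ennreal_leI)
    finally show ?thesis by simp
  qed
  then show ?thesis by (metis ennreal_le_epsilon le_zero_eq)
qed

lemma net_content_subset_singleton:
  assumes "0 < s" "A \<subseteq> {a}" shows "net_content s A = 0"
  using net_content_mono[OF assms(2), of s] net_content_singleton[OF assms(1)] by simp

lemma net_content_countable_union_zero:
  assumes "countable I" "\<And>i. i \<in> I \<Longrightarrow> net_content s (A i) = 0"
  shows "net_content s (\<Union>i\<in>I. A i) = 0"
proof (cases "I = {}")
  case False
  have "(\<Union>i\<in>I. A i) = (\<Union>n. A (from_nat_into I n))"
    using image_image[of A "from_nat_into I" UNIV] by (simp only: range_from_nat_into[OF False assms(1)])
  then have "net_content s (\<Union>i\<in>I. A i) \<le> (\<Sum>n. net_content s (A (from_nat_into I n)))"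
    using net_content_countably_subadditive[of s "\<lambda>n. A (from_nat_into I n)"] by simp
  also have "\<dots> = 0" using assms(2) from_nat_into[OF False] by simp
  finally show ?thesis by simp
qed simp

lemma net_content_finite:
  assumes "0 < s" "finite A" shows "net_content s A = 0"
  using net_content_countable_union_zero[of A s "\<lambda>a. {a}"] assms net_content_singleton
  by (simp add: countable_finite)

text \<open>A half-open interval becomes open once a short piece is added on the left, and this
  piece fits into one adjacent dyadic interval \<open>g p\<close>. The levels \<open>K p\<close> are
  so high that the added costs fit into the gap below \<open>t\<close>.\<close>

lemma net_content_open_cover:
  assumes "0 < s" "net_content s A < t"
  shows "\<exists>S Q (g :: nat \<times> int \<Rightarrow> nat \<times> int). A \<subseteq> (\<Union>p\<in>S. Q p) \<and>
    (\<forall>p\<in>S. open (Q p) \<and> Q p \<subseteq> dyad p \<union> dyad (g p)) \<and> emeasure (dyad_cost s) (S \<union> g ` S) < t"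
proof -
  obtain S where S: "A \<subseteq> (\<Union>p\<in>S. dyad p)" "emeasure (dyad_cost s) S < t"
    using assms(2) unfolding net_content_less by blast
  obtain m where m: "emeasure (dyad_cost s) S < m" "m < t" using dense[OF S(2)] by blast
  have "\<exists>e>0. emeasure (dyad_cost s) S + ennreal e \<le> m"
  proof -
    have "m < \<infinity>" using order.strict_trans2[OF m(2) top_greatest] by simp
    then obtain m' where m': "m = ennreal m'" "0 \<le> m'" by (cases m) auto
    obtain c where c: "emeasure (dyad_cost s) S = ennreal c" "0 \<le> c"
      using m(1) m' by (cases "emeasure (dyad_cost s) S") auto
    have "c < m'" using m(1) m' c by (simp add: ennreal_less_iff)
    moreover have "ennreal c + ennreal (m' - c) = ennreal m'"
      using c \<open>c < m'\<close> by (subst ennreal_plus[symmetric]) auto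
    ultimately show ?thesis using m' c by (intro exI[of _ "m' - c"]) simp
  qed
  then obtain e where e: "0 < e" "emeasure (dyad_cost s) S + ennreal e \<le> m" by blast
  have "\<forall>p :: nat \<times> int. \<exists>k\<ge>fst p. 2 powr (- s * real k) < e / 2 ^ Suc (to_nat p)"
    using e(1) by (intro allI ex_small_level assms) auto
  then obtain K where K: "\<And>p :: nat \<times> int. fst p \<le> K p"
      "\<And>p. 2 powr (- s * real (K p)) < e / 2 ^ Suc (to_nat p)" by metis
  \<comment> \<open>The interval of level \<open>K p\<close> ending at the left end point of
    \<open>dyad p\<close>; hence the \<open>- 1\<close>.\<close>
  define g where "g p = (K p, snd p * 2 ^ (K p - fst p) - 1)" for p
  define Q where "Q p = {of_int (snd p) / 2 ^ fst p - 1 / 2 ^ K p <..< (of_int (snd p) + 1) / (2 :: real) ^ fst p}" for p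
  have "Q p \<subseteq> dyad p \<union> dyad (g p)" for p
  proof -
    have "(2 :: real) ^ K p = 2 ^ fst p * 2 ^ (K p - fst p)" using K(1)[of p] by (simp flip: power_add)
    then have "of_int (snd p) / (2 :: real) ^ fst p = of_int (snd p * 2 ^ (K p - fst p)) / 2 ^ K p"
      by simp
    then show ?thesis by (auto simp: dyad_def Q_def g_def diff_divide_distrib)
  qed
  moreover have "dyad p \<subseteq> Q p" for p
  proof -
    have "0 < 1 / (2 :: real) ^ K p" by simp
    then show ?thesis unfolding dyad_def Q_def by (auto simp only: atLeastLessThan_iff greaterThanLessThan_iff)
  qed
  moreover have "emeasure (dyad_cost s) (g ` S) \<le> ennreal e"
  proof -
    define X where "X n = (if n \<in> range (to_nat :: nat \<times> int \<Rightarrow> nat) then {g (from_nat n)} else {})" for n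
    have "g ` S \<subseteq> (\<Union>n. X n)"
    proof (rule image_subsetI)
      fix p show "g p \<in> (\<Union>n. X n)" by (intro UN_I[of "to_nat p"]) (auto simp: X_def)
    qed
    then have "emeasure (dyad_cost s) (g ` S) \<le> emeasure (dyad_cost s) (\<Union>n. X n)"
      by (intro emeasure_mono) auto
    also have "\<dots> \<le> (\<Sum>n. emeasure (dyad_cost s) (X n))"
      by (intro emeasure_subadditive_countably) auto
    also have "\<dots> \<le> (\<Sum>n. ennreal (e / 2 ^ Suc n))"
    proof (intro suminf_le)
      fix n show "emeasure (dyad_cost s) (X n) \<le> ennreal (e / 2 ^ Suc n)"
      proof (cases "n \<in> range (to_nat :: nat \<times> int \<Rightarrow> nat)")
        case True
        then obtain p :: "nat \<times> int" where p: "n = to_nat p" by blast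
        have "2 powr (- s * real (K p)) \<le> e / 2 ^ Suc n" using K(2)[of p] p by simp
        then have "ennreal (2 powr (- s * real (K p))) \<le> ennreal (e / 2 ^ Suc n)" by (rule ennreal_leI)
        then show ?thesis using True p by (simp add: X_def g_def)
      qed (simp add: X_def)
    qed auto
    also have "\<dots> = ennreal e" using e(1) by (intro suminf_ennreal_halves) simp
    finally show ?thesis .
  qed
  then have "emeasure (dyad_cost s) (S \<union> g ` S) \<le> emeasure (dyad_cost s) S + ennreal e"
    using emeasure_subadditive[of S "dyad_cost s" "g ` S"] add_left_mono order_trans by fastforce
  then have "emeasure (dyad_cost s) (S \<union> g ` S) < t"
    using e(2) m(2) by (metis order.strict_trans1 order_trans)
  moreover have "open (Q p)" for p by (simp add: Q_def)
  moreover have "A \<subseteq> (\<Union>p\<in>S. Q p)" using S(1) \<open>\<And>p. dyad p \<subseteq> Q p\<close> by (meson UN_mono order_refl order_trans)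
  ultimately show ?thesis by (intro exI[of _ S] exI[of _ Q] exI[of _ g] conjI ballI)
qed

lemma net_content_outer_open:
  assumes "0 < s" "net_content s A < t"
  shows "\<exists>U. open U \<and> A \<subseteq> U \<and> net_content s U < t"
proof -
  obtain S Q g where S: "A \<subseteq> (\<Union>p\<in>S. Q p)" "\<forall>p\<in>S. open (Q p) \<and> Q p \<subseteq> dyad p \<union> dyad (g p)"
      "emeasure (dyad_cost s) (S \<union> g ` S) < t"
    using net_content_open_cover[OF assms] by blast
  have "net_content s (\<Union>p\<in>S. Q p) \<le> emeasure (dyad_cost s) (S \<union> g ` S)"
    using S(2) by (intro net_content_le) blast
  then show ?thesis using S by (intro exI[of _ "\<Union>p\<in>S. Q p"]) auto
qed

text \<open>Finiteness of the cover lets it be counted level by level against discrete Frostman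
  weights, which are good only down to a finite scale.\<close>

lemma net_content_compact_cover:
  assumes "0 < s" "compact A" "net_content s A < t"
  shows "\<exists>T. finite T \<and> A \<subseteq> (\<Union>p\<in>T. dyad p) \<and> emeasure (dyad_cost s) T < t"
proof -
  obtain S Q g where S: "A \<subseteq> (\<Union>p\<in>S. Q p)" "\<forall>p\<in>S. open (Q p) \<and> Q p \<subseteq> dyad p \<union> dyad (g p)"
      "emeasure (dyad_cost s) (S \<union> g ` S) < t"
    using net_content_open_cover[OF assms(1,3)] by blast
  obtain R where R: "R \<subseteq> S" "finite R" "A \<subseteq> (\<Union>p\<in>R. Q p)"
    using compactE_image[OF assms(2), of S Q] S by metis
  have "emeasure (dyad_cost s) (R \<union> g ` R) \<le> emeasure (dyad_cost s) (S \<union> g ` S)"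
    using R by (intro emeasure_mono) auto
  moreover have "A \<subseteq> (\<Union>p\<in>R \<union> g ` R. dyad p)" using R S(2) by blast
  ultimately show ?thesis using R S(3) by (intro exI[of _ "R \<union> g ` R"]) auto
qed

section \<open>Comparison of the dyadic content with Hausdorff measure\<close>

lemma net_content_le_diameter:
  assumes "0 < s" "bounded U" "diameter U \<le> 1"
  shows "net_content s U \<le> ennreal (2 * 2 powr s * diameter_powr s U)"
proof (cases "U = {} \<or> diameter U = 0")
  case True
  then have "\<exists>a. U \<subseteq> {a}"
  proof
    assume "diameter U = 0"
    then have "x = y" if "x \<in> U" "y \<in> U" for x y
      using diameter_bounded_bound[OF assms(2) that] by simp
    then show ?thesis by blast
  qed simp
  then show ?thesis using net_content_subset_singleton[OF assms(1)] by auto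
next
  case False
  define d where "d = diameter U"
  have d: "0 < d" "d \<le> 1" using False assms diameter_ge_0[OF assms(2)] by (auto simp: d_def)
  \<comment> \<open>At the level with 2^-(k+1) < d \<le> 2^-k two neighbouring cells cover
    \<open>U\<close>, and each costs at most (2d)^s.\<close>
  obtain k :: nat where k: "(1 / 2) ^ Suc k < d" "d \<le> (1 / 2) ^ k"
  proof -
    define k where "k = (LEAST k. (1 / 2 :: real) ^ Suc k < d)"
    obtain n where "(1 / 2 :: real) ^ n < d" using real_arch_pow_inv[of d "1/2"] d by auto
    moreover have "(1 / 2 :: real) ^ Suc n \<le> (1 / 2) ^ n" by (rule power_decreasing) auto
    ultimately have "(1 / 2 :: real) ^ Suc n < d" by linarith
    then have 1: "(1 / 2 :: real) ^ Suc k < d" unfolding k_def by (rule LeastI)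
    have "d \<le> (1 / 2) ^ k"
    proof (cases k)
      case (Suc j)
      then have "\<not> (1 / 2 :: real) ^ Suc j < d" using not_less_Least[of j "\<lambda>k. (1 / 2 :: real) ^ Suc k < d"] unfolding k_def by simp
      then show ?thesis using Suc by simp
    qed (use d in simp)
    then show ?thesis using that 1 by blast
  qed
  define a where "a = Inf U"
  have U: "a \<le> x" "x \<le> a + d" if "x \<in> U" for x
  proof -
    have bdd: "bdd_below U" using assms(2) by (rule bounded_imp_bdd_below)
    then show "a \<le> x" unfolding a_def using that by (intro cInf_lower)
    have "x - d \<le> Inf U"
    proof (rule cInf_greatest)
      fix y assume "y \<in> U"
      then show "x - d \<le> y" using diameter_bounded_bound[OF assms(2) that, of y] by (simp add: d_def dist_real_def)
    qed (use False in auto)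
    then show "x \<le> a + d" by (simp add: a_def)
  qed
  define j where "j = \<lfloor>a * 2 ^ k\<rfloor>"
  have "U \<subseteq> (\<Union>p\<in>{(k, j), (k, j + 1)}. dyad p)"
  proof
    fix x assume x: "x \<in> U"
    have "a * 2 ^ k \<le> x * 2 ^ k" "x * 2 ^ k \<le> (a + d) * 2 ^ k"
      using U[OF x] by (auto intro: mult_right_mono)
    moreover have "d * 2 ^ k \<le> 1" using k(2) by (simp add: field_simps)
    ultimately have "j \<le> \<lfloor>x * 2 ^ k\<rfloor>" "\<lfloor>x * 2 ^ k\<rfloor> \<le> j + 1"
      unfolding j_def by (auto simp: floor_mono distrib_right) linarith
    then show "x \<in> (\<Union>p\<in>{(k, j), (k, j + 1)}. dyad p)" by (auto simp: mem_dyad)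
  qed
  then have "net_content s U \<le> emeasure (dyad_cost s) ({(k, j)} \<union> {(k, j + 1)})"
    by (intro net_content_le) auto
  also have "\<dots> \<le> ennreal (2 powr (- s * real k)) + ennreal (2 powr (- s * real k))"
    using emeasure_subadditive[of "{(k, j)}" "dyad_cost s" "{(k, j + 1)}"] by simp
  also have "\<dots> = ennreal (2 * ((1 / 2) ^ k) powr s)"
    unfolding half_powr by (simp flip: ennreal_plus)
  also have "\<dots> \<le> ennreal (2 * 2 powr s * diameter_powr s U)"
  proof (rule ennreal_leI)
    have "((1 / 2 :: real) ^ k) powr s \<le> (2 * d) powr s"
      using k(1) assms(1) by (intro powr_mono2) auto
    also have "\<dots> = 2 powr s * d powr s" using d by (simp add: powr_mult)
    finally show "2 * ((1 / 2) ^ k) powr s \<le> 2 * 2 powr s * diameter_powr s U"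
      using False assms(1) by (simp add: diameter_powr_def d_def)
  qed
  finally show ?thesis .
qed

lemma net_content_zero_if_hausdorff_zero:
  assumes "0 < s" "hausdorff_measure s A = 0" shows "net_content s A = 0"
proof -
  have pre: "hausdorff_premeasure s 1 A = 0"
    using assms(2) SUP_upper[of 1 "{0<..}" "\<lambda>\<delta>. hausdorff_premeasure s \<delta> A"]
    by (simp add: hausdorff_measure_def)
  have "net_content s A \<le> 0 + ennreal e" if e: "0 < e" for e
  proof -
    define e' where "e' = e / (2 * 2 powr s)"
    have "0 < e'" using e by (simp add: e'_def)
    then have "hausdorff_premeasure s 1 A < ennreal e'" using pre by simp
    then obtain U :: "nat \<Rightarrow> real set" where U: "A \<subseteq> (\<Union>i. U i)" "\<And>i. bounded (U i)" "\<And>i. diameter (U i) \<le> 1"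
        "(\<Sum>i. ennreal (diameter_powr s (U i))) < ennreal e'"
      unfolding hausdorff_premeasure_def by (auto simp: INF_less_iff)
    have "net_content s A \<le> (\<Sum>i. net_content s (U i))"
      using net_content_mono[OF U(1), of s] net_content_countably_subadditive[of s U] by simp
    also have "\<dots> \<le> (\<Sum>i. ennreal (2 * 2 powr s) * ennreal (diameter_powr s (U i)))"
    proof (intro suminf_le)
      fix i show "net_content s (U i) \<le> ennreal (2 * 2 powr s) * ennreal (diameter_powr s (U i))"
        using net_content_le_diameter[OF assms(1) U(2,3), of i] by (simp add: ennreal_mult')
    qed auto
    also have "\<dots> = ennreal (2 * 2 powr s) * (\<Sum>i. ennreal (diameter_powr s (U i)))"
      by simp
    also have "\<dots> \<le> ennreal (2 * 2 powr s) * ennreal e'"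
      using U(4) by (intro mult_left_mono) auto
    also have "\<dots> = ennreal e"
      unfolding e'_def by (subst ennreal_mult'[symmetric]) auto
    finally show ?thesis by simp
  qed
  then show ?thesis by (metis ennreal_le_epsilon le_zero_eq)
qed

text \<open>A cover of total cost below \<open>\<delta> powr s\<close> consists of intervals shorter
  than \<delta>, so cheap covers are automatically fine.\<close>

lemma hausdorff_zero_if_net_content_zero:
  assumes "0 < s" "net_content s A = 0" shows "hausdorff_measure s A = 0"
proof -
  have "hausdorff_premeasure s \<delta> A \<le> 0 + ennreal e" if de: "0 < \<delta>" "0 < e" for \<delta> e
  proof -
    define e' where "e' = min e (\<delta> powr s)"
    have "0 < e'" using de by (simp add: e'_def)
    then obtain S where S: "A \<subseteq> (\<Union>p\<in>S. dyad p)" "emeasure (dyad_cost s) S < ennreal e'"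
      using net_content_less[of s A "ennreal e'"] assms(2) by auto
    define X where "X n = S \<inter> {p. to_nat p = n}" for n
    define U where "U n = (\<Union>p\<in>X n. dyad p)" for n
    have X: "X n = {} \<or> (\<exists>p\<in>S. X n = {p} \<and> U n = dyad p)" for n
    proof (cases "X n = {}")
      case False
      then obtain p where "p \<in> X n" by blast
      then have "X n = {p}" "p \<in> S" by (auto simp: X_def)
      then show ?thesis by (auto simp: U_def)
    qed simp
    have "diameter_powr s (dyad p) = 2 powr (- s * real (fst p))" for p
      using assms(1) left_mem_dyad[of p] unfolding half_powr by (auto simp: diameter_powr_def diameter_dyad)
    then have dp: "ennreal (diameter_powr s (dyad p)) = emeasure (dyad_cost s) {p}" for p
      by simp
    have cost: "ennreal (diameter_powr s (U n)) = emeasure (dyad_cost s) (X n)" for n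
      using X[of n]
    proof
      assume "X n = {}" then show ?thesis by (simp add: U_def diameter_powr_def)
    next
      assume "\<exists>p\<in>S. X n = {p} \<and> U n = dyad p"
      then obtain p where p: "X n = {p}" "U n = dyad p" by blast
      show ?thesis unfolding p by (rule dp)
    qed
    have diam: "bounded (U n) \<and> diameter (U n) \<le> \<delta>" for n
      using X[of n]
    proof
      assume "\<exists>p\<in>S. X n = {p} \<and> U n = dyad p"
      then obtain p where p: "p \<in> S" "U n = dyad p" by blast
      have "emeasure (dyad_cost s) {p} \<le> emeasure (dyad_cost s) S" using p by (intro emeasure_mono) auto
      then have "ennreal (2 powr (- s * real (fst p))) < ennreal (\<delta> powr s)"
        using S(2) unfolding emeasure_dyad_cost_singleton
        by (rule order.strict_trans1[THEN order.strict_trans2]) (simp add: e'_def ennreal_leI)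
      then have "((1 / 2) ^ fst p) powr s < \<delta> powr s" unfolding half_powr by (simp add: ennreal_less_iff)
      then have "(1 / 2) ^ fst p < \<delta>" using assms(1) de by (intro powr_less_cancel2[of s "(1 / 2) ^ fst p" \<delta>]) auto
      then show ?thesis using p bounded_dyad by (simp add: diameter_dyad)
    qed (use de in \<open>simp add: U_def\<close>)
    have "A \<subseteq> (\<Union>n. U n)"
    proof
      fix x assume "x \<in> A"
      then obtain p where "p \<in> S" "x \<in> dyad p" using S(1) by blast
      then show "x \<in> (\<Union>n. U n)" by (auto simp: U_def X_def intro!: exI[of _ "to_nat p"] bexI[of _ p])
    qed
    then have "hausdorff_premeasure s \<delta> A \<le> (\<Sum>n. ennreal (diameter_powr s (U n)))"
      unfolding hausdorff_premeasure_def using diam by (intro INF_lower) auto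
    also have "\<dots> = emeasure (dyad_cost s) (\<Union>n. X n)"
      unfolding cost by (rule suminf_emeasure) (auto simp: disjoint_family_on_def X_def)
    also have "\<dots> \<le> emeasure (dyad_cost s) S" by (rule emeasure_mono) (auto simp: X_def)
    also have "\<dots> \<le> ennreal e" using S(2) by (rule order.strict_implies_order[THEN order_trans]) (simp add: e'_def ennreal_leI)
    finally show ?thesis by simp
  qed
  then have "hausdorff_premeasure s \<delta> A = 0" if "0 < \<delta>" for \<delta>
    using that by (metis ennreal_le_epsilon le_zero_eq)
  then show ?thesis by (simp add: hausdorff_measure_def)
qed

text \<open>For exponent 0 every nonempty covering set costs 1, so a cover of total cost below 1
  consists of empty sets. Exponent 0 is kept apart because the comparison of contents needs
  \<open>0 < s\<close>.\<close>

lemma hausdorff_measure_0_empty: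
  assumes "hausdorff_measure 0 A = 0" shows "A = {}"
proof -
  have "hausdorff_premeasure 0 1 A = 0"
    using assms SUP_upper[of 1 "{0<..}" "\<lambda>\<delta>. hausdorff_premeasure 0 \<delta> A"]
    by (simp add: hausdorff_measure_def)
  then have "hausdorff_premeasure 0 1 A < 1" by simp
  then obtain U :: "nat \<Rightarrow> 'a set" where U: "A \<subseteq> (\<Union>i. U i)" "(\<Sum>i. ennreal (diameter_powr 0 (U i))) < 1"
    unfolding hausdorff_premeasure_def by (auto simp: INF_less_iff)
  have "U i = {}" for i
  proof (rule ccontr)
    assume "U i \<noteq> {}"
    then have "1 = (\<Sum>n\<in>{i}. ennreal (diameter_powr 0 (U n)))" by (simp add: diameter_powr_def)
    also have "\<dots> \<le> (\<Sum>i. ennreal (diameter_powr 0 (U i)))" by (rule sum_le_suminf) auto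
    finally show False using U(2) by simp
  qed
  then show ?thesis using U(1) by simp
qed

lemma net_content_pos_if_dim:
  assumes "hausdorff_dim A = ereal d" "0 < s" "s < d"
  shows "0 < net_content s A"
proof (rule ccontr)
  assume "\<not> 0 < net_content s A"
  then have "hausdorff_measure s A = 0"
    using hausdorff_zero_if_net_content_zero[OF assms(2)] by (simp add: not_less)
  then have "hausdorff_dim A \<le> ereal s"
    unfolding hausdorff_dim_def using assms(2) by (intro Inf_lower) auto
  then show False using assms by simp
qed

text \<open>A finite weighted point set in the role of a Frostman measure of exponent
  \<open>s\<close> and mass at least \<open>c\<close>, reliable down to scale 2^-n. The factor 3
  stems from the three dyadic cells that an interval of radius 2^-i can meet.\<close>

definition frostman :: "real \<Rightarrow> real \<Rightarrow> nat \<Rightarrow> real set \<Rightarrow> (real \<Rightarrow> real) \<Rightarrow> bool" where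
  "frostman s c n X m \<longleftrightarrow> finite X \<and> (\<forall>x. 0 \<le> m x) \<and> c \<le> sum m X \<and> sum m X \<le> 1 \<and>
     (\<forall>i\<le>n. \<forall>x. sum m {y \<in> X. \<bar>y - x\<bar> \<le> (1 / 2) ^ i} \<le> 3 * 2 powr (- s * real i))"

text \<open>Going up the dyadic tree from level \<open>n\<close>, the masses of two siblings are added and scaled
  down where they exceed the permitted mass of the parent.\<close>

lemma dyadic_frostman:
  assumes "k \<le> n"
  shows "\<exists>X m. finite X \<and> X \<subseteq> A \<inter> dyad (k, j) \<and> (\<forall>x. 0 \<le> m x) \<and>
    net_content s (A \<inter> dyad (k, j)) \<le> ennreal (sum m X) \<and>
    (\<forall>q. k \<le> fst q \<and> fst q \<le> n \<longrightarrow> sum m (X \<inter> dyad q) \<le> 2 powr (- s * real (fst q)))"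
  using assms
proof (induction k arbitrary: j rule: inc_induct)
  case base
  have N: "net_content s (A \<inter> dyad (n, j)) \<le> ennreal (2 powr (- s * real n))"
    using net_content_le[of "A \<inter> dyad (n, j)" "{(n, j)}" s] by simp
  show ?case
  proof (cases "A \<inter> dyad (n, j) = {}")
    case True
    then show ?thesis by (intro exI[of _ "{}"] exI[of _ "\<lambda>_. 0"]) auto
  next
    case False
    then obtain a where "a \<in> A \<inter> dyad (n, j)" by blast
    then show ?thesis using N
      by (intro exI[of _ "{a}"] exI[of _ "\<lambda>_. 2 powr (- s * real n)"]) (auto simp: Int_insert_left)
  qed
next
  case (step k)
  define w where "w = 2 powr (- s * real k)"
  have "0 < w" by (simp add: w_def)
  obtain X m where X: "finite X" "X \<subseteq> A \<inter> dyad (Suc k, 2 * j)" "\<And>x. 0 \<le> m x"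
    "net_content s (A \<inter> dyad (Suc k, 2 * j)) \<le> ennreal (sum m X)"
    "\<And>q. Suc k \<le> fst q \<and> fst q \<le> n \<Longrightarrow> sum m (X \<inter> dyad q) \<le> 2 powr (- s * real (fst q))"
    using step.IH[of "2 * j"] by blast
  obtain Y m' where Y: "finite Y" "Y \<subseteq> A \<inter> dyad (Suc k, 2 * j + 1)" "\<And>x. 0 \<le> m' x"
    "net_content s (A \<inter> dyad (Suc k, 2 * j + 1)) \<le> ennreal (sum m' Y)"
    "\<And>q. Suc k \<le> fst q \<and> fst q \<le> n \<Longrightarrow> sum m' (Y \<inter> dyad q) \<le> 2 powr (- s * real (fst q))"
    using step.IH[of "2 * j + 1"] by blast
  have split: "dyad (k, j) = dyad (Suc k, 2 * j) \<union> dyad (Suc k, 2 * j + 1)"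
    by (auto simp: dyad_def field_simps)
  have disj: "dyad (Suc k, 2 * j) \<inter> dyad (Suc k, 2 * j + 1) = {}"
    by (auto simp: mem_dyad)
  have XY: "X \<inter> Y = {}" using X(2) Y(2) disj by blast
  define f where "f x = (if x \<in> X then m x else m' x)" for x
  have f0: "0 \<le> f x" for x using X(3) Y(3) by (simp add: f_def)
  have fX: "sum f (X \<inter> Z) = sum m (X \<inter> Z)" for Z by (rule sum.cong) (auto simp: f_def)
  have fY: "sum f (Y \<inter> Z) = sum m' (Y \<inter> Z)" for Z using XY by (intro sum.cong) (auto simp: f_def)
  have fXY: "sum f ((X \<union> Y) \<inter> Z) = sum m (X \<inter> Z) + sum m' (Y \<inter> Z)" for Z
    using X(1) Y(1) XY by (subst fX[symmetric], subst fY[symmetric], subst sum.union_disjoint[symmetric])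
      (auto intro!: sum.cong)
  define \<tau> where "\<tau> = sum f (X \<union> Y)"
  have \<tau>: "\<tau> = sum m X + sum m' Y" using fXY[of UNIV] by (simp add: \<tau>_def)
  have "0 \<le> \<tau>" unfolding \<tau>_def by (intro sum_nonneg f0)
  \<comment> \<open>The scaling caps the mass of the parent at \<open>w\<close>. The content stays
    below the mass, because the content inside the parent is at most \<open>w\<close> and at most
    the sum over both children.\<close>
  define c where "c = (if \<tau> \<le> w then 1 else w / \<tau>)"
  have c: "0 \<le> c" "c \<le> 1" using \<open>0 < w\<close> by (auto simp: c_def)
  have ctau: "c * \<tau> = min \<tau> w" using \<open>0 < w\<close> by (auto simp: c_def)
  have "net_content s (A \<inter> dyad (k, j)) \<le> ennreal (c * \<tau>)"
  proof -
    have "net_content s (A \<inter> dyad (k, j)) \<le> ennreal w"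
      using net_content_le[of "A \<inter> dyad (k, j)" "{(k, j)}" s] by (simp add: w_def)
    moreover have "net_content s (A \<inter> dyad (k, j)) \<le> ennreal \<tau>"
    proof -
      have "net_content s (A \<inter> dyad (k, j)) \<le>
          net_content s (A \<inter> dyad (Suc k, 2 * j)) + net_content s (A \<inter> dyad (Suc k, 2 * j + 1))"
        unfolding split Int_Un_distrib by (rule net_content_Un)
      also have "\<dots> \<le> ennreal (sum m X) + ennreal (sum m' Y)" by (intro add_mono X Y)
      also have "\<dots> = ennreal \<tau>" unfolding \<tau> using X(3) Y(3) by (intro ennreal_plus[symmetric] sum_nonneg) auto
      finally show ?thesis .
    qed
    ultimately show ?thesis unfolding ctau by (simp add: min_def)
  qed
  moreover have "sum (\<lambda>x. c * f x) ((X \<union> Y) \<inter> dyad q) \<le> 2 powr (- s * real (fst q))"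
    if q: "k \<le> fst q" "fst q \<le> n" for q
  proof (cases "fst q = k")
    case True
    have "sum f ((X \<union> Y) \<inter> dyad q) \<le> \<tau>"
      unfolding \<tau>_def using X(1) Y(1) f0 by (intro sum_mono2) auto
    then have "sum (\<lambda>x. c * f x) ((X \<union> Y) \<inter> dyad q) \<le> c * \<tau>"
      using c by (simp add: sum_distrib_left[symmetric] mult_left_mono)
    also have "\<dots> \<le> w" by (simp add: ctau)
    finally show ?thesis using True by (simp add: w_def)
  next
    case False
    then have q': "Suc k \<le> fst q" using q by simp
    have "sum f ((X \<union> Y) \<inter> dyad q) \<le> 2 powr (- s * real (fst q))"
    proof (cases "X \<inter> dyad q = {}")
      case True
      then show ?thesis using Y(5) q q' by (simp add: fXY)
    next
      case False
      then obtain x where "x \<in> dyad q" "x \<in> dyad (Suc k, 2 * j)" using X(2) by blast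
      then have "dyad q \<subseteq> dyad (Suc k, 2 * j)" using dyad_nested[of x "(Suc k, 2 * j)" q] q' by simp
      then have "Y \<inter> dyad q = {}" using Y(2) disj by blast
      then show ?thesis using X(5) q q' by (simp add: fXY)
    qed
    moreover have "sum (\<lambda>x. c * f x) ((X \<union> Y) \<inter> dyad q) \<le> sum f ((X \<union> Y) \<inter> dyad q)"
      using c f0 by (intro sum_mono mult_left_le_one_le) auto
    ultimately show ?thesis by simp
  qed
  moreover have "X \<union> Y \<subseteq> A \<inter> dyad (k, j)" using X(2) Y(2) unfolding split by blast
  moreover have "sum (\<lambda>x. c * f x) (X \<union> Y) = c * \<tau>" by (simp add: \<tau>_def sum_distrib_left)
  ultimately show ?case using X(1) Y(1) c f0
    by (intro exI[of _ "X \<union> Y"] exI[of _ "\<lambda>x. c * f x"]) auto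
qed

lemma sum_Un_le:
  fixes m :: "'a \<Rightarrow> real"
  assumes "finite A" "finite B" "\<And>x. 0 \<le> m x"
  shows "sum m (A \<union> B) \<le> sum m A + sum m B"
  using sum.union_inter[OF assms(1,2), of m] sum_nonneg[of "A \<inter> B" m] assms(3) by simp

text \<open>The set lies in the two dyadic intervals [0,1) and [1,2), one of which carries positive
  content. That content serves as \<open>c\<close> for every \<open>n\<close>.\<close>

lemma frostman_exists:
  assumes "0 < net_content s K" "K \<subseteq> {0..1}"
  shows "\<exists>c>0. \<forall>n. \<exists>X m. X \<subseteq> K \<and> frostman s c n X m"
proof -
  have "K = (K \<inter> dyad (0, 0)) \<union> (K \<inter> dyad (0, 1))"
    using assms(2) by (auto simp: dyad_def)
  then have "net_content s K \<le> net_content s (K \<inter> dyad (0, 0)) + net_content s (K \<inter> dyad (0, 1))"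
    using net_content_Un by metis
  then have "0 < net_content s (K \<inter> dyad (0, 0)) + net_content s (K \<inter> dyad (0, 1))"
    using assms(1) by (rule order.strict_trans2[rotated])
  then obtain j where j: "0 < net_content s (K \<inter> dyad (0, j))" by (auto simp: zero_less_iff_neq_zero)
  define c where "c = enn2real (net_content s (K \<inter> dyad (0, j)))"
  have fin: "net_content s (K \<inter> dyad (0, j)) \<le> 1"
    using net_content_le[of "K \<inter> dyad (0, j)" "{(0, j)}" s] by simp
  then have fin': "net_content s (K \<inter> dyad (0, j)) < top" by (rule order.strict_trans1) simp
  have "0 < c" using j fin' by (simp add: c_def enn2real_positive_iff)
  moreover have "\<exists>X m. X \<subseteq> K \<and> frostman s c n X m" for n
  proof -
    obtain X m where X: "finite X" "X \<subseteq> K \<inter> dyad (0, j)" "\<And>x. 0 \<le> m x"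
      "net_content s (K \<inter> dyad (0, j)) \<le> ennreal (sum m X)"
      "\<And>q. fst q \<le> n \<Longrightarrow> sum m (X \<inter> dyad q) \<le> 2 powr (- s * real (fst q))"
    proof -
      obtain X m where "finite X \<and> X \<subseteq> K \<inter> dyad (0, j) \<and> (\<forall>x. 0 \<le> m x) \<and>
        net_content s (K \<inter> dyad (0, j)) \<le> ennreal (sum m X) \<and>
        (\<forall>q. 0 \<le> fst q \<and> fst q \<le> n \<longrightarrow> sum m (X \<inter> dyad q) \<le> 2 powr (- s * real (fst q)))"
        using dyadic_frostman[of 0 n K j s, OF le0] by (elim exE)
      then show ?thesis using that by blast
    qed
    have "sum m {y \<in> X. \<bar>y - x\<bar> \<le> (1 / 2) ^ i} \<le> 3 * 2 powr (- s * real i)" if "i \<le> n" for i x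
    proof -
      define l where "l = \<lfloor>x * 2 ^ i\<rfloor>"
      have "{y \<in> X. \<bar>y - x\<bar> \<le> (1 / 2) ^ i} \<subseteq>
          (X \<inter> dyad (i, l - 1)) \<union> (X \<inter> dyad (i, l)) \<union> (X \<inter> dyad (i, l + 1))"
      proof safe
        fix y assume y: "y \<in> X" "\<bar>y - x\<bar> \<le> (1 / 2) ^ i" "y \<notin> dyad (i, l + 1)" "y \<notin> dyad (i, l)"
        have "\<bar>y - x\<bar> * 2 ^ i \<le> (1 / 2) ^ i * 2 ^ i" using y(2) by (intro mult_right_mono) auto
        then have "\<bar>(y - x) * 2 ^ i\<bar> \<le> 1" by (simp add: abs_mult power_divide)
        then have "\<bar>y * 2 ^ i - x * 2 ^ i\<bar> \<le> 1" by (simp add: left_diff_distrib)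
        then have "\<lfloor>y * 2 ^ i\<rfloor> = l - 1 \<or> \<lfloor>y * 2 ^ i\<rfloor> = l \<or> \<lfloor>y * 2 ^ i\<rfloor> = l + 1"
          unfolding l_def by linarith
        then show "y \<in> dyad (i, l - 1)" using y(3,4) by (auto simp: mem_dyad)
      qed
      then have "sum m {y \<in> X. \<bar>y - x\<bar> \<le> (1 / 2) ^ i} \<le>
          sum m ((X \<inter> dyad (i, l - 1)) \<union> (X \<inter> dyad (i, l)) \<union> (X \<inter> dyad (i, l + 1)))"
        using X(1,3) by (intro sum_mono2) auto
      also have "\<dots> \<le> sum m (X \<inter> dyad (i, l - 1)) + sum m (X \<inter> dyad (i, l)) + sum m (X \<inter> dyad (i, l + 1))"
        using X(1,3) by (intro order_trans[OF sum_Un_le] add_right_mono sum_Un_le) auto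
      also have "\<dots> \<le> 2 powr (- s * real i) + 2 powr (- s * real i) + 2 powr (- s * real i)"
        using X(5)[of "(i, _)"] that by (intro add_mono) auto
      finally show ?thesis by simp
    qed
    moreover have "c \<le> sum m X"
      using X(4) sum_nonneg[of X m] X(3) unfolding c_def by (intro enn2real_leI) auto
    moreover have "sum m X \<le> 1"
    proof -
      have "X \<inter> dyad (0, j) = X" using X(2) by blast
      then show ?thesis using X(5)[of "(0, j)"] by simp
    qed
    ultimately show ?thesis using X unfolding frostman_def by (intro exI[of _ X] exI[of _ m]) auto
  qed
  ultimately show ?thesis by blast
qed

subsection \<open>Poisson kernels\<close>

text \<open>\<open>v\<close> is the improper integral of \<open>\<phi>\<close> over the half-line \<open>{0..}\<close>.\<close>

definition half_line_integral :: "(real \<Rightarrow> real) \<Rightarrow> real \<Rightarrow> bool" where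
  "half_line_integral \<phi> v \<longleftrightarrow>
     (\<exists>A. (\<forall>\<xi>. (A has_real_derivative \<phi> \<xi>) (at \<xi>)) \<and> (A \<longlongrightarrow> 0) at_top \<and> A 0 = - v)"

lemma half_line_integral_add:
  assumes "half_line_integral f u" "half_line_integral g v"
  shows "half_line_integral (\<lambda>\<xi>. f \<xi> + g \<xi>) (u + v)"
proof -
  obtain A B where "\<And>\<xi>. (A has_real_derivative f \<xi>) (at \<xi>)" "(A \<longlongrightarrow> 0) at_top" "A 0 = - u"
    "\<And>\<xi>. (B has_real_derivative g \<xi>) (at \<xi>)" "(B \<longlongrightarrow> 0) at_top" "B 0 = - v"
    using assms unfolding half_line_integral_def by blast
  then show ?thesis unfolding half_line_integral_def
    by (intro exI[of _ "\<lambda>\<xi>. A \<xi> + B \<xi>"]) (auto intro!: DERIV_add tendsto_add_zero)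
qed

lemma half_line_integral_cmult:
  assumes "half_line_integral f u"
  shows "half_line_integral (\<lambda>\<xi>. c * f \<xi>) (c * u)"
proof -
  obtain A where "\<And>\<xi>. (A has_real_derivative f \<xi>) (at \<xi>)" "(A \<longlongrightarrow> 0) at_top" "A 0 = - u"
    using assms unfolding half_line_integral_def by blast
  then show ?thesis unfolding half_line_integral_def
    by (intro exI[of _ "\<lambda>\<xi>. c * A \<xi>"]) (auto intro!: DERIV_cmult tendsto_mult_right_zero)
qed

lemma half_line_integral_zero: "half_line_integral (\<lambda>_. 0) 0"
  unfolding half_line_integral_def by (intro exI[of _ "\<lambda>_. 0"]) auto

lemma half_line_integral_sum:
  assumes "\<And>i. i \<in> I \<Longrightarrow> half_line_integral (f i) (v i)"
  shows "half_line_integral (\<lambda>\<xi>. \<Sum>i\<in>I. f i \<xi>) (\<Sum>i\<in>I. v i)"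
  using assms
proof (induction I rule: infinite_finite_induct)
  case (insert i I)
  then show ?case using half_line_integral_add[of "f i" "v i"] by simp
qed (auto simp: half_line_integral_zero)

lemma half_line_integral_nonneg:
  assumes "half_line_integral f v" "\<And>\<xi>. 0 \<le> \<xi> \<Longrightarrow> 0 \<le> f \<xi>"
  shows "0 \<le> v"
proof -
  obtain A where A: "\<And>\<xi>. (A has_real_derivative f \<xi>) (at \<xi>)" "(A \<longlongrightarrow> 0) at_top" "A 0 = - v"
    using assms(1) unfolding half_line_integral_def by blast
  have "\<forall>\<^sub>F \<xi> in at_top. A 0 \<le> A \<xi>"
    using eventually_ge_at_top[of 0]
  proof eventually_elim
    case (elim \<xi>)
    then show ?case using A(1) assms(2) by (intro DERIV_nonneg_imp_nondecreasing[of 0 \<xi> A]) auto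
  qed
  then have "A 0 \<le> 0" using A(2) by (intro tendsto_lowerbound[OF A(2)]) auto
  then show ?thesis using A(3) by simp
qed

text \<open>Repeated integration by parts; the value at 0 is minus the Laplace transform of the
  power.\<close>

lemma exp_power_antiderivative:
  fixes s :: complex
  assumes "0 < Re s"
  shows "\<exists>B :: real \<Rightarrow> complex. (\<forall>\<xi>. (B has_vector_derivative of_real \<xi> ^ k * exp (- s * of_real \<xi>)) (at \<xi>)) \<and>
    (B \<longlongrightarrow> 0) at_top \<and> B 0 = - (fact k / s ^ Suc k)"
proof (induction k)
  case 0
  have s: "s \<noteq> 0" using assms by auto
  have "((\<lambda>\<xi>. - exp (- s * of_real \<xi>) / s) has_vector_derivative exp (- s * of_real \<xi>)) (at \<xi>)" for \<xi> :: real
    by (rule has_vector_derivative_eq_rhs, rule has_vector_derivative_real_field)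
      (use s in \<open>auto intro!: derivative_eq_intros\<close>)
  moreover have "((\<lambda>\<xi>. - exp (- s * of_real \<xi>) / s) \<longlongrightarrow> 0) at_top"
  proof (rule tendsto_norm_zero_cancel)
    have "((\<lambda>\<xi>. exp (- Re s * \<xi>) / cmod s) \<longlongrightarrow> 0) at_top" using assms s by real_asymp
    then show "((\<lambda>\<xi>. cmod (- exp (- s * of_real \<xi>) / s)) \<longlongrightarrow> 0) at_top"
      by (simp add: norm_divide)
  qed
  ultimately show ?case by (intro exI[of _ "\<lambda>\<xi>. - exp (- s * of_real \<xi>) / s"]) auto
next
  case (Suc k)
  have s: "s \<noteq> 0" using assms by auto
  obtain B where B: "\<And>\<xi>. (B has_vector_derivative of_real \<xi> ^ k * exp (- s * of_real \<xi>)) (at \<xi>)"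
    "(B \<longlongrightarrow> 0) at_top" "B 0 = - (fact k / s ^ Suc k)" using Suc.IH by blast
  define B' where "B' \<xi> = (of_nat (Suc k) * B \<xi> - of_real \<xi> ^ Suc k * exp (- s * of_real \<xi>)) / s" for \<xi> :: real
  have 1: "(B' has_vector_derivative of_real \<xi> ^ Suc k * exp (- s * of_real \<xi>)) (at \<xi>)" for \<xi> :: real
  proof -
    have "((\<lambda>\<xi>. of_real \<xi> ^ Suc k * exp (- s * of_real \<xi>)) has_vector_derivative
        (of_nat (Suc k) * of_real \<xi> ^ k * exp (- s * of_real \<xi>) - of_real \<xi> ^ Suc k * s * exp (- s * of_real \<xi>))) (at \<xi>)"
      by (rule has_vector_derivative_eq_rhs, rule has_vector_derivative_real_field)
        (auto intro!: derivative_eq_intros simp: algebra_simps simp del: power_Suc)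
    from has_vector_derivative_divide[OF has_vector_derivative_diff[OF
          has_vector_derivative_mult_right[OF B(1), of "of_nat (Suc k)"] this], of s]
    show ?thesis unfolding B'_def
      by (rule has_vector_derivative_eq_rhs) (use s in \<open>simp add: field_simps\<close>)
  qed
  have 2: "(B' \<longlongrightarrow> 0) at_top"
  proof -
    have "((\<lambda>\<xi>. of_real \<xi> ^ Suc k * exp (- s * of_real \<xi>)) \<longlongrightarrow> 0) at_top"
    proof (rule tendsto_norm_zero_cancel)
      have "((\<lambda>\<xi>. \<bar>\<xi>\<bar> ^ Suc k * exp (- Re s * \<xi>)) \<longlongrightarrow> 0) at_top" using assms by real_asymp
      then show "((\<lambda>\<xi>. cmod (of_real \<xi> ^ Suc k * exp (- s * of_real \<xi>))) \<longlongrightarrow> 0) at_top"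
        by (simp add: norm_mult norm_power)
    qed
    from tendsto_divide[OF tendsto_diff[OF
          tendsto_mult[OF tendsto_const[of "of_nat (Suc k)"] B(2)] this] tendsto_const[of s]] s
    show ?thesis by (simp add: B'_def[abs_def])
  qed
  have 3: "B' 0 = - (fact (Suc k) / s ^ Suc (Suc k))"
    unfolding B'_def B(3) using s by (simp add: divide_simps)
  show ?case using 1 2 3 by blast
qed

text \<open>The integral over the half-line of \<open>\<xi> ^ k * exp (- T * \<xi>)\<close> against
  the character with frequency \<open>w\<close>, i.e. the Laplace transform of the power at T -
  iw.\<close>

definition poisson :: "nat \<Rightarrow> real \<Rightarrow> real \<Rightarrow> complex" where
  "poisson k T w = fact k / Complex T (- w) ^ Suc k"

lemma half_line_integral_cos_sin:
  assumes "0 < T"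
  shows "half_line_integral (\<lambda>\<xi>. \<xi> ^ k * exp (- T * \<xi>) * cos (w * \<xi>)) (Re (poisson k T w))"
    and "half_line_integral (\<lambda>\<xi>. \<xi> ^ k * exp (- T * \<xi>) * sin (w * \<xi>)) (Im (poisson k T w))"
proof -
  obtain B where B: "\<And>\<xi>. (B has_vector_derivative of_real \<xi> ^ k * exp (- Complex T (- w) * of_real \<xi>)) (at \<xi>)"
    "(B \<longlongrightarrow> 0) at_top" "B 0 = - (fact k / Complex T (- w) ^ Suc k)"
    using exp_power_antiderivative[of "Complex T (- w)" k] assms by auto
  have e: "of_real \<xi> ^ k * exp (- Complex T (- w) * of_real \<xi>) =
      Complex (\<xi> ^ k * exp (- T * \<xi>) * cos (w * \<xi>)) (\<xi> ^ k * exp (- T * \<xi>) * sin (w * \<xi>))" for \<xi> :: real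
    by (simp add: complex_eq_iff Re_exp Im_exp flip: of_real_power)
  have "((\<lambda>\<xi>. Re (B \<xi>)) has_real_derivative \<xi> ^ k * exp (- T * \<xi>) * cos (w * \<xi>)) (at \<xi>)"
    and "((\<lambda>\<xi>. Im (B \<xi>)) has_real_derivative \<xi> ^ k * exp (- T * \<xi>) * sin (w * \<xi>)) (at \<xi>)" for \<xi>
    using has_field_derivative_Re[OF B(1)[of \<xi>]] has_field_derivative_Im[OF B(1)[of \<xi>]] unfolding e by simp_all
  note D = this
  show "half_line_integral (\<lambda>\<xi>. \<xi> ^ k * exp (- T * \<xi>) * cos (w * \<xi>)) (Re (poisson k T w))"
    unfolding half_line_integral_def poisson_def using tendsto_Re[OF B(2)] B(3) D(1)
    by (intro exI[of _ "\<lambda>\<xi>. Re (B \<xi>)"]) simp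
  show "half_line_integral (\<lambda>\<xi>. \<xi> ^ k * exp (- T * \<xi>) * sin (w * \<xi>)) (Im (poisson k T w))"
    unfolding half_line_integral_def poisson_def using tendsto_Im[OF B(2)] B(3) D(2)
    by (intro exI[of _ "\<lambda>\<xi>. Im (B \<xi>)"]) simp
qed

text \<open>\<open>K0\<close> is \<pi> times the Poisson kernel of the half-plane and
  \<open>K1\<close> is minus its \<open>T\<close>-derivative. In the variable \<open>w\<close>, the
  derivative of \<open>K1\<close> is \<open>- K2\<close> and that of \<open>K2\<close> is
  \<open>K3\<close>.\<close>

definition K0 :: "real \<Rightarrow> real \<Rightarrow> real" where "K0 T w = T / (T\<^sup>2 + w\<^sup>2)"
definition K1 :: "real \<Rightarrow> real \<Rightarrow> real" where "K1 T w = (T\<^sup>2 - w\<^sup>2) / (T\<^sup>2 + w\<^sup>2)\<^sup>2"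
definition K2 :: "real \<Rightarrow> real \<Rightarrow> real" where "K2 T w = 2 * (3 * T\<^sup>2 * w - w ^ 3) / (T\<^sup>2 + w\<^sup>2) ^ 3"
definition K3 :: "real \<Rightarrow> real \<Rightarrow> real" where
  "K3 T w = 6 * (T ^ 4 - 6 * T\<^sup>2 * w\<^sup>2 + w ^ 4) / (T\<^sup>2 + w\<^sup>2) ^ 4"

lemma poisson_eq:
  assumes "0 < T"
  shows "poisson k T w = of_real (fact k / (T\<^sup>2 + w\<^sup>2) ^ Suc k) * Complex T w ^ Suc k"
proof -
  have "Complex T (- w) * Complex T w = of_real (T\<^sup>2 + w\<^sup>2)"
    by (simp add: complex_eq_iff power2_eq_square)
  then have "Complex T (- w) ^ Suc k * Complex T w ^ Suc k = of_real ((T\<^sup>2 + w\<^sup>2) ^ Suc k)"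
    by (simp only: power_mult_distrib[symmetric] of_real_power)
  moreover have "Complex T w \<noteq> 0" using assms by (simp add: complex_eq_iff)
  then have "poisson k T w = fact k * Complex T w ^ Suc k / (Complex T (- w) ^ Suc k * Complex T w ^ Suc k)"
    unfolding poisson_def by (simp del: power_Suc)
  ultimately have "poisson k T w = fact k * Complex T w ^ Suc k / of_real ((T\<^sup>2 + w\<^sup>2) ^ Suc k)"
    by (simp only:)
  then show ?thesis by (simp del: power_Suc)
qed

lemma poisson_kernels:
  assumes "0 < T"
  shows "Re (poisson 0 T w) = K0 T w" "Re (poisson 1 T w) = K1 T w"
    "Im (poisson 2 T w) = K2 T w" "Re (poisson 3 T w) = K3 T w"
  unfolding poisson_eq[OF assms] K0_def K1_def K2_def K3_def
  by (simp_all add: eval_nat_numeral fact_numeral) (simp_all add: algebra_simps)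

lemma half_line_integral_kernels:
  assumes "0 < T"
  shows "half_line_integral (\<lambda>\<xi>. exp (- T * \<xi>) * cos (w * \<xi>)) (K0 T w)"
    and "half_line_integral (\<lambda>\<xi>. \<xi> * exp (- T * \<xi>) * cos (w * \<xi>)) (K1 T w)"
    and "half_line_integral (\<lambda>\<xi>. \<xi>\<^sup>2 * exp (- T * \<xi>) * sin (w * \<xi>)) (K2 T w)"
    and "half_line_integral (\<lambda>\<xi>. \<xi> ^ 3 * exp (- T * \<xi>) * cos (w * \<xi>)) (K3 T w)"
  using half_line_integral_cos_sin(1)[OF assms, of 0 w] half_line_integral_cos_sin(1)[OF assms, of 1 w]
    half_line_integral_cos_sin(2)[OF assms, of 2 w] half_line_integral_cos_sin(1)[OF assms, of 3 w]
  by (simp_all add: poisson_kernels[OF assms] poisson_kernels(2)[OF assms, simplified])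

context
  fixes I :: "'a set" and m y :: "'a \<Rightarrow> real" and T :: real
  assumes T: "0 < T"
begin

lemma cos_double_sum:
  "(\<Sum>p\<in>I. \<Sum>q\<in>I. u p * v q * cos ((y p - y q) * \<xi>)) =
    (\<Sum>p\<in>I. u p * cos (y p * \<xi>)) * (\<Sum>p\<in>I. v p * cos (y p * \<xi>)) +
    (\<Sum>p\<in>I. u p * sin (y p * \<xi>)) * (\<Sum>p\<in>I. v p * sin (y p * \<xi>))"
  by (simp add: left_diff_distrib cos_diff sum_product sum.distrib[symmetric] algebra_simps)

lemma sin_double_sum:
  "(\<Sum>p\<in>I. \<Sum>q\<in>I. u p * v q * sin ((y p - y q) * \<xi>)) =
    (\<Sum>p\<in>I. u p * sin (y p * \<xi>)) * (\<Sum>p\<in>I. v p * cos (y p * \<xi>)) -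
    (\<Sum>p\<in>I. u p * cos (y p * \<xi>)) * (\<Sum>p\<in>I. v p * sin (y p * \<xi>))"
  by (simp add: left_diff_distrib sin_diff sum_product sum_subtractf[symmetric] algebra_simps)

text \<open>The form is the squared modulus of the trigonometric sum with weights \<open>u\<close>.
  Every kernel whose transform is nonnegative inherits this positivity.\<close>

lemma cos_form_nonneg: "0 \<le> (\<Sum>p\<in>I. \<Sum>q\<in>I. u p * u q * cos ((y p - y q) * \<xi>))"
  unfolding cos_double_sum by (intro add_nonneg_nonneg zero_le_square)

text \<open>This is \<open>1 \<le> exp (- x) + x\<close> for \<open>x = T * \<xi>\<close> on the Fourier side.\<close>

lemma energy_halving:
  "(\<Sum>p\<in>I. \<Sum>q\<in>I. m p * m q * K0 T (y p - y q)) \<le>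
    (\<Sum>p\<in>I. \<Sum>q\<in>I. m p * m q * K0 (2 * T) (y p - y q)) +
    T * (\<Sum>p\<in>I. \<Sum>q\<in>I. m p * m q * K1 T (y p - y q))"
proof -
  define \<phi> where "\<phi> w \<xi> = (exp (- (2 * T) * \<xi>) * cos (w * \<xi>) + T * (\<xi> * exp (- T * \<xi>) * cos (w * \<xi>)))
    + (- 1) * (exp (- T * \<xi>) * cos (w * \<xi>))" for w \<xi>
  have "half_line_integral (\<phi> w) (K0 (2 * T) w + T * K1 T w + (- 1) * K0 T w)" for w
    unfolding \<phi>_def[abs_def] using T
    by (intro half_line_integral_add half_line_integral_cmult half_line_integral_kernels) auto
  then have "half_line_integral (\<lambda>\<xi>. \<Sum>p\<in>I. \<Sum>q\<in>I. m p * m q * \<phi> (y p - y q) \<xi>)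
    (\<Sum>p\<in>I. \<Sum>q\<in>I. m p * m q * (K0 (2 * T) (y p - y q) + T * K1 T (y p - y q) + (- 1) * K0 T (y p - y q)))"
    by (intro half_line_integral_sum half_line_integral_cmult)
  moreover have "0 \<le> (\<Sum>p\<in>I. \<Sum>q\<in>I. m p * m q * \<phi> (y p - y q) \<xi>)" if "0 \<le> \<xi>" for \<xi>
  proof -
    have "exp (- (2 * T) * \<xi>) = exp (- T * \<xi>) * exp (- T * \<xi>)" by (simp flip: exp_add)
    then have "exp (- (2 * T) * \<xi>) + T * \<xi> * exp (- T * \<xi>) - exp (- T * \<xi>)
      = exp (- T * \<xi>) * (exp (- (T * \<xi>)) - (1 - T * \<xi>))" by (simp add: algebra_simps)
    moreover have "1 - T * \<xi> \<le> exp (- (T * \<xi>))" using exp_ge_add_one_self[of "- (T * \<xi>)"] by simp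
    ultimately have pos: "0 \<le> exp (- (2 * T) * \<xi>) + T * \<xi> * exp (- T * \<xi>) - exp (- T * \<xi>)" by simp
    have "(\<Sum>p\<in>I. \<Sum>q\<in>I. m p * m q * \<phi> (y p - y q) \<xi>) =
      (exp (- (2 * T) * \<xi>) + T * \<xi> * exp (- T * \<xi>) - exp (- T * \<xi>)) *
      (\<Sum>p\<in>I. \<Sum>q\<in>I. m p * m q * cos ((y p - y q) * \<xi>))"
      unfolding sum_distrib_left by (intro sum.cong refl) (simp add: \<phi>_def algebra_simps)
    also have "\<dots> \<ge> 0" by (intro mult_nonneg_nonneg pos cos_form_nonneg)
    finally show ?thesis .
  qed
  ultimately have "0 \<le> (\<Sum>p\<in>I. \<Sum>q\<in>I. m p * m q * (K0 (2 * T) (y p - y q) + T * K1 T (y p - y q) + (- 1) * K0 T (y p - y q)))"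
    by (rule half_line_integral_nonneg)
  then show ?thesis by (simp add: algebra_simps sum.distrib sum_subtractf sum_distrib_left)
qed

text \<open>\<open>K1\<close> changes sign, but its transform
  \<open>\<xi> * exp (- T * \<xi>)\<close> does not.\<close>

lemma K1_form_nonneg: "0 \<le> (\<Sum>p\<in>I. \<Sum>q\<in>I. m p * m q * K1 T (y p - y q))"
proof (rule half_line_integral_nonneg)
  show "half_line_integral (\<lambda>\<xi>. \<Sum>p\<in>I. \<Sum>q\<in>I. m p * m q * (\<xi> * exp (- T * \<xi>) * cos ((y p - y q) * \<xi>)))
    (\<Sum>p\<in>I. \<Sum>q\<in>I. m p * m q * K1 T (y p - y q))"
    by (intro half_line_integral_sum half_line_integral_cmult half_line_integral_kernels T)
  fix \<xi> :: real assume "0 \<le> \<xi>"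
  have "(\<Sum>p\<in>I. \<Sum>q\<in>I. m p * m q * (\<xi> * exp (- T * \<xi>) * cos ((y p - y q) * \<xi>))) =
    \<xi> * exp (- T * \<xi>) * (\<Sum>p\<in>I. \<Sum>q\<in>I. m p * m q * cos ((y p - y q) * \<xi>))"
    unfolding sum_distrib_left by (intro sum.cong refl) (simp add: ac_simps)
  also have "\<dots> \<ge> 0" using \<open>0 \<le> \<xi>\<close>
    by (intro mult_nonneg_nonneg cos_form_nonneg) auto
  finally show "0 \<le> (\<Sum>p\<in>I. \<Sum>q\<in>I. m p * m q * (\<xi> * exp (- T * \<xi>) * cos ((y p - y q) * \<xi>)))" .
qed

lemma K3_form_nonneg: "0 \<le> (\<Sum>p\<in>I. \<Sum>q\<in>I. m p * m q * K3 T (y p - y q))"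
proof (rule half_line_integral_nonneg)
  show "half_line_integral (\<lambda>\<xi>. \<Sum>p\<in>I. \<Sum>q\<in>I. m p * m q * (\<xi> ^ 3 * exp (- T * \<xi>) * cos ((y p - y q) * \<xi>)))
    (\<Sum>p\<in>I. \<Sum>q\<in>I. m p * m q * K3 T (y p - y q))"
    by (intro half_line_integral_sum half_line_integral_cmult half_line_integral_kernels T)
  fix \<xi> :: real assume "0 \<le> \<xi>"
  have "(\<Sum>p\<in>I. \<Sum>q\<in>I. m p * m q * (\<xi> ^ 3 * exp (- T * \<xi>) * cos ((y p - y q) * \<xi>))) =
    \<xi> ^ 3 * exp (- T * \<xi>) * (\<Sum>p\<in>I. \<Sum>q\<in>I. m p * m q * cos ((y p - y q) * \<xi>))"
    unfolding sum_distrib_left by (intro sum.cong refl) (simp add: ac_simps)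
  also have "\<dots> \<ge> 0" using \<open>0 \<le> \<xi>\<close>
    by (intro mult_nonneg_nonneg cos_form_nonneg) auto
  finally show "0 \<le> (\<Sum>p\<in>I. \<Sum>q\<in>I. m p * m q * (\<xi> ^ 3 * exp (- T * \<xi>) * cos ((y p - y q) * \<xi>)))" .
qed

text \<open>The sum on the left is the derivative of the \<open>K1\<close> form when the points
  \<open>y p\<close> move with velocities \<open>a p\<close>. On the Fourier side the bound is the
  nonnegativity of a square: with transforms \<mu> of \<open>m\<close> and \<nu> of
  \<open>m * a\<close>, the squared modulus of \<mu> + i e T \<xi> \<nu> is integrated for e = 1 and
  e = -1.\<close>

lemma K1_form_derivative_bound:
  "T * \<bar>\<Sum>p\<in>I. \<Sum>q\<in>I. m p * m q * (- K2 T (y p - y q) * (a p - a q))\<bar> \<le>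
    (\<Sum>p\<in>I. \<Sum>q\<in>I. m p * m q * K1 T (y p - y q)) +
    T\<^sup>2 * (\<Sum>p\<in>I. \<Sum>q\<in>I. (m p * a p) * (m q * a q) * K3 T (y p - y q))"
proof -
  let ?G = "\<Sum>p\<in>I. \<Sum>q\<in>I. m p * m q * K1 T (y p - y q)"
  let ?H = "\<Sum>p\<in>I. \<Sum>q\<in>I. (m p * a p) * (m q * a q) * K3 T (y p - y q)"
  let ?D = "\<Sum>p\<in>I. \<Sum>q\<in>I. m p * (m q * a q) * K2 T (y p - y q)"
  have main: "0 \<le> ?G + T\<^sup>2 * ?H + 2 * e * T * ?D" if e: "e\<^sup>2 = 1" for e :: real
  proof (rule half_line_integral_nonneg)
    show "half_line_integral (\<lambda>\<xi>.
       (\<Sum>p\<in>I. \<Sum>q\<in>I. m p * m q * (\<xi> * exp (- T * \<xi>) * cos ((y p - y q) * \<xi>))) +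
       T\<^sup>2 * (\<Sum>p\<in>I. \<Sum>q\<in>I. (m p * a p) * (m q * a q) * (\<xi> ^ 3 * exp (- T * \<xi>) * cos ((y p - y q) * \<xi>))) +
       2 * e * T * (\<Sum>p\<in>I. \<Sum>q\<in>I. m p * (m q * a q) * (\<xi>\<^sup>2 * exp (- T * \<xi>) * sin ((y p - y q) * \<xi>))))
      (?G + T\<^sup>2 * ?H + 2 * e * T * ?D)"
      by (intro half_line_integral_add half_line_integral_sum half_line_integral_cmult half_line_integral_kernels T)
    fix \<xi> :: real assume "0 \<le> \<xi>"
    let ?C = "\<Sum>p\<in>I. m p * cos (y p * \<xi>)" and ?S = "\<Sum>p\<in>I. m p * sin (y p * \<xi>)"
    let ?Ca = "\<Sum>p\<in>I. (m p * a p) * cos (y p * \<xi>)" and ?Sa = "\<Sum>p\<in>I. (m p * a p) * sin (y p * \<xi>)"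
    have 1: "(\<Sum>p\<in>I. \<Sum>q\<in>I. m p * m q * (\<xi> * exp (- T * \<xi>) * cos ((y p - y q) * \<xi>))) =
        \<xi> * exp (- T * \<xi>) * (?C * ?C + ?S * ?S)"
      by (subst cos_double_sum[symmetric], unfold sum_distrib_left, intro sum.cong refl) (simp add: ac_simps)
    have 2: "(\<Sum>p\<in>I. \<Sum>q\<in>I. (m p * a p) * (m q * a q) * (\<xi> ^ 3 * exp (- T * \<xi>) * cos ((y p - y q) * \<xi>))) =
        \<xi> ^ 3 * exp (- T * \<xi>) * (?Ca * ?Ca + ?Sa * ?Sa)"
      by (subst cos_double_sum[symmetric], unfold sum_distrib_left, intro sum.cong refl) (simp add: ac_simps)
    have 3: "(\<Sum>p\<in>I. \<Sum>q\<in>I. m p * (m q * a q) * (\<xi>\<^sup>2 * exp (- T * \<xi>) * sin ((y p - y q) * \<xi>))) =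
        \<xi>\<^sup>2 * exp (- T * \<xi>) * (?S * ?Ca - ?C * ?Sa)"
      by (subst sin_double_sum[symmetric], unfold sum_distrib_left, intro sum.cong refl) (simp add: ac_simps)
    have "x * E * (C * C + S * S) + T\<^sup>2 * (x ^ 3 * E * (Ca * Ca + Sa * Sa)) +
        2 * e * T * (x\<^sup>2 * E * (S * Ca - C * Sa)) =
        x * E * ((C - e * T * x * Sa)\<^sup>2 + (S + e * T * x * Ca)\<^sup>2)" for x E C S Ca Sa :: real
    proof -
      have "(C - e * T * x * Sa)\<^sup>2 + (S + e * T * x * Ca)\<^sup>2 =
        C * C + S * S + e\<^sup>2 * T\<^sup>2 * x\<^sup>2 * (Ca * Ca + Sa * Sa) + 2 * e * T * x * (S * Ca - C * Sa)"
        by (simp add: power2_eq_square algebra_simps)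
      then show ?thesis unfolding e by (simp add: power2_eq_square power3_eq_cube algebra_simps)
    qed
    note sq = this
    show "0 \<le> (\<Sum>p\<in>I. \<Sum>q\<in>I. m p * m q * (\<xi> * exp (- T * \<xi>) * cos ((y p - y q) * \<xi>))) +
       T\<^sup>2 * (\<Sum>p\<in>I. \<Sum>q\<in>I. (m p * a p) * (m q * a q) * (\<xi> ^ 3 * exp (- T * \<xi>) * cos ((y p - y q) * \<xi>))) +
       2 * e * T * (\<Sum>p\<in>I. \<Sum>q\<in>I. m p * (m q * a q) * (\<xi>\<^sup>2 * exp (- T * \<xi>) * sin ((y p - y q) * \<xi>)))"
      unfolding 1 2 3 sq using \<open>0 \<le> \<xi>\<close> by (intro mult_nonneg_nonneg add_nonneg_nonneg) auto
  qed
  \<comment> \<open>As \<open>K2\<close> is odd, exchanging \<open>p\<close> and \<open>q\<close>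
    turns the part with \<open>a p\<close> into the part with \<open>a q\<close>, which doubles
    \<open>?D\<close>.\<close>
  have odd: "K2 T (- w) = - K2 T w" for w unfolding K2_def minus_divide_left by simp
  have odd': "K2 T (y v - y u) = - K2 T (y u - y v)" for u v
    using odd[of "y u - y v"] by simp
  have "(\<Sum>p\<in>I. \<Sum>q\<in>I. m p * m q * (K2 T (y p - y q) * a p)) =
      (\<Sum>q\<in>I. \<Sum>p\<in>I. m p * m q * (K2 T (y p - y q) * a p))" by (rule sum.swap)
  also have "\<dots> = - ?D"
    unfolding sum_negf[symmetric] by (intro sum.cong refl, subst odd', simp)
  finally have sw: "(\<Sum>p\<in>I. \<Sum>q\<in>I. m p * m q * (K2 T (y p - y q) * a p)) = - ?D" .
  have "(\<Sum>p\<in>I. \<Sum>q\<in>I. m p * m q * (- K2 T (y p - y q) * (a p - a q))) =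
      ?D - (\<Sum>p\<in>I. \<Sum>q\<in>I. m p * m q * (K2 T (y p - y q) * a p))"
    unfolding sum_subtractf[symmetric] by (intro sum.cong refl) (simp add: algebra_simps)
  then have "(\<Sum>p\<in>I. \<Sum>q\<in>I. m p * m q * (- K2 T (y p - y q) * (a p - a q))) = 2 * ?D"
    unfolding sw by simp
  then show ?thesis using main[of 1] main[of "- 1"] T by (simp add: abs_if algebra_simps split: if_splits)
qed

end

section \<open>Pointwise bounds and primitives of the kernels\<close>

lemma K0_pos: "0 < T \<Longrightarrow> 0 \<le> K0 T w"
  by (simp add: K0_def)

lemma K1_even: "K1 T (- w) = K1 T w" and K3_even: "K3 T (- w) = K3 T w"
  by (simp_all add: K1_def K3_def)

lemma sum_squares_pos: "0 < T \<Longrightarrow> 0 < T\<^sup>2 + (w :: real)\<^sup>2"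
  by (simp add: add_pos_nonneg)

lemma K1_bound: "0 < T \<Longrightarrow> \<bar>K1 T w\<bar> \<le> 1 / (T\<^sup>2 + w\<^sup>2)"
proof -
  assume T: "0 < T"
  have "\<bar>T\<^sup>2 - w\<^sup>2\<bar> \<le> T\<^sup>2 + w\<^sup>2" by (simp add: abs_le_iff)
  then show ?thesis using sum_squares_pos[OF T, of w]
    by (simp add: K1_def abs_divide divide_simps power2_eq_square[of "T\<^sup>2 + w\<^sup>2"] mult_right_mono)
qed

text \<open>The numerator is 6 times the real part of (T + iw)^4. The two formulas for
  \<open>n\<close> bound that real part from above and from below.\<close>

lemma K3_bound: "0 < T \<Longrightarrow> \<bar>K3 T w\<bar> \<le> 6 / (T\<^sup>2 + w\<^sup>2)\<^sup>2"
proof -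
  assume T: "0 < T"
  define s where "s = T\<^sup>2 + w\<^sup>2"
  have s: "0 < s" using sum_squares_pos[OF T] by (simp add: s_def)
  define n where "n = T ^ 4 - 6 * T\<^sup>2 * w\<^sup>2 + w ^ 4"
  have "n = s\<^sup>2 - 8 * (T * w)\<^sup>2" "n = 2 * (T\<^sup>2 - w\<^sup>2)\<^sup>2 - s\<^sup>2"
    by (simp_all add: n_def s_def power2_eq_square power4_eq_xxxx algebra_simps)
  then have "\<bar>n\<bar> \<le> s\<^sup>2" using zero_le_power2[of "T * w"] zero_le_power2[of "T\<^sup>2 - w\<^sup>2"]
    by linarith
  then have "\<bar>n\<bar> / s ^ 4 \<le> s\<^sup>2 / s ^ 4" using s by (intro divide_right_mono) auto
  also have "\<dots> = 1 / s\<^sup>2" using s by (simp add: power2_eq_square power4_eq_xxxx)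
  finally show ?thesis unfolding K3_def n_def[symmetric] s_def[symmetric]
    using s by (simp add: abs_mult abs_divide)
qed

definition K1_primitive :: "real \<Rightarrow> real \<Rightarrow> real" where "K1_primitive T w = w / (T\<^sup>2 + w\<^sup>2)"

lemma K1_primitive_deriv: "0 < T \<Longrightarrow> (K1_primitive T has_real_derivative K1 T w) (at w)"
  using sum_squares_pos[of T w] unfolding K1_primitive_def[abs_def] K1_def
  by (auto intro!: derivative_eq_intros simp: power2_eq_square)

lemma K1_deriv: "0 < T \<Longrightarrow> (K1 T has_real_derivative - K2 T w) (at w)"
proof -
  assume T: "0 < T"
  define s where "s = T\<^sup>2 + w\<^sup>2"
  have s: "s \<noteq> 0" using sum_squares_pos[OF T, of w] unfolding s_def by (metis less_irrefl)
  have 1: "((\<lambda>w. T\<^sup>2 - w\<^sup>2) has_real_derivative - (2 * w)) (at w)"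
    by (auto intro!: derivative_eq_intros)
  have 2: "((\<lambda>w. (T\<^sup>2 + w\<^sup>2)\<^sup>2) has_real_derivative 2 * s * (2 * w)) (at w)"
    unfolding s_def by (auto intro!: derivative_eq_intros)
  have "(K1 T has_real_derivative (- (2 * w) * s\<^sup>2 - (T\<^sup>2 - w\<^sup>2) * (2 * s * (2 * w))) / (s\<^sup>2 * s\<^sup>2)) (at w)"
    using DERIV_divide[OF 1 2] s unfolding K1_def[abs_def] s_def[symmetric] by simp
  moreover have "- (2 * w) * s\<^sup>2 - (T\<^sup>2 - w\<^sup>2) * (2 * s * (2 * w)) = s * (- (2 * (3 * T\<^sup>2 * w - w ^ 3)))"
    unfolding s_def by (simp add: algebra_simps power2_eq_square power3_eq_cube)
  moreover have "s * n / (s\<^sup>2 * s\<^sup>2) = n / s ^ 3" for n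
    using s by (simp add: power2_eq_square power3_eq_cube)
  ultimately show ?thesis unfolding K2_def s_def[symmetric] minus_divide_left by (simp only:)
qed

lemma K2_deriv: "0 < T \<Longrightarrow> (K2 T has_real_derivative K3 T w) (at w)"
proof -
  assume T: "0 < T"
  define s where "s = T\<^sup>2 + w\<^sup>2"
  have s: "s \<noteq> 0" using sum_squares_pos[OF T, of w] unfolding s_def by (metis less_irrefl)
  have 1: "((\<lambda>w. 2 * (3 * T\<^sup>2 * w - w ^ 3)) has_real_derivative 6 * (T\<^sup>2 - w\<^sup>2)) (at w)"
    by (auto intro!: derivative_eq_intros)
  have 2: "((\<lambda>w. (T\<^sup>2 + w\<^sup>2) ^ 3) has_real_derivative 3 * s\<^sup>2 * (2 * w)) (at w)"
    unfolding s_def by (auto intro!: derivative_eq_intros)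
  have "(K2 T has_real_derivative (6 * (T\<^sup>2 - w\<^sup>2) * s ^ 3 - 2 * (3 * T\<^sup>2 * w - w ^ 3) * (3 * s\<^sup>2 * (2 * w))) / (s ^ 3 * s ^ 3)) (at w)"
    using DERIV_divide[OF 1 2] s unfolding K2_def[abs_def] s_def[symmetric] by simp
  moreover have "6 * (T\<^sup>2 - w\<^sup>2) * s ^ 3 - 2 * (3 * T\<^sup>2 * w - w ^ 3) * (3 * s\<^sup>2 * (2 * w))
      = s\<^sup>2 * (6 * (T\<^sup>2 - w\<^sup>2) * s - 12 * (3 * T\<^sup>2 * w - w ^ 3) * w)"
    by (simp add: algebra_simps power2_eq_square power3_eq_cube)
  moreover have "6 * (T\<^sup>2 - w\<^sup>2) * s - 12 * (3 * T\<^sup>2 * w - w ^ 3) * w = 6 * (T ^ 4 - 6 * T\<^sup>2 * w\<^sup>2 + w ^ 4)"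
    unfolding s_def by (simp add: algebra_simps power2_eq_square power3_eq_cube power4_eq_xxxx)
  moreover have "s\<^sup>2 * n / (s ^ 3 * s ^ 3) = n / s ^ 4" for n
    using s by (simp add: power2_eq_square power3_eq_cube power4_eq_xxxx)
  ultimately show ?thesis unfolding K3_def s_def[symmetric] by simp
qed

text \<open>The majorant is chosen for its explicit primitive \<open>arsinh (u / T)\<close>. This is
  the origin of the logarithmic growth of the constants in the scale.\<close>

lemma K1_primitive_bound: "0 < T \<Longrightarrow> \<bar>K1_primitive T w\<bar> \<le> 1 / sqrt (T\<^sup>2 + w\<^sup>2)"
proof -
  assume T: "0 < T"
  have "\<bar>w\<bar> * sqrt (T\<^sup>2 + w\<^sup>2) \<le> sqrt (T\<^sup>2 + w\<^sup>2) * sqrt (T\<^sup>2 + w\<^sup>2)"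
    by (intro mult_right_mono) (auto intro: real_le_rsqrt)
  then show ?thesis using sum_squares_pos[OF T, of w]
    by (simp add: K1_primitive_def abs_divide divide_simps)
qed

text \<open>The numerator is twice the imaginary part of (T + iw)^3. One factor sqrt (T^2 + w^2) is
  estimated by \<open>T\<close> in the denominator, so that the majorant has an
  \<open>arctan\<close> as primitive.\<close>

lemma K2_bound: "0 < T \<Longrightarrow> \<bar>K2 T w\<bar> \<le> 2 / T * (1 / (T\<^sup>2 + w\<^sup>2))"
proof -
  assume T: "0 < T"
  define s where "s = T\<^sup>2 + w\<^sup>2"
  have s: "0 < s" using sum_squares_pos[OF T] by (simp add: s_def)
  define n where "n = 3 * T\<^sup>2 * w - w ^ 3"
  have "(T * n)\<^sup>2 + (T * (T ^ 3 - 3 * T * w\<^sup>2))\<^sup>2 = T\<^sup>2 * s ^ 3"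
    by (simp add: n_def s_def eval_nat_numeral algebra_simps)
  also have "\<dots> \<le> s * s ^ 3" using s by (intro mult_right_mono) (auto simp: s_def)
  also have "\<dots> = (s\<^sup>2)\<^sup>2" by (simp add: eval_nat_numeral)
  finally have "(T * n)\<^sup>2 \<le> (s\<^sup>2)\<^sup>2" using zero_le_power2[of "T * (T ^ 3 - 3 * T * w\<^sup>2)"] by linarith
  then have "\<bar>T * n\<bar> \<le> s\<^sup>2" using s by (intro power2_le_imp_le[of "\<bar>T * n\<bar>"]) (simp_all only: power2_abs, simp)
  then have "T * \<bar>n\<bar> \<le> s\<^sup>2" using T by (simp add: abs_mult)
  then have "\<bar>n\<bar> \<le> s\<^sup>2 / T" using T by (simp add: field_simps)
  then have "2 * \<bar>n\<bar> / s ^ 3 \<le> 2 * (s\<^sup>2 / T) / s ^ 3" using s by (intro divide_right_mono) auto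
  also have "\<dots> = 2 / T * (1 / s)" using s by (simp add: eval_nat_numeral)
  finally show ?thesis unfolding K2_def n_def[symmetric] s_def[symmetric]
    using s by (simp add: abs_mult abs_divide)
qed

section \<open>Oscillatory integrals of the kernels along transversal phases\<close>

lemma arsinh_real_mono: "x \<le> y \<Longrightarrow> arsinh x \<le> arsinh (y :: real)"
  by (metis arsinh_less_iff_real not_le)

lemma deriv_continuous_on:
  fixes f :: "real \<Rightarrow> real"
  assumes "\<And>z. z \<in> S \<Longrightarrow> (f has_real_derivative f' z) (at z)"
  shows "continuous_on S f"
  using assms by (intro continuous_at_imp_continuous_on ballI) (rule DERIV_isCont)

text \<open>Integration by parts, with \<open>K (w z)\<close> the derivative of
  \<open>\<Theta> (w z)\<close> divided by \<open>w1 z\<close>; the boundary terms vanish with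
  \<beta>. The rest \<open>R\<close> is bounded by a multiple of \<open>\<theta> (w z)\<close>, and
  after the substitution u = w z, at the price of a further 1/e, only the increment of
  \<open>H\<close> remains.\<close>

lemma oscillatory_integral:
  fixes w w1 w2 \<beta> \<beta>1 K \<Theta> \<theta> H :: "real \<Rightarrow> real"
  assumes z: "z1 \<le> z2"
    and dw: "\<And>z. z \<in> {z1..z2} \<Longrightarrow> (w has_real_derivative w1 z) (at z)"
    and dw1: "\<And>z. z \<in> {z1..z2} \<Longrightarrow> (w1 has_real_derivative w2 z) (at z)"
    and d\<beta>: "\<And>z. z \<in> {z1..z2} \<Longrightarrow> (\<beta> has_real_derivative \<beta>1 z) (at z)"
    and ends: "\<beta> z1 = 0" "\<beta> z2 = 0"
    and e: "0 < e" "\<And>z. z \<in> {z1..z2} \<Longrightarrow> e \<le> w1 z"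
    and w2: "\<And>z. z \<in> {z1..z2} \<Longrightarrow> \<bar>w2 z\<bar> \<le> D"
    and \<beta>: "\<And>z. z \<in> {z1..z2} \<Longrightarrow> \<bar>\<beta> z\<bar> \<le> B" "\<And>z. z \<in> {z1..z2} \<Longrightarrow> \<bar>\<beta>1 z\<bar> \<le> B"
    and \<Theta>: "\<And>u. (\<Theta> has_real_derivative K u) (at u)" "\<And>u. \<bar>\<Theta> u\<bar> \<le> \<theta> u"
    and H: "\<And>u. (H has_real_derivative \<theta> u) (at u)"
    and K: "continuous_on UNIV K"
  shows "\<bar>integral {z1..z2} (\<lambda>z. K (w z) * \<beta> z)\<bar> \<le> (B / e + B * D / e\<^sup>2) / e * (H (w z2) - H (w z1))"
proof -
  define R where "R z = \<Theta> (w z) * (\<beta>1 z / w1 z - \<beta> z * w2 z / (w1 z)\<^sup>2)" for z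
  have w1: "0 < w1 z" if "z \<in> {z1..z2}" for z using e that by (meson order.strict_trans2)
  have "((\<lambda>z. \<Theta> (w z) * (\<beta> z / w1 z)) has_real_derivative K (w z) * \<beta> z + R z) (at z)"
    if zz: "z \<in> {z1..z2}" for z
  proof -
    have 1: "((\<lambda>z. \<Theta> (w z)) has_real_derivative K (w z) * w1 z) (at z)"
      using DERIV_chain2[OF \<Theta>(1) dw[OF zz]] by simp
    have 2: "((\<lambda>z. \<beta> z / w1 z) has_real_derivative \<beta>1 z / w1 z - \<beta> z * w2 z / (w1 z)\<^sup>2) (at z)"
      using DERIV_divide[OF d\<beta>[OF zz] dw1[OF zz]] w1[OF zz]
      by (simp add: diff_divide_distrib power2_eq_square)
    show ?thesis using DERIV_mult[OF 1 2] w1[OF zz] by (simp add: R_def ac_simps add.commute)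
  qed
  then have "((\<lambda>z. K (w z) * \<beta> z + R z) has_integral \<Theta> (w z2) * (\<beta> z2 / w1 z2) - \<Theta> (w z1) * (\<beta> z1 / w1 z1)) {z1..z2}"
    using z by (intro fundamental_theorem_of_calculus)
      (auto simp: has_real_derivative_iff_has_vector_derivative intro: has_vector_derivative_at_within)
  then have I0: "((\<lambda>z. K (w z) * \<beta> z + R z) has_integral 0) {z1..z2}" using ends by simp
  have "continuous_on {z1..z2} w" "continuous_on {z1..z2} \<beta>"
    by (rule deriv_continuous_on[OF dw] deriv_continuous_on[OF d\<beta>]; assumption)+
  then have "continuous_on {z1..z2} (\<lambda>z. K (w z) * \<beta> z)"
    by (intro continuous_on_mult continuous_on_compose2[OF K]) auto
  then have IK: "(\<lambda>z. K (w z) * \<beta> z) integrable_on {z1..z2}" by (rule integrable_continuous_interval)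
  have IR: "(R has_integral - integral {z1..z2} (\<lambda>z. K (w z) * \<beta> z)) {z1..z2}"
    using has_integral_diff[OF I0 integrable_integral[OF IK]] by simp
  have "((\<lambda>z. \<theta> (w z) * w1 z) has_integral H (w z2) - H (w z1)) {z1..z2}"
    using z DERIV_chain2[OF H dw] by (intro fundamental_theorem_of_calculus)
      (auto simp: has_real_derivative_iff_has_vector_derivative[symmetric] intro: DERIV_subset)
  from has_integral_mult_right[OF this, of "(B / e + B * D / e\<^sup>2) / e"]
  have IH: "((\<lambda>z. (B / e + B * D / e\<^sup>2) / e * (\<theta> (w z) * w1 z)) has_integral
      (B / e + B * D / e\<^sup>2) / e * (H (w z2) - H (w z1))) {z1..z2}" .
  have "\<bar>R z\<bar> \<le> (B / e + B * D / e\<^sup>2) / e * (\<theta> (w z) * w1 z)" if zz: "z \<in> {z1..z2}" for z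
  proof -
    have B0: "0 \<le> B" and D0: "0 \<le> D" using \<beta>(1)[OF zz] w2[OF zz] by linarith+
    have th0: "0 \<le> \<theta> (w z)" using \<Theta>(2)[of "w z"] by linarith
    have "\<bar>\<beta>1 z / w1 z\<bar> \<le> B / e"
      using \<beta>(2)[OF zz] e(1) e(2)[OF zz] w1[OF zz] B0 by (simp add: abs_divide frac_le)
    moreover have "\<bar>\<beta> z * w2 z / (w1 z)\<^sup>2\<bar> \<le> B * D / e\<^sup>2"
      using \<beta>(1)[OF zz] w2[OF zz] e(1) e(2)[OF zz] w1[OF zz] B0 D0
      by (simp add: abs_divide abs_mult) (intro frac_le mult_mono power_mono; simp)
    ultimately have "\<bar>\<beta>1 z / w1 z - \<beta> z * w2 z / (w1 z)\<^sup>2\<bar> \<le> B / e + B * D / e\<^sup>2" by linarith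
    then have "\<bar>R z\<bar> \<le> \<theta> (w z) * (B / e + B * D / e\<^sup>2)"
      unfolding R_def abs_mult using \<Theta>(2) th0 by (intro mult_mono) auto
    also have "\<dots> \<le> (\<theta> (w z) * (B / e + B * D / e\<^sup>2)) * (w1 z / e)"
    proof -
      have "0 \<le> \<theta> (w z) * (B / e + B * D / e\<^sup>2)" using e(1) th0 B0 D0 by simp
      moreover have "1 \<le> w1 z / e" using e(1) e(2)[OF zz] by simp
      ultimately show ?thesis using mult_left_mono[of 1 "w1 z / e"] by fastforce
    qed
    finally show ?thesis by (simp add: ac_simps)
  qed
  then have "norm (integral {z1..z2} R) \<le> integral {z1..z2} (\<lambda>z. (B / e + B * D / e\<^sup>2) / e * (\<theta> (w z) * w1 z))"
    using IR IH by (intro integral_norm_bound_integral) (auto simp: has_integral_iff)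
  then show ?thesis unfolding integral_unique[OF IR] integral_unique[OF IH] by simp
qed

lemma K1_continuous: "0 < T \<Longrightarrow> continuous_on UNIV (K1 T)"
  by (rule deriv_continuous_on) (rule K1_deriv)

lemma K3_continuous: "0 < T \<Longrightarrow> continuous_on UNIV (K3 T)"
  unfolding K3_def[abs_def] using sum_squares_pos
  by (intro continuous_intros) (auto simp: less_imp_neq[symmetric])

text \<open>A phase bounded away from 0 is handled by the decay of the kernel, an increasing phase
  by integration by parts. A decreasing phase is reflected, the kernel being even.\<close>

lemma oscillatory_integral_cases:
  fixes w w1 w2 \<beta> \<beta>1 :: "real \<Rightarrow> real"
  assumes z: "z1 \<le> z2"
    and dw: "\<And>z. z \<in> {z1..z2} \<Longrightarrow> (w has_real_derivative w1 z) (at z)"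
    and dw1: "\<And>z. z \<in> {z1..z2} \<Longrightarrow> (w1 has_real_derivative w2 z) (at z)"
    and d\<beta>: "\<And>z. z \<in> {z1..z2} \<Longrightarrow> (\<beta> has_real_derivative \<beta>1 z) (at z)"
    and ends: "\<beta> z1 = 0" "\<beta> z2 = 0"
    and w2: "\<And>z. z \<in> {z1..z2} \<Longrightarrow> \<bar>w2 z\<bar> \<le> C * d"
    and \<beta>: "\<And>z. z \<in> {z1..z2} \<Longrightarrow> \<bar>\<beta> z\<bar> \<le> B" "\<And>z. z \<in> {z1..z2} \<Longrightarrow> \<bar>\<beta>1 z\<bar> \<le> B"
    and cd: "0 < c" "0 < d" "0 \<le> C" "0 \<le> B"
    and dich: "(\<forall>z\<in>{z1..z2}. c * d \<le> \<bar>w z\<bar>) \<or> (\<forall>z\<in>{z1..z2}. c * d \<le> w1 z) \<or> (\<forall>z\<in>{z1..z2}. w1 z \<le> - (c * d))"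
    and even: "\<And>u. K (- u) = K u" and K: "continuous_on UNIV K"
    and \<Theta>: "\<And>u. (\<Theta> has_real_derivative K u) (at u)" "\<And>u. \<bar>\<Theta> u\<bar> \<le> \<theta> u"
    and H: "\<And>u. (H has_real_derivative \<theta> u) (at u)" "\<And>u v. \<bar>u\<bar> \<le> M \<Longrightarrow> \<bar>v\<bar> \<le> M \<Longrightarrow> H u - H v \<le> V"
    and M: "\<And>z. z \<in> {z1..z2} \<Longrightarrow> \<bar>w z\<bar> \<le> M"
    and far: "\<And>u. c * d \<le> \<bar>u\<bar> \<Longrightarrow> \<bar>K u\<bar> \<le> W / (c * d)\<^sup>2" and W: "0 \<le> W" "0 \<le> V"
  shows "\<bar>integral {z1..z2} (\<lambda>z. K (w z) * \<beta> z)\<bar> \<le> (B * (1 / c + C / c\<^sup>2) / c * V + B * (z2 - z1) * W / c\<^sup>2) * (1 / d)\<^sup>2"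
proof -
  \<comment> \<open>With slope bound \<open>c * d\<close> and second derivative bound
    \<open>C * d\<close>, every term is homogeneous of degree -2 in \<open>d\<close>.\<close>
  have X: "(B / (c * d) + B * (C * d) / (c * d)\<^sup>2) / (c * d) = B * (1 / c + C / c\<^sup>2) / c * (1 / d)\<^sup>2"
    using cd by (simp add: field_simps power2_eq_square)
  have X0: "0 \<le> B * (1 / c + C / c\<^sup>2) / c * (1 / d)\<^sup>2" and Y0: "0 \<le> B * (z2 - z1) * W / c\<^sup>2 * (1 / d)\<^sup>2"
    using cd W z by auto
  have mono: "x \<le> (B * (1 / c + C / c\<^sup>2) / c * V + B * (z2 - z1) * W / c\<^sup>2) * (1 / d)\<^sup>2"
    if "x \<le> (B / (c * d) + B * (C * d) / (c * d)\<^sup>2) / (c * d) * v" "v \<le> V" for x v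
  proof -
    have "x \<le> B * (1 / c + C / c\<^sup>2) / c * (1 / d)\<^sup>2 * V"
      using that X0 unfolding X by (meson mult_left_mono order_trans)
    then show ?thesis using Y0 by (simp add: algebra_simps)
  qed
  from dich consider "\<forall>z\<in>{z1..z2}. c * d \<le> \<bar>w z\<bar>" | "\<forall>z\<in>{z1..z2}. c * d \<le> w1 z" | "\<forall>z\<in>{z1..z2}. w1 z \<le> - (c * d)"
    by blast
  then show ?thesis
  proof cases
    case 1
    have "\<bar>K (w z) * \<beta> z\<bar> \<le> W / (c * d)\<^sup>2 * B" if "z \<in> {z1..z2}" for z
      unfolding abs_mult using far[of "w z"] 1 \<beta>(1) that W by (intro mult_mono) auto
    moreover have "continuous_on {z1..z2} w" "continuous_on {z1..z2} \<beta>"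
      by (rule deriv_continuous_on[OF dw] deriv_continuous_on[OF d\<beta>]; assumption)+
    then have "continuous_on {z1..z2} (\<lambda>z. K (w z) * \<beta> z)"
      by (intro continuous_on_mult continuous_on_compose2[OF K]) auto
    ultimately have "norm (integral {z1..z2} (\<lambda>z. K (w z) * \<beta> z)) \<le> W / (c * d)\<^sup>2 * B * (z2 - z1)"
      using z by (intro integral_bound) auto
    also have "\<dots> = B * (z2 - z1) * W / c\<^sup>2 * (1 / d)\<^sup>2"
      using cd by (simp add: field_simps)
    also have "\<dots> \<le> (B * (1 / c + C / c\<^sup>2) / c * V + B * (z2 - z1) * W / c\<^sup>2) * (1 / d)\<^sup>2"
      using mult_nonneg_nonneg[OF X0 W(2)] by (simp add: algebra_simps)
    finally show ?thesis by simp
  next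
    case 2
    show ?thesis
      by (rule mono[OF oscillatory_integral[OF z dw dw1 d\<beta> ends _ _ w2 \<beta> \<Theta> H(1) K]])
        (use 2 cd M z in \<open>auto intro!: H(2)\<close>)
  next
    case 3
    have "\<bar>integral {z1..z2} (\<lambda>z. K (- w z) * \<beta> z)\<bar> \<le> (B * (1 / c + C / c\<^sup>2) / c * V + B * (z2 - z1) * W / c\<^sup>2) * (1 / d)\<^sup>2"
      by (rule mono[OF oscillatory_integral[OF z DERIV_minus[OF dw] DERIV_minus[OF dw1] d\<beta> ends _ _ _ \<beta> \<Theta> H(1) K]])
        (use 3 cd M z w2 in \<open>auto intro!: H(2) simp: le_minus_iff[of "c * d"]\<close>)
    then show ?thesis by (simp add: even)
  qed
qed

subsection \<open>Transversal families\<close>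

text \<open>\<open>F z\<close> is the member of the family with parameter \<open>z\<close>, and
  \<open>dd\<close> stands for the distance of two points. The alternative in
  \<open>transversal\<close>, including the sign, is the same for all \<open>z\<close>, so that each
  pair of points falls under one case of the oscillatory estimate on the whole interval.\<close>

locale phase =
  fixes F F1 F2 :: "real \<Rightarrow> 'a \<Rightarrow> real" and P :: "'a set" and dd :: "'a \<Rightarrow> 'a \<Rightarrow> real"
    and z1 z2 c C M :: real
  assumes z12: "z1 < z2" and c: "0 < c" and C: "0 \<le> C" and M: "0 \<le> M" and dd: "\<And>p q. 0 \<le> dd p q"
    and F: "\<And>p z. p \<in> P \<Longrightarrow> z \<in> {z1..z2} \<Longrightarrow> ((\<lambda>z. F z p) has_real_derivative F1 z p) (at z)"
    and F1: "\<And>p z. p \<in> P \<Longrightarrow> z \<in> {z1..z2} \<Longrightarrow> ((\<lambda>z. F1 z p) has_real_derivative F2 z p) (at z)"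
    and F1_bound: "\<And>p z. p \<in> P \<Longrightarrow> z \<in> {z1..z2} \<Longrightarrow> \<bar>F1 z p\<bar> \<le> C"
    and F2_bound: "\<And>p z. p \<in> P \<Longrightarrow> z \<in> {z1..z2} \<Longrightarrow> \<bar>F2 z p\<bar> \<le> C"
    and F_bound: "\<And>p q z. p \<in> P \<Longrightarrow> q \<in> P \<Longrightarrow> z \<in> {z1..z2} \<Longrightarrow> \<bar>F z p - F z q\<bar> \<le> M"
    and F2_diff: "\<And>p q z. p \<in> P \<Longrightarrow> q \<in> P \<Longrightarrow> z \<in> {z1..z2} \<Longrightarrow> \<bar>F2 z p - F2 z q\<bar> \<le> C * dd p q"
    and transversal: "\<And>p q. p \<in> P \<Longrightarrow> q \<in> P \<Longrightarrow>
      (\<forall>z\<in>{z1..z2}. c * dd p q \<le> \<bar>F z p - F z q\<bar>) \<or>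
      (\<forall>z\<in>{z1..z2}. c * dd p q \<le> F1 z p - F1 z q) \<or> (\<forall>z\<in>{z1..z2}. F1 z p - F1 z q \<le> - (c * dd p q))"
begin

text \<open>It vanishes at both ends, which removes the boundary terms of the integration by parts,
  and it is bounded below away from the ends.\<close>

definition cutoff :: "real \<Rightarrow> real" where "cutoff z = (z - z1) * (z2 - z)"

definition "len = z2 - z1"
text \<open>\<open>cutoff_norm\<close> bounds the cutoff and its product with two factors
  \<open>F1\<close>, together with their derivatives; this explains
  \<open>1 + 3 * C\<^sup>2\<close>. \<open>slope\<close> is the factor of the oscillatory estimate.
  \<open>const T\<close> collects the \<open>arsinh\<close> term of \<open>K1\<close>, the
  \<open>arctan\<close> term of \<open>K3\<close>, and the bounds for far and for close pairs, so
  that one constant serves both kernels.\<close>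

definition "cutoff_norm = (len\<^sup>2 + len) * (1 + 3 * C\<^sup>2)"
definition "slope = cutoff_norm * (1 / c + C / c\<^sup>2) / c"
definition "const T = slope * (2 * arsinh (M / T)) + slope * (2 * pi) + 6 * cutoff_norm * len * (1 / c\<^sup>2 + 1)"

lemma len_pos: "0 < len" using z12 by (simp add: len_def)
lemma cutoff_norm_nonneg: "0 \<le> cutoff_norm" using len_pos by (simp add: cutoff_norm_def)
lemma slope_nonneg: "0 \<le> slope" using cutoff_norm_nonneg c C by (simp add: slope_def)

lemma cutoff_deriv: "(cutoff has_real_derivative (z1 + z2 - 2 * z)) (at z)"
  unfolding cutoff_def[abs_def] by (auto intro!: derivative_eq_intros simp: algebra_simps)

lemma cutoff_ends: "cutoff z1 = 0" "cutoff z2 = 0" by (simp_all add: cutoff_def)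

lemma cutoff_bounds:
  assumes "z \<in> {z1..z2}"
  shows "0 \<le> cutoff z" "cutoff z \<le> len\<^sup>2 + len" "\<bar>z1 + z2 - 2 * z\<bar> \<le> len\<^sup>2 + len"
proof -
  show "0 \<le> cutoff z" using assms by (simp add: cutoff_def)
  have "cutoff z \<le> len * len" unfolding cutoff_def len_def using assms by (intro mult_mono) auto
  then show "cutoff z \<le> len\<^sup>2 + len" using len_pos by (simp add: power2_eq_square)
  have "\<bar>z1 + z2 - 2 * z\<bar> \<le> len" using assms by (simp add: len_def abs_le_iff)
  then show "\<bar>z1 + z2 - 2 * z\<bar> \<le> len\<^sup>2 + len" by (simp add: add_increasing)
qed

lemma trivial_integral_bound:
  assumes "continuous_on {z1..z2} g" "\<And>z. z \<in> {z1..z2} \<Longrightarrow> \<bar>g z\<bar> \<le> B"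
  shows "\<bar>integral {z1..z2} g\<bar> \<le> B * len"
  using integral_bound[of z1 z2 g B] assms z12 by (simp add: len_def)

lemma arsinh_deriv: "0 < T \<Longrightarrow> ((\<lambda>u. arsinh (u / T)) has_real_derivative 1 / sqrt (T\<^sup>2 + u\<^sup>2)) (at u)"
proof -
  assume T: "0 < T"
  have "((\<lambda>u. arsinh (u / T)) has_real_derivative (1 / T) / sqrt ((u / T)\<^sup>2 + 1)) (at u)"
    by (rule DERIV_cong[OF DERIV_chain2[OF arsinh_real_has_field_derivative DERIV_cdivide[OF DERIV_ident]]]) simp
  moreover have "T * sqrt ((u / T)\<^sup>2 + 1) = sqrt (T\<^sup>2 + u\<^sup>2)"
  proof -
    have "T * sqrt ((u / T)\<^sup>2 + 1) = sqrt (T\<^sup>2) * sqrt ((u / T)\<^sup>2 + 1)" using T by simp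
    also have "\<dots> = sqrt (T\<^sup>2 * ((u / T)\<^sup>2 + 1))" by (rule real_sqrt_mult[symmetric])
    also have "T\<^sup>2 * ((u / T)\<^sup>2 + 1) = T\<^sup>2 + u\<^sup>2" using T by (simp add: power_divide distrib_left)
    finally show ?thesis .
  qed
  ultimately show ?thesis by (simp add: divide_divide_eq_left)
qed

lemma arctan_deriv: "0 < T \<Longrightarrow> ((\<lambda>u. 2 / T\<^sup>2 * arctan (u / T)) has_real_derivative 2 / T * (1 / (T\<^sup>2 + u\<^sup>2))) (at u)"
proof -
  assume T: "0 < T"
  have "((\<lambda>u. 2 / T\<^sup>2 * arctan (u / T)) has_real_derivative 2 / T\<^sup>2 * ((1 / T) / (1 + (u / T)\<^sup>2))) (at u)"
    by (auto intro!: derivative_eq_intros simp: divide_inverse)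
  moreover have "T\<^sup>2 * (T * (1 + (u / T)\<^sup>2)) = T * (T\<^sup>2 + u\<^sup>2)" using T by (simp add: power_divide distrib_left)
  ultimately show ?thesis by simp
qed

lemma arsinh_nonneg: "0 < T \<Longrightarrow> 0 \<le> arsinh (M / T)"
  using arsinh_real_mono[of 0 "M / T"] M by simp

lemma const_parts:
  assumes "0 < T"
  shows "0 \<le> slope * (2 * arsinh (M / T))" "0 \<le> slope * (2 * pi)" "0 \<le> 6 * cutoff_norm * len / c\<^sup>2" "0 \<le> 6 * cutoff_norm * len"
proof -
  show "0 \<le> slope * (2 * arsinh (M / T))" using slope_nonneg arsinh_nonneg[OF assms] by simp
qed (use assms slope_nonneg cutoff_norm_nonneg len_pos c in auto)

text \<open>For points closer than \<open>T\<close> the size of the kernel suffices. For the others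
  the cancellation in \<open>K1\<close> is essential: its absolute value integrated over a
  transversal crossing would give only 1 / (T d).\<close>

lemma K1_pair_bound:
  assumes p: "p \<in> P" "q \<in> P" and T: "0 < T"
  shows "\<bar>integral {z1..z2} (\<lambda>z. K1 T (F z p - F z q) * cutoff z)\<bar> \<le> const T * (1 / max T (dd p q))\<^sup>2"
proof (cases "dd p q \<le> T")
  case True
  have "continuous_on {z1..z2} (\<lambda>z. F z p - F z q)"
    by (rule deriv_continuous_on) (rule DERIV_diff F p | assumption)+
  then have "continuous_on {z1..z2} (\<lambda>z. K1 T (F z p - F z q) * cutoff z)"
    by (intro continuous_on_mult continuous_on_compose2[OF K1_continuous[OF T]]
        deriv_continuous_on[OF cutoff_deriv]) auto
  moreover have "\<bar>K1 T (F z p - F z q) * cutoff z\<bar> \<le> 1 / T\<^sup>2 * cutoff_norm" if "z \<in> {z1..z2}" for z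
  proof -
    have "\<bar>K1 T u\<bar> \<le> 1 / T\<^sup>2" for u
      using T by (intro order_trans[OF K1_bound[OF T, of u]]) (simp add: frac_le)
    moreover have "\<bar>cutoff z\<bar> \<le> cutoff_norm"
    proof -
      have "(len\<^sup>2 + len) * 1 \<le> cutoff_norm" unfolding cutoff_norm_def using len_pos by (intro mult_left_mono) auto
      then show ?thesis using cutoff_bounds[OF that] by simp
    qed
    ultimately show ?thesis unfolding abs_mult by (intro mult_mono) auto
  qed
  ultimately have "\<bar>integral {z1..z2} (\<lambda>z. K1 T (F z p - F z q) * cutoff z)\<bar> \<le> 1 / T\<^sup>2 * cutoff_norm * len"
    by (rule trivial_integral_bound)
  also have "\<dots> = (cutoff_norm * len) * (1 / max T (dd p q))\<^sup>2" using True by (simp add: power_divide)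
  also have "\<dots> \<le> const T * (1 / max T (dd p q))\<^sup>2"
    using const_parts[OF T] cutoff_norm_nonneg len_pos
    by (intro mult_right_mono) (auto simp: const_def distrib_left)
  finally show ?thesis .
next
  case False
  have "\<bar>integral {z1..z2} (\<lambda>z. K1 T (F z p - F z q) * cutoff z)\<bar> \<le>
      (cutoff_norm * (1 / c + C / c\<^sup>2) / c * (2 * arsinh (M / T)) + cutoff_norm * (z2 - z1) * 1 / c\<^sup>2) * (1 / dd p q)\<^sup>2"
  proof (rule oscillatory_integral_cases[where \<Theta> = "K1_primitive T" and H = "\<lambda>u. arsinh (u / T)"
        and \<theta> = "\<lambda>u. 1 / sqrt (T\<^sup>2 + u\<^sup>2)" and M = M
        and w = "\<lambda>z. F z p - F z q" and ?w1.0 = "\<lambda>z. F1 z p - F1 z q" and ?w2.0 = "\<lambda>z. F2 z p - F2 z q"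
        and \<beta> = cutoff and ?\<beta>1.0 = "\<lambda>z. z1 + z2 - 2 * z"])
    have N: "len\<^sup>2 + len \<le> cutoff_norm"
    proof -
      have "(len\<^sup>2 + len) * 1 \<le> cutoff_norm" unfolding cutoff_norm_def using len_pos by (intro mult_left_mono) auto
      then show ?thesis by simp
    qed
    show "\<bar>cutoff z\<bar> \<le> cutoff_norm" "\<bar>z1 + z2 - 2 * z\<bar> \<le> cutoff_norm" if "z \<in> {z1..z2}" for z
      using cutoff_bounds[OF that] N by auto
    show "arsinh (u / T) - arsinh (v / T) \<le> 2 * arsinh (M / T)" if "\<bar>u\<bar> \<le> M" "\<bar>v\<bar> \<le> M" for u v
    proof -
      have "arsinh (u / T) \<le> arsinh (M / T)" "arsinh (- v / T) \<le> arsinh (M / T)"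
        by (intro arsinh_real_mono divide_right_mono; use that T in simp)+
      then show ?thesis by simp
    qed
    show "\<bar>K1 T u\<bar> \<le> 1 / (c * dd p q)\<^sup>2" if "c * dd p q \<le> \<bar>u\<bar>" for u
    proof -
      have "(c * dd p q)\<^sup>2 \<le> u\<^sup>2" using that c dd[of p q] by (intro abs_le_square_iff[THEN iffD1]) auto
      then have "(c * dd p q)\<^sup>2 \<le> T\<^sup>2 + u\<^sup>2" by (simp add: add_increasing)
      moreover have "0 < (c * dd p q)\<^sup>2" using False T c by simp
      ultimately have "1 / (T\<^sup>2 + u\<^sup>2) \<le> 1 / (c * dd p q)\<^sup>2"
        by (intro divide_left_mono mult_pos_pos sum_squares_pos[OF T]) auto
      then show ?thesis using K1_bound[OF T, of u] by simp
    qed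
    show "0 < dd p q" using False T by simp
  qed (use p F F1 F2_diff F_bound c C M T z12 transversal in
      \<open>auto intro!: DERIV_diff cutoff_deriv K1_primitive_deriv K1_primitive_bound arsinh_deriv K1_continuous
         simp: cutoff_ends cutoff_norm_nonneg K1_even arsinh_nonneg\<close>)
  also have "\<dots> \<le> const T * (1 / dd p q)\<^sup>2"
  proof (intro mult_right_mono)
    show "cutoff_norm * (1 / c + C / c\<^sup>2) / c * (2 * arsinh (M / T)) + cutoff_norm * (z2 - z1) * 1 / c\<^sup>2 \<le> const T"
    proof -
      have "6 * cutoff_norm * len / c\<^sup>2 = 6 * (cutoff_norm * len / c\<^sup>2)" by simp
      moreover have "const T = slope * (2 * arsinh (M / T)) + slope * (2 * pi) + 6 * cutoff_norm * len / c\<^sup>2 + 6 * cutoff_norm * len"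
        by (simp add: const_def distrib_left)
      ultimately show ?thesis
        using const_parts[OF T] unfolding slope_def[symmetric] len_def[symmetric] mult_1_right by linarith
    qed
  qed simp
  finally show ?thesis using False by (simp add: max_def)
qed

text \<open>\<open>T\<^sup>2 * K3 T\<close> scales like \<open>K1 T\<close>. The velocities are
  absorbed into the cutoff, whose derivative then involves \<open>F2\<close>.\<close>

lemma K3_pair_bound:
  assumes p: "p \<in> P" "q \<in> P" and T: "0 < T"
  shows "T\<^sup>2 * \<bar>integral {z1..z2} (\<lambda>z. K3 T (F z p - F z q) * (cutoff z * (F1 z p * F1 z q)))\<bar>
    \<le> const T * (1 / max T (dd p q))\<^sup>2"
proof -
  define \<beta>1 where "\<beta>1 z = (z1 + z2 - 2 * z) * (F1 z p * F1 z q) + (F2 z p * F1 z q + F2 z q * F1 z p) * cutoff z" for z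
  have d\<beta>: "((\<lambda>z. cutoff z * (F1 z p * F1 z q)) has_real_derivative \<beta>1 z) (at z)" if "z \<in> {z1..z2}" for z
    unfolding \<beta>1_def using that p by (intro DERIV_mult cutoff_deriv F1)
  have prod: "\<bar>a * b\<bar> \<le> C\<^sup>2" if "\<bar>a\<bar> \<le> C" "\<bar>b\<bar> \<le> C" for a b
    unfolding abs_mult power2_eq_square using that by (intro mult_mono) auto
  have \<beta>: "\<bar>cutoff z * (F1 z p * F1 z q)\<bar> \<le> cutoff_norm" "\<bar>\<beta>1 z\<bar> \<le> cutoff_norm" if z: "z \<in> {z1..z2}" for z
  proof -
    let ?L = "len\<^sup>2 + len"
    have L: "0 \<le> ?L" using len_pos by simp
    have FF: "\<bar>F1 z p * F1 z q\<bar> \<le> C\<^sup>2" "\<bar>F2 z p * F1 z q\<bar> \<le> C\<^sup>2" "\<bar>F2 z q * F1 z p\<bar> \<le> C\<^sup>2"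
      using F1_bound F2_bound p z by (auto intro!: prod)
    have cut: "\<bar>cutoff z\<bar> \<le> ?L" using cutoff_bounds[OF z] by simp
    have 1: "\<bar>cutoff z * (F1 z p * F1 z q)\<bar> \<le> ?L * C\<^sup>2"
      unfolding abs_mult[of "cutoff z"] using cut FF L by (intro mult_mono) auto
    have 2: "\<bar>(z1 + z2 - 2 * z) * (F1 z p * F1 z q)\<bar> \<le> ?L * C\<^sup>2"
      unfolding abs_mult[of "z1 + z2 - 2 * z"] using cutoff_bounds[OF z] FF L by (intro mult_mono) auto
    have "\<bar>F2 z p * F1 z q + F2 z q * F1 z p\<bar> \<le> 2 * C\<^sup>2" using FF by linarith
    then have 3: "\<bar>(F2 z p * F1 z q + F2 z q * F1 z p) * cutoff z\<bar> \<le> (2 * C\<^sup>2) * ?L"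
      unfolding abs_mult[of _ "cutoff z"] using cut L by (intro mult_mono) auto
    have N: "cutoff_norm = ?L + 3 * (?L * C\<^sup>2)" by (simp add: cutoff_norm_def distrib_left)
    have "0 \<le> ?L * C\<^sup>2" using L by simp
    then show "\<bar>cutoff z * (F1 z p * F1 z q)\<bar> \<le> cutoff_norm" using 1 L unfolding N by linarith
    have "\<bar>\<beta>1 z\<bar> \<le> ?L * C\<^sup>2 + (2 * C\<^sup>2) * ?L" unfolding \<beta>1_def using 2 3 by linarith
    also have "\<dots> = 3 * (?L * C\<^sup>2)" by simp
    finally show "\<bar>\<beta>1 z\<bar> \<le> cutoff_norm" using L unfolding N by linarith
  qed
  show ?thesis
  proof (cases "dd p q \<le> T")
    case True
    have "continuous_on {z1..z2} (\<lambda>z. F z p - F z q)"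
      by (rule deriv_continuous_on) (rule DERIV_diff F p | assumption)+
    then have "continuous_on {z1..z2} (\<lambda>z. K3 T (F z p - F z q) * (cutoff z * (F1 z p * F1 z q)))"
      by (intro continuous_on_mult[OF continuous_on_compose2[OF K3_continuous[OF T]]]
          deriv_continuous_on[OF d\<beta>]) auto
    moreover have "\<bar>K3 T (F z p - F z q) * (cutoff z * (F1 z p * F1 z q))\<bar> \<le> 6 / (T\<^sup>2)\<^sup>2 * cutoff_norm" if "z \<in> {z1..z2}" for z
    proof -
      have "\<bar>K3 T u\<bar> \<le> 6 / (T\<^sup>2)\<^sup>2" for u
        using T by (intro order_trans[OF K3_bound[OF T, of u]] divide_left_mono power_mono mult_pos_pos zero_less_power)
          (auto simp: sum_squares_pos)
      then show ?thesis unfolding abs_mult[of "K3 _ _"] using \<beta>(1)[OF that] by (intro mult_mono) auto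
    qed
    ultimately have "\<bar>integral {z1..z2} (\<lambda>z. K3 T (F z p - F z q) * (cutoff z * (F1 z p * F1 z q)))\<bar>
        \<le> 6 / (T\<^sup>2)\<^sup>2 * cutoff_norm * len"
      by (rule trivial_integral_bound)
    then have "T\<^sup>2 * \<bar>integral {z1..z2} (\<lambda>z. K3 T (F z p - F z q) * (cutoff z * (F1 z p * F1 z q)))\<bar>
        \<le> T\<^sup>2 * (6 / (T\<^sup>2)\<^sup>2 * cutoff_norm * len)" by (intro mult_left_mono) auto
    also have "\<dots> = (6 * cutoff_norm * len) * (1 / max T (dd p q))\<^sup>2"
      using True T by (simp add: field_simps power2_eq_square)
    also have "\<dots> \<le> const T * (1 / max T (dd p q))\<^sup>2"
      using const_parts[OF T] by (intro mult_right_mono) (auto simp: const_def distrib_left)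
    finally show ?thesis .
  next
    case False
    have "\<bar>integral {z1..z2} (\<lambda>z. K3 T (F z p - F z q) * (cutoff z * (F1 z p * F1 z q)))\<bar> \<le>
        (cutoff_norm * (1 / c + C / c\<^sup>2) / c * (2 * pi / T\<^sup>2) + cutoff_norm * (z2 - z1) * (6 / T\<^sup>2) / c\<^sup>2) * (1 / dd p q)\<^sup>2"
    proof (rule oscillatory_integral_cases[where \<Theta> = "K2 T" and H = "\<lambda>u. 2 / T\<^sup>2 * arctan (u / T)"
          and \<theta> = "\<lambda>u. 2 / T * (1 / (T\<^sup>2 + u\<^sup>2))" and M = M
          and w = "\<lambda>z. F z p - F z q" and ?w1.0 = "\<lambda>z. F1 z p - F1 z q" and ?w2.0 = "\<lambda>z. F2 z p - F2 z q"
          and \<beta> = "\<lambda>z. cutoff z * (F1 z p * F1 z q)" and ?\<beta>1.0 = \<beta>1])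
      show "2 / T\<^sup>2 * arctan (u / T) - 2 / T\<^sup>2 * arctan (v / T) \<le> 2 * pi / T\<^sup>2" for u v
      proof -
        have "arctan (u / T) - arctan (v / T) \<le> pi"
          using arctan_ubound[of "u / T"] arctan_lbound[of "v / T"] by linarith
        then have "2 / T\<^sup>2 * (arctan (u / T) - arctan (v / T)) \<le> 2 / T\<^sup>2 * pi" by (intro mult_left_mono) auto
        then show ?thesis by (simp add: right_diff_distrib)
      qed
      show "\<bar>K3 T u\<bar> \<le> 6 / T\<^sup>2 / (c * dd p q)\<^sup>2" if "c * dd p q \<le> \<bar>u\<bar>" for u
      proof -
        have 1: "(c * dd p q)\<^sup>2 \<le> u\<^sup>2" using that c dd[of p q] by (intro abs_le_square_iff[THEN iffD1]) auto
        then have "T\<^sup>2 * (c * dd p q)\<^sup>2 \<le> (T\<^sup>2 + u\<^sup>2) * (T\<^sup>2 + u\<^sup>2)" by (intro mult_mono) (auto simp: add_increasing)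
        moreover have "0 < (c * dd p q)\<^sup>2" using False T c by simp
        ultimately have "6 / (T\<^sup>2 + u\<^sup>2)\<^sup>2 \<le> 6 / (T\<^sup>2 * (c * dd p q)\<^sup>2)"
          using T by (intro divide_left_mono mult_pos_pos) (auto simp: power2_eq_square[of "T\<^sup>2 + u\<^sup>2"] sum_squares_pos)
        then show ?thesis using K3_bound[OF T, of u] by simp
      qed
      show "0 < dd p q" using False T by simp
      show "\<bar>K2 T u\<bar> \<le> 2 / T * (1 / (T\<^sup>2 + u\<^sup>2))" for u by (rule K2_bound[OF T])
      show "((\<lambda>u. 2 / T\<^sup>2 * arctan (u / T)) has_real_derivative 2 / T * (1 / (T\<^sup>2 + u\<^sup>2))) (at u)" for u
        by (rule arctan_deriv[OF T])
    qed (use p F F1 F2_diff F_bound c C M T z12 transversal \<beta> d\<beta> in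
        \<open>auto intro!: DERIV_diff K2_deriv K3_continuous
           simp: cutoff_ends cutoff_norm_nonneg K3_even\<close>)
    then have "T\<^sup>2 * \<bar>integral {z1..z2} (\<lambda>z. K3 T (F z p - F z q) * (cutoff z * (F1 z p * F1 z q)))\<bar> \<le>
        T\<^sup>2 * ((cutoff_norm * (1 / c + C / c\<^sup>2) / c * (2 * pi / T\<^sup>2) + cutoff_norm * (z2 - z1) * (6 / T\<^sup>2) / c\<^sup>2) * (1 / dd p q)\<^sup>2)"
      by (intro mult_left_mono) auto
    also have "\<dots> = (slope * (2 * pi) + 6 * cutoff_norm * len / c\<^sup>2) * (1 / dd p q)\<^sup>2"
      unfolding slope_def[symmetric] len_def[symmetric]
    proof -
      have "T\<^sup>2 * (a * (2 * pi / T\<^sup>2)) = a * (2 * pi)" "T\<^sup>2 * (b * (6 / T\<^sup>2) / c\<^sup>2) = 6 * b / c\<^sup>2" for a b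
        using T by simp_all
      then show "T\<^sup>2 * ((slope * (2 * pi / T\<^sup>2) + cutoff_norm * len * (6 / T\<^sup>2) / c\<^sup>2) * (1 / dd p q)\<^sup>2) =
          (slope * (2 * pi) + 6 * cutoff_norm * len / c\<^sup>2) * (1 / dd p q)\<^sup>2"
        by (simp only: mult.assoc[symmetric] distrib_left)
    qed
    also have "\<dots> \<le> const T * (1 / dd p q)\<^sup>2"
      using const_parts[OF T] by (intro mult_right_mono) (auto simp: const_def distrib_left)
    finally show ?thesis using False by (simp add: max_def)
  qed
qed

end

section \<open>Energies of discrete measures along the family\<close>

context phase
begin

context
  fixes I :: "'a set" and m :: "'a \<Rightarrow> real"
  assumes I: "finite I" "I \<subseteq> P" and m: "\<And>p. 0 \<le> m p"
begin

text \<open>\<open>dissipation\<close> is minus the \<open>T\<close>-derivative of the energy.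
  \<open>majorant\<close> equals it plus \<open>T\<close> times the bound for its
  \<open>z\<close>-derivative, in which \<open>dissipation1\<close> is the form of \<open>K3\<close>
  for the measure weighted by velocities.\<close>

definition "energy T z = (\<Sum>p\<in>I. \<Sum>q\<in>I. m p * m q * K0 T (F z p - F z q))"
definition "dissipation T z = (\<Sum>p\<in>I. \<Sum>q\<in>I. m p * m q * K1 T (F z p - F z q))"
definition "dissipation1 T z = (\<Sum>p\<in>I. \<Sum>q\<in>I. (m p * F1 z p) * (m q * F1 z q) * K3 T (F z p - F z q))"
definition "majorant T z = 2 * dissipation T z + T\<^sup>2 * dissipation1 T z"

lemma energy_step: "0 < T \<Longrightarrow> energy T z \<le> energy (2 * T) z + T * dissipation T z"
  unfolding energy_def dissipation_def by (rule energy_halving)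

lemma dissipation_nonneg: "0 < T \<Longrightarrow> 0 \<le> dissipation T z"
  unfolding dissipation_def by (rule K1_form_nonneg)

lemma dissipation1_nonneg: "0 < T \<Longrightarrow> 0 \<le> dissipation1 T z"
  unfolding dissipation1_def by (rule K3_form_nonneg)

lemma majorant_nonneg: "0 < T \<Longrightarrow> 0 \<le> majorant T z"
  unfolding majorant_def using dissipation_nonneg dissipation1_nonneg by simp

lemma F_continuous: "p \<in> P \<Longrightarrow> continuous_on {z1..z2} (\<lambda>z. F z p)"
  by (rule deriv_continuous_on) (rule F)

lemma F1_continuous: "p \<in> P \<Longrightarrow> continuous_on {z1..z2} (\<lambda>z. F1 z p)"
  by (rule deriv_continuous_on) (rule F1)

lemma dissipation_continuous: "0 < T \<Longrightarrow> continuous_on {z1..z2} (dissipation T)"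
  unfolding dissipation_def[abs_def] using I(2)
  by (intro continuous_intros continuous_on_compose2[OF K1_continuous] F_continuous) auto

lemma dissipation1_continuous: "0 < T \<Longrightarrow> continuous_on {z1..z2} (dissipation1 T)"
  unfolding dissipation1_def[abs_def] using I(2)
  by (intro continuous_intros continuous_on_compose2[OF K3_continuous] F_continuous F1_continuous) auto

lemma majorant_continuous: "0 < T \<Longrightarrow> continuous_on {z1..z2} (majorant T)"
  unfolding majorant_def[abs_def] by (intro continuous_intros dissipation_continuous dissipation1_continuous)

lemma majorant_integral_bound:
  assumes T: "0 < T"
  shows "integral {z1..z2} (\<lambda>z. cutoff z * majorant T z) \<le>
    3 * const T * (\<Sum>p\<in>I. \<Sum>q\<in>I. m p * m q * (1 / max T (dd p q))\<^sup>2)"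
proof -
  let ?k1 = "\<lambda>p q z. K1 T (F z p - F z q) * cutoff z"
  let ?k3 = "\<lambda>p q z. K3 T (F z p - F z q) * (cutoff z * (F1 z p * F1 z q))"
  have cont: "continuous_on {z1..z2} cutoff"
    by (rule deriv_continuous_on) (rule cutoff_deriv)
  have int: "?k1 p q integrable_on {z1..z2}" "?k3 p q integrable_on {z1..z2}" if "p \<in> I" "q \<in> I" for p q
    using that I(2) T
    by (intro integrable_continuous_interval continuous_intros continuous_on_compose2[OF K1_continuous]
        continuous_on_compose2[OF K3_continuous] F_continuous F1_continuous cont; auto)+
  have "(\<lambda>z. cutoff z * majorant T z) = (\<lambda>z. \<Sum>p\<in>I. \<Sum>q\<in>I. m p * m q * (2 * ?k1 p q z + T\<^sup>2 * ?k3 p q z))"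
    unfolding majorant_def dissipation_def dissipation1_def
    by (intro ext) (simp add: sum_distrib_left sum.distrib algebra_simps)
  then have "integral {z1..z2} (\<lambda>z. cutoff z * majorant T z) =
      (\<Sum>p\<in>I. \<Sum>q\<in>I. m p * m q * (2 * integral {z1..z2} (?k1 p q) + T\<^sup>2 * integral {z1..z2} (?k3 p q)))"
    using I(1) int
    by (simp add: integral_sum integral_mult_right integral_add integrable_sum integrable_add integrable_on_mult_right)
  also have "\<dots> \<le> (\<Sum>p\<in>I. \<Sum>q\<in>I. m p * m q * (3 * const T * (1 / max T (dd p q))\<^sup>2))"
  proof (intro sum_mono mult_left_mono)
    fix p q assume "p \<in> I" "q \<in> I"
    then have pq: "p \<in> P" "q \<in> P" using I(2) by auto
    have "integral {z1..z2} (?k1 p q) \<le> const T * (1 / max T (dd p q))\<^sup>2"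
      using K1_pair_bound[OF pq T] by linarith
    moreover have "T\<^sup>2 * integral {z1..z2} (?k3 p q) \<le> const T * (1 / max T (dd p q))\<^sup>2"
    proof -
      have "T\<^sup>2 * integral {z1..z2} (?k3 p q) \<le> T\<^sup>2 * \<bar>integral {z1..z2} (?k3 p q)\<bar>"
        by (intro mult_left_mono) auto
      then show ?thesis using K3_pair_bound[OF pq T] by linarith
    qed
    ultimately show "2 * integral {z1..z2} (?k1 p q) + T\<^sup>2 * integral {z1..z2} (?k3 p q) \<le>
        3 * const T * (1 / max T (dd p q))\<^sup>2" by linarith
    show "0 \<le> m p * m q" using m by simp
  qed
  also have "\<dots> = 3 * const T * (\<Sum>p\<in>I. \<Sum>q\<in>I. m p * m q * (1 / max T (dd p q))\<^sup>2)"
    by (simp add: sum_distrib_left ac_simps)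
  finally show ?thesis .
qed

text \<open>A one-dimensional Sobolev inequality: the form is nearly constant in \<open>z\<close> at scale \<open>T\<close>.\<close>

lemma dissipation_local_bound:
  assumes T: "0 < T" and z0: "z1 \<le> z0" "z0 + T \<le> z2"
  shows "T * dissipation T z0 \<le> integral {z0..z0 + T} (majorant T)"
proof -
  define G' where "G' z = (\<Sum>p\<in>I. \<Sum>q\<in>I. m p * m q * (- K2 T (F z p - F z q) * (F1 z p - F1 z q)))" for z
  define g where "g z = (dissipation T z + T\<^sup>2 * dissipation1 T z) / T" for z
  have sub: "{z0..z0 + T} \<subseteq> {z1..z2}" using z0 by auto
  have dG: "(dissipation T has_real_derivative G' z) (at z)" if "z \<in> {z0..z0 + T}" for z
  proof -
    have "((\<lambda>z. K1 T (F z p - F z q)) has_real_derivative - K2 T (F z p - F z q) * (F1 z p - F1 z q)) (at z)"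
      if "p \<in> I" "q \<in> I" for p q
      using that I(2) sub \<open>z \<in> {z0..z0 + T}\<close>
      by (intro DERIV_chain2[OF K1_deriv[OF T]] DERIV_diff F) auto
    then show ?thesis unfolding dissipation_def[abs_def] G'_def
      by (intro DERIV_sum DERIV_cmult)
  qed
  have G'g: "\<bar>G' z\<bar> \<le> g z" for z
    using K1_form_derivative_bound[OF T, where y = "F z" and a = "F1 z" and m = m and I = I] T
    unfolding G'_def g_def dissipation_def dissipation1_def by (simp add: field_simps)
  have g0: "0 \<le> g z" for z using G'g[of z] by linarith
  have gcont: "continuous_on {z0..z0 + T} g"
    unfolding g_def[abs_def] using sub T
    by (intro continuous_intros continuous_on_subset[OF dissipation_continuous]
        continuous_on_subset[OF dissipation1_continuous]) auto
  then have gint: "g integrable_on {z0..z0 + T}" by (rule integrable_continuous_interval)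
  have upper: "dissipation T z0 \<le> dissipation T z + integral {z0..z0 + T} g" if z: "z \<in> {z0..z0 + T}" for z
  proof -
    have sub': "{z0..z} \<subseteq> {z0..z0 + T}" using z by auto
    have "(G' has_integral dissipation T z - dissipation T z0) {z0..z}"
      using z by (intro fundamental_theorem_of_calculus)
        (auto simp: has_real_derivative_iff_has_vector_derivative[symmetric] intro!: has_field_derivative_at_within dG)
    then have "((\<lambda>z. - G' z) has_integral - (dissipation T z - dissipation T z0)) {z0..z}"
      by (rule has_integral_neg)
    moreover have gint': "g integrable_on {z0..z}"
      using gcont sub' by (intro integrable_continuous_interval) (rule continuous_on_subset)
    ultimately have "- (dissipation T z - dissipation T z0) \<le> integral {z0..z} g"
      using G'g by (intro has_integral_le[OF _ integrable_integral[OF gint']]) (auto simp: abs_le_iff)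
    also have "\<dots> \<le> integral {z0..z0 + T} g"
      using sub' gint gint' g0 by (intro integral_subset_le) auto
    finally show ?thesis by simp
  qed
  have Dint: "dissipation T integrable_on {z0..z0 + T}"
    using T sub by (intro integrable_continuous_interval continuous_on_subset[OF dissipation_continuous])
  \<comment> \<open>The inequality \<open>upper\<close> is averaged over the interval of length
    \<open>T\<close>.\<close>
  have "T * dissipation T z0 = integral {z0..z0 + T} (\<lambda>_. dissipation T z0)"
    using T by simp
  also have "\<dots> \<le> integral {z0..z0 + T} (\<lambda>z. dissipation T z + integral {z0..z0 + T} g)"
    using upper Dint by (intro integral_le integrable_add) auto
  also have "\<dots> = integral {z0..z0 + T} (dissipation T) + T * integral {z0..z0 + T} g"
    using Dint T by (subst integral_add) auto
  also have "\<dots> = integral {z0..z0 + T} (\<lambda>z. dissipation T z + T * g z)"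
    using Dint gint by (subst integral_add) (auto simp: integrable_on_mult_right)
  also have "(\<lambda>z. dissipation T z + T * g z) = majorant T"
    using T by (auto simp: g_def majorant_def)
  finally show ?thesis .
qed

text \<open>Each point \<open>z\<close> of the discrete measure is spread over the interval of
  length \<open>T\<close> to its right. The intervals that contain a given \<open>y\<close> have
  total weight at most \<open>S\<close>, so the weighted sum is dominated by a Lebesgue integral, to
  which transversality applies.\<close>

lemma dissipation_sum_bound:
  assumes T: "0 < T" "T \<le> \<eta>" and Z: "finite Z" "Z \<subseteq> {z1 + \<eta>..z2 - 2 * \<eta>}"
    and \<rho>: "\<And>z. 0 \<le> \<rho> z" and S: "\<And>z. sum \<rho> {y \<in> Z. \<bar>y - z\<bar> \<le> T} \<le> S"
  shows "T * (\<Sum>z\<in>Z. \<rho> z * dissipation T z) \<le>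
    S / \<eta>\<^sup>2 * (3 * const T * (\<Sum>p\<in>I. \<Sum>q\<in>I. m p * m q * (1 / max T (dd p q))\<^sup>2))"
proof -
  have \<eta>: "0 < \<eta>" using T by simp
  have S0: "0 \<le> S" using S[of 0] \<rho> by (meson order_trans sum_nonneg)
  define f where "f z y = (if y \<in> {z..z + T} then majorant T y else 0)" for z y
  have fint: "(f z has_integral integral {z..z + T} (majorant T)) {z1..z2}" if "z \<in> Z" for z
  proof -
    have sub: "{z..z + T} \<subseteq> {z1..z2}" using that Z T by auto
    then have "majorant T integrable_on {z..z + T}"
      using T(1) by (intro integrable_continuous_interval continuous_on_subset[OF majorant_continuous])
    then show ?thesis unfolding f_def[abs_def] has_integral_restrict[OF sub] by (rule integrable_integral)
  qed
  have "T * (\<Sum>z\<in>Z. \<rho> z * dissipation T z) = (\<Sum>z\<in>Z. \<rho> z * (T * dissipation T z))"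
    by (simp add: sum_distrib_left ac_simps)
  also have "\<dots> \<le> (\<Sum>z\<in>Z. \<rho> z * integral {z..z + T} (majorant T))"
  proof (intro sum_mono mult_left_mono \<rho> dissipation_local_bound T)
    fix z assume "z \<in> Z"
    then show "z1 \<le> z" "z + T \<le> z2" using Z T by auto
  qed
  also have "\<dots> \<le> S / \<eta>\<^sup>2 * integral {z1..z2} (\<lambda>z. cutoff z * majorant T z)"
  proof (rule has_integral_le)
    show "((\<lambda>y. \<Sum>z\<in>Z. \<rho> z * f z y) has_integral (\<Sum>z\<in>Z. \<rho> z * integral {z..z + T} (majorant T))) {z1..z2}"
      by (intro has_integral_sum Z has_integral_mult_right fint)
    have "(\<lambda>z. cutoff z * majorant T z) integrable_on {z1..z2}"
      using T(1) by (intro integrable_continuous_interval continuous_intros majorant_continuous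
          deriv_continuous_on[OF cutoff_deriv])
    then show "((\<lambda>y. S / \<eta>\<^sup>2 * (cutoff y * majorant T y)) has_integral
        S / \<eta>\<^sup>2 * integral {z1..z2} (\<lambda>z. cutoff z * majorant T z)) {z1..z2}"
      by (intro has_integral_mult_right integrable_integral)
    fix y assume y: "y \<in> {z1..z2}"
    have M: "0 \<le> majorant T y" by (rule majorant_nonneg[OF T(1)])
    show "(\<Sum>z\<in>Z. \<rho> z * f z y) \<le> S / \<eta>\<^sup>2 * (cutoff y * majorant T y)"
    proof (cases "\<exists>z\<in>Z. y \<in> {z..z + T}")
      case True
      then obtain z where z: "z \<in> Z" "y \<in> {z..z + T}" by blast
      \<comment> \<open>The interval reaches at most \<eta> beyond \<open>z\<close>. With the
        margins \<eta> on the left and \<open>2 * \<eta>\<close> on the right, \<open>y\<close>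
        keeps distance \<eta> from both ends.\<close>
      have "\<eta> * \<eta> \<le> (y - z1) * (z2 - y)" using z Z T by (intro mult_mono) auto
      then have cut: "1 \<le> cutoff y / \<eta>\<^sup>2" using \<eta> by (simp add: cutoff_def power2_eq_square)
      have "(\<Sum>z\<in>Z. \<rho> z * f z y) = (\<Sum>z\<in>{z\<in>Z. y \<in> {z..z + T}}. \<rho> z * majorant T y)"
        using Z(1) by (intro sum.mono_neutral_cong_right) (auto simp: f_def)
      also have "\<dots> \<le> (\<Sum>z\<in>{z \<in> Z. \<bar>z - y\<bar> \<le> T}. \<rho> z * majorant T y)"
        using Z(1) \<rho> M by (intro sum_mono2) auto
      also have "\<dots> \<le> S * majorant T y"
        unfolding sum_distrib_right[symmetric] by (intro mult_right_mono S M)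
      also have "\<dots> \<le> S * majorant T y * (cutoff y / \<eta>\<^sup>2)"
        using mult_left_mono[OF cut, of "S * majorant T y"] S0 M by simp
      finally show ?thesis by (simp add: ac_simps)
    next
      case False
      then have "(\<Sum>z\<in>Z. \<rho> z * f z y) = 0" by (intro sum.neutral) (auto simp: f_def)
      then show ?thesis using S0 M cutoff_bounds[OF y] by simp
    qed
  qed
  also have "\<dots> \<le> S / \<eta>\<^sup>2 * (3 * const T * (\<Sum>p\<in>I. \<Sum>q\<in>I. m p * m q * (1 / max T (dd p q))\<^sup>2))"
    using S0 by (intro mult_left_mono majorant_integral_bound T) auto
  finally show ?thesis .
qed

end

end

subsection \<open>Energy of image measures\<close>

abbreviation taxi :: "real \<times> real \<Rightarrow> real \<times> real \<Rightarrow> real" where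
  "taxi p q \<equiv> \<bar>fst p - fst q\<bar> + \<bar>snd p - snd q\<bar>"

text \<open>A single summand dominates the left side: level \<open>k\<close> if d \<le> 2^-k, and
  otherwise the level i with 2^-(i+1) < d \<le> 2^-i.\<close>

lemma kernel_dyadic_sum:
  fixes d :: real
  assumes "0 \<le> d" "d \<le> 1"
  shows "(1 / max ((1 / 2) ^ k) d)\<^sup>2 \<le> (\<Sum>i\<le>k. if d \<le> (1 / 2) ^ i then 4 * 4 ^ i else 0)"
proof -
  have four: "(2 ^ i)\<^sup>2 = (4 :: real) ^ i" for i by (simp add: power2_eq_square flip: power_mult_distrib)
  have single: "(if d \<le> (1 / 2) ^ i then 4 * 4 ^ i else 0) \<le> (\<Sum>i\<le>k. if d \<le> (1 / 2) ^ i then 4 * 4 ^ i else 0 :: real)"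
    if "i \<le> k" for i
    using that by (intro member_le_sum) auto
  show ?thesis
  proof (cases "d \<le> (1 / 2) ^ k")
    case True
    have "(1 / max ((1 / 2) ^ k) d)\<^sup>2 = 4 ^ k" using True four by (simp add: max_def power_divide)
    also have "\<dots> \<le> 4 * 4 ^ k" by simp
    finally show ?thesis using single[of k] True by simp
  next
    case False
    define j where "j = (LEAST j. \<not> d \<le> (1 / 2) ^ j)"
    have j: "\<not> d \<le> (1 / 2) ^ j" "j \<le> k"
      using LeastI[of "\<lambda>j. \<not> d \<le> (1 / 2) ^ j" k] Least_le[of "\<lambda>j. \<not> d \<le> (1 / 2) ^ j" k] False
      unfolding j_def by blast+
    have "j \<noteq> 0" using j(1) assms by (intro notI) simp
    then obtain i where i: "j = Suc i" using not0_implies_Suc by blast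
    have di: "d \<le> (1 / 2) ^ i"
      using not_less_Least[of i "\<lambda>j. \<not> d \<le> (1 / 2) ^ j"] i unfolding j_def by auto
    have dj: "(1 / 2) ^ Suc i < d" using j(1) i by simp
    have "0 < d" using dj by (rule order.strict_trans[rotated]) simp
    have "(1 / d)\<^sup>2 \<le> (1 / (1 / 2) ^ Suc i)\<^sup>2"
      using dj \<open>0 < d\<close> by (intro power_mono divide_left_mono mult_pos_pos) auto
    also have "\<dots> = 4 * 4 ^ i" using four[of "Suc i"] by (simp add: power_divide)
    finally show ?thesis using single[of i] di j(2) i False by (simp add: max_def)
  qed
qed

section \<open>Energy of products of Frostman weights\<close>

lemma frostman_taxi_ball:
  assumes "frostman s a n X \<mu>" "frostman t b n Y \<nu>" "i \<le> n"
  shows "(\<Sum>q\<in>X \<times> Y. if taxi p q \<le> (1 / 2) ^ i then \<mu> (fst q) * \<nu> (snd q) else 0) \<le> 9 * 2 powr (- (s + t) * real i)"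
proof -
  have fin: "finite X" "finite Y" and nn: "\<And>x. 0 \<le> \<mu> x" "\<And>x. 0 \<le> \<nu> x"
    and ball: "sum \<mu> {x \<in> X. \<bar>x - fst p\<bar> \<le> (1 / 2) ^ i} \<le> 3 * 2 powr (- s * real i)"
      "sum \<nu> {y \<in> Y. \<bar>y - snd p\<bar> \<le> (1 / 2) ^ i} \<le> 3 * 2 powr (- t * real i)"
    using assms unfolding frostman_def by blast+
  let ?A = "{x \<in> X. \<bar>x - fst p\<bar> \<le> (1 / 2) ^ i}" and ?B = "{y \<in> Y. \<bar>y - snd p\<bar> \<le> (1 / 2) ^ i}"
  have "(\<Sum>q\<in>X \<times> Y. if taxi p q \<le> (1 / 2) ^ i then \<mu> (fst q) * \<nu> (snd q) else 0) =
      (\<Sum>q\<in>{q \<in> X \<times> Y. taxi p q \<le> (1 / 2) ^ i}. \<mu> (fst q) * \<nu> (snd q))"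
    using fin by (intro sum.inter_filter[symmetric]) auto
  also have "\<dots> \<le> (\<Sum>q\<in>?A \<times> ?B. \<mu> (fst q) * \<nu> (snd q))"
    using fin nn by (intro sum_mono2) (auto simp: abs_minus_commute)
  also have "\<dots> = sum \<mu> ?A * sum \<nu> ?B"
    by (simp add: sum_product sum.cartesian_product case_prod_beta)
  also have "\<dots> \<le> (3 * 2 powr (- s * real i)) * (3 * 2 powr (- t * real i))"
    using ball nn by (intro mult_mono sum_nonneg) auto
  also have "\<dots> = 9 * 2 powr (- (s + t) * real i)"
    by (simp add: powr_add[symmetric] algebra_simps)
  finally show ?thesis .
qed

lemma frostman_mass: "frostman s a n X \<mu> \<Longrightarrow> frostman t b n Y \<nu> \<Longrightarrow>
  (\<Sum>q\<in>X \<times> Y. \<mu> (fst q) * \<nu> (snd q)) \<le> 1"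
proof -
  assume *: "frostman s a n X \<mu>" "frostman t b n Y \<nu>"
  have "(\<Sum>q\<in>X \<times> Y. \<mu> (fst q) * \<nu> (snd q)) = sum \<mu> X * sum \<nu> Y"
    by (simp add: sum_product sum.cartesian_product case_prod_beta)
  also have "\<dots> \<le> 1 * 1" using * unfolding frostman_def by (intro mult_mono sum_nonneg) auto
  finally show ?thesis by simp
qed

text \<open>Level \<open>i\<close> contributes at most 4 * 4^i times the mass 9 * 2^(-(s+t)i) of a
  ball. As \<open>s + t \<le> 2\<close>, each of the \<open>k + 1\<close> levels is bounded by the
  last one; the factor 36 is 4 * 9.\<close>

lemma frostman_pair_sum:
  assumes \<mu>: "frostman s a n X \<mu>" and \<nu>: "frostman t b n Y \<nu>" and k: "k \<le> n" and st: "s + t \<le> 2"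
    and small: "\<And>p q. p \<in> X \<times> Y \<Longrightarrow> q \<in> X \<times> Y \<Longrightarrow> taxi p q \<le> 1"
  defines "m \<equiv> \<lambda>p. \<mu> (fst p) * \<nu> (snd p)"
  shows "(\<Sum>p\<in>X \<times> Y. \<Sum>q\<in>X \<times> Y. m p * m q * (1 / max ((1 / 2) ^ k) (taxi p q))\<^sup>2) \<le>
    36 * (real k + 1) * 2 powr ((2 - s - t) * real k)"
proof -
  have m0: "0 \<le> m p" for p using \<mu> \<nu> by (auto simp: frostman_def m_def)
  have inner: "(\<Sum>q\<in>X \<times> Y. m q * (1 / max ((1 / 2) ^ k) (taxi p q))\<^sup>2) \<le> 36 * (real k + 1) * 2 powr ((2 - s - t) * real k)"
    if p: "p \<in> X \<times> Y" for p
  proof -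
    have "(\<Sum>q\<in>X \<times> Y. m q * (1 / max ((1 / 2) ^ k) (taxi p q))\<^sup>2) \<le>
        (\<Sum>q\<in>X \<times> Y. m q * (\<Sum>i\<le>k. if taxi p q \<le> (1 / 2) ^ i then 4 * 4 ^ i else 0))"
      using small[OF p] m0 by (intro sum_mono mult_left_mono kernel_dyadic_sum) auto
    also have "\<dots> = (\<Sum>i\<le>k. \<Sum>q\<in>X \<times> Y. m q * (if taxi p q \<le> (1 / 2) ^ i then 4 * 4 ^ i else 0))"
      unfolding sum_distrib_left by (rule sum.swap)
    also have "\<dots> = (\<Sum>i\<le>k. 4 * 4 ^ i * (\<Sum>q\<in>X \<times> Y. if taxi p q \<le> (1 / 2) ^ i then m q else 0))"
      unfolding sum_distrib_left by (intro sum.cong refl) auto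
    also have "\<dots> \<le> (\<Sum>i\<le>k. 36 * 2 powr ((2 - s - t) * real k))"
    proof (intro sum_mono)
      fix i assume i: "i \<in> {..k}"
      have "4 * 4 ^ i * (\<Sum>q\<in>X \<times> Y. if taxi p q \<le> (1 / 2) ^ i then m q else 0) \<le>
          4 * 4 ^ i * (9 * 2 powr (- (s + t) * real i))"
        unfolding m_def using i k by (intro mult_left_mono frostman_taxi_ball[OF \<mu> \<nu>]) auto
      also have "4 * 4 ^ i * (9 * 2 powr (- (s + t) * real i)) = 36 * 2 powr ((2 - s - t) * real i)"
      proof -
        have "(4 :: real) ^ i = 2 powr (2 * real i)"
          by (simp add: powr_realpow[symmetric] powr_powr[of 2 2, symmetric] powr_numeral)
        then show ?thesis by (simp add: powr_add[symmetric] algebra_simps)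
      qed
      also have "\<dots> \<le> 36 * 2 powr ((2 - s - t) * real k)"
        using i st by (intro mult_left_mono powr_mono mult_left_mono) auto
      finally show "4 * 4 ^ i * (\<Sum>q\<in>X \<times> Y. if taxi p q \<le> (1 / 2) ^ i then m q else 0) \<le> 36 * 2 powr ((2 - s - t) * real k)" .
    qed
    also have "\<dots> = 36 * (real k + 1) * 2 powr ((2 - s - t) * real k)" by simp
    finally show ?thesis .
  qed
  have "(\<Sum>p\<in>X \<times> Y. \<Sum>q\<in>X \<times> Y. m p * m q * (1 / max ((1 / 2) ^ k) (taxi p q))\<^sup>2) =
      (\<Sum>p\<in>X \<times> Y. m p * (\<Sum>q\<in>X \<times> Y. m q * (1 / max ((1 / 2) ^ k) (taxi p q))\<^sup>2))"
    by (simp add: sum_distrib_left mult.assoc)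
  also have "\<dots> \<le> (\<Sum>p\<in>X \<times> Y. m p * (36 * (real k + 1) * 2 powr ((2 - s - t) * real k)))"
    by (intro sum_mono mult_left_mono inner m0)
  also have "\<dots> = (\<Sum>p\<in>X \<times> Y. m p) * (36 * (real k + 1) * 2 powr ((2 - s - t) * real k))"
    by (rule sum_distrib_right[symmetric])
  also have "\<dots> \<le> 1 * (36 * (real k + 1) * 2 powr ((2 - s - t) * real k))"
    unfolding m_def by (intro mult_right_mono frostman_mass[OF \<mu> \<nu>]) auto
  finally show ?thesis by simp
qed

text \<open>\<open>arsinh (M * 2 ^ k)\<close> grows like the logarithm of its argument, hence
  linearly in \<open>k\<close>.\<close>

lemma (in phase) const_dyadic_bound: "\<exists>B\<ge>0. \<forall>k. const ((1 / 2) ^ k) \<le> B * (real k + 1)"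
proof -
  have ars: "arsinh (M / (1 / 2) ^ k) \<le> (ln (2 * M + 1) + 1) * (real k + 1)" for k
  proof -
    define x where "x = M * 2 ^ k"
    have x: "0 \<le> x" using M by (simp add: x_def)
    have "sqrt (x\<^sup>2 + 1) \<le> x + 1"
      using x by (intro real_le_lsqrt) (auto simp: power2_eq_square algebra_simps)
    then have "arsinh x \<le> ln (2 * x + 1)"
      unfolding arsinh_real_def using x arsinh_real_aux[of x] by (subst ln_le_cancel_iff) auto
    also have "\<dots> \<le> ln ((2 * M + 1) * 2 ^ k)"
      using x M by (subst ln_le_cancel_iff) (auto simp: x_def algebra_simps intro!: add_pos_nonneg)
    also have "\<dots> = ln (2 * M + 1) + real k * ln 2"
      using M by (simp add: ln_mult ln_realpow)
    also have "\<dots> \<le> ln (2 * M + 1) * (real k + 1) + 1 * (real k + 1)"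
    proof (intro add_mono)
      have "0 \<le> ln (2 * M + 1)" using M by simp
      then have "ln (2 * M + 1) * 1 \<le> ln (2 * M + 1) * (real k + 1)" by (intro mult_left_mono) auto
      then show "ln (2 * M + 1) \<le> ln (2 * M + 1) * (real k + 1)" by simp
      have "real k * ln 2 \<le> real k * 1" using ln_2_less_1 by (intro mult_left_mono) auto
      then show "real k * ln 2 \<le> 1 * (real k + 1)" by simp
    qed
    finally show ?thesis by (simp add: x_def distrib_right power_divide)
  qed
  define R where "R = slope * (2 * pi) + 6 * cutoff_norm * len * (1 / c\<^sup>2 + 1)"
  have R: "0 \<le> R" using slope_nonneg cutoff_norm_nonneg len_pos c by (simp add: R_def)
  have L: "0 \<le> ln (2 * M + 1) + 1" using M by (simp add: add_nonneg_nonneg)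
  show ?thesis
  proof (intro exI[of _ "slope * 2 * (ln (2 * M + 1) + 1) + R"] conjI allI)
    show "0 \<le> slope * 2 * (ln (2 * M + 1) + 1) + R" using R L slope_nonneg by simp
    fix k :: nat
    have "const ((1 / 2) ^ k) = slope * 2 * arsinh (M / (1 / 2) ^ k) + R"
      by (simp add: const_def R_def)
    also have "\<dots> \<le> slope * 2 * ((ln (2 * M + 1) + 1) * (real k + 1)) + R * (real k + 1)"
      using slope_nonneg R mult_left_mono[of 1 "real k + 1" R] by (intro add_mono mult_left_mono ars) auto
    also have "\<dots> = (slope * 2 * (ln (2 * M + 1) + 1) + R) * (real k + 1)"
      by (simp add: algebra_simps)
    finally show "const ((1 / 2) ^ k) \<le> (slope * 2 * (ln (2 * M + 1) + 1) + R) * (real k + 1)" .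
  qed
qed

text \<open>This absorbs the two logarithmic losses, one from \<open>const\<close> and one from the
  number of dyadic levels, at the price of an arbitrarily small exponent.\<close>

lemma square_powr_bounded:
  assumes "0 < (e :: real)"
  shows "\<exists>B\<ge>0. \<forall>k :: nat. (real k + 1)\<^sup>2 * 2 powr (- e * real k) \<le> B"
proof -
  have "(\<lambda>k. (real k + 1)\<^sup>2 * 2 powr (- e * real k)) \<longlonglongrightarrow> 0" using assms by real_asymp
  then have "Bseq (\<lambda>k. (real k + 1)\<^sup>2 * 2 powr (- e * real k))"
    by (intro convergent_imp_Bseq) (auto simp: convergent_def)
  then obtain B where "0 < B" "\<And>k. norm ((real k + 1)\<^sup>2 * 2 powr (- e * real k)) \<le> B" by (auto elim: BseqE)
  then show ?thesis by (intro exI[of _ B]) auto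
qed

text \<open>The energy is telescoped over dyadic scales with \<open>energy_step\<close>; the
  increment at scale 2^-i is of order (i+1)^2 * 2^((2-s-t-u)i). The constant \<open>A\<close>
  depends neither on \<open>n\<close> nor on the weighted point sets, which replaces a passage to
  the limit.\<close>

lemma phase_energy_bound:
  assumes ph: "phase F F1 F2 P taxi z1 z2 c C M" and small: "\<And>p q. p \<in> P \<Longrightarrow> q \<in> P \<Longrightarrow> taxi p q \<le> 1"
    and \<eta>: "0 < \<eta>" and st: "s + t \<le> 2" and \<tau>: "\<tau> < s + t + u"
  shows "\<exists>A\<ge>0. \<forall>n X \<mu> Y \<nu> Z \<rho> a b e k. frostman s a n X \<mu> \<and> frostman t b n Y \<nu> \<and> frostman u e n Z \<rho> \<and>
    X \<times> Y \<subseteq> P \<and> Z \<subseteq> {z1 + \<eta>..z2 - 2 * \<eta>} \<and> k \<le> n \<longrightarrow>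
    (\<Sum>z\<in>Z. \<rho> z * (\<Sum>p\<in>X \<times> Y. \<Sum>q\<in>X \<times> Y. (\<mu> (fst p) * \<nu> (snd p)) * (\<mu> (fst q) * \<nu> (snd q)) *
       K0 ((1 / 2) ^ k) (F z p - F z q))) \<le> A * (\<Sum>i\<le>k. 2 powr ((2 - \<tau>) * real i))"
proof -
  interpret phase F F1 F2 P taxi z1 z2 c C M by (rule ph)
  obtain B1 where B1: "0 \<le> B1" "\<And>k. const ((1 / 2) ^ k) \<le> B1 * (real k + 1)"
    using const_dyadic_bound by blast
  obtain B2 where B2: "0 \<le> B2" "\<And>k. (real k + 1)\<^sup>2 * 2 powr (- (s + t + u - \<tau>) * real k) \<le> B2"
    using square_powr_bounded[of "s + t + u - \<tau>"] \<tau> by auto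
  \<comment> \<open>Scales coarser than \<eta> do not fit into the margins of the interval. For
    these finitely many scales the trivial bound 2^k is used, which explains the summand
    \<open>2 ^ k0\<close> of the constant.\<close>
  obtain k0 where "(1 / 2) ^ k0 < \<eta>" using real_arch_pow_inv[OF \<eta>, of "1 / 2"] by auto
  then have k0: "(1 / 2) ^ k \<le> \<eta>" if "k0 \<le> k" for k
  proof -
    have "(1 / 2 :: real) ^ k \<le> (1 / 2) ^ k0" by (rule power_decreasing[OF that]) auto
    then show ?thesis using \<open>(1 / 2) ^ k0 < \<eta>\<close> by linarith
  qed
  \<comment> \<open>324 is 3 * 3 * 36, from the Frostman bound on \<open>Z\<close>, the integral of
    the majorant and the pair sum.\<close>
  define B where "B = 324 * B1 * B2 / \<eta>\<^sup>2"
  have B: "0 \<le> B" using B1 B2 by (simp add: B_def)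
  show ?thesis
  proof (intro exI[of _ "2 ^ k0 + B"] conjI allI impI)
    show "0 \<le> 2 ^ k0 + B" using B by simp
    fix n X \<mu> Y \<nu> Z \<rho> a b e and k :: nat
    assume asm: "frostman s a n X \<mu> \<and> frostman t b n Y \<nu> \<and> frostman u e n Z \<rho> \<and>
      X \<times> Y \<subseteq> P \<and> Z \<subseteq> {z1 + \<eta>..z2 - 2 * \<eta>} \<and> k \<le> n"
    then have \<mu>: "frostman s a n X \<mu>" and \<nu>: "frostman t b n Y \<nu>" and \<rho>: "frostman u e n Z \<rho>"
      and XY: "X \<times> Y \<subseteq> P" and Z: "Z \<subseteq> {z1 + \<eta>..z2 - 2 * \<eta>}" by auto
    define m where "m p = \<mu> (fst p) * \<nu> (snd p)" for p
    have fin: "finite (X \<times> Y)" "finite Z" and nn: "\<And>p. 0 \<le> m p" "\<And>z. 0 \<le> \<rho> z"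
      using \<mu> \<nu> \<rho> by (auto simp: frostman_def m_def)
    define E where "E k = (\<Sum>z\<in>Z. \<rho> z * energy (X \<times> Y) m ((1 / 2) ^ k) z)" for k :: nat
    define D where "D k = (\<Sum>z\<in>Z. \<rho> z * dissipation (X \<times> Y) m ((1 / 2) ^ k) z)" for k :: nat
    have mass: "(\<Sum>p\<in>X \<times> Y. m p) \<le> 1" unfolding m_def by (rule frostman_mass[OF \<mu> \<nu>])
    have mass0: "0 \<le> (\<Sum>p\<in>X \<times> Y. m p)" using nn by (intro sum_nonneg) auto
    have trivial: "E k \<le> 2 ^ k" for k
    proof -
      have "energy (X \<times> Y) m ((1 / 2) ^ k) z \<le> 2 ^ k" for z
      proof -
        have K: "K0 ((1 / 2) ^ k) w \<le> 2 ^ k" for w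
        proof -
          have "K0 ((1 / 2) ^ k) w \<le> (1 / 2) ^ k / ((1 / 2) ^ k)\<^sup>2"
            unfolding K0_def by (intro divide_left_mono mult_pos_pos sum_squares_pos) auto
          also have "\<dots> = 2 ^ k" by (simp add: power2_eq_square power_divide)
          finally show ?thesis .
        qed
        have "energy (X \<times> Y) m ((1 / 2) ^ k) z \<le> (\<Sum>p\<in>X \<times> Y. \<Sum>q\<in>X \<times> Y. m p * m q * 2 ^ k)"
          unfolding energy_def[OF fin(1) XY nn(1)] using nn by (intro sum_mono mult_left_mono K) auto
        also have "\<dots> = (\<Sum>p\<in>X \<times> Y. \<Sum>q\<in>X \<times> Y. m p * m q) * 2 ^ k"
          by (simp only: sum_distrib_right)
        also have "\<dots> = ((\<Sum>p\<in>X \<times> Y. m p) * (\<Sum>p\<in>X \<times> Y. m p)) * 2 ^ k"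
          by (simp only: sum_product)
        also have "\<dots> \<le> 1 * 1 * 2 ^ k" using mass mass0 by (intro mult_right_mono mult_mono) auto
        finally show ?thesis by simp
      qed
      then have "E k \<le> (\<Sum>z\<in>Z. \<rho> z * 2 ^ k)" unfolding E_def using nn by (intro sum_mono mult_left_mono) auto
      also have "\<dots> = sum \<rho> Z * 2 ^ k" by (rule sum_distrib_right[symmetric])
      also have "\<dots> \<le> 1 * 2 ^ k" using \<rho> by (intro mult_right_mono) (auto simp: frostman_def)
      finally show ?thesis by simp
    qed
    have step: "E (Suc k) \<le> E k + (1 / 2) ^ Suc k * D (Suc k)" for k
    proof -
      have "energy (X \<times> Y) m ((1 / 2) ^ Suc k) z \<le> energy (X \<times> Y) m ((1 / 2) ^ k) z
          + (1 / 2) ^ Suc k * dissipation (X \<times> Y) m ((1 / 2) ^ Suc k) z" for z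
        using energy_step[OF fin(1) XY, where m = m and T = "(1 / 2) ^ Suc k" and z = z] nn(1) by simp
      then have "E (Suc k) \<le> (\<Sum>z\<in>Z. \<rho> z * (energy (X \<times> Y) m ((1 / 2) ^ k) z
          + (1 / 2) ^ Suc k * dissipation (X \<times> Y) m ((1 / 2) ^ Suc k) z))"
        unfolding E_def using nn by (intro sum_mono mult_left_mono) auto
      also have "\<dots> = E k + (1 / 2) ^ Suc k * D (Suc k)"
        unfolding E_def D_def by (simp add: distrib_left sum.distrib sum_distrib_left ac_simps)
      finally show ?thesis .
    qed
    have diss: "(1 / 2) ^ k * D k \<le> B * 2 powr ((2 - \<tau>) * real k)" if k: "k0 \<le> k" "k \<le> n" for k
    proof -
      have "(1 / 2) ^ k * D k \<le> 3 * 2 powr (- u * real k) / \<eta>\<^sup>2 * (3 * const ((1 / 2) ^ k) *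
          (\<Sum>p\<in>X \<times> Y. \<Sum>q\<in>X \<times> Y. m p * m q * (1 / max ((1 / 2) ^ k) (taxi p q))\<^sup>2))"
        unfolding D_def
        by (rule dissipation_sum_bound[OF fin(1) XY _ _ k0[OF k(1)] fin(2) Z nn(2)])
          (use \<rho> k nn in \<open>auto simp: frostman_def\<close>)
      also have "\<dots> \<le> 3 * 2 powr (- u * real k) / \<eta>\<^sup>2 * (3 * (B1 * (real k + 1)) *
          (36 * (real k + 1) * 2 powr ((2 - s - t) * real k)))"
      proof (intro mult_left_mono mult_mono)
        show "(\<Sum>p\<in>X \<times> Y. \<Sum>q\<in>X \<times> Y. m p * m q * (1 / max ((1 / 2) ^ k) (taxi p q))\<^sup>2) \<le>
            36 * (real k + 1) * 2 powr ((2 - s - t) * real k)"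
          unfolding m_def by (intro frostman_pair_sum[OF \<mu> \<nu> k(2) st] small XY[THEN subsetD])
        show "0 \<le> (\<Sum>p\<in>X \<times> Y. \<Sum>q\<in>X \<times> Y. m p * m q * (1 / max ((1 / 2) ^ k) (taxi p q))\<^sup>2)"
          using nn by (intro sum_nonneg mult_nonneg_nonneg) auto
      qed (use B1 in auto)
      also have "\<dots> = 324 * B1 / \<eta>\<^sup>2 * ((real k + 1)\<^sup>2 * (2 powr (- u * real k) * 2 powr ((2 - s - t) * real k)))"
        by (simp add: power2_eq_square)
      also have "2 powr (- u * real k) * 2 powr ((2 - s - t) * real k) =
          2 powr (- (s + t + u - \<tau>) * real k) * 2 powr ((2 - \<tau>) * real k)"
        by (simp add: powr_add[symmetric] algebra_simps)
      also have "324 * B1 / \<eta>\<^sup>2 * ((real k + 1)\<^sup>2 * (2 powr (- (s + t + u - \<tau>) * real k) * 2 powr ((2 - \<tau>) * real k))) =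
          324 * B1 / \<eta>\<^sup>2 * ((real k + 1)\<^sup>2 * 2 powr (- (s + t + u - \<tau>) * real k)) * 2 powr ((2 - \<tau>) * real k)"
        by (simp only: mult.assoc)
      also have "\<dots> \<le> 324 * B1 / \<eta>\<^sup>2 * B2 * 2 powr ((2 - \<tau>) * real k)"
        using B1 by (intro mult_right_mono mult_left_mono B2) auto
      also have "\<dots> = B * 2 powr ((2 - \<tau>) * real k)" by (simp add: B_def)
      finally show ?thesis .
    qed
    have "E k \<le> (2 ^ k0 + B) * (\<Sum>i\<le>k. 2 powr ((2 - \<tau>) * real i))" if "k \<le> n" for k
      using that
    proof (induction k)
      case 0
      have "(2 :: real) ^ 0 \<le> 2 ^ k0" by (intro power_increasing) auto
      then have "E 0 \<le> 2 ^ k0" using trivial[of 0] by (rule order_trans[rotated])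
      then have "E 0 \<le> 2 ^ k0 + B" by (rule add_increasing2[OF B])
      then show ?case by simp
    next
      case (Suc k)
      show ?case
      proof (cases "k0 \<le> Suc k")
        case True
        have "E (Suc k) \<le> E k + B * 2 powr ((2 - \<tau>) * real (Suc k))"
          using step[of k] diss[OF True Suc.prems] by linarith
        also have "\<dots> \<le> (2 ^ k0 + B) * (\<Sum>i\<le>k. 2 powr ((2 - \<tau>) * real i)) + (2 ^ k0 + B) * 2 powr ((2 - \<tau>) * real (Suc k))"
          using Suc by (intro add_mono mult_right_mono) auto
        finally show ?thesis by (simp add: distrib_left)
      next
        case False
        have "E (Suc k) \<le> 2 ^ Suc k" by (rule trivial)
        also have "\<dots> \<le> 2 ^ k0" using False by (intro power_increasing) auto
        also have "\<dots> \<le> (2 ^ k0 + B) * 1" using B by simp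
        also have "\<dots> \<le> (2 ^ k0 + B) * (\<Sum>i\<le>Suc k. 2 powr ((2 - \<tau>) * real i))"
          using B member_le_sum[of 0 "{..Suc k}" "\<lambda>i. 2 powr ((2 - \<tau>) * real i)"]
          by (intro mult_left_mono) auto
        finally show ?thesis .
      qed
    qed
    then show "(\<Sum>z\<in>Z. \<rho> z * (\<Sum>p\<in>X \<times> Y. \<Sum>q\<in>X \<times> Y. (\<mu> (fst p) * \<nu> (snd p)) * (\<mu> (fst q) * \<nu> (snd q)) *
       K0 ((1 / 2) ^ k) (F z p - F z q))) \<le> (2 ^ k0 + B) * (\<Sum>i\<le>k. 2 powr ((2 - \<tau>) * real i))"
      using asm unfolding E_def energy_def[OF fin(1) XY nn(1)] m_def by blast
  qed
qed

subsection \<open>Size of the image\<close>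

text \<open>Cauchy-Schwarz over the cells bounds the mass by the number of cells times the sum of
  squared cell masses. That sum is an energy, because \<open>K0 T\<close> is at least 1/(2T) for two
  points in a common cell of length \<open>T\<close>.\<close>

lemma mass_in_dyadic_cells:
  fixes m y :: "'a \<Rightarrow> real"
  assumes I: "finite I" and m: "\<And>p. 0 \<le> m p" and J: "finite J"
  shows "(\<Sum>p\<in>{p \<in> I. \<exists>j\<in>J. y p \<in> dyad (k, j)}. m p)\<^sup>2 \<le>
    2 * real (card J) * (1 / 2) ^ k * (\<Sum>p\<in>I. \<Sum>q\<in>I. m p * m q * K0 ((1 / 2) ^ k) (y p - y q))"
proof -
  define T :: real where "T = (1 / 2) ^ k"
  have T: "0 < T" by (simp add: T_def)
  define l where "l j = (\<Sum>p\<in>{p \<in> I. y p \<in> dyad (k, j)}. m p)" for j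
  have disj: "i = j" if "y p \<in> dyad (k, i)" "y p \<in> dyad (k, j)" for p i j
    using that by (simp add: mem_dyad)
  have eq: "(\<Sum>p\<in>{p \<in> I. \<exists>j\<in>J. y p \<in> dyad (k, j)}. m p) = (\<Sum>j\<in>J. l j)"
  proof -
    have "{p \<in> I. \<exists>j\<in>J. y p \<in> dyad (k, j)} = (\<Union>j\<in>J. {p \<in> I. y p \<in> dyad (k, j)})" by blast
    then show ?thesis unfolding l_def using I J disj
      by (simp only:) (intro sum.UNION_disjoint; auto)
  qed
  have "(\<Sum>j\<in>J. l j)\<^sup>2 \<le> (\<Sum>j\<in>J. (l j)\<^sup>2) * (\<Sum>j\<in>J. 1\<^sup>2)"
    using Cauchy_Schwarz_ineq_sum[of l "\<lambda>_. 1" J] by simp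
  also have "(\<Sum>j\<in>J. (l j)\<^sup>2) \<le> 2 * T * (\<Sum>p\<in>I. \<Sum>q\<in>I. m p * m q * K0 T (y p - y q))"
  proof -
    have sq: "(l j)\<^sup>2 = (\<Sum>p\<in>I. \<Sum>q\<in>I. if y p \<in> dyad (k, j) \<and> y q \<in> dyad (k, j) then m p * m q else 0)" for j
    proof -
      have "l j = (\<Sum>p\<in>I. if y p \<in> dyad (k, j) then m p else 0)"
        unfolding l_def using I by (rule sum.inter_filter)
      then show ?thesis unfolding power2_eq_square
        by (simp add: sum_product) (intro sum.cong refl; auto)
    qed
    have "(\<Sum>j\<in>J. (l j)\<^sup>2) = (\<Sum>p\<in>I. \<Sum>q\<in>I. \<Sum>j\<in>J. if y p \<in> dyad (k, j) \<and> y q \<in> dyad (k, j) then m p * m q else 0)"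
      unfolding sq by (subst sum.swap) (intro sum.cong refl sum.swap)
    also have "\<dots> \<le> (\<Sum>p\<in>I. \<Sum>q\<in>I. 2 * T * (m p * m q * K0 T (y p - y q)))"
    proof (intro sum_mono)
      fix p q
      show "(\<Sum>j\<in>J. if y p \<in> dyad (k, j) \<and> y q \<in> dyad (k, j) then m p * m q else 0) \<le> 2 * T * (m p * m q * K0 T (y p - y q))"
      proof (cases "\<exists>j\<in>J. y p \<in> dyad (k, j) \<and> y q \<in> dyad (k, j)")
        case True
        then obtain i where i: "i \<in> J" "y p \<in> dyad (k, i)" "y q \<in> dyad (k, i)" by blast
        have "(\<Sum>j\<in>J. if y p \<in> dyad (k, j) \<and> y q \<in> dyad (k, j) then m p * m q else 0) =
            (\<Sum>j\<in>{i}. if y p \<in> dyad (k, j) \<and> y q \<in> dyad (k, j) then m p * m q else 0)"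
          using J i disj by (intro sum.mono_neutral_right) auto
        also have "\<dots> = m p * m q" using i by simp
        finally have l: "(\<Sum>j\<in>J. if y p \<in> dyad (k, j) \<and> y q \<in> dyad (k, j) then m p * m q else 0) = m p * m q" .
        have "dist (y p) (y q) \<le> T"
          using diameter_bounded_bound[OF bounded_dyad i(2,3)] by (simp add: diameter_dyad T_def)
        then have "(y p - y q)\<^sup>2 \<le> T\<^sup>2" using T by (simp add: dist_real_def abs_le_square_iff[symmetric])
        then have "T\<^sup>2 + (y p - y q)\<^sup>2 \<le> 2 * T\<^sup>2" by simp
        then have "T / (2 * T\<^sup>2) \<le> K0 T (y p - y q)"
          unfolding K0_def using T by (intro divide_left_mono mult_pos_pos sum_squares_pos) auto
        then have "2 * T * (T / (2 * T\<^sup>2)) \<le> 2 * T * K0 T (y p - y q)" using T by (intro mult_left_mono) auto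
        then have "1 \<le> 2 * T * K0 T (y p - y q)" using T by (simp add: power2_eq_square)
        then have "m p * m q * 1 \<le> m p * m q * (2 * T * K0 T (y p - y q))"
          using m by (intro mult_left_mono) auto
        then show ?thesis unfolding l by (simp add: ac_simps)
      next
        case False
        then have "(\<Sum>j\<in>J. if y p \<in> dyad (k, j) \<and> y q \<in> dyad (k, j) then m p * m q else 0) = 0"
          by (intro sum.neutral) auto
        then show ?thesis using m K0_pos[OF T] T by simp
      qed
    qed
    also have "\<dots> = 2 * T * (\<Sum>p\<in>I. \<Sum>q\<in>I. m p * m q * K0 T (y p - y q))"
      by (simp add: sum_distrib_left)
    finally show ?thesis .
  qed
  finally show ?thesis unfolding eq T_def by (simp add: ac_simps mult_right_mono)
qed

text \<open>By Cauchy-Schwarz, a set made up of few dyadic cells carries little of the averaged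
  push-forward measure.\<close>

lemma averaged_mass_in_dyadic_cells:
  fixes m :: "'a \<Rightarrow> real" and \<rho> :: "real \<Rightarrow> real"
  assumes I: "finite I" and m: "\<And>p. 0 \<le> m p" and J: "finite J"
    and Z: "finite Z" and \<rho>: "\<And>z. 0 \<le> \<rho> z" "sum \<rho> Z \<le> 1"
    and E: "(\<Sum>z\<in>Z. \<rho> z * (\<Sum>p\<in>I. \<Sum>q\<in>I. m p * m q * K0 ((1 / 2) ^ k) (F z p - F z q))) \<le> E"
  shows "(\<Sum>z\<in>Z. \<rho> z * (\<Sum>p\<in>{p \<in> I. \<exists>j\<in>J. F z p \<in> dyad (k, j)}. m p)) \<le>
    sqrt (2 * real (card J) * (1 / 2) ^ k * E)"
proof (rule real_le_rsqrt)
  define l where "l z = (\<Sum>p\<in>{p \<in> I. \<exists>j\<in>J. F z p \<in> dyad (k, j)}. m p)" for z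
  have "(\<Sum>z\<in>Z. \<rho> z * l z)\<^sup>2 = (\<Sum>z\<in>Z. sqrt (\<rho> z) * (sqrt (\<rho> z) * l z))\<^sup>2"
    using \<rho> by (simp flip: mult.assoc)
  also have "\<dots> \<le> (\<Sum>z\<in>Z. (sqrt (\<rho> z))\<^sup>2) * (\<Sum>z\<in>Z. (sqrt (\<rho> z) * l z)\<^sup>2)"
    by (rule Cauchy_Schwarz_ineq_sum)
  also have "\<dots> = sum \<rho> Z * (\<Sum>z\<in>Z. \<rho> z * (l z)\<^sup>2)"
    using \<rho> by (simp add: power_mult_distrib)
  also have "\<dots> \<le> 1 * (\<Sum>z\<in>Z. \<rho> z * (l z)\<^sup>2)"
    using \<rho> by (intro mult_right_mono sum_nonneg) auto
  also have "\<dots> \<le> 1 * (\<Sum>z\<in>Z. \<rho> z * (2 * real (card J) * (1 / 2) ^ k * (\<Sum>p\<in>I. \<Sum>q\<in>I. m p * m q * K0 ((1 / 2) ^ k) (F z p - F z q))))"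
    unfolding l_def using \<rho> by (intro mult_left_mono sum_mono mass_in_dyadic_cells I m J) auto
  also have "\<dots> = 2 * real (card J) * (1 / 2) ^ k * (\<Sum>z\<in>Z. \<rho> z * (\<Sum>p\<in>I. \<Sum>q\<in>I. m p * m q * K0 ((1 / 2) ^ k) (F z p - F z q)))"
    by (simp add: sum_distrib_left ac_simps)
  also have "\<dots> \<le> 2 * real (card J) * (1 / 2) ^ k * E" using E by (intro mult_left_mono) auto
  finally show "(\<Sum>z\<in>Z. \<rho> z * (\<Sum>p\<in>{p \<in> I. \<exists>j\<in>J. F z p \<in> dyad (k, j)}. m p))\<^sup>2 \<le> 2 * real (card J) * (1 / 2) ^ k * E"
    unfolding l_def .
qed

lemma sets_dyad [simp, measurable]: "dyad p \<in> sets borel"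
  by (simp add: dyad_def)

lemma sum_UNION_le:
  fixes m :: "'a \<Rightarrow> real"
  assumes "finite K" "\<And>k. k \<in> K \<Longrightarrow> finite (S k)" "\<And>x. 0 \<le> m x"
  shows "sum m (\<Union>k\<in>K. S k) \<le> (\<Sum>k\<in>K. sum m (S k))"
  using assms
proof (induction K rule: finite_induct)
  case (insert k K)
  have "sum m (S k \<union> (\<Union>k\<in>K. S k)) \<le> sum m (S k) + sum m (\<Union>k\<in>K. S k)"
    using insert by (intro sum_Un_le) auto
  then show ?case using insert by auto
qed simp

lemma emeasure_dyad: "emeasure lborel (dyad p) = ennreal ((1 / 2) ^ fst p)"
proof -
  have "of_int (snd p) / 2 ^ fst p \<le> (of_int (snd p) + 1) / (2 :: real) ^ fst p"
    by (simp add: divide_right_mono)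
  then show ?thesis by (simp add: dyad_def diff_divide_distrib[symmetric] power_divide)
qed

text \<open>A compact set is the decreasing intersection of the unions \<open>W n\<close> of the
  cells that meet it, and the measure is continuous from above.\<close>

lemma compact_measure_lower_bound:
  assumes E: "compact E" and N: "\<And>n. \<exists>J. finite J \<and> J = {j. dyad (n, j) \<inter> E \<noteq> {}} \<and> \<kappa> \<le> real (card J) * (1 / 2) ^ n"
  shows "ennreal \<kappa> \<le> emeasure lborel E"
proof -
  define J where "J n = {j. dyad (n, j) \<inter> E \<noteq> {}}" for n
  have J: "finite (J n)" "\<kappa> \<le> real (card (J n)) * (1 / 2) ^ n" for n using N[of n] by (auto simp: J_def)
  define W where "W n = (\<Union>j\<in>J n. dyad (n, j))" for n
  have Wiff: "x \<in> W n \<longleftrightarrow> (\<exists>e\<in>E. \<lfloor>e * 2 ^ n\<rfloor> = \<lfloor>x * 2 ^ n\<rfloor>)" for x n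
    by (auto simp: W_def J_def mem_dyad disjoint_iff)
  have sets: "W n \<in> sets lborel" for n
    unfolding W_def using J(1) by (intro sets.finite_UN) auto
  have meas: "emeasure lborel (W n) = ennreal (real (card (J n)) * (1 / 2) ^ n)" for n
  proof -
    have "emeasure lborel (W n) = (\<Sum>j\<in>J n. emeasure lborel (dyad (n, j)))"
      unfolding W_def using J(1)
      by (intro sum_emeasure[symmetric]) (auto simp: disjoint_family_on_def mem_dyad)
    also have "\<dots> = of_nat (card (J n)) * ennreal ((1 / 2) ^ n)" by (simp add: emeasure_dyad)
    finally show ?thesis by (simp add: ennreal_mult ennreal_of_nat_eq_real_of_nat)
  qed
  have "decseq W"
  proof (rule decseq_SucI, rule subsetI)
    fix n x assume "x \<in> W (Suc n)"
    then obtain e where "e \<in> E" "\<lfloor>e * 2 ^ Suc n\<rfloor> = \<lfloor>x * 2 ^ Suc n\<rfloor>" using Wiff by blast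
    then show "x \<in> W n" using floor_scale[of e "Suc n" x n] Wiff by (metis le_SucI order_refl)
  qed
  have "E = (\<Inter>n. W n)"
  proof
    show "E \<subseteq> (\<Inter>n. W n)" using Wiff by blast
    show "(\<Inter>n. W n) \<subseteq> E"
    proof
      fix x assume x: "x \<in> (\<Inter>n. W n)"
      have "x \<in> closure E"
      proof (unfold closure_approachable, intro allI impI)
        fix r :: real assume "0 < r"
        then obtain n where n: "(1 / 2) ^ n < r" using real_arch_pow_inv[of r "1 / 2"] by auto
        obtain e where e: "e \<in> E" "\<lfloor>e * 2 ^ n\<rfloor> = \<lfloor>x * 2 ^ n\<rfloor>" using x Wiff by blast
        then have "e \<in> dyad (n, \<lfloor>x * 2 ^ n\<rfloor>)" "x \<in> dyad (n, \<lfloor>x * 2 ^ n\<rfloor>)" by (auto simp: mem_dyad)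
        then have "dist e x \<le> (1 / 2) ^ n"
          using diameter_bounded_bound[OF bounded_dyad] by (metis diameter_dyad fst_conv)
        then show "\<exists>y\<in>E. dist y x < r" using e n by (intro bexI[of _ e]) auto
      qed
      then show "x \<in> E" using E by (simp add: compact_imp_closed closure_closed)
    qed
  qed
  moreover have "(\<lambda>n. emeasure lborel (W n)) \<longlonglongrightarrow> emeasure lborel (\<Inter>n. W n)"
    using sets \<open>decseq W\<close> meas by (intro Lim_emeasure_decseq) auto
  ultimately show ?thesis
    using meas J(2) by (intro LIMSEQ_le_const[of "\<lambda>n. emeasure lborel (W n)"]) (auto intro!: exI[of _ 0] ennreal_leI)
qed

lemma finite_dyadic_cells:
  assumes "bounded E" shows "finite {j. dyad (n, j) \<inter> E \<noteq> {}}"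
proof -
  obtain B where B: "\<And>x. x \<in> E \<Longrightarrow> \<bar>x\<bar> \<le> B" using assms by (auto simp: bounded_iff)
  have "{j. dyad (n, j) \<inter> E \<noteq> {}} \<subseteq> {\<lfloor>- B * 2 ^ n\<rfloor>..\<lfloor>B * 2 ^ n\<rfloor>}"
  proof
    fix j assume "j \<in> {j. dyad (n, j) \<inter> E \<noteq> {}}"
    then obtain x where "x \<in> E" "x \<in> dyad (n, j)" by blast
    then have x: "x \<in> E" "\<lfloor>x * 2 ^ n\<rfloor> = j" by (simp_all add: mem_dyad)
    have "- B * 2 ^ n \<le> x * 2 ^ n" "x * 2 ^ n \<le> B * 2 ^ n" 
      using B[OF x(1)] mult_right_mono[of "- B" x "2 ^ n"] mult_right_mono[of x B "2 ^ n"] by auto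
    then show "j \<in> {\<lfloor>- B * 2 ^ n\<rfloor>..\<lfloor>B * 2 ^ n\<rfloor>}" using x(2) floor_mono by (metis atLeastAtMost_iff)
  qed
  then show ?thesis by (rule finite_subset) simp
qed

lemma two_powr_mult: "2 powr (a * real k) = (2 powr a) ^ k"
  by (metis powr_gt_zero powr_powr powr_realpow zero_neq_numeral)

lemma half_power_powr: "(1 / 2) ^ k = 2 powr (- real k)"
  by (simp add: powr_minus powr_realpow power_divide inverse_eq_divide)

section \<open>Measure and content of the image of a product\<close>

context
  fixes F F1 F2 :: "real \<Rightarrow> real \<times> real \<Rightarrow> real" and P :: "(real \<times> real) set"
    and z1 z2 c C M \<eta> s t u :: real and X Y Z E :: "real set"
  assumes ph: "phase F F1 F2 P taxi z1 z2 c C M" and small: "\<And>p q. p \<in> P \<Longrightarrow> q \<in> P \<Longrightarrow> taxi p q \<le> 1"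
    and \<eta>: "0 < \<eta>" and st: "s + t \<le> 2"
    and X: "X \<subseteq> {0..1}" "0 < net_content s X" and Y: "Y \<subseteq> {0..1}" "0 < net_content t Y"
    and Z: "Z \<subseteq> {0..1}" "0 < net_content u Z"
    and P: "X \<times> Y \<subseteq> P" and Z': "Z \<subseteq> {z1 + \<eta>..z2 - 2 * \<eta>}"
    and E: "compact E" "\<And>x y z. x \<in> X \<Longrightarrow> y \<in> Y \<Longrightarrow> z \<in> Z \<Longrightarrow> F z (x, y) \<in> E"
begin

text \<open>A cover of \<open>E\<close> catches the whole averaged push-forward mass, which is at
  least \<kappa>; each level catches at most its energy bound. The discrete weights are chosen after
  the finest level \<open>n\<close> of the cover is known, so it matters that \<kappa> and
  \<open>A\<close> are fixed before \<open>n\<close>.\<close>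

lemma covered_mass_bound:
  assumes \<tau>: "\<tau> < s + t + u"
  shows "\<exists>\<kappa>>0. \<exists>A\<ge>0. \<forall>n J. (\<forall>k. finite (J k)) \<longrightarrow> E \<subseteq> (\<Union>k\<le>n. \<Union>j\<in>J k. dyad (k, j)) \<longrightarrow>
    \<kappa> \<le> (\<Sum>k\<le>n. sqrt (2 * real (card (J k)) * (1 / 2) ^ k * (A * (\<Sum>i\<le>k. 2 powr ((2 - \<tau>) * real i)))))"
proof -
  obtain a where a: "0 < a" "\<And>n. \<exists>X' m. X' \<subseteq> X \<and> frostman s a n X' m" using frostman_exists[OF X(2,1)] by blast
  obtain b where b: "0 < b" "\<And>n. \<exists>X' m. X' \<subseteq> Y \<and> frostman t b n X' m" using frostman_exists[OF Y(2,1)] by blast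
  obtain e where e: "0 < e" "\<And>n. \<exists>X' m. X' \<subseteq> Z \<and> frostman u e n X' m" using frostman_exists[OF Z(2,1)] by blast
  obtain A where A: "0 \<le> A" "\<And>n X \<mu> Y \<nu> Z \<rho> a b e k. frostman s a n X \<mu> \<and> frostman t b n Y \<nu> \<and> frostman u e n Z \<rho> \<and>
    X \<times> Y \<subseteq> P \<and> Z \<subseteq> {z1 + \<eta>..z2 - 2 * \<eta>} \<and> k \<le> n \<Longrightarrow>
    (\<Sum>z\<in>Z. \<rho> z * (\<Sum>p\<in>X \<times> Y. \<Sum>q\<in>X \<times> Y. (\<mu> (fst p) * \<nu> (snd p)) * (\<mu> (fst q) * \<nu> (snd q)) *
       K0 ((1 / 2) ^ k) (F z p - F z q))) \<le> A * (\<Sum>i\<le>k. 2 powr ((2 - \<tau>) * real i))"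
    using phase_energy_bound[OF ph small \<eta> st \<tau>] by blast
  show ?thesis
  proof (rule exI[of _ "e * (a * b)"], rule conjI, use a b e in simp,
      rule exI[of _ A], intro conjI A(1) allI impI)
    fix n and J :: "nat \<Rightarrow> int set" assume J: "\<forall>k. finite (J k)" and cov: "E \<subseteq> (\<Union>k\<le>n. \<Union>j\<in>J k. dyad (k, j))"
    obtain X' \<mu> where X': "X' \<subseteq> X" "frostman s a n X' \<mu>" using a by blast
    obtain Y' \<nu> where Y': "Y' \<subseteq> Y" "frostman t b n Y' \<nu>" using b by blast
    obtain V \<rho> where V: "V \<subseteq> Z" "frostman u e n V \<rho>" using e by blast
    define m where "m p = \<mu> (fst p) * \<nu> (snd p)" for p
    let ?I = "X' \<times> Y'"
    have fin: "finite ?I" "finite V" and nn: "\<And>p. 0 \<le> m p" "\<And>z. 0 \<le> \<rho> z" and \<rho>1: "sum \<rho> V \<le> 1" "e \<le> sum \<rho> V"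
      using X'(2) Y'(2) V(2) by (auto simp: frostman_def m_def)
    have mass: "a * b \<le> sum m ?I"
    proof -
      have "a * b \<le> sum \<mu> X' * sum \<nu> Y'" using X'(2) Y'(2) a(1) b(1) by (intro mult_mono) (auto simp: frostman_def intro: sum_nonneg)
      also have "\<dots> = sum m ?I" unfolding m_def by (simp add: sum_product sum.cartesian_product case_prod_beta)
      finally show ?thesis .
    qed
    define l where "l k z = (\<Sum>p\<in>{p \<in> ?I. \<exists>j\<in>J k. F z p \<in> dyad (k, j)}. m p)" for k z
    have total: "sum m ?I \<le> (\<Sum>k\<le>n. l k z)" if z: "z \<in> V" for z
    proof -
      have "?I \<subseteq> (\<Union>k\<le>n. {p \<in> ?I. \<exists>j\<in>J k. F z p \<in> dyad (k, j)})"
      proof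
        fix p assume p: "p \<in> ?I"
        obtain x y where xy: "p = (x, y)" by (cases p)
        have "F z p \<in> E" unfolding xy using p X'(1) Y'(1) V(1) z by (intro E(2)) (auto simp: xy)
        then show "p \<in> (\<Union>k\<le>n. {p \<in> ?I. \<exists>j\<in>J k. F z p \<in> dyad (k, j)})" using cov p by blast
      qed
      then have "sum m ?I \<le> sum m (\<Union>k\<le>n. {p \<in> ?I. \<exists>j\<in>J k. F z p \<in> dyad (k, j)})"
        using fin nn by (intro sum_mono2) auto
      also have "\<dots> \<le> (\<Sum>k\<le>n. l k z)"
        unfolding l_def using fin nn by (intro sum_UNION_le) auto
      finally show ?thesis .
    qed
    have "e * (a * b) \<le> sum \<rho> V * sum m ?I" using \<rho>1 mass a(1) b(1) e(1) by (intro mult_mono) auto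
    also have "\<dots> = (\<Sum>z\<in>V. \<rho> z * sum m ?I)" by (rule sum_distrib_right)
    also have "\<dots> \<le> (\<Sum>z\<in>V. \<rho> z * (\<Sum>k\<le>n. l k z))" using nn by (intro sum_mono mult_left_mono total) auto
    also have "\<dots> = (\<Sum>k\<le>n. \<Sum>z\<in>V. \<rho> z * l k z)" unfolding sum_distrib_left by (rule sum.swap)
    also have "\<dots> \<le> (\<Sum>k\<le>n. sqrt (2 * real (card (J k)) * (1 / 2) ^ k * (A * (\<Sum>i\<le>k. 2 powr ((2 - \<tau>) * real i)))))"
    proof (intro sum_mono)
      fix k assume "k \<in> {..n}"
      then have k: "k \<le> n" by simp
      have sub: "X' \<times> Y' \<subseteq> P" "V \<subseteq> {z1 + \<eta>..z2 - 2 * \<eta>}" using X' Y' V P Z' by auto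
      show "(\<Sum>z\<in>V. \<rho> z * l k z) \<le> sqrt (2 * real (card (J k)) * (1 / 2) ^ k * (A * (\<Sum>i\<le>k. 2 powr ((2 - \<tau>) * real i))))"
        unfolding l_def m_def using J fin nn \<rho>1 X' Y' V sub k A(2)[of a n X' \<mu> b Y' \<nu> e V \<rho> k]
        by (intro averaged_mass_in_dyadic_cells) (simp_all add: m_def)
    qed
    finally show "e * (a * b) \<le> (\<Sum>k\<le>n. sqrt (2 * real (card (J k)) * (1 / 2) ^ k * (A * (\<Sum>i\<le>k. 2 powr ((2 - \<tau>) * real i)))))" .
  qed
qed

text \<open>With \<tau> above 2 the energies stay bounded in the scale. Catching a fixed mass then
  takes at least a fixed multiple of 2^n cells of level \<open>n\<close>.\<close>

lemma image_measure_positive: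
  assumes "2 < s + t + u"
  shows "0 < emeasure lborel E"
proof -
  obtain \<tau> where \<tau>: "2 < \<tau>" "\<tau> < s + t + u" using assms dense by blast
  obtain \<kappa> A where \<kappa>: "0 < \<kappa>" "0 \<le> A" "\<And>n J. (\<forall>k. finite (J k)) \<Longrightarrow> E \<subseteq> (\<Union>k\<le>n. \<Union>j\<in>J k. dyad (k, j)) \<Longrightarrow>
    \<kappa> \<le> (\<Sum>k\<le>n. sqrt (2 * real (card (J k)) * (1 / 2) ^ k * (A * (\<Sum>i\<le>k. 2 powr ((2 - \<tau>) * real i)))))"
    using covered_mass_bound[OF \<tau>(2)] by blast
  define r where "r = 2 powr (2 - \<tau>)"
  have r: "0 < r" "r < 1" using \<tau> by (auto simp: r_def powr_less_one)
  have geo: "(\<Sum>i\<le>k. 2 powr ((2 - \<tau>) * real i)) \<le> 1 / (1 - r)" for k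
  proof -
    have "2 powr ((2 - \<tau>) * real i) = r ^ i" for i
      unfolding r_def by (rule two_powr_mult)
    then have "(\<Sum>i\<le>k. 2 powr ((2 - \<tau>) * real i)) = (1 - r ^ Suc k) / (1 - r)"
      using r by (simp add: sum_gp0 del: power_Suc)
    also have "\<dots> \<le> 1 / (1 - r)" using r by (intro divide_right_mono) auto
    finally show ?thesis .
  qed
  define G where "G = A / (1 - r)"
  have G: "0 \<le> G" using \<kappa>(2) r by (simp add: G_def)
  \<comment> \<open>The cover consists of cells of the single level \<open>n\<close>. The summand 1
    keeps the denominator positive if \<open>G = 0\<close>.\<close>
  have low: "\<kappa>\<^sup>2 / (2 * G + 1) \<le> real (card {j. dyad (n, j) \<inter> E \<noteq> {}}) * (1 / 2) ^ n" for n
  proof -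
    define J where "J k = (if k = n then {j. dyad (n, j) \<inter> E \<noteq> {}} else {})" for k
    define N where "N = real (card (J n)) * (1 / 2) ^ n"
    have N: "0 \<le> N" by (simp add: N_def)
    have fin: "\<forall>k. finite (J k)" using finite_dyadic_cells[OF compact_imp_bounded[OF E(1)]] by (simp add: J_def)
    have "E \<subseteq> (\<Union>k\<le>n. \<Union>j\<in>J k. dyad (k, j))"
    proof
      fix x assume "x \<in> E"
      then have "x \<in> dyad (n, \<lfloor>x * 2 ^ n\<rfloor>)" "\<lfloor>x * 2 ^ n\<rfloor> \<in> J n" by (auto simp: J_def mem_dyad)
      then show "x \<in> (\<Union>k\<le>n. \<Union>j\<in>J k. dyad (k, j))" by blast
    qed
    from \<kappa>(3)[OF fin this] have "\<kappa> \<le> (\<Sum>k\<le>n. sqrt (2 * real (card (J k)) * (1 / 2) ^ k * (A * (\<Sum>i\<le>k. 2 powr ((2 - \<tau>) * real i)))))" .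
    also have "\<dots> = (\<Sum>k\<in>{n}. sqrt (2 * real (card (J k)) * (1 / 2) ^ k * (A * (\<Sum>i\<le>k. 2 powr ((2 - \<tau>) * real i)))))"
      by (intro sum.mono_neutral_right) (auto simp: J_def)
    also have "\<dots> \<le> sqrt (2 * N * G)"
    proof -
      have "A * (\<Sum>i\<le>n. 2 powr ((2 - \<tau>) * real i)) \<le> G"
        using mult_left_mono[OF geo[of n] \<kappa>(2)] by (simp add: G_def)
      then have "2 * N * (A * (\<Sum>i\<le>n. 2 powr ((2 - \<tau>) * real i))) \<le> 2 * N * G" using N by (intro mult_left_mono) auto
      then show ?thesis by (simp add: N_def)
    qed
    finally have "\<kappa>\<^sup>2 \<le> (sqrt (2 * N * G))\<^sup>2" using \<kappa>(1) by (intro power_mono) auto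
    then have "\<kappa>\<^sup>2 \<le> N * (2 * G)" using N G by (simp add: ac_simps)
    also have "\<dots> \<le> N * (2 * G + 1)" using N by (intro mult_left_mono) auto
    finally have "\<kappa>\<^sup>2 / (2 * G + 1) \<le> N" using G by (simp add: divide_le_eq)
    then show ?thesis by (simp add: N_def J_def)
  qed
  have "ennreal (\<kappa>\<^sup>2 / (2 * G + 1)) \<le> emeasure lborel E"
    using low finite_dyadic_cells[OF compact_imp_bounded[OF E(1)]] by (intro compact_measure_lower_bound E(1)) auto
  moreover have "0 < ennreal (\<kappa>\<^sup>2 / (2 * G + 1))" using \<kappa>(1) G by (simp add: zero_less_divide_iff)
  ultimately show ?thesis by (rule order.strict_trans2[rotated])
qed

text \<open>If the content vanished, there would be finite covers of cost below any
  \<open>e\<close>, with at most e * 2^(vk) cells of level \<open>k\<close>. The mass they catch is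
  of order sqrt e and cannot reach \<kappa>.\<close>

lemma image_content_positive:
  assumes v: "0 < v" "v < 1" "v + 1 < s + t + u"
  shows "0 < net_content v E"
proof (rule ccontr)
  assume "\<not> 0 < net_content v E"
  then have null: "net_content v E = 0" by (simp add: not_less)
  \<comment> \<open>Keeping \<tau> below 2 makes the last summand of the energy bound the
    largest.\<close>
  obtain \<tau> where \<tau>: "v + 1 < \<tau>" "\<tau> < min 2 (s + t + u)" using dense[of "v + 1" "min 2 (s + t + u)"] v by auto
  then have \<tau>': "\<tau> < s + t + u" "\<tau> \<le> 2" by auto
  obtain \<kappa> A where \<kappa>: "0 < \<kappa>" "0 \<le> A" "\<And>n J. (\<forall>k. finite (J k)) \<Longrightarrow> E \<subseteq> (\<Union>k\<le>n. \<Union>j\<in>J k. dyad (k, j)) \<Longrightarrow>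
    \<kappa> \<le> (\<Sum>k\<le>n. sqrt (2 * real (card (J k)) * (1 / 2) ^ k * (A * (\<Sum>i\<le>k. 2 powr ((2 - \<tau>) * real i)))))"
    using covered_mass_bound[OF \<tau>'(1)] by blast
  \<comment> \<open>The spare exponent is split into four parts. The square root leaves two: one
    absorbs the polynomial factor, the other makes the sum over levels a geometric series.\<close>
  define \<delta> where "\<delta> = (\<tau> - 1 - v) / 4"
  have \<delta>: "0 < \<delta>" using \<tau> by (simp add: \<delta>_def)
  obtain B where B: "0 \<le> B" "\<And>k. (real k + 1)\<^sup>2 * 2 powr (- \<delta> * real k) \<le> B"
    using square_powr_bounded[OF \<delta>] by blast
  define r where "r = 2 powr (- \<delta>)"
  have r: "0 < r" "r < 1" using \<delta> by (auto simp: r_def powr_less_one)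
  have scale_sum: "(\<Sum>k\<le>n. sqrt (2 * N k * (1 / 2) ^ k * (A * (\<Sum>i\<le>k. 2 powr ((2 - \<tau>) * real i))))) \<le> sqrt (2 * A * e) * (B / (1 - r))"
    if N: "\<And>k. 0 \<le> N k" "\<And>k. N k \<le> e * 2 powr (v * real k)" and e: "0 \<le> e" for N e n
  proof -
    have "sqrt (2 * N k * (1 / 2) ^ k * (A * (\<Sum>i\<le>k. 2 powr ((2 - \<tau>) * real i)))) \<le> sqrt (2 * A * e) * (B * r ^ k)" for k
    proof -
      have "(\<Sum>i\<le>k. 2 powr ((2 - \<tau>) * real i)) \<le> (\<Sum>i\<le>k. 2 powr ((2 - \<tau>) * real k))"
        using \<tau>' by (intro sum_mono powr_mono mult_left_mono) auto
      also have "\<dots> = (real k + 1) * 2 powr ((2 - \<tau>) * real k)" by simp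
      finally have S: "(\<Sum>i\<le>k. 2 powr ((2 - \<tau>) * real i)) \<le> (real k + 1) * 2 powr ((2 - \<tau>) * real k)" .
      have "2 * N k * (1 / 2) ^ k * (A * (\<Sum>i\<le>k. 2 powr ((2 - \<tau>) * real i))) \<le>
          2 * (e * 2 powr (v * real k)) * (1 / 2) ^ k * (A * ((real k + 1) * 2 powr ((2 - \<tau>) * real k)))"
        using \<kappa>(2) N e by (intro mult_mono mult_left_mono S N) (auto intro!: mult_nonneg_nonneg sum_nonneg)
      also have "\<dots> = 2 * A * e * ((real k + 1) * (2 powr (v * real k) * (1 / 2) ^ k * 2 powr ((2 - \<tau>) * real k)))"
        by (simp only: ac_simps)
      also have "2 powr (v * real k) * (1 / 2) ^ k * 2 powr ((2 - \<tau>) * real k) = (2 powr (- \<delta> * real k) * 2 powr (- \<delta> * real k))\<^sup>2"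
      proof -
        have "(v + 1 - \<tau>) * real k = - (4 * \<delta> * real k)" by (simp add: \<delta>_def field_simps)
        then have "v * real k + - real k + (2 - \<tau>) * real k =
            - \<delta> * real k + - \<delta> * real k + (- \<delta> * real k + - \<delta> * real k)"
          by (simp add: algebra_simps)
        then show ?thesis unfolding half_power_powr power2_eq_square powr_add[symmetric] by (simp only:)
      qed
      also have "2 * A * e * ((real k + 1) * (2 powr (- \<delta> * real k) * 2 powr (- \<delta> * real k))\<^sup>2) \<le>
          2 * A * e * (((real k + 1)\<^sup>2 * (2 powr (- \<delta> * real k) * 2 powr (- \<delta> * real k)))\<^sup>2)"
      proof (intro mult_left_mono)
        have "real k + 1 \<le> ((real k + 1)\<^sup>2)\<^sup>2" by (simp add: self_le_power flip: power_mult)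
        then show "(real k + 1) * (2 powr (- \<delta> * real k) * 2 powr (- \<delta> * real k))\<^sup>2 \<le>
            ((real k + 1)\<^sup>2 * (2 powr (- \<delta> * real k) * 2 powr (- \<delta> * real k)))\<^sup>2"
          unfolding power_mult_distrib[of "(real k + 1)\<^sup>2"] by (intro mult_right_mono) auto
      qed (use \<kappa>(2) e in auto)
      finally have "sqrt (2 * N k * (1 / 2) ^ k * (A * (\<Sum>i\<le>k. 2 powr ((2 - \<tau>) * real i)))) \<le>
          sqrt (2 * A * e * (((real k + 1)\<^sup>2 * (2 powr (- \<delta> * real k) * 2 powr (- \<delta> * real k)))\<^sup>2))"
        by (rule real_sqrt_le_mono)
      also have "\<dots> = sqrt (2 * A * e) * ((real k + 1)\<^sup>2 * 2 powr (- \<delta> * real k) * 2 powr (- \<delta> * real k))"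
        by (simp add: real_sqrt_mult)
      also have "2 powr (- \<delta> * real k) = r ^ k" unfolding r_def by (rule two_powr_mult)
      also have "sqrt (2 * A * e) * ((real k + 1)\<^sup>2 * r ^ k * r ^ k) \<le> sqrt (2 * A * e) * (B * r ^ k)"
      proof (intro mult_left_mono mult_right_mono)
        show "(real k + 1)\<^sup>2 * r ^ k \<le> B" using B(2)[of k] unfolding r_def two_powr_mult .
      qed (use r \<kappa>(2) e in auto)
      finally show ?thesis .
    qed
    then have "(\<Sum>k\<le>n. sqrt (2 * N k * (1 / 2) ^ k * (A * (\<Sum>i\<le>k. 2 powr ((2 - \<tau>) * real i))))) \<le> (\<Sum>k\<le>n. sqrt (2 * A * e) * (B * r ^ k))"
      by (intro sum_mono) auto
    also have "\<dots> = sqrt (2 * A * e) * (B * ((1 - r ^ Suc n) / (1 - r)))"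
      using r by (simp add: sum_distrib_left[symmetric] sum_gp0 del: power_Suc)
    also have "\<dots> \<le> sqrt (2 * A * e) * (B * (1 / (1 - r)))"
      using r B(1) \<kappa>(2) e by (intro mult_left_mono divide_right_mono) auto
    finally show ?thesis by simp
  qed
  define Q where "Q = B / (1 - r)"
  have Q: "0 \<le> Q" using B(1) r by (simp add: Q_def)
  \<comment> \<open>Chosen such that the final bound for \<open>\<kappa>\<^sup>2\<close> is
    \<open>\<kappa>\<^sup>2 / 2\<close>.\<close>
  define e where "e = \<kappa>\<^sup>2 / (2 * (2 * A * Q\<^sup>2 + 1))"
  have den: "0 < 2 * A * Q\<^sup>2 + 1" using \<kappa>(2) by (intro add_nonneg_pos) auto
  have e: "0 < e" using \<kappa>(1) den by (simp add: e_def)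
  obtain R where R: "finite R" "E \<subseteq> (\<Union>p\<in>R. dyad p)" "emeasure (dyad_cost v) R < ennreal e"
    using net_content_compact_cover[OF v(1) E(1), of "ennreal e"] null e by auto
  define J where "J k = {j. (k, j) \<in> R}" for k
  define n where "n = Max (insert 0 (fst ` R))"
  have fin: "finite (J k)" for k
    using finite_subset[of "J k" "snd ` R"] R(1) by (force simp: J_def)
  have "E \<subseteq> (\<Union>k\<le>n. \<Union>j\<in>J k. dyad (k, j))"
  proof
    fix x assume "x \<in> E"
    then obtain p where p: "p \<in> R" "x \<in> dyad p" using R(2) by blast
    then have "fst p \<le> n" unfolding n_def using R(1) by (intro Max_ge) auto
    then show "x \<in> (\<Union>k\<le>n. \<Union>j\<in>J k. dyad (k, j))" using p
      by (intro UN_I[of "fst p"] UN_I[of "snd p"]) (auto simp: J_def)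
  qed
  then have "\<kappa> \<le> (\<Sum>k\<le>n. sqrt (2 * real (card (J k)) * (1 / 2) ^ k * (A * (\<Sum>i\<le>k. 2 powr ((2 - \<tau>) * real i)))))"
    using fin by (intro \<kappa>(3)) auto
  also have "\<dots> \<le> sqrt (2 * A * e) * (B / (1 - r))"
  proof (rule scale_sum)
    fix k
    have "ennreal (real (card (J k)) * 2 powr (- v * real k)) = (\<Sum>j\<in>J k. emeasure (dyad_cost v) {(k, j)})"
      by (simp add: ennreal_mult ennreal_of_nat_eq_real_of_nat)
    also have "\<dots> = emeasure (dyad_cost v) (\<Union>j\<in>J k. {(k, j)})"
      using fin by (intro sum_emeasure) (auto simp: disjoint_family_on_def)
    also have "\<dots> \<le> emeasure (dyad_cost v) R" by (intro emeasure_mono) (auto simp: J_def)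
    also have "\<dots> < ennreal e" by (rule R(3))
    finally have "real (card (J k)) * 2 powr (- v * real k) \<le> e" using e by (simp add: ennreal_less_iff)
    then have "real (card (J k)) * 2 powr (- v * real k) * 2 powr (v * real k) \<le> e * 2 powr (v * real k)"
      by (intro mult_right_mono) auto
    then show "real (card (J k)) \<le> e * 2 powr (v * real k)"
      by (simp add: mult.assoc powr_add[symmetric])
  qed (use e in auto)
  finally have "\<kappa>\<^sup>2 \<le> (sqrt (2 * A * e) * Q)\<^sup>2" unfolding Q_def using \<kappa>(1) by (intro power_mono) auto
  also have "\<dots> = 2 * A * Q\<^sup>2 * e" using \<kappa>(2) e by (simp add: power_mult_distrib)
  also have "\<dots> \<le> (2 * A * Q\<^sup>2 + 1) * e" using e by (intro mult_right_mono) auto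
  also have "\<dots> = \<kappa>\<^sup>2 / 2"
  proof -
    have "x * (y / (2 * x)) = y / 2" if "0 < x" for x y :: real using that by simp
    from this[OF den] show ?thesis by (simp only: e_def)
  qed
  finally show False using \<kappa>(1) by simp
qed

end

subsection \<open>Analytic functions of three variables\<close>

text \<open>Index triples and boxes replace multi-index functions and balls: a box is stable under
  permuting the variables and under summing over some of them first.\<close>

definition power_series_at ::
    "(real \<times> real \<times> real \<Rightarrow> real) \<Rightarrow> real \<times> real \<times> real \<Rightarrow> real \<Rightarrow> (nat \<times> nat \<times> nat \<Rightarrow> real) \<Rightarrow> bool" where
  "power_series_at g p r c \<longleftrightarrow> 0 < r \<and> (\<forall>x y z. \<bar>x\<bar> < r \<longrightarrow> \<bar>y\<bar> < r \<longrightarrow> \<bar>z\<bar> < r \<longrightarrow>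
     ((\<lambda>(i, j, k). c (i, j, k) * x ^ i * y ^ j * z ^ k) has_sum g (p + (x, y, z))) UNIV)"

definition analytic3 :: "(real \<times> real \<times> real \<Rightarrow> real) \<Rightarrow> (real \<times> real \<times> real) set \<Rightarrow> bool" where
  "analytic3 g S \<longleftrightarrow> (\<forall>p\<in>S. \<exists>r c. power_series_at g p r c)"

lemma power_series_atD:
  "power_series_at g p r c \<Longrightarrow> \<bar>x\<bar> < r \<Longrightarrow> \<bar>y\<bar> < r \<Longrightarrow> \<bar>z\<bar> < r \<Longrightarrow>
    ((\<lambda>(i, j, k). c (i, j, k) * x ^ i * y ^ j * z ^ k) has_sum g (p + (x, y, z))) UNIV"
  unfolding power_series_at_def by blast

lemma Basis_real3: "(Basis :: (real \<times> real \<times> real) set) = {(1, 0, 0), (0, 1, 0), (0, 0, 1)}"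
  by (auto simp: Basis_prod_def zero_prod_def)

text \<open>A box of half-side \<open>r / 3\<close> lies in the ball of radius \<open>r\<close>. The
  map \<open>h\<close> identifies index triples with extensional functions, hence
  \<open>undefined\<close> off the basis.\<close>

lemma analytic3_if_real_analytic_on:
  assumes "real_analytic_on f S" shows "analytic3 f S"
  unfolding analytic3_def
proof
  fix p assume "p \<in> S"
  then obtain r c where r: "0 < r" "\<And>x. x \<in> ball p r \<Longrightarrow>
      ((\<lambda>m. c m * (\<Prod>b\<in>Basis. ((x - p) \<bullet> b) ^ m b)) has_sum f x) (Basis \<rightarrow>\<^sub>E UNIV)"
    using assms unfolding real_analytic_on_def by blast
  define h :: "nat \<times> nat \<times> nat \<Rightarrow> real \<times> real \<times> real \<Rightarrow> nat" where
    "h = (\<lambda>(i, j, k) b. if b = (1, 0, 0) then i else if b = (0, 1, 0) then j else if b = (0, 0, 1) then k else undefined)"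
  have bij: "bij_betw h UNIV (Basis \<rightarrow>\<^sub>E UNIV)"
  proof (rule bij_betw_byWitness[where f' = "\<lambda>m. (m (1, 0, 0), m (0, 1, 0), m (0, 0, 1))"])
    show "\<forall>m\<in>Basis \<rightarrow>\<^sub>E UNIV. h (m (1, 0, 0), m (0, 1, 0), m (0, 0, 1)) = m"
      by (auto simp: h_def Basis_real3 fun_eq_iff PiE_def extensional_def)
    show "h ` UNIV \<subseteq> Basis \<rightarrow>\<^sub>E UNIV"
      by (auto simp: h_def Basis_real3 PiE_def extensional_def)
  qed (auto simp: h_def)
  have "power_series_at f p (r / 3) (\<lambda>q. c (h q))"
    unfolding power_series_at_def
  proof (intro conjI allI impI)
    fix x y z :: real assume xyz: "\<bar>x\<bar> < r / 3" "\<bar>y\<bar> < r / 3" "\<bar>z\<bar> < r / 3"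
    have "norm (x, y, z) \<le> norm x + norm (y, z)" by (rule norm_Pair_le)
    also have "\<dots> \<le> norm x + (norm y + norm z)" by (intro add_left_mono norm_Pair_le)
    finally have "norm (x, y, z) < r" using xyz by simp
    moreover have "dist p (p + (x, y, z)) = norm (x, y, z)" by (metis add_diff_cancel_left' dist_commute dist_norm)
    ultimately have "p + (x, y, z) \<in> ball p r" by simp
    from r(2)[OF this] have "((\<lambda>m. c m * (\<Prod>b\<in>Basis. ((x, y, z) \<bullet> b) ^ m b)) has_sum f (p + (x, y, z))) (Basis \<rightarrow>\<^sub>E UNIV)"
      by simp
    then have "((\<lambda>q. c (h q) * (\<Prod>b\<in>Basis. ((x, y, z) \<bullet> b) ^ h q b)) has_sum f (p + (x, y, z))) UNIV"
      by (subst has_sum_reindex_bij_betw[OF bij])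
    moreover have "(\<lambda>q. c (h q) * (\<Prod>b\<in>Basis. ((x, y, z) \<bullet> b) ^ h q b)) = (\<lambda>(i, j, k). c (h (i, j, k)) * x ^ i * y ^ j * z ^ k)"
      by (auto simp: fun_eq_iff Basis_real3 h_def)
    ultimately show "((\<lambda>(i, j, k). c (h (i, j, k)) * x ^ i * y ^ j * z ^ k) has_sum f (p + (x, y, z))) UNIV"
      by simp
  qed (use r(1) in simp)
  then show "\<exists>r c. power_series_at f p r c" by blast
qed

lemma power_series_at_abs_summable:
  assumes "power_series_at g p r c" "\<bar>x\<bar> < r" "\<bar>y\<bar> < r" "\<bar>z\<bar> < r"
  shows "(\<lambda>(i, j, k). \<bar>c (i, j, k)\<bar> * \<bar>x\<bar> ^ i * \<bar>y\<bar> ^ j * \<bar>z\<bar> ^ k) summable_on UNIV"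
proof -
  have "(\<lambda>(i, j, k). c (i, j, k) * x ^ i * y ^ j * z ^ k) summable_on UNIV"
    using power_series_atD[OF assms] by (auto simp: summable_on_def)
  then have "(\<lambda>q. norm (case q of (i, j, k) \<Rightarrow> c (i, j, k) * x ^ i * y ^ j * z ^ k)) summable_on UNIV"
    using summable_on_iff_abs_summable_on_real by blast
  then show ?thesis by (rule summable_on_cong[THEN iffD1, rotated]) (auto simp: abs_mult power_abs)
qed

definition coeff_x :: "(nat \<times> nat \<times> nat \<Rightarrow> real) \<Rightarrow> nat \<times> nat \<times> nat \<Rightarrow> real" where
  "coeff_x c = (\<lambda>(i, j, k). real (Suc i) * c (Suc i, j, k))"

text \<open>For \<rho> strictly between the modulus of \<open>x\<close> and \<open>r\<close>, the
  factor \<open>Suc i\<close> of the differentiated series is absorbed by the exponential decay of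
  (\<bar>x\<bar> / \<rho>)^i.\<close>

lemma coeff_x_summable:
  assumes g: "power_series_at g p r c" and x: "\<bar>x\<bar> < r" and y: "\<bar>y\<bar> < r" and z: "\<bar>z\<bar> < r"
  shows "(\<lambda>(i, j, k). coeff_x c (i, j, k) * x ^ i * y ^ j * z ^ k) summable_on UNIV"
proof -
  obtain \<rho> where \<rho>: "\<bar>x\<bar> < \<rho>" "\<rho> < r" using dense[OF x] by blast
  have "0 < \<rho>" using \<rho> by linarith
  define q where "q = \<bar>x\<bar> / \<rho>"
  have q: "0 \<le> q" "q < 1" using \<rho> \<open>0 < \<rho>\<close> by (auto simp: q_def)
  have "summable (\<lambda>n. real (Suc n) * q ^ n)"
    using geometric_deriv_sums[of q] q by (auto simp: sums_iff)
  then have "Bseq (\<lambda>n. real (Suc n) * q ^ n)"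
    by (intro convergent_imp_Bseq) (auto simp: convergent_def dest: summable_LIMSEQ_zero)
  then obtain B where B: "0 < B" "\<And>n. norm (real (Suc n) * q ^ n) \<le> B" by (auto elim: BseqE)
  have bound: "real (Suc i) * \<bar>x\<bar> ^ i \<le> B / \<rho> * \<rho> ^ Suc i" for i
  proof -
    have "real (Suc i) * \<bar>x\<bar> ^ i = real (Suc i) * q ^ i * \<rho> ^ i"
      using \<open>0 < \<rho>\<close> by (simp add: q_def power_divide)
    also have "\<dots> \<le> B * \<rho> ^ i" using B(2)[of i] q \<open>0 < \<rho>\<close> by (intro mult_right_mono) auto
    finally show ?thesis using \<open>0 < \<rho>\<close> by simp
  qed
  have "(\<lambda>(i, j, k). \<bar>c (i, j, k)\<bar> * \<bar>\<rho>\<bar> ^ i * \<bar>y\<bar> ^ j * \<bar>z\<bar> ^ k) summable_on UNIV"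
    using \<rho> \<open>0 < \<rho>\<close> y z by (intro power_series_at_abs_summable[OF g]) auto
  then have "(\<lambda>(i, j, k). \<bar>c (i, j, k)\<bar> * \<bar>\<rho>\<bar> ^ i * \<bar>y\<bar> ^ j * \<bar>z\<bar> ^ k) summable_on range (\<lambda>(i, j, k). (Suc i, j, k))"
    by (rule summable_on_subset_banach) simp
  then have "((\<lambda>(i, j, k). \<bar>c (i, j, k)\<bar> * \<bar>\<rho>\<bar> ^ i * \<bar>y\<bar> ^ j * \<bar>z\<bar> ^ k) \<circ> (\<lambda>(i, j, k). (Suc i, j, k))) summable_on UNIV"
    by (subst (asm) summable_on_reindex) (auto simp: inj_on_def)
  then have "(\<lambda>q. B / \<rho> * (((\<lambda>(i, j, k). \<bar>c (i, j, k)\<bar> * \<bar>\<rho>\<bar> ^ i * \<bar>y\<bar> ^ j * \<bar>z\<bar> ^ k) \<circ> (\<lambda>(i, j, k). (Suc i, j, k))) q)) summable_on UNIV"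
    by (rule summable_on_cmult_right)
  then have "(\<lambda>q. norm (case q of (i, j, k) \<Rightarrow> coeff_x c (i, j, k) * x ^ i * y ^ j * z ^ k)) summable_on UNIV"
  proof (rule summable_on_comparison_test)
    fix q :: "nat \<times> nat \<times> nat"
    obtain i j k where q: "q = (i, j, k)" by (cases q)
    have "real (Suc i) * \<bar>x\<bar> ^ i * (\<bar>c (Suc i, j, k)\<bar> * \<bar>y\<bar> ^ j * \<bar>z\<bar> ^ k) \<le>
        B / \<rho> * \<rho> ^ Suc i * (\<bar>c (Suc i, j, k)\<bar> * \<bar>y\<bar> ^ j * \<bar>z\<bar> ^ k)"
      by (intro mult_right_mono bound) auto
    then show "norm (case q of (i, j, k) \<Rightarrow> coeff_x c (i, j, k) * x ^ i * y ^ j * z ^ k) \<le>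
        B / \<rho> * (((\<lambda>(i, j, k). \<bar>c (i, j, k)\<bar> * \<bar>\<rho>\<bar> ^ i * \<bar>y\<bar> ^ j * \<bar>z\<bar> ^ k) \<circ> (\<lambda>(i, j, k). (Suc i, j, k))) q)"
      using \<open>0 < \<rho>\<close> unfolding q by (simp add: coeff_x_def abs_mult power_abs ac_simps)
  qed auto
  then show ?thesis using summable_on_iff_abs_summable_on_real by blast
qed

lemma has_sum_iterated:
  fixes f :: "nat \<times> 'b \<Rightarrow> real"
  assumes "f summable_on UNIV"
  shows "((\<lambda>i. \<Sum>\<^sub>\<infinity>q. f (i, q)) has_sum infsum f UNIV) UNIV"
proof -
  have "f summable_on (UNIV \<times> UNIV)" using assms by simp
  then have "((\<lambda>i. \<Sum>\<^sub>\<infinity>q\<in>UNIV. f (i, q)) summable_on UNIV)" "infsum (\<lambda>i. \<Sum>\<^sub>\<infinity>q\<in>UNIV. f (i, q)) UNIV = infsum f (UNIV \<times> UNIV)"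
    using summable_on_Sigma_banach[of "\<lambda>i q. f (i, q)" UNIV "\<lambda>_. UNIV"] infsum_Sigma'_banach[of "\<lambda>i q. f (i, q)" UNIV "\<lambda>_. UNIV"]
    by simp_all
  then show ?thesis by (metis UNIV_Times_UNIV has_sum_infsum)
qed

text \<open>Summing over \<open>j\<close> and \<open>k\<close> first leaves a power series in one
  variable, which may be differentiated termwise.\<close>

lemma power_series_at_deriv_x:
  assumes g: "power_series_at g (a, b, e) r c" and x: "\<bar>x\<bar> < r" and y: "\<bar>y\<bar> < r" and z: "\<bar>z\<bar> < r"
  shows "((\<lambda>t. g (t, b + y, e + z)) has_real_derivative
    (\<Sum>\<^sub>\<infinity>(i, j, k). coeff_x c (i, j, k) * x ^ i * y ^ j * z ^ k)) (at (a + x))"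
proof -
  define A where "A i = (\<Sum>\<^sub>\<infinity>(j, k). c (i, j, k) * y ^ j * z ^ k)" for i
  have sums: "(\<lambda>i. A i * t ^ i) sums g (a + t, b + y, e + z)" if t: "\<bar>t\<bar> < r" for t
  proof -
    note hs = power_series_atD[OF g t y z]
    have "((\<lambda>i. \<Sum>\<^sub>\<infinity>q. case (i, q) of (i, j, k) \<Rightarrow> c (i, j, k) * t ^ i * y ^ j * z ^ k) has_sum g (a + t, b + y, e + z)) UNIV"
      using has_sum_iterated[OF has_sum_imp_summable[OF hs]] infsumI[OF hs] by simp
    moreover have "(\<Sum>\<^sub>\<infinity>q. case (i, q) of (i, j, k) \<Rightarrow> c (i, j, k) * t ^ i * y ^ j * z ^ k) = A i * t ^ i" for i
    proof -
      have "(\<lambda>q. case (i, q) of (i, j, k) \<Rightarrow> c (i, j, k) * t ^ i * y ^ j * z ^ k) = (\<lambda>q. (case q of (j, k) \<Rightarrow> c (i, j, k) * y ^ j * z ^ k) * t ^ i)"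
        by (auto simp: fun_eq_iff)
      then show ?thesis unfolding A_def by (simp only: infsum_cmult_left')
    qed
    ultimately show ?thesis by (simp add: has_sum_imp_sums)
  qed
  obtain K where K: "\<bar>x\<bar> < K" "K < r" using dense[OF x] by blast
  have "summable (\<lambda>i. A i * K ^ i)" using sums[of K] K by (auto simp: sums_iff)
  then have "((\<lambda>t. \<Sum>i. A i * t ^ i) has_real_derivative (\<Sum>i. diffs A i * x ^ i)) (at x)"
    using K by (intro termdiffs_strong) auto
  moreover have "(\<Sum>i. diffs A i * x ^ i) = (\<Sum>\<^sub>\<infinity>(i, j, k). coeff_x c (i, j, k) * x ^ i * y ^ j * z ^ k)"
  proof -
    have "((\<lambda>i. \<Sum>\<^sub>\<infinity>q. case (i, q) of (i, j, k) \<Rightarrow> coeff_x c (i, j, k) * x ^ i * y ^ j * z ^ k) has_sum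
        (\<Sum>\<^sub>\<infinity>(i, j, k). coeff_x c (i, j, k) * x ^ i * y ^ j * z ^ k)) UNIV"
      by (rule has_sum_iterated[OF coeff_x_summable[OF g x y z]])
    moreover have "(\<Sum>\<^sub>\<infinity>q. case (i, q) of (i, j, k) \<Rightarrow> coeff_x c (i, j, k) * x ^ i * y ^ j * z ^ k) = diffs A i * x ^ i" for i
    proof -
      have "(\<lambda>q. case (i, q) of (i, j, k) \<Rightarrow> coeff_x c (i, j, k) * x ^ i * y ^ j * z ^ k) =
          (\<lambda>q. (case q of (j, k) \<Rightarrow> c (Suc i, j, k) * y ^ j * z ^ k) * (real (Suc i) * x ^ i))"
        by (auto simp: fun_eq_iff coeff_x_def)
      then show ?thesis unfolding A_def diffs_def by (simp only: infsum_cmult_left') (simp add: ac_simps)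
    qed
    ultimately show ?thesis by (metis (no_types, lifting) has_sum_cong has_sum_imp_sums sums_unique)
  qed
  ultimately have D: "((\<lambda>t. \<Sum>i. A i * t ^ i) has_real_derivative
      (\<Sum>\<^sub>\<infinity>(i, j, k). coeff_x c (i, j, k) * x ^ i * y ^ j * z ^ k)) (at x)" by simp
  have "\<forall>\<^sub>F t in nhds x. \<bar>t\<bar> < r"
    using x by (intro order_tendstoD[of _ "\<bar>x\<bar>"] tendsto_rabs filterlim_ident)
  then have "\<forall>\<^sub>F t in nhds x. (\<Sum>i. A i * t ^ i) = g (a + t, b + y, e + z)"
    by eventually_elim (use sums in \<open>auto simp: sums_iff\<close>)
  then have "((\<lambda>t. g (a + t, b + y, e + z)) has_real_derivative
      (\<Sum>\<^sub>\<infinity>(i, j, k). coeff_x c (i, j, k) * x ^ i * y ^ j * z ^ k)) (at x)"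
    using D by (subst (asm) DERIV_cong_ev[OF refl _ refl]) auto
  then show ?thesis using DERIV_shift[of "\<lambda>t. g (t, b + y, e + z)" _ x a] by (simp add: add.commute)
qed

lemma power_series_at_partial_x:
  assumes g: "power_series_at g (a, b, e) r c"
  shows "power_series_at (partial_x g) (a, b, e) r (coeff_x c)"
    and "\<bar>x\<bar> < r \<Longrightarrow> \<bar>y\<bar> < r \<Longrightarrow> \<bar>z\<bar> < r \<Longrightarrow>
      ((\<lambda>t. g (t, b + y, e + z)) has_real_derivative partial_x g (a + x, b + y, e + z)) (at (a + x))"
proof -
  have *: "partial_x g (a + x, b + y, e + z) = (\<Sum>\<^sub>\<infinity>(i, j, k). coeff_x c (i, j, k) * x ^ i * y ^ j * z ^ k)"
    if "\<bar>x\<bar> < r" "\<bar>y\<bar> < r" "\<bar>z\<bar> < r" for x y z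
    using power_series_at_deriv_x[OF g that] by (simp add: partial_x_def DERIV_imp_deriv)
  then show "power_series_at (partial_x g) (a, b, e) r (coeff_x c)"
    using g coeff_x_summable[OF g] unfolding power_series_at_def by (auto simp: has_sum_infsum)
  show "((\<lambda>t. g (t, b + y, e + z)) has_real_derivative partial_x g (a + x, b + y, e + z)) (at (a + x))"
    if "\<bar>x\<bar> < r" "\<bar>y\<bar> < r" "\<bar>z\<bar> < r"
    using power_series_at_deriv_x[OF g that] *[OF that] by simp
qed

text \<open>Only the first variable is differentiated directly; the others are reduced to it by
  these swaps. They are polymorphic because they act on index triples as well as on points.\<close>

definition swap_xy :: "'a \<times> 'a \<times> 'c \<Rightarrow> 'a \<times> 'a \<times> 'c" where "swap_xy = (\<lambda>(x, y, z). (y, x, z))"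
definition swap_xz :: "'a \<times> 'b \<times> 'a \<Rightarrow> 'a \<times> 'b \<times> 'a" where "swap_xz = (\<lambda>(x, y, z). (z, y, x))"

lemma swap_simps [simp]: "swap_xy (x, y, z) = (y, x, z)" "swap_xz (x, y, z) = (z, y, x)"
  "swap_xy (swap_xy p) = p" "swap_xz (swap_xz q) = q"
  by (auto simp: swap_xy_def swap_xz_def split: prod.splits)

lemma partial_y_swap: "partial_y g p = partial_x (g \<circ> swap_xy) (swap_xy p)"
  and partial_z_swap: "partial_z g p = partial_x (g \<circ> swap_xz) (swap_xz p)"
  by (cases p; simp add: partial_x_def partial_y_def partial_z_def)+

lemma power_series_at_swap_xy:
  assumes "power_series_at g p r c"
  shows "power_series_at (g \<circ> swap_xy) (swap_xy p) r (c \<circ> swap_xy)"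
proof -
  obtain a b e where p: "p = (a, b, e)" by (cases p)
  have bij: "bij_betw swap_xy UNIV UNIV" by (rule bij_betw_byWitness[where f' = swap_xy]) auto
  show ?thesis unfolding power_series_at_def
  proof (intro conjI allI impI)
    fix x y z :: real assume "\<bar>x\<bar> < r" "\<bar>y\<bar> < r" "\<bar>z\<bar> < r"
    then have "((\<lambda>(i, j, k). c (i, j, k) * y ^ i * x ^ j * z ^ k) has_sum g (p + (y, x, z))) UNIV"
      using power_series_atD[OF assms] by blast
    then have "((\<lambda>q. (\<lambda>(i, j, k). c (i, j, k) * y ^ i * x ^ j * z ^ k) (swap_xy q)) has_sum g (p + (y, x, z))) UNIV"
      using has_sum_reindex_bij_betw[OF bij] by blast
    then show "((\<lambda>(i, j, k). (c \<circ> swap_xy) (i, j, k) * x ^ i * y ^ j * z ^ k) has_sum (g \<circ> swap_xy) (swap_xy p + (x, y, z))) UNIV"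
      by (simp add: p case_prod_unfold swap_xy_def ac_simps)
  qed (use assms in \<open>simp add: power_series_at_def\<close>)
qed

lemma power_series_at_swap_xz:
  assumes "power_series_at g p r c"
  shows "power_series_at (g \<circ> swap_xz) (swap_xz p) r (c \<circ> swap_xz)"
proof -
  obtain a b e where p: "p = (a, b, e)" by (cases p)
  have bij: "bij_betw swap_xz UNIV UNIV" by (rule bij_betw_byWitness[where f' = swap_xz]) auto
  show ?thesis unfolding power_series_at_def
  proof (intro conjI allI impI)
    fix x y z :: real assume "\<bar>x\<bar> < r" "\<bar>y\<bar> < r" "\<bar>z\<bar> < r"
    then have "((\<lambda>(i, j, k). c (i, j, k) * z ^ i * y ^ j * x ^ k) has_sum g (p + (z, y, x))) UNIV"
      using power_series_atD[OF assms] by blast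
    then have "((\<lambda>q. (\<lambda>(i, j, k). c (i, j, k) * z ^ i * y ^ j * x ^ k) (swap_xz q)) has_sum g (p + (z, y, x))) UNIV"
      using has_sum_reindex_bij_betw[OF bij] by blast
    then show "((\<lambda>(i, j, k). (c \<circ> swap_xz) (i, j, k) * x ^ i * y ^ j * z ^ k) has_sum (g \<circ> swap_xz) (swap_xz p + (x, y, z))) UNIV"
      by (simp add: p case_prod_unfold swap_xz_def ac_simps)
  qed (use assms in \<open>simp add: power_series_at_def\<close>)
qed

lemma power_series_at_partial_y:
  assumes "power_series_at g p r c"
  shows "power_series_at (partial_y g) p r (coeff_x (c \<circ> swap_xy) \<circ> swap_xy)"
proof -
  obtain a b e where p: "swap_xy p = (a, b, e)" by (cases "swap_xy p")
  have "power_series_at (partial_x (g \<circ> swap_xy)) (swap_xy p) r (coeff_x (c \<circ> swap_xy))"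
    using power_series_at_partial_x(1) power_series_at_swap_xy[OF assms] unfolding p by blast
  from power_series_at_swap_xy[OF this] show ?thesis
    by (simp add: o_def partial_y_swap[abs_def])
qed

lemma power_series_at_partial_z:
  assumes "power_series_at g p r c"
  shows "power_series_at (partial_z g) p r (coeff_x (c \<circ> swap_xz) \<circ> swap_xz)"
proof -
  obtain a b e where p: "swap_xz p = (a, b, e)" by (cases "swap_xz p")
  have "power_series_at (partial_x (g \<circ> swap_xz)) (swap_xz p) r (coeff_x (c \<circ> swap_xz))"
    using power_series_at_partial_x(1) power_series_at_swap_xz[OF assms] unfolding p by blast
  from power_series_at_swap_xz[OF this] show ?thesis
    by (simp add: o_def partial_z_swap[abs_def])
qed

section \<open>Symmetry of second derivatives and continuity\<close>

lemma power_series_at_center: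
  assumes "power_series_at g p r c" shows "g p = c (0, 0, 0)"
proof -
  have 1: "((\<lambda>(i, j, k). c (i, j, k) * 0 ^ i * 0 ^ j * 0 ^ k) has_sum g (p + (0, 0, 0))) UNIV"
    using assms by (intro power_series_atD) (auto simp: power_series_at_def)
  have "((\<lambda>(i, j, k). c (i, j, k) * 0 ^ i * 0 ^ j * 0 ^ k) has_sum (\<Sum>(i, j, k)\<in>{(0, 0, 0)}. c (i, j, k) * 0 ^ i * 0 ^ j * 0 ^ k)) {(0, 0, 0)}"
    by (rule has_sum_finite) simp
  then have 2: "((\<lambda>(i, j, k). c (i, j, k) * 0 ^ i * 0 ^ j * 0 ^ k) has_sum c (0, 0, 0)) UNIV"
    by (subst (asm) has_sum_cong_neutral[where T = UNIV and g = "\<lambda>(i, j, k). c (i, j, k) * 0 ^ i * 0 ^ j * 0 ^ k"])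
      (auto simp: power_0_left split: if_splits)
  have "p + (0, 0, 0) = p" by (simp flip: zero_prod_def)
  then show ?thesis using has_sum_unique[OF 1 2] by (simp only:)
qed

lemma analytic3_partials:
  assumes "analytic3 g S"
  shows "analytic3 (partial_x g) S" "analytic3 (partial_y g) S" "analytic3 (partial_z g) S"
  unfolding analytic3_def
proof safe
  fix a b e assume "(a, b, e) \<in> S"
  then obtain r c where g: "power_series_at g (a, b, e) r c" using assms by (auto simp: analytic3_def)
  show "\<exists>r c. power_series_at (partial_x g) (a, b, e) r c" using power_series_at_partial_x(1)[OF g] by (intro exI)
  show "\<exists>r c. power_series_at (partial_y g) (a, b, e) r c" using power_series_at_partial_y[OF g] by (intro exI)
  show "\<exists>r c. power_series_at (partial_z g) (a, b, e) r c" using power_series_at_partial_z[OF g] by (intro exI)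
qed

lemma analytic3_deriv:
  assumes "analytic3 g S" "(x, y, z) \<in> S"
  shows "((\<lambda>t. g (t, y, z)) has_real_derivative partial_x g (x, y, z)) (at x)"
    "((\<lambda>t. g (x, t, z)) has_real_derivative partial_y g (x, y, z)) (at y)"
    "((\<lambda>t. g (x, y, t)) has_real_derivative partial_z g (x, y, z)) (at z)"
proof -
  obtain r c where g: "power_series_at g (x, y, z) r c" using assms by (auto simp: analytic3_def)
  then have r: "0 < r" by (simp add: power_series_at_def)
  show "((\<lambda>t. g (t, y, z)) has_real_derivative partial_x g (x, y, z)) (at x)"
    using power_series_at_partial_x(2)[OF g, of 0 0 0] r by simp
  show "((\<lambda>t. g (x, t, z)) has_real_derivative partial_y g (x, y, z)) (at y)"
    using power_series_at_partial_x(2)[OF power_series_at_swap_xy[OF g, simplified], of 0 0 0] r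
    by (simp add: partial_y_swap)
  show "((\<lambda>t. g (x, y, t)) has_real_derivative partial_z g (x, y, z)) (at z)"
    using power_series_at_partial_x(2)[OF power_series_at_swap_xz[OF g, simplified], of 0 0 0] r
    by (simp add: partial_z_swap)
qed

text \<open>At the centre of the expansion both sides are the same Taylor coefficient.\<close>

lemma analytic3_mixed:
  assumes "analytic3 g S" "p \<in> S"
  shows "partial_x (partial_y g) p = partial_y (partial_x g) p"
    "partial_x (partial_z g) p = partial_z (partial_x g) p"
    "partial_y (partial_z g) p = partial_z (partial_y g) p"
proof -
  obtain r c where g: "power_series_at g p r c" using assms by (auto simp: analytic3_def)
  obtain a b e where p: "p = (a, b, e)" by (cases p)
  note X = power_series_at_partial_x(1)[where a = a and b = b and e = e, folded p]
  note Y = power_series_at_partial_y and Z = power_series_at_partial_z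
  show "partial_x (partial_y g) p = partial_y (partial_x g) p"
    using power_series_at_center[OF X[OF Y[OF g]]] power_series_at_center[OF Y[OF X[OF g]]] by (simp add: coeff_x_def)
  show "partial_x (partial_z g) p = partial_z (partial_x g) p"
    using power_series_at_center[OF X[OF Z[OF g]]] power_series_at_center[OF Z[OF X[OF g]]] by (simp add: coeff_x_def)
  show "partial_y (partial_z g) p = partial_z (partial_y g) p"
    using power_series_at_center[OF Y[OF Z[OF g]]] power_series_at_center[OF Z[OF Y[OF g]]] by (simp add: coeff_x_def)
qed

text \<open>Every nonconstant monomial at a point with coordinates of size at most t is smaller by a
  factor t / \<rho> than at the corner of the box of half-side \<rho>. So the difference quotient is
  bounded by the absolutely convergent sum.\<close>

lemma power_series_at_continuous:
  assumes g: "power_series_at g p r c" shows "isCont g p"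
proof -
  define \<rho> where "\<rho> = r / 2"
  have \<rho>: "0 < \<rho>" "\<rho> < r" using g by (auto simp: \<rho>_def power_series_at_def)
  define b where "b = (\<lambda>(i, j, k). \<bar>c (i, j, k)\<bar> * \<rho> ^ i * \<rho> ^ j * \<rho> ^ k)"
  have "(\<lambda>(i, j, k). \<bar>c (i, j, k)\<bar> * \<bar>\<rho>\<bar> ^ i * \<bar>\<rho>\<bar> ^ j * \<bar>\<rho>\<bar> ^ k) summable_on UNIV"
    using \<rho> by (intro power_series_at_abs_summable[OF g]) auto
  then have b: "(b has_sum infsum b UNIV) UNIV" using \<rho> by (simp add: b_def has_sum_infsum)
  have bound: "\<bar>g (p + (x, y, z)) - g p\<bar> \<le> infsum b UNIV * (t / \<rho>)"
    if xyz: "\<bar>x\<bar> \<le> t" "\<bar>y\<bar> \<le> t" "\<bar>z\<bar> \<le> t" "t \<le> \<rho>" for x y z t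
  proof -
    have t: "0 \<le> t" using xyz by linarith
    define u where "u = (\<lambda>(i, j, k). c (i, j, k) * x ^ i * y ^ j * z ^ k - c (i, j, k) * 0 ^ i * 0 ^ j * 0 ^ k)"
    have 1: "((\<lambda>(i, j, k). c (i, j, k) * x ^ i * y ^ j * z ^ k) has_sum g (p + (x, y, z))) UNIV"
      and 2: "((\<lambda>(i, j, k). c (i, j, k) * 0 ^ i * 0 ^ j * 0 ^ k) has_sum g (p + (0, 0, 0))) UNIV"
      using xyz \<rho> by (intro power_series_atD[OF g]; simp)+
    have "((\<lambda>q. (case q of (i, j, k) \<Rightarrow> c (i, j, k) * x ^ i * y ^ j * z ^ k) +
        - (case q of (i, j, k) \<Rightarrow> c (i, j, k) * 0 ^ i * 0 ^ j * 0 ^ k)) has_sum (g (p + (x, y, z)) + - g (p + (0, 0, 0)))) UNIV"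
      by (rule has_sum_add[OF 1 has_sum_uminusI[OF 2]])
    moreover have "p + (0, 0, 0) = p" by (simp flip: zero_prod_def)
    ultimately have u: "(u has_sum (g (p + (x, y, z)) - g p)) UNIV"
      by (simp add: u_def case_prod_unfold)
    have ub: "\<bar>u q\<bar> \<le> b q * (t / \<rho>)" for q
    proof -
      obtain i j k where q: "q = (i, j, k)" by (cases q)
      show ?thesis
      proof (cases "i = 0 \<and> j = 0 \<and> k = 0")
        case True then show ?thesis using q t \<rho> by (simp add: u_def b_def)
      next
        case False
        then have "(0 :: real) ^ i * 0 ^ j * 0 ^ k = 0" by (auto simp: power_0_left)
        then have "u q = c (i, j, k) * x ^ i * y ^ j * z ^ k" unfolding u_def q by (simp add: mult.assoc)
        then have "\<bar>u q\<bar> = \<bar>c q\<bar> * (\<bar>x\<bar> ^ i * \<bar>y\<bar> ^ j * \<bar>z\<bar> ^ k)" by (simp add: q abs_mult power_abs)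
        also have "\<dots> \<le> \<bar>c q\<bar> * (t ^ i * t ^ j * t ^ k)"
          using xyz t by (intro mult_left_mono mult_mono power_mono) auto
        also have "t ^ i * t ^ j * t ^ k = \<rho> ^ i * \<rho> ^ j * \<rho> ^ k * (t / \<rho>) ^ (i + j + k)"
          using \<rho> by (simp add: power_add power_divide)
        also have "\<bar>c q\<bar> * (\<rho> ^ i * \<rho> ^ j * \<rho> ^ k * (t / \<rho>) ^ (i + j + k)) \<le> \<bar>c q\<bar> * (\<rho> ^ i * \<rho> ^ j * \<rho> ^ k * (t / \<rho>))"
        proof (intro mult_left_mono)
          have "(t / \<rho>) ^ (i + j + k) \<le> (t / \<rho>) ^ 1"
            using False xyz t \<rho> by (intro power_decreasing) auto
          then show "(t / \<rho>) ^ (i + j + k) \<le> t / \<rho>" by simp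
        qed (use \<rho> in auto)
        finally show ?thesis by (simp add: b_def q ac_simps)
      qed
    qed
    have bt: "((\<lambda>q. b q * (t / \<rho>)) has_sum infsum b UNIV * (t / \<rho>)) UNIV"
      using b by (rule has_sum_cmult_left)
    have "g (p + (x, y, z)) - g p \<le> infsum b UNIV * (t / \<rho>)"
      by (rule has_sum_mono[OF u bt]) (use ub in \<open>auto simp: abs_le_iff\<close>)
    moreover have "((\<lambda>q. - u q) has_sum - (g (p + (x, y, z)) - g p)) UNIV" by (rule has_sum_uminusI[OF u])
    then have "- (g (p + (x, y, z)) - g p) \<le> infsum b UNIV * (t / \<rho>)"
      by (rule has_sum_mono[OF _ bt]) (use ub in \<open>auto simp: abs_le_iff\<close>)
    ultimately show ?thesis by linarith
  qed
  have "((\<lambda>q. g q - g p) \<longlongrightarrow> 0) (at p)"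
  proof (rule Lim_null_comparison)
    have "\<forall>\<^sub>F q in at p. dist q p < \<rho>" using \<rho>(1) by (auto simp: eventually_at)
    then show "\<forall>\<^sub>F q in at p. norm (g q - g p) \<le> infsum b UNIV * (dist q p / \<rho>)"
    proof eventually_elim
      case (elim q)
      obtain x y z where h: "q - p = (x, y, z)" by (cases "q - p")
      have "norm x \<le> norm (x, y, z)" "norm (y, z) \<le> norm (x, y, z)" "norm y \<le> norm (y, z)" "norm z \<le> norm (y, z)"
        by (rule norm_fst_le norm_snd_le)+
      then have "\<bar>x\<bar> \<le> dist q p" "\<bar>y\<bar> \<le> dist q p" "\<bar>z\<bar> \<le> dist q p" by (auto simp: dist_norm h)
      then have "\<bar>g (p + (x, y, z)) - g p\<bar> \<le> infsum b UNIV * (dist q p / \<rho>)" using elim by (intro bound) auto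
      then show ?case by (simp flip: h)
    qed
    show "((\<lambda>q. infsum b UNIV * (dist q p / \<rho>)) \<longlongrightarrow> 0) (at p)"
      using \<rho>(1) by (auto intro!: tendsto_eq_intros)
  qed
  then show ?thesis by (simp add: isCont_def LIM_zero_iff)
qed

lemma analytic3_continuous: "analytic3 g S \<Longrightarrow> p \<in> S \<Longrightarrow> isCont g p"
  using power_series_at_continuous unfolding analytic3_def by blast

text \<open>Analyticity is encoded by a holomorphic extension to a disc, so that complex analysis
  supplies the identity theorem, primitives and local inverses.\<close>

definition analytic1 :: "(real \<Rightarrow> real) \<Rightarrow> real \<Rightarrow> bool" where
  "analytic1 \<phi> t \<longleftrightarrow> (\<exists>\<Phi> r. 0 < r \<and> \<Phi> holomorphic_on ball (complex_of_real t) r \<and>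
     (\<forall>s. \<bar>s - t\<bar> < r \<longrightarrow> \<Phi> (of_real s) = of_real (\<phi> s)))"

text \<open>Absolute convergence allows the triple series to be grouped by total degree, which gives
  a power series in a complex parameter. The summand 1 in \<open>R\<close> covers the direction
  \<open>v = 0\<close>.\<close>

lemma power_series_at_line:
  assumes g: "power_series_at g p r c"
  shows "analytic1 (\<lambda>t. g (p + t *\<^sub>R v)) 0"
proof -
  obtain v1 v2 v3 where v: "v = (v1, v2, v3)" by (cases v)
  define R where "R = r / (1 + \<bar>v1\<bar> + \<bar>v2\<bar> + \<bar>v3\<bar>)"
  have r: "0 < r" using g by (simp add: power_series_at_def)
  then have R: "0 < R" by (simp add: R_def add_pos_nonneg)
  have small: "\<tau> * \<bar>w\<bar> < r" if "0 \<le> \<tau>" "\<tau> < R" "\<bar>w\<bar> \<le> \<bar>v1\<bar> + \<bar>v2\<bar> + \<bar>v3\<bar>" for \<tau> w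
  proof -
    have "\<tau> * \<bar>w\<bar> \<le> \<tau> * (1 + \<bar>v1\<bar> + \<bar>v2\<bar> + \<bar>v3\<bar>)" using that by (intro mult_left_mono) auto
    also have "\<dots> < R * (1 + \<bar>v1\<bar> + \<bar>v2\<bar> + \<bar>v3\<bar>)" using that by (intro mult_strict_right_mono) (auto simp: add_pos_nonneg)
    also have "\<dots> = r" by (simp add: R_def add_pos_nonneg less_imp_neq[symmetric])
    finally show ?thesis .
  qed
  define d where "d = (\<lambda>(i, j, k). c (i, j, k) * v1 ^ i * v2 ^ j * v3 ^ k)"
  define deg :: "nat \<times> nat \<times> nat \<Rightarrow> nat" where "deg = (\<lambda>(i, j, k). i + j + k)"
  define \<Phi> where "\<Phi> \<zeta> = (\<Sum>\<^sub>\<infinity>q. complex_of_real (d q) * \<zeta> ^ deg q)" for \<zeta>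
  have fin: "finite {q. deg q = n}" for n
  proof (rule finite_subset)
    show "{q. deg q = n} \<subseteq> {..n} \<times> {..n} \<times> {..n}" by (auto simp: deg_def)
  qed simp
  have hs: "((\<lambda>q. complex_of_real (d q) * \<zeta> ^ deg q) has_sum \<Phi> \<zeta>) UNIV" if \<zeta>: "norm \<zeta> < R" for \<zeta>
  proof -
    have "(\<lambda>(i, j, k). \<bar>c (i, j, k)\<bar> * \<bar>norm \<zeta> * \<bar>v1\<bar>\<bar> ^ i * \<bar>norm \<zeta> * \<bar>v2\<bar>\<bar> ^ j * \<bar>norm \<zeta> * \<bar>v3\<bar>\<bar> ^ k) summable_on UNIV"
      using \<zeta> by (intro power_series_at_abs_summable[OF g]) (auto simp: abs_mult intro!: small)
    then have "(\<lambda>q. norm (complex_of_real (d q) * \<zeta> ^ deg q)) summable_on UNIV"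
      by (rule summable_on_cong[THEN iffD1, rotated])
        (auto simp: d_def deg_def norm_mult norm_power abs_mult power_mult_distrib power_abs power_add)
    then show ?thesis unfolding \<Phi>_def by (rule has_sum_infsum[OF abs_summable_summable])
  qed
  define a where "a n = (\<Sum>q\<in>{q. deg q = n}. d q)" for n
  have sums: "(\<lambda>n. complex_of_real (a n) * (\<zeta> - 0) ^ n) sums \<Phi> \<zeta>" if "\<zeta> \<in> ball 0 R" for \<zeta>
  proof -
    have \<zeta>: "norm \<zeta> < R" using that by simp
    have bij: "bij_betw snd (Sigma UNIV (\<lambda>n. {q. deg q = n})) UNIV"
      by (rule bij_betw_byWitness[where f' = "\<lambda>q. (deg q, q)"]) auto
    have "((\<lambda>x. complex_of_real (d (snd x)) * \<zeta> ^ deg (snd x)) has_sum \<Phi> \<zeta>) (Sigma UNIV (\<lambda>n. {q. deg q = n}))"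
      by (rule has_sum_reindex_bij_betw[OF bij, THEN iffD2, OF hs[OF \<zeta>]])
    then have "((\<lambda>n. complex_of_real (a n) * \<zeta> ^ n) has_sum \<Phi> \<zeta>) UNIV"
    proof (rule has_sum_SigmaD)
      fix n :: nat
      have "((\<lambda>q. complex_of_real (d q) * \<zeta> ^ deg q) has_sum (\<Sum>q\<in>{q. deg q = n}. complex_of_real (d q) * \<zeta> ^ deg q)) {q. deg q = n}"
        by (rule has_sum_finite[OF fin])
      also have "(\<Sum>q\<in>{q. deg q = n}. complex_of_real (d q) * \<zeta> ^ deg q) = complex_of_real (a n) * \<zeta> ^ n"
        unfolding a_def of_real_sum sum_distrib_right by (intro sum.cong) auto
      finally show "((\<lambda>y. complex_of_real (d (snd (n, y))) * \<zeta> ^ deg (snd (n, y))) has_sum complex_of_real (a n) * \<zeta> ^ n) {q. deg q = n}"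
        by simp
    qed
    then show ?thesis by (simp add: has_sum_imp_sums)
  qed
  have "\<Phi> holomorphic_on ball 0 R" using sums by (rule power_series_holomorphic)
  moreover have "\<Phi> (of_real s) = of_real (g (p + s *\<^sub>R v))" if "\<bar>s - 0\<bar> < R" for s
  proof -
    have s: "\<bar>s\<bar> < R" using that by simp
    have "((\<lambda>(i, j, k). c (i, j, k) * (s * v1) ^ i * (s * v2) ^ j * (s * v3) ^ k) has_sum g (p + (s * v1, s * v2, s * v3))) UNIV"
      using s by (intro power_series_atD[OF g]) (auto simp: abs_mult intro!: small)
    from has_sum_of_real[OF this, where ?'a = complex]
    have "((\<lambda>q. complex_of_real (case q of (i, j, k) \<Rightarrow> c (i, j, k) * (s * v1) ^ i * (s * v2) ^ j * (s * v3) ^ k)) has_sum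
        complex_of_real (g (p + s *\<^sub>R v))) UNIV" by (simp add: v)
    moreover have "complex_of_real (case q of (i, j, k) \<Rightarrow> c (i, j, k) * (s * v1) ^ i * (s * v2) ^ j * (s * v3) ^ k) =
        complex_of_real (d q) * of_real s ^ deg q" for q
      by (cases q) (simp add: d_def deg_def power_mult_distrib power_add)
    ultimately have "((\<lambda>q. complex_of_real (d q) * of_real s ^ deg q) has_sum complex_of_real (g (p + s *\<^sub>R v))) UNIV"
      by simp
    moreover have "norm (complex_of_real s) < R" using s by simp
    ultimately show ?thesis using hs has_sum_unique by blast
  qed
  ultimately show ?thesis unfolding analytic1_def using R by (intro exI[of _ \<Phi>] exI[of _ R]) auto
qed

lemma analytic1_shift: "analytic1 (\<lambda>s. \<phi> (t + s)) 0 \<Longrightarrow> analytic1 \<phi> t"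
proof -
  assume "analytic1 (\<lambda>s. \<phi> (t + s)) 0"
  then obtain \<Phi> r where \<Phi>: "0 < r" "\<Phi> holomorphic_on ball 0 r" "\<And>s. \<bar>s\<bar> < r \<Longrightarrow> \<Phi> (of_real s) = of_real (\<phi> (t + s))"
    unfolding analytic1_def by auto
  have "(\<Phi> \<circ> (\<lambda>\<zeta>. \<zeta> - of_real t)) holomorphic_on ball (of_real t) r"
    by (rule holomorphic_on_compose_gen[OF _ \<Phi>(2)]) (auto intro!: holomorphic_intros simp: dist_norm norm_minus_commute)
  moreover have "(\<Phi> \<circ> (\<lambda>\<zeta>. \<zeta> - of_real t)) (of_real s) = of_real (\<phi> s)" if "\<bar>s - t\<bar> < r" for s
    using \<Phi>(3)[OF that] by (simp flip: of_real_diff)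
  ultimately show ?thesis unfolding analytic1_def using \<Phi>(1) by blast
qed

lemma analytic3_line:
  assumes "analytic3 g S" "q + t *\<^sub>R v \<in> S"
  shows "analytic1 (\<lambda>t. g (q + t *\<^sub>R v)) t"
proof (rule analytic1_shift)
  obtain r c where "power_series_at g (q + t *\<^sub>R v) r c" using assms by (auto simp: analytic3_def)
  from power_series_at_line[OF this, of v] show "analytic1 (\<lambda>s. g (q + (t + s) *\<^sub>R v)) 0"
    by (simp add: scaleR_add_left add.assoc)
qed

subsection \<open>Analytic functions of one real variable\<close>

lemma eventually_nhds_real: "(\<forall>\<^sub>F s in nhds t. P s) \<longleftrightarrow> (\<exists>e>0. \<forall>s. \<bar>s - t\<bar> < e \<longrightarrow> P (s :: real))"
  unfolding eventually_nhds_metric by (simp add: dist_real_def)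

lemma analytic1_cong:
  assumes "analytic1 \<phi> t" "\<forall>\<^sub>F s in nhds t. \<phi> s = \<psi> s"
  shows "analytic1 \<psi> t"
proof -
  obtain \<Phi> r where \<Phi>: "0 < r" "\<Phi> holomorphic_on ball (of_real t) r" "\<And>s. \<bar>s - t\<bar> < r \<Longrightarrow> \<Phi> (of_real s) = of_real (\<phi> s)"
    using assms(1) unfolding analytic1_def by blast
  obtain e where e: "0 < e" "\<And>s. \<bar>s - t\<bar> < e \<Longrightarrow> \<phi> s = \<psi> s"
    using assms(2) unfolding eventually_nhds_real by blast
  show ?thesis unfolding analytic1_def
    using \<Phi> e by (intro exI[of _ \<Phi>] exI[of _ "min e r"]) (auto intro: holomorphic_on_subset)
qed

lemma analytic1_binary:
  assumes "analytic1 \<phi> t" "analytic1 \<psi> t"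
    and hol: "\<And>\<Phi> \<Psi> S. \<Phi> holomorphic_on S \<Longrightarrow> \<Psi> holomorphic_on S \<Longrightarrow> (\<lambda>z. F (\<Phi> z) (\<Psi> z)) holomorphic_on S"
    and real: "\<And>a b. F (of_real a) (of_real b) = of_real (G a b)"
  shows "analytic1 (\<lambda>s. G (\<phi> s) (\<psi> s)) t"
proof -
  obtain \<Phi> r where \<Phi>: "0 < r" "\<Phi> holomorphic_on ball (of_real t) r" "\<And>s. \<bar>s - t\<bar> < r \<Longrightarrow> \<Phi> (of_real s) = of_real (\<phi> s)"
    using assms(1) unfolding analytic1_def by blast
  obtain \<Psi> q where \<Psi>: "0 < q" "\<Psi> holomorphic_on ball (of_real t) q" "\<And>s. \<bar>s - t\<bar> < q \<Longrightarrow> \<Psi> (of_real s) = of_real (\<psi> s)"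
    using assms(2) unfolding analytic1_def by blast
  have "(\<lambda>z. F (\<Phi> z) (\<Psi> z)) holomorphic_on ball (of_real t) (min r q)"
    by (intro hol holomorphic_on_subset[OF \<Phi>(2)] holomorphic_on_subset[OF \<Psi>(2)]) auto
  moreover have "F (\<Phi> (of_real s)) (\<Psi> (of_real s)) = of_real (G (\<phi> s) (\<psi> s))" if "\<bar>s - t\<bar> < min r q" for s
    using \<Phi>(3)[of s] \<Psi>(3)[of s] that real by simp
  ultimately show ?thesis unfolding analytic1_def using \<Phi>(1) \<Psi>(1)
    by (intro exI[of _ "\<lambda>z. F (\<Phi> z) (\<Psi> z)"] exI[of _ "min r q"]) auto
qed

lemma analytic1_const: "analytic1 (\<lambda>_. c) t"
  unfolding analytic1_def by (intro exI[of _ "\<lambda>_. of_real c"] exI[of _ 1]) auto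

lemma analytic1_ident: "analytic1 (\<lambda>s. s) t"
  unfolding analytic1_def by (intro exI[of _ "\<lambda>z. z"] exI[of _ 1]) auto

lemma analytic1_mult: "analytic1 \<phi> t \<Longrightarrow> analytic1 \<psi> t \<Longrightarrow> analytic1 (\<lambda>s. \<phi> s * \<psi> s) t"
  by (erule analytic1_binary[where F = "(*)"]) (auto intro: holomorphic_intros)

lemma analytic1_diff: "analytic1 \<phi> t \<Longrightarrow> analytic1 \<psi> t \<Longrightarrow> analytic1 (\<lambda>s. \<phi> s - \<psi> s) t"
  by (erule analytic1_binary[where F = "(-)"]) (auto intro: holomorphic_intros)

lemma analytic1_compose:
  assumes "analytic1 \<psi> t" "analytic1 \<phi> (\<psi> t)" shows "analytic1 (\<lambda>s. \<phi> (\<psi> s)) t"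
proof -
  obtain \<Psi> r where \<Psi>: "0 < r" "\<Psi> holomorphic_on ball (of_real t) r" "\<And>s. \<bar>s - t\<bar> < r \<Longrightarrow> \<Psi> (of_real s) = of_real (\<psi> s)"
    using assms(1) unfolding analytic1_def by blast
  obtain \<Phi> q where \<Phi>: "0 < q" "\<Phi> holomorphic_on ball (of_real (\<psi> t)) q"
      "\<And>s. \<bar>s - \<psi> t\<bar> < q \<Longrightarrow> \<Phi> (of_real s) = of_real (\<phi> s)"
    using assms(2) unfolding analytic1_def by blast
  have "isCont \<Psi> (of_real t)"
    using \<Psi>(1,2) by (meson centre_in_ball continuous_on_eq_continuous_at holomorphic_on_imp_continuous_on open_ball)
  then have "\<exists>d>0. \<forall>z. dist z (of_real t) < d \<longrightarrow> dist (\<Psi> z) (\<Psi> (of_real t)) < q"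
    using \<Phi>(1) unfolding continuous_at_eps_delta by blast
  then obtain d where d: "0 < d" "\<And>z. dist z (of_real t) < d \<Longrightarrow> dist (\<Psi> z) (of_real (\<psi> t)) < q"
    using \<Psi>(1) \<Psi>(3)[of t] by auto
  let ?e = "min d r"
  have "(\<Phi> \<circ> \<Psi>) holomorphic_on ball (of_real t) ?e"
    by (rule holomorphic_on_compose_gen[OF _ \<Phi>(2)])
      (use \<Psi>(2) d in \<open>auto intro: holomorphic_on_subset simp: dist_commute\<close>)
  moreover have "(\<Phi> \<circ> \<Psi>) (of_real s) = of_real (\<phi> (\<psi> s))" if "\<bar>s - t\<bar> < ?e" for s
  proof -
    have "dist (complex_of_real s) (of_real t) < d" using that by (simp add: dist_norm flip: of_real_diff)
    then have "dist (\<Psi> (of_real s)) (of_real (\<psi> t)) < q" by (rule d(2))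
    then have "\<bar>\<psi> s - \<psi> t\<bar> < q" using \<Psi>(3)[of s] that by (simp add: dist_real_def)
    then show ?thesis using \<Phi>(3) \<Psi>(3)[of s] that by simp
  qed
  ultimately show ?thesis unfolding analytic1_def using d(1) \<Psi>(1)
    by (intro exI[of _ "\<Phi> \<circ> \<Psi>"] exI[of _ ?e]) auto
qed

lemma analytic1_inverse: "(t :: real) \<noteq> 0 \<Longrightarrow> analytic1 inverse t"
  unfolding analytic1_def
  by (intro exI[of _ inverse] exI[of _ "\<bar>t\<bar>"]) (auto intro!: holomorphic_intros simp: dist_norm)

lemma analytic1_divide:
  assumes "analytic1 \<phi> t" "analytic1 \<psi> t" "\<psi> t \<noteq> 0" shows "analytic1 (\<lambda>s. \<phi> s / \<psi> s) t"
  unfolding divide_inverse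
  by (rule analytic1_mult[OF assms(1) analytic1_compose[OF assms(2) analytic1_inverse[OF assms(3)]]])

lemma analytic1_exp: "analytic1 exp t"
  unfolding analytic1_def
  by (intro exI[of _ exp] exI[of _ 1]) (auto intro!: holomorphic_intros simp: exp_of_real)

lemma analytic1_deriv_extension:
  assumes \<Phi>: "\<Phi> holomorphic_on ball (complex_of_real t) r" "\<And>s. \<bar>s - t\<bar> < r \<Longrightarrow> \<Phi> (of_real s) = of_real (\<phi> s)"
    and s: "\<bar>s - t\<bar> < r"
  shows "(\<phi> has_real_derivative Re (deriv \<Phi> (of_real s))) (at s)" "deriv \<Phi> (of_real s) = of_real (Re (deriv \<Phi> (of_real s)))"
proof -
  have "complex_of_real s \<in> ball (of_real t) r" using s by (simp add: dist_norm norm_minus_commute flip: of_real_diff)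
  then have "(\<Phi> has_field_derivative deriv \<Phi> (of_real s)) (at (of_real s))"
    using \<Phi>(1) by (meson holomorphic_derivI open_ball)
  then have "((\<lambda>x. \<Phi> (of_real x)) has_vector_derivative deriv \<Phi> (of_real s)) (at s)"
    by (rule has_vector_derivative_real_field)
  then have D: "((\<lambda>x. complex_of_real (\<phi> x)) has_vector_derivative deriv \<Phi> (of_real s)) (at s)"
    by (rule has_vector_derivative_transform_within_open[where S = "{t - r<..<t + r}"]) (use s \<Phi>(2) in auto)
  from has_field_derivative_Re[OF D] show "(\<phi> has_real_derivative Re (deriv \<Phi> (of_real s))) (at s)" by simp
  from has_field_derivative_Im[OF D] have "((\<lambda>x. 0 :: real) has_real_derivative Im (deriv \<Phi> (of_real s))) (at s)" by simp
  then have "Im (deriv \<Phi> (of_real s)) = 0" using DERIV_unique DERIV_const by blast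
  then show "deriv \<Phi> (of_real s) = of_real (Re (deriv \<Phi> (of_real s)))" by (simp add: complex_eq_iff)
qed

lemma analytic1_deriv:
  assumes "analytic1 \<phi> t"
  shows "analytic1 (deriv \<phi>) t" "\<forall>\<^sub>F s in nhds t. (\<phi> has_real_derivative deriv \<phi> s) (at s)"
proof -
  obtain \<Phi> r where \<Phi>: "0 < r" "\<Phi> holomorphic_on ball (of_real t) r" "\<And>s. \<bar>s - t\<bar> < r \<Longrightarrow> \<Phi> (of_real s) = of_real (\<phi> s)"
    using assms unfolding analytic1_def by blast
  have D: "(\<phi> has_real_derivative Re (deriv \<Phi> (of_real s))) (at s)"
    "deriv \<Phi> (of_real s) = of_real (Re (deriv \<Phi> (of_real s)))" if "\<bar>s - t\<bar> < r" for s
    using analytic1_deriv_extension[OF \<Phi>(2,3) that] by auto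
  have eq: "Re (deriv \<Phi> (of_real s)) = deriv \<phi> s" if "\<bar>s - t\<bar> < r" for s
    using DERIV_imp_deriv[OF D(1)[OF that]] by simp
  show "analytic1 (deriv \<phi>) t" unfolding analytic1_def
    using \<Phi> D(2) eq by (intro exI[of _ "deriv \<Phi>"] exI[of _ r]) (auto intro!: holomorphic_deriv)
  show "\<forall>\<^sub>F s in nhds t. (\<phi> has_real_derivative deriv \<phi> s) (at s)"
    unfolding eventually_nhds_real using \<Phi>(1) D(1) eq by (intro exI[of _ r]) auto
qed

lemma analytic1_DERIV: "analytic1 \<phi> t \<Longrightarrow> (\<phi> has_real_derivative deriv \<phi> t) (at t)"
  using analytic1_deriv(2) eventually_nhds_x_imp_x by blast

lemma analytic1_isCont: "analytic1 \<phi> t \<Longrightarrow> isCont \<phi> t"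
  using analytic1_DERIV DERIV_isCont by blast

lemma analytic1_eventually:
  assumes "analytic1 \<phi> t" shows "\<forall>\<^sub>F s in nhds t. analytic1 \<phi> s"
proof -
  obtain \<Phi> r where \<Phi>: "0 < r" "\<Phi> holomorphic_on ball (of_real t) r" "\<And>s. \<bar>s - t\<bar> < r \<Longrightarrow> \<Phi> (of_real s) = of_real (\<phi> s)"
    using assms unfolding analytic1_def by blast
  show ?thesis unfolding eventually_nhds_real
  proof (intro exI[of _ r] conjI allI impI)
    fix s assume s: "\<bar>s - t\<bar> < r"
    have sub: "ball (complex_of_real s) (r - \<bar>s - t\<bar>) \<subseteq> ball (of_real t) r"
    proof
      fix w assume "w \<in> ball (complex_of_real s) (r - \<bar>s - t\<bar>)"
      moreover have "dist (complex_of_real t) (of_real s) = \<bar>s - t\<bar>"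
        by (simp add: dist_norm abs_minus_commute flip: of_real_diff)
      ultimately show "w \<in> ball (complex_of_real t) r"
        using dist_triangle[of "complex_of_real t" w "of_real s"] by simp
    qed
    show "analytic1 \<phi> s" unfolding analytic1_def
      using s holomorphic_on_subset[OF \<Phi>(2) sub] \<Phi>(3)
      by (intro exI[of _ \<Phi>] exI[of _ "r - \<bar>s - t\<bar>"]) auto
  qed (rule \<Phi>(1))
qed

text \<open>A primitive of the holomorphic extension differs from \<open>H\<close> by a constant on
  the real interval; subtracting it gives the extension of \<open>H\<close>.\<close>

lemma analytic1_antiderivative_local:
  assumes \<phi>: "analytic1 \<phi> t" and H: "\<forall>\<^sub>F s in nhds t. (H has_real_derivative \<phi> s) (at s)"
  shows "analytic1 H t"
proof -
  obtain \<Phi> r where \<Phi>: "0 < r" "\<Phi> holomorphic_on ball (of_real t) r" "\<And>s. \<bar>s - t\<bar> < r \<Longrightarrow> \<Phi> (of_real s) = of_real (\<phi> s)"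
    using \<phi> unfolding analytic1_def by blast
  obtain e where e: "0 < e" "\<And>s. \<bar>s - t\<bar> < e \<Longrightarrow> (H has_real_derivative \<phi> s) (at s)"
    using H unfolding eventually_nhds_real by blast
  obtain \<Psi> where \<Psi>: "\<And>z. z \<in> ball (of_real t) r \<Longrightarrow> (\<Psi> has_field_derivative \<Phi> z) (at z within ball (of_real t) r)"
    using holomorphic_convex_primitive'[OF convex_ball open_ball \<Phi>(2)] by blast
  let ?d = "min e r"
  have D: "((\<lambda>x. \<Psi> (of_real x) - of_real (H x)) has_vector_derivative 0) (at s within {t - ?d<..<t + ?d})"
    if s: "s \<in> {t - ?d<..<t + ?d}" for s
  proof -
    have s': "\<bar>s - t\<bar> < r" "\<bar>s - t\<bar> < e" using s by auto
    then have b: "complex_of_real s \<in> ball (of_real t) r" by (simp add: dist_norm norm_minus_commute flip: of_real_diff)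
    have "(\<Psi> has_field_derivative \<Phi> (of_real s)) (at (of_real s))" using \<Psi>[OF b] unfolding at_within_open[OF b open_ball] .
    then have 1: "((\<lambda>x. \<Psi> (of_real x)) has_vector_derivative of_real (\<phi> s)) (at s)"
      unfolding \<Phi>(3)[OF s'(1), symmetric] by (rule has_vector_derivative_real_field)
    have 2: "((\<lambda>x. complex_of_real (H x)) has_vector_derivative of_real (\<phi> s)) (at s)"
      using e(2)[OF s'(2)] by (rule has_vector_derivative_of_real)
    show ?thesis using has_vector_derivative_diff[OF 1 2] by (simp add: has_vector_derivative_at_within)
  qed
  have "\<exists>k. \<forall>s\<in>{t - ?d<..<t + ?d}. \<Psi> (of_real s) - of_real (H s) = k"
    using has_vector_derivative_zero_constant[OF convex_real_interval(8) D] by metis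
  then obtain k where k: "\<And>s. s \<in> {t - ?d<..<t + ?d} \<Longrightarrow> \<Psi> (of_real s) - of_real (H s) = k" by blast
  have "(\<lambda>z. \<Psi> z - k) holomorphic_on ball (of_real t) ?d"
  proof -
    have "\<Psi> holomorphic_on ball (of_real t) r" 
      unfolding holomorphic_on_def field_differentiable_def using \<Psi> by blast
    then show ?thesis by (intro holomorphic_intros) (auto elim: holomorphic_on_subset)
  qed
  moreover have "\<Psi> (of_real s) - k = of_real (H s)" if "\<bar>s - t\<bar> < ?d" for s
  proof -
    have "s \<in> {t - ?d<..<t + ?d}" using that unfolding abs_less_iff greaterThanLessThan_iff by linarith
    from k[OF this] show ?thesis by (simp add: algebra_simps)
  qed
  ultimately show ?thesis unfolding analytic1_def using e(1) \<Phi>(1)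
    by (intro exI[of _ "\<lambda>z. \<Psi> z - k"] exI[of _ ?d]) auto
qed

lemma analytic1_antiderivative:
  fixes J :: "real set"
  assumes J: "open J" "connected J" and \<phi>: "\<And>t. t \<in> J \<Longrightarrow> analytic1 \<phi> t"
  shows "\<exists>H. \<forall>t\<in>J. (H has_real_derivative \<phi> t) (at t) \<and> analytic1 H t"
proof (cases "J = {}")
  case False
  then obtain t0 where t0: "t0 \<in> J" by blast
  define H where "H t = (if t0 \<le> t then integral {t0..t} \<phi> else - integral {t..t0} \<phi>)" for t
  have cont: "continuous_on J \<phi>" using \<phi> analytic1_isCont by (simp add: continuous_at_imp_continuous_on)
  have sub: "{a..b} \<subseteq> J" if "a \<in> J" "b \<in> J" for a b
    using that J(2) by (meson connected_contains_Icc)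
  have int: "\<phi> integrable_on {a..b}" if "a \<in> J" "b \<in> J" for a b
    using cont sub[OF that] by (intro integrable_continuous_interval) (rule continuous_on_subset)
  have D: "(H has_real_derivative \<phi> t) (at t)" if t: "t \<in> J" for t
  proof -
    obtain e where e: "0 < e" "cball t e \<subseteq> J" using J(1) t open_contains_cball by blast
    \<comment> \<open>The interval from \<open>a\<close> to \<open>b\<close> contains
      \<open>t0\<close> and a neighbourhood of \<open>t\<close>. Near \<open>t\<close> the function
      \<open>H\<close> thus differs by a constant from the integral starting at \<open>a\<close>,
      whatever the order of \<open>t\<close> and \<open>t0\<close>.\<close>
    define a where "a = min t0 (t - e)"
    define b where "b = max t0 (t + e)"
    have ab: "a \<in> J" "b \<in> J" using e t0 by (auto simp: a_def b_def min_def max_def subset_iff dist_real_def)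
    have "((\<lambda>u. integral {a..u} \<phi>) has_real_derivative \<phi> t) (at t within {a..b})"
      using continuous_on_subset[OF cont sub[OF ab]] e(1)
      by (intro integral_has_real_derivative) (auto simp: a_def b_def)
    moreover have "at t within {a..b} = at t"
      using e(1) by (intro at_within_interior) (auto simp: a_def b_def interior_atLeastAtMost_real)
    ultimately have 1: "((\<lambda>u. integral {a..u} \<phi> - integral {a..t0} \<phi>) has_real_derivative \<phi> t) (at t)"
      by (auto intro!: derivative_eq_intros)
    have "\<forall>\<^sub>F u in nhds t. integral {a..u} \<phi> - integral {a..t0} \<phi> = H u"
      unfolding eventually_nhds_real
    proof (intro exI[of _ e] conjI allI impI)
      fix u assume u: "\<bar>u - t\<bar> < e"
      then have uJ: "u \<in> J" using e(2) by (auto simp: subset_iff dist_real_def abs_minus_commute)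
      have au: "a \<le> u" "a \<le> t0" using u by (auto simp: a_def)
      show "integral {a..u} \<phi> - integral {a..t0} \<phi> = H u"
      proof (cases "t0 \<le> u")
        case True
        then show ?thesis using Henstock_Kurzweil_Integration.integral_combine[of a t0 u \<phi>] au int[OF ab(1) uJ] by (simp add: H_def)
      next
        case False
        then show ?thesis using Henstock_Kurzweil_Integration.integral_combine[of a u t0 \<phi>] au int[OF ab(1) t0] by (simp add: H_def)
      qed
    qed (rule e(1))
    then show ?thesis using 1 by (subst (asm) DERIV_cong_ev[OF refl _ refl]) auto
  qed
  moreover have "analytic1 H t" if "t \<in> J" for t
  proof (rule analytic1_antiderivative_local[OF \<phi>[OF that]])
    show "\<forall>\<^sub>F s in nhds t. (H has_real_derivative \<phi> s) (at s)"
      using eventually_nhds_in_open[OF J(1) that] by eventually_elim (rule D)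
  qed
  ultimately show ?thesis by blast
qed simp

text \<open>The holomorphic extension is locally injective with holomorphic inverse. That inverse is
  real on the image of the real interval, which is a neighbourhood of \<open>h t\<close> by
  invariance of domain.\<close>

lemma analytic1_inverse_function:
  assumes h: "analytic1 h t" and d: "deriv h t \<noteq> 0"
  obtains \<psi> where "analytic1 \<psi> (h t)" "\<psi> (h t) = t"
    "\<forall>\<^sub>F s in nhds (h t). h (\<psi> s) = s" "\<forall>\<^sub>F s in nhds t. \<psi> (h s) = s"
proof -
  obtain \<Phi> r where \<Phi>: "0 < r" "\<Phi> holomorphic_on ball (of_real t) r" "\<And>s. \<bar>s - t\<bar> < r \<Longrightarrow> \<Phi> (of_real s) = of_real (h s)"
    using h unfolding analytic1_def by blast
  have "(h has_real_derivative Re (deriv \<Phi> (of_real t))) (at t)"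
    using analytic1_deriv_extension(1)[OF \<Phi>(2,3), of t] \<Phi>(1) by simp
  then have nz: "deriv \<Phi> (of_real t) \<noteq> 0" using d by (auto simp: DERIV_imp_deriv)
  obtain q where q: "0 < q" "ball (complex_of_real t) q \<subseteq> ball (of_real t) r" "inj_on \<Phi> (ball (of_real t) q)"
    by (rule has_complex_derivative_locally_injective[OF \<Phi>(2) _ open_ball nz]) (use \<Phi>(1) in auto)
  have hol: "\<Phi> holomorphic_on ball (of_real t) q" using \<Phi>(2) q(2) by (rule holomorphic_on_subset)
  obtain g where g: "g holomorphic_on \<Phi> ` ball (of_real t) q" "\<And>z. z \<in> ball (of_real t) q \<Longrightarrow> g (\<Phi> z) = z"
    using holomorphic_has_inverse[OF hol open_ball q(3)] by metis
  have op: "open (\<Phi> ` ball (of_real t) q)" by (rule open_mapping_thm3[OF hol open_ball q(3)])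
  let ?I = "ball t (min q r)"
  have inI: "complex_of_real s \<in> ball (of_real t) q" "\<bar>s - t\<bar> < r" if "s \<in> ?I" for s
    using that by (auto simp: dist_norm norm_minus_commute simp flip: of_real_diff)
  have inj: "inj_on h ?I"
  proof (rule inj_onI)
    fix s s' assume s: "s \<in> ?I" "s' \<in> ?I" "h s = h s'"
    then have "\<Phi> (of_real s) = \<Phi> (of_real s')" using \<Phi>(3) inI(2) by simp
    then show "s = s'" using inj_onD[OF q(3)] inI(1) s by force
  qed
  have "continuous_on ?I h"
  proof (rule continuous_at_imp_continuous_on, rule ballI)
    fix s assume "s \<in> ?I"
    then show "isCont h s" using analytic1_deriv_extension(1)[OF \<Phi>(2,3) inI(2)] DERIV_isCont by blast
  qed
  then have opI: "open (h ` ?I)" by (rule invariance_of_domain[OF _ open_ball inj])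
  have tI: "t \<in> ?I" using q(1) \<Phi>(1) by simp
  define \<psi> where "\<psi> s = Re (g (of_real s))" for s
  have \<psi>h: "\<psi> (h s) = s" if "s \<in> ?I" for s
    using g(2)[OF inI(1)[OF that]] \<Phi>(3)[OF inI(2)[OF that]] by (simp add: \<psi>_def)
  have "\<forall>\<^sub>F s in nhds (h t). s \<in> h ` ?I" using opI tI by (intro eventually_nhds_in_open) auto
  then have h\<psi>: "\<forall>\<^sub>F s in nhds (h t). h (\<psi> s) = s"
    by eventually_elim (use \<psi>h in auto)
  have "\<exists>e1>0. ball (complex_of_real (h t)) e1 \<subseteq> \<Phi> ` ball (of_real t) q"
    using op inI(1)[OF tI] \<Phi>(3)[OF inI(2)[OF tI]] by (metis image_eqI open_contains_ball)
  then obtain e1 where e1: "0 < e1" "ball (complex_of_real (h t)) e1 \<subseteq> \<Phi> ` ball (of_real t) q" by blast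
  obtain e2 where e2: "0 < e2" "ball (h t) e2 \<subseteq> h ` ?I" using opI tI by (metis image_eqI open_contains_ball)
  have "analytic1 \<psi> (h t)" unfolding analytic1_def
  proof (intro exI[of _ g] exI[of _ "min e1 e2"] conjI allI impI)
    show "g holomorphic_on ball (complex_of_real (h t)) (min e1 e2)"
      by (rule holomorphic_on_subset[OF g(1)]) (use e1(2) in auto)
    fix s assume "\<bar>s - h t\<bar> < min e1 e2"
    then have "s \<in> h ` ?I" using e2(2) by (auto simp: subset_iff dist_real_def abs_minus_commute)
    then obtain u where u: "u \<in> ?I" "s = h u" by blast
    then show "g (complex_of_real s) = complex_of_real (\<psi> s)"
      using g(2)[OF inI(1)[OF u(1)]] \<Phi>(3)[OF inI(2)[OF u(1)]] by (simp add: \<psi>_def)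
  qed (use e1 e2 in simp)
  moreover have "\<forall>\<^sub>F s in nhds t. \<psi> (h s) = s"
    using eventually_nhds_in_open[OF open_ball tI] by eventually_elim (rule \<psi>h)
  ultimately show ?thesis using that[of \<psi>] h\<psi> \<psi>h[OF tI] by simp
qed

lemma analytic1_zero_near:
  assumes "analytic1 \<phi> t" "t islimpt {s. \<phi> s = 0}"
  shows "\<forall>\<^sub>F s in nhds t. \<phi> s = 0"
proof -
  obtain \<Phi> r where \<Phi>: "0 < r" "\<Phi> holomorphic_on ball (of_real t) r" "\<And>s. \<bar>s - t\<bar> < r \<Longrightarrow> \<Phi> (of_real s) = of_real (\<phi> s)"
    using assms(1) unfolding analytic1_def by blast
  let ?U = "of_real ` {s. \<bar>s - t\<bar> < r \<and> \<phi> s = 0} :: complex set"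
  have in_ball: "complex_of_real s \<in> ball (of_real t) r \<longleftrightarrow> \<bar>s - t\<bar> < r" for s
    by (simp add: dist_real_def abs_minus_commute)
  have "complex_of_real t islimpt ?U"
    unfolding islimpt_approachable
  proof (intro allI impI)
    fix e :: real assume "0 < e"
    then obtain s where "\<phi> s = 0" "s \<noteq> t" "dist s t < min e r"
      using assms(2)[unfolded islimpt_approachable, rule_format, of "min e r"] \<Phi>(1) by auto
    then show "\<exists>x'\<in>?U. x' \<noteq> complex_of_real t \<and> dist x' (complex_of_real t) < e"
      by (intro bexI[of _ "of_real s"]) (auto simp: dist_norm simp flip: of_real_diff)
  qed
  then have "\<Phi> z = 0" if "z \<in> ball (of_real t) r" for z
    using that \<Phi> in_ball
    by (intro analytic_continuation[OF \<Phi>(2) open_ball connected_ball, of ?U "of_real t" z]) auto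
  then have "\<phi> s = 0" if "\<bar>s - t\<bar> < r" for s using that in_ball \<Phi>(3)[OF that] by simp
  then show ?thesis unfolding eventually_nhds_real using \<Phi>(1) by blast
qed

text \<open>The points near which the function vanishes identically form a set that is open and
  closed in \<open>J\<close>.\<close>

lemma analytic1_identity:
  assumes J: "connected J" and \<phi>: "\<And>t. t \<in> J \<Longrightarrow> analytic1 \<phi> t"
    and t0: "t0 \<in> J" "t0 islimpt {s. \<phi> s = 0}" and t: "t \<in> J"
  shows "\<phi> t = 0"
proof -
  let ?Z = "{t. \<forall>\<^sub>F s in nhds t. \<phi> s = 0}"
  have op: "open ?Z"
    unfolding open_dist
  proof safe
    fix t assume "\<forall>\<^sub>F s in nhds t. \<phi> s = 0"
    then have "\<forall>\<^sub>F s in nhds t. \<forall>\<^sub>F x in nhds s. \<phi> x = 0" by (simp add: eventually_eventually)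
    then show "\<exists>e>0. \<forall>y. dist y t < e \<longrightarrow> y \<in> ?Z" unfolding eventually_nhds_metric by simp
  qed
  have "openin (top_of_set J) (J \<inter> ?Z)" using op by (simp add: openin_open_Int)
  moreover have "closedin (top_of_set J) (J \<inter> ?Z)"
    unfolding closedin_limpt
  proof (intro conjI allI impI)
    fix x assume x: "x islimpt J \<inter> ?Z \<and> x \<in> J"
    have "J \<inter> ?Z \<subseteq> {s. \<phi> s = 0}" by (auto dest: eventually_nhds_x_imp_x)
    then have "x islimpt {s. \<phi> s = 0}" using x islimpt_subset by blast
    then show "x \<in> J \<inter> ?Z" using analytic1_zero_near[OF \<phi>] x by blast
  qed simp
  moreover have "t0 \<in> J \<inter> ?Z" using t0 analytic1_zero_near[OF \<phi>] by blast
  ultimately have "J \<inter> ?Z = J" using J unfolding connected_clopen by blast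
  then have "t \<in> ?Z" using t by blast
  then show ?thesis by (auto dest: eventually_nhds_x_imp_x)
qed

text \<open>The Taylor coefficients of the extension are replaced by their real parts. On the line a
  multi-index is its value at the only basis vector 1.\<close>

lemma real_analytic_on_if_analytic1:
  assumes "\<And>t. t \<in> S \<Longrightarrow> analytic1 h t" shows "real_analytic_on h S"
  unfolding real_analytic_on_def
proof
  fix t assume "t \<in> S"
  then obtain \<Phi> r where \<Phi>: "0 < r" "\<Phi> holomorphic_on ball (of_real t) r" "\<And>s. \<bar>s - t\<bar> < r \<Longrightarrow> \<Phi> (of_real s) = of_real (h s)"
    using assms unfolding analytic1_def by blast
  define a where "a n = (deriv ^^ n) \<Phi> (of_real t) / fact n" for n
  have sums: "(\<lambda>n. a n * (w - of_real t) ^ n) sums \<Phi> w" if "w \<in> ball (of_real t) r" for w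
    unfolding a_def using holomorphic_power_series[OF \<Phi>(2) that] .
  have bij: "bij_betw (\<lambda>n. (\<lambda>b\<in>{1 :: real}. n)) UNIV ((Basis :: real set) \<rightarrow>\<^sub>E (UNIV :: nat set))"
  proof (rule bij_betw_byWitness[where f' = "\<lambda>m. m 1"])
    show "\<forall>m\<in>(Basis :: real set) \<rightarrow>\<^sub>E (UNIV :: nat set). (\<lambda>b\<in>{1 :: real}. m 1) = m"
    proof (intro ballI ext)
      fix m :: "real \<Rightarrow> nat" and b :: real assume m: "m \<in> Basis \<rightarrow>\<^sub>E UNIV"
      show "(\<lambda>b\<in>{1 :: real}. m 1) b = m b"
        using PiE_arb[OF m, of b] by (cases "b = 1") simp_all
    qed
    show "(\<lambda>n. \<lambda>b\<in>{1 :: real}. n) ` UNIV \<subseteq> (Basis :: real set) \<rightarrow>\<^sub>E (UNIV :: nat set)"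
      by (intro image_subsetI PiE_I) simp_all
  qed simp_all
  show "\<exists>r>0. \<exists>c. \<forall>x\<in>ball t r. ((\<lambda>m. c m * (\<Prod>b\<in>Basis. ((x - t) \<bullet> b) ^ m b)) has_sum h x) (Basis \<rightarrow>\<^sub>E UNIV)"
  proof (intro exI[of _ r] conjI \<Phi>(1) exI[of _ "\<lambda>m. Re (a (m 1))"] ballI)
    fix x assume x: "x \<in> ball t r"
    have x': "\<bar>x - t\<bar> < r" using x by (simp add: dist_real_def abs_minus_commute)
    define u where "u = (\<bar>x - t\<bar> + r) / 2"
    have u: "\<bar>x - t\<bar> < u" "u < r" using x' by (auto simp: u_def)
    have "complex_of_real (t + u) \<in> ball (of_real t) r" using u by (simp add: dist_norm)
    from sums[OF this] have "summable (\<lambda>n. a n * of_real u ^ n)" by (simp add: sums_iff)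
    then have "summable (\<lambda>n. norm (a n * of_real (x - t) ^ n))"
      by (rule powser_insidea) (use u in \<open>simp del: of_real_diff\<close>)
    then have S: "summable (\<lambda>n. norm (Re (a n) * (x - t) ^ n))"
      by (rule summable_comparison_test'[of _ 0]) (auto simp: norm_mult norm_power abs_mult power_abs simp del: of_real_diff intro!: mult_right_mono abs_Re_le_cmod)
    have "complex_of_real x \<in> ball (of_real t) r" using x' by (simp add: dist_norm norm_minus_commute flip: of_real_diff)
    from sums_Re[OF sums[OF this]] have "(\<lambda>n. Re (a n) * (x - t) ^ n) sums h x"
      using \<Phi>(3)[OF x'] by (simp flip: of_real_diff of_real_power)
    then have "((\<lambda>n. Re (a n) * (x - t) ^ n) has_sum h x) UNIV"
      using S by (intro norm_summable_imp_has_sum) auto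
    then have "((\<lambda>n. Re (a ((\<lambda>b\<in>{1 :: real}. n) 1)) * (\<Prod>b\<in>Basis. ((x - t) \<bullet> b) ^ (\<lambda>b\<in>{1 :: real}. n) b)) has_sum h x) UNIV"
      by simp
    then show "((\<lambda>m. Re (a (m 1)) * (\<Prod>b\<in>Basis. ((x - t) \<bullet> b) ^ m b)) has_sum h x) (Basis \<rightarrow>\<^sub>E UNIV)"
      by (rule has_sum_reindex_bij_betw[OF bij, THEN iffD1])
  qed
qed

subsection \<open>Special forms\<close>

lemma connected_real_Int:
  fixes I J :: "real set"
  assumes "connected I" "connected J" shows "connected (I \<inter> J)"
  using assms by (simp add: is_interval_Int flip: is_interval_connected_1)

text \<open>The germ of \<open>g\<close> at one point is continued along the line as far as possible. Since the line is
  simply connected, the continuation is single-valued although the fibres of \<open>w\<close> in \<open>U\<close> may be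
  disconnected.\<close>

lemma function_of_analytic_coordinate:
  fixes w \<phi> :: "real \<times> real \<times> real \<Rightarrow> real"
  assumes U: "open U" "connected U" and w: "continuous_on U w"
    and nonconst: "\<And>p e. 0 < e \<Longrightarrow> ball p e \<subseteq> U \<Longrightarrow> \<exists>q\<in>ball p e. w q \<noteq> w p"
    and local: "\<And>p. p \<in> U \<Longrightarrow> \<exists>g. analytic1 g (w p) \<and> (\<forall>\<^sub>F q in nhds p. \<phi> q = g (w q))"
  shows "\<exists>g. \<forall>p\<in>U. analytic1 g (w p) \<and> \<phi> p = g (w p)"
proof (cases "U = {}")
  case False
  then obtain p0 where p0: "p0 \<in> U" by blast
  define x0 where "x0 = w p0"
  obtain g0 where g0: "analytic1 g0 x0" "\<forall>\<^sub>F q in nhds p0. \<phi> q = g0 (w q)"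
    using local[OF p0] unfolding x0_def by blast
  have wcont: "isCont w p" if "p \<in> U" for p
    using w U(1) that by (simp add: continuous_on_eq_continuous_at)
  have near: "\<forall>\<^sub>F q in nhds p. w q \<in> J" if "p \<in> U" "open J" "w p \<in> J" for p J
  proof -
    have "\<forall>\<^sub>F q in at p. w q \<in> J" using wcont[OF that(1)] that(2,3) unfolding isCont_def by (rule topological_tendstoD)
    then show ?thesis using that(3) by (simp add: eventually_nhds_conv_at)
  qed
  \<comment> \<open>All continuations of the germ of \<open>g0\<close> to open intervals around
    \<open>x0\<close>.\<close>
  define \<C> where "\<C> = {(J, g). open J \<and> connected J \<and> x0 \<in> J \<and> (\<forall>t\<in>J. analytic1 g t) \<and> (\<forall>\<^sub>F s in nhds x0. g s = g0 s)}"
  have agree: "g t = g' t" if C: "(J, g) \<in> \<C>" "(J', g') \<in> \<C>" and t: "t \<in> J" "t \<in> J'" for J g J' g' t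
  proof -
    have "\<forall>\<^sub>F s in nhds x0. g s - g' s = 0"
      using C by (auto simp: \<C>_def elim: eventually_elim2)
    then obtain T where T: "open T" "x0 \<in> T" "T \<subseteq> {s. g s - g' s = 0}" unfolding eventually_nhds by blast
    have "x0 islimpt T" using interior_limit_point[of x0 T] T(1,2) by (simp add: interior_open)
    then have "x0 islimpt {s. g s - g' s = 0}" using T(3) by (rule islimpt_subset)
    then have "g t - g' t = 0"
      using C t by (intro analytic1_identity[of "J \<inter> J'" "\<lambda>s. g s - g' s" x0 t])
        (auto simp: \<C>_def intro!: connected_real_Int analytic1_diff)
    then show ?thesis by simp
  qed
  \<comment> \<open>Since two continuations agree wherever both are defined, they glue to a largest
    one, \<open>G\<close> on \<open>Jm\<close>.\<close>
  define Jm where "Jm = \<Union> (fst ` \<C>)"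
  define G where "G t = snd (SOME c. c \<in> \<C> \<and> t \<in> fst c) t" for t
  have G: "G t = g t" if "(J, g) \<in> \<C>" "t \<in> J" for J g t
  proof -
    have "\<exists>c. c \<in> \<C> \<and> t \<in> fst c" using that by (intro exI[of _ "(J, g)"]) simp
    then have *: "(SOME c. c \<in> \<C> \<and> t \<in> fst c) \<in> \<C> \<and> t \<in> fst (SOME c. c \<in> \<C> \<and> t \<in> fst c)" by (rule someI_ex)
    obtain J' g' where c: "(SOME c. c \<in> \<C> \<and> t \<in> fst c) = (J', g')" by fastforce
    show ?thesis unfolding G_def c snd_conv using * that unfolding c by (intro agree[of J' g' J g t]) simp_all
  qed
  obtain e0 where e0: "0 < e0" "\<And>s. \<bar>s - x0\<bar> < e0 \<Longrightarrow> analytic1 g0 s"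
    using analytic1_eventually[OF g0(1)] unfolding eventually_nhds_real by blast
  have C0: "(ball x0 e0, g0) \<in> \<C>"
    unfolding \<C>_def using e0 by (auto simp: dist_real_def abs_minus_commute)
  have Gan: "analytic1 G t" if t: "t \<in> Jm" for t
  proof -
    obtain J g where Jg: "(J, g) \<in> \<C>" "t \<in> J" using t by (auto simp: Jm_def)
    have "\<forall>\<^sub>F s in nhds t. s \<in> J" using Jg by (intro eventually_nhds_in_open) (auto simp: \<C>_def)
    then have "\<forall>\<^sub>F s in nhds t. g s = G s" by eventually_elim (use G[OF Jg(1)] in simp)
    moreover have "analytic1 g t" using Jg by (auto simp: \<C>_def)
    ultimately show ?thesis using analytic1_cong by blast
  qed
  have CD: "open J" "connected J" "x0 \<in> J" if "J \<in> fst ` \<C>" for J using that by (auto simp: \<C>_def)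
  have Jm: "open Jm" "connected Jm" "x0 \<in> Jm"
  proof -
    show "open Jm" unfolding Jm_def using CD(1) by (rule open_Union[rule_format])
    have "x0 \<in> \<Inter> (fst ` \<C>)" using CD(3) by blast
    then show "connected Jm" unfolding Jm_def using CD(2) by (intro connected_Union) blast+
    have "fst (ball x0 e0, g0) \<in> fst ` \<C>" using C0 by (rule imageI)
    then show "x0 \<in> Jm" unfolding Jm_def using CD(3) by (intro UnionI)
  qed
  have G0: "\<forall>\<^sub>F s in nhds x0. G s = g0 s"
    using eventually_nhds_in_open[OF open_ball, of x0 x0 e0] e0(1) by (auto elim!: eventually_mono intro: G[OF C0])
  define W where "W = {p. w p \<in> Jm \<and> (\<forall>\<^sub>F q in nhds p. \<phi> q = G (w q))}"
  have "openin (top_of_set U) (U \<inter> W)"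
  proof -
    have "open (U \<inter> W)"
    proof (subst open_subopen, safe)
      fix p assume p: "p \<in> U" "p \<in> W"
      have "\<forall>\<^sub>F q in nhds p. w q \<in> Jm" using near[OF p(1) Jm(1)] p(2) by (simp add: W_def)
      moreover have "\<forall>\<^sub>F q in nhds p. \<forall>\<^sub>F r in nhds q. \<phi> r = G (w r)"
        using p(2) by (simp add: W_def eventually_eventually)
      moreover have "\<forall>\<^sub>F q in nhds p. q \<in> U" using eventually_nhds_in_open[OF U(1) p(1)] .
      ultimately have "\<forall>\<^sub>F q in nhds p. q \<in> U \<inter> W"
        by eventually_elim (simp add: W_def)
      then show "\<exists>T. open T \<and> p \<in> T \<and> T \<subseteq> U \<inter> W" unfolding eventually_nhds by blast
    qed
    then show ?thesis by (simp add: open_subset)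
  qed
  moreover have "closedin (top_of_set U) (U \<inter> W)"
    unfolding closedin_limpt
  proof (intro conjI allI impI)
    fix p assume p: "p islimpt U \<inter> W \<and> p \<in> U"
    obtain g where g: "analytic1 g (w p)" "\<forall>\<^sub>F q in nhds p. \<phi> q = g (w q)" using local p by blast
    obtain e where e: "0 < e" "\<And>s. \<bar>s - w p\<bar> < e \<Longrightarrow> analytic1 g s"
      using analytic1_eventually[OF g(1)] unfolding eventually_nhds_real by blast
    define N where "N = ball (w p) e"
    have N: "open N" "connected N" "w p \<in> N" "\<And>s. s \<in> N \<Longrightarrow> analytic1 g s"
      using e by (auto simp: N_def dist_real_def abs_minus_commute)
    have "\<forall>\<^sub>F q in nhds p. w q \<in> N" using near p N by blast
    then have "\<forall>\<^sub>F q in nhds p. \<phi> q = g (w q) \<and> w q \<in> N \<and> q \<in> U"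
      using g(2) eventually_nhds_in_open[OF U(1) conjunct2[OF p]] by (intro eventually_conj)
    then obtain V where V: "open V" "p \<in> V" "\<And>q. q \<in> V \<Longrightarrow> \<phi> q = g (w q) \<and> w q \<in> N \<and> q \<in> U"
      unfolding eventually_nhds by blast
    \<comment> \<open>Near \<open>p'\<close> both descriptions of \<phi> are valid. On a small ball
      there \<open>w\<close> is not constant and its values form a connected set, so
      \<open>G\<close> and \<open>g\<close> agree on a set with limit point
      \<open>w p'\<close>.\<close>
    obtain p' where p': "p' \<in> U" "p' \<in> W" "p' \<in> V"
      using p V unfolding islimpt_def by blast
    have "\<forall>\<^sub>F q in nhds p'. \<phi> q = G (w q) \<and> w q \<in> Jm \<and> q \<in> V"
      using p'(2) near[OF p'(1) Jm(1)] eventually_nhds_in_open[OF V(1) p'(3)]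
      by (intro eventually_conj) (simp_all add: W_def)
    then obtain d where d: "0 < d" "\<And>q. q \<in> ball p' d \<Longrightarrow> \<phi> q = G (w q) \<and> w q \<in> Jm \<and> q \<in> V"
      unfolding eventually_nhds_metric by (auto simp: dist_commute)
    have sub: "ball p' d \<subseteq> U" using d V by blast
    have conn: "connected (w ` ball p' d)"
      using w sub by (intro connected_continuous_image connected_ball) (rule continuous_on_subset)
    obtain q where q: "q \<in> ball p' d" "w q \<noteq> w p'" using nonconst[OF d(1) sub] by blast
    have "w p' islimpt w ` ball p' d"
    proof (rule connected_imp_perfect[OF conn])
      show p'': "w p' \<in> w ` ball p' d" using d(1) by simp
      have q': "w q \<in> w ` ball p' d" using q(1) by (rule imageI)
      show "w ` ball p' d \<noteq> {x}" for x using q' p'' q(2) by (metis singletonD)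
    qed
    moreover have "w ` ball p' d \<subseteq> {s. G s - g s = 0}"
    proof (intro image_subsetI CollectI)
      fix r assume "r \<in> ball p' d"
      then show "G (w r) - g (w r) = 0" using d(2)[of r] V(3)[of r] by simp
    qed
    ultimately have lim: "w p' islimpt {s. G s - g s = 0}" using islimpt_subset by blast
    have eq: "G s = g s" if "s \<in> Jm" "s \<in> N" for s
    proof -
      have "G s - g s = 0"
        using lim that d(1) d(2)[of p'] V(3)[OF p'(3)] N Jm Gan
        by (intro analytic1_identity[of "Jm \<inter> N" "\<lambda>s. G s - g s" "w p'" s])
          (auto intro!: connected_real_Int analytic1_diff)
      then show ?thesis by simp
    qed
    \<comment> \<open>Extending \<open>G\<close> by \<open>g\<close> over \<open>N\<close> gives a
      member of \<open>\<C>\<close>. Maximality of \<open>Jm\<close> then forces \<open>N\<close>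
      into \<open>Jm\<close>.\<close>
    define g' where "g' s = (if s \<in> Jm then G s else g s)" for s
    have "(Jm \<union> N, g') \<in> \<C>"
      unfolding \<C>_def
    proof (clarify, intro conjI ballI)
      show "open (Jm \<union> N)" using Jm N by blast
      show "connected (Jm \<union> N)" using Jm N d(1) d(2)[of p'] V(3)[OF p'(3)] by (intro connected_Un) auto
      show "x0 \<in> Jm \<union> N" using Jm by blast
      have 1: "\<forall>\<^sub>F s in nhds t. G s = g' s" if "t \<in> Jm" for t
        using eventually_nhds_in_open[OF Jm(1) that] by eventually_elim (simp add: g'_def)
      show "\<forall>\<^sub>F s in nhds x0. g' s = g0 s" using 1[OF Jm(3)] G0 by eventually_elim simp
      fix t assume "t \<in> Jm \<union> N"
      then show "analytic1 g' t"
      proof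
        assume t: "t \<in> Jm" then show ?thesis using analytic1_cong[OF Gan 1] by blast
      next
        assume t: "t \<in> N"
        have "\<forall>\<^sub>F s in nhds t. g s = g' s"
          using eventually_nhds_in_open[OF N(1) t] by eventually_elim (simp add: g'_def eq)
        then show ?thesis using analytic1_cong[OF N(4)[OF t]] by blast
      qed
    qed
    then have "N \<subseteq> Jm" by (force simp: Jm_def)
    then have "w p \<in> Jm" using N by blast
    moreover have "\<forall>\<^sub>F q in nhds p. \<phi> q = G (w q)"
      using eventually_nhds_in_open[OF V(1,2)] 
    proof eventually_elim
      case (elim q)
      then show ?case using V(3)[OF elim] eq[of "w q"] \<open>N \<subseteq> Jm\<close> by (simp add: subset_iff)
    qed
    ultimately show "p \<in> U \<inter> W" using p by (simp add: W_def)
  qed simp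
  moreover have "p0 \<in> U \<inter> W"
  proof -
    have "\<forall>\<^sub>F q in nhds p0. G (w q) = g0 (w q)"
    proof -
      have "\<forall>\<^sub>F q in nhds p0. w q \<in> ball x0 e0" using near[OF p0 open_ball] e0(1) by (simp add: x0_def)
      then show ?thesis by eventually_elim (rule G[OF C0])
    qed
    with g0(2) have "\<forall>\<^sub>F q in nhds p0. \<phi> q = G (w q)" by eventually_elim simp
    then show ?thesis using p0 Jm(3) by (simp add: W_def x0_def)
  qed
  ultimately have "U \<inter> W = U" using U(2) unfolding connected_clopen by blast
  then have "analytic1 G (w p) \<and> \<phi> p = G (w p)" if "p \<in> U" for p
    using that Gan by (auto simp: W_def dest: eventually_nhds_x_imp_x)
  then show ?thesis by blast
qed simp

text \<open>\<open>eq\<close> says that the \<open>z\<close>-derivative of a / b vanishes, so a / b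
  and its \<open>x\<close>-derivative do not depend on \<open>z\<close>. The difference of
  logarithmic derivatives is the quotient of these two.\<close>

lemma log_derivative_of_ratio:
  fixes a b ax az bx bz :: "real \<Rightarrow> real \<Rightarrow> real"
  assumes I: "open I" and K: "convex K"
    and D: "\<And>x z. x \<in> I \<Longrightarrow> z \<in> K \<Longrightarrow> ((\<lambda>x. a x z) has_real_derivative ax x z) (at x)"
      "\<And>x z. x \<in> I \<Longrightarrow> z \<in> K \<Longrightarrow> ((\<lambda>z. a x z) has_real_derivative az x z) (at z)"
      "\<And>x z. x \<in> I \<Longrightarrow> z \<in> K \<Longrightarrow> ((\<lambda>x. b x z) has_real_derivative bx x z) (at x)"
      "\<And>x z. x \<in> I \<Longrightarrow> z \<in> K \<Longrightarrow> ((\<lambda>z. b x z) has_real_derivative bz x z) (at z)"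
    and nz: "\<And>x z. x \<in> I \<Longrightarrow> z \<in> K \<Longrightarrow> a x z \<noteq> 0" "\<And>x z. x \<in> I \<Longrightarrow> z \<in> K \<Longrightarrow> b x z \<noteq> 0"
    and eq: "\<And>x z. x \<in> I \<Longrightarrow> z \<in> K \<Longrightarrow> b x z * az x z = a x z * bz x z"
    and x: "x \<in> I" and z: "z \<in> K" "z' \<in> K"
  shows "ax x z / a x z - bx x z / b x z = ax x z' / a x z' - bx x z' / b x z'"
proof -
  have R: "a x z / b x z = a x z' / b x z'" if x: "x \<in> I" for x
  proof -
    have "((\<lambda>z. a x z / b x z) has_real_derivative 0) (at z within K)" if "z \<in> K" for z
    proof -
      have "((\<lambda>z. a x z / b x z) has_real_derivative (az x z * b x z - a x z * bz x z) / (b x z * b x z)) (at z)"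
        by (rule DERIV_divide[OF D(2)[OF x that] D(4)[OF x that] nz(2)[OF x that]])
      then have "((\<lambda>z. a x z / b x z) has_real_derivative 0) (at z)"
        using eq[OF x that] by (simp add: mult.commute)
      then show ?thesis by (rule has_field_derivative_at_within)
    qed
    then have "\<exists>k. \<forall>z\<in>K. a x z / b x z = k" by (rule has_field_derivative_zero_constant[OF K])
    then show ?thesis using z by metis
  qed
  have Q: "((\<lambda>x. a x z / b x z) has_real_derivative (ax x z * b x z - a x z * bx x z) / (b x z * b x z)) (at x)" if "z \<in> K" for z
    by (rule DERIV_divide[OF D(1)[OF x that] D(3)[OF x that] nz(2)[OF x that]])
  have "\<forall>\<^sub>F t in nhds x. a t z / b t z = a t z' / b t z'"
    using eventually_nhds_in_open[OF I x] by eventually_elim (rule R)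
  then have "((\<lambda>x. a x z' / b x z') has_real_derivative (ax x z * b x z - a x z * bx x z) / (b x z * b x z)) (at x)"
    using Q[OF z(1)] by (subst (asm) DERIV_cong_ev[OF refl _ refl]) auto
  then have E: "(ax x z * b x z - a x z * bx x z) / (b x z * b x z) = (ax x z' * b x z' - a x z' * bx x z') / (b x z' * b x z')"
    using Q[OF z(2)] by (rule DERIV_unique)
  have F: "ax x z / a x z - bx x z / b x z = (ax x z * b x z - a x z * bx x z) / (b x z * b x z) / (a x z / b x z)" if "z \<in> K" for z
    using nz[OF x that] by (simp add: field_simps)
  show ?thesis unfolding F[OF z(1)] F[OF z(2)] E R[OF x] ..
qed

lemma open_real3_box:
  fixes U :: "(real \<times> real \<times> real) set"
  assumes "open U" "(x, y, z) \<in> U"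
  obtains e where "0 < e" "\<And>x' y' z'. \<bar>x' - x\<bar> < e \<Longrightarrow> \<bar>y' - y\<bar> < e \<Longrightarrow> \<bar>z' - z\<bar> < e \<Longrightarrow> (x', y', z') \<in> U"
proof -
  obtain r where r: "0 < r" "ball (x, y, z) r \<subseteq> U" using assms open_contains_ball by blast
  show ?thesis
  proof (rule that[of "r / 3"])
    fix x' y' z' assume *: "\<bar>x' - x\<bar> < r / 3" "\<bar>y' - y\<bar> < r / 3" "\<bar>z' - z\<bar> < r / 3"
    have "dist (x', y', z') (x, y, z) = norm (x' - x, y' - y, z' - z)" by (simp add: dist_norm)
    also have "\<dots> \<le> norm (x' - x) + norm (y' - y, z' - z)" by (rule norm_Pair_le)
    also have "\<dots> \<le> norm (x' - x) + (norm (y' - y) + norm (z' - z))" by (intro add_left_mono norm_Pair_le)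
    finally show "(x', y', z') \<in> U" using * r(2) by (auto simp: dist_commute)
  qed (use r in simp)
qed

lemma eventually_nhds_real3:
  fixes x y z :: real
  assumes "0 < e" "\<And>x' y' z'. \<bar>x' - x\<bar> < e \<Longrightarrow> \<bar>y' - y\<bar> < e \<Longrightarrow> \<bar>z' - z\<bar> < e \<Longrightarrow> P (x', y', z')"
  shows "\<forall>\<^sub>F q in nhds (x, y, z). P q"
  unfolding eventually_nhds
proof (intro exI[of _ "ball x e \<times> ball y e \<times> ball z e"] conjI ballI)
  show "open (ball x e \<times> ball y e \<times> ball z e)" by (intro open_Times open_ball)
qed (use assms in \<open>auto simp: dist_real_def abs_minus_commute\<close>)

lemma constant_if_partials_zero:
  fixes q :: "real \<times> real \<times> real \<Rightarrow> real"
  assumes U: "open U" "connected U"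
    and D: "\<And>x y z. (x, y, z) \<in> U \<Longrightarrow> ((\<lambda>t. q (t, y, z)) has_real_derivative 0) (at x)"
      "\<And>x y z. (x, y, z) \<in> U \<Longrightarrow> ((\<lambda>t. q (x, t, z)) has_real_derivative 0) (at y)"
      "\<And>x y z. (x, y, z) \<in> U \<Longrightarrow> ((\<lambda>t. q (x, y, t)) has_real_derivative 0) (at z)"
    and p: "p \<in> U" "p' \<in> U"
  shows "q p = q p'"
proof (rule connected_local_const[OF U(2) p], rule ballI)
  fix s assume s: "s \<in> U"
  obtain x y z where xyz: "s = (x, y, z)" by (cases s)
  obtain e where e: "0 < e" "\<And>x' y' z'. \<bar>x' - x\<bar> < e \<Longrightarrow> \<bar>y' - y\<bar> < e \<Longrightarrow> \<bar>z' - z\<bar> < e \<Longrightarrow> (x', y', z') \<in> U"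
    using open_real3_box[OF U(1) s[unfolded xyz]] by blast
  have const: "g u = g v" if "\<And>t. \<bar>t - c\<bar> < e \<Longrightarrow> (g has_real_derivative 0) (at t)" "\<bar>u - c\<bar> < e" "\<bar>v - c\<bar> < e"
    for g :: "real \<Rightarrow> real" and c u v
  proof -
    have "\<exists>k. \<forall>t\<in>ball c e. g t = k"
      using that(1) by (intro has_field_derivative_zero_constant) (auto simp: dist_real_def abs_minus_commute has_field_derivative_at_within)
    then show ?thesis using that(2,3) by (metis dist_commute dist_real_def mem_ball)
  qed
  have "q (x', y', z') = q s" if "\<bar>x' - x\<bar> < e" "\<bar>y' - y\<bar> < e" "\<bar>z' - z\<bar> < e" for x' y' z'
  proof -
    have "q (x', y', z') = q (x, y', z')"
      using that e by (intro const[of x "\<lambda>t. q (t, y', z')"] D) auto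
    also have "\<dots> = q (x, y, z')"
      using that e by (intro const[of y "\<lambda>t. q (x, t, z')"] D) auto
    also have "\<dots> = q (x, y, z)"
      using that e by (intro const[of z "\<lambda>t. q (x, y, t)"] D) auto
    finally show ?thesis by (simp add: xyz)
  qed
  then have "\<forall>\<^sub>F r in nhds s. q s = q r"
    unfolding xyz by (intro eventually_nhds_real3[OF e(1)]) (rule sym, blast)
  then show "\<forall>\<^sub>F r in at s within U. q s = q r"
    unfolding eventually_at_filter by (rule eventually_mono) simp
qed

section \<open>Separated gradients and permutations of the variables\<close>

lemma partial_comp_swap:
  "partial_x (g \<circ> swap_xy) = partial_y g \<circ> swap_xy" "partial_y (g \<circ> swap_xy) = partial_x g \<circ> swap_xy"
  "partial_z (g \<circ> swap_xy) = partial_z g \<circ> swap_xy"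
  "partial_x (g \<circ> swap_xz) = partial_z g \<circ> swap_xz" "partial_y (g \<circ> swap_xz) = partial_y g \<circ> swap_xz"
  "partial_z (g \<circ> swap_xz) = partial_x g \<circ> swap_xz"
  by (auto simp: fun_eq_iff partial_x_def partial_y_def partial_z_def)

lemma analytic3_swap:
  assumes "analytic3 f U"
  shows "analytic3 (f \<circ> swap_xy) (swap_xy ` U)" "analytic3 (f \<circ> swap_xz) (swap_xz ` U)"
proof -
  show "analytic3 (f \<circ> swap_xy) (swap_xy ` U)"
    unfolding analytic3_def
  proof (rule ballI, erule imageE)
    fix p q assume "p = swap_xy q" "q \<in> U"
    then obtain r c where "power_series_at f q r c" using assms unfolding analytic3_def by meson
    from power_series_at_swap_xy[OF this] show "\<exists>r c. power_series_at (f \<circ> swap_xy) p r c"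
      unfolding \<open>p = swap_xy q\<close> by (intro exI)
  qed
  show "analytic3 (f \<circ> swap_xz) (swap_xz ` U)"
    unfolding analytic3_def
  proof (rule ballI, erule imageE)
    fix p q assume "p = swap_xz q" "q \<in> U"
    then obtain r c where "power_series_at f q r c" using assms unfolding analytic3_def by meson
    from power_series_at_swap_xz[OF this] show "\<exists>r c. power_series_at (f \<circ> swap_xz) p r c"
      unfolding \<open>p = swap_xz q\<close> by (intro exI)
  qed
qed

text \<open>The three equations say that f_x / f_y, f_x / f_z and f_y / f_z do not depend on
  \<open>z\<close>, \<open>y\<close> and \<open>x\<close> respectively. The condition is symmetric
  in the variables, so that swaps preserve it.\<close>

definition separable :: "(real \<times> real \<times> real \<Rightarrow> real) \<Rightarrow> (real \<times> real \<times> real) set \<Rightarrow> bool" where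
  "separable f U \<longleftrightarrow> open U \<and> connected U \<and> analytic3 f U \<and>
     (\<forall>p\<in>U. partial_x f p \<noteq> 0 \<and> partial_y f p \<noteq> 0 \<and> partial_z f p \<noteq> 0 \<and>
       partial_y f p * partial_z (partial_x f) p = partial_x f p * partial_z (partial_y f) p \<and>
       partial_z f p * partial_y (partial_x f) p = partial_x f p * partial_y (partial_z f) p \<and>
       partial_z f p * partial_x (partial_y f) p = partial_y f p * partial_x (partial_z f) p)"

lemma separable_swap:
  assumes "separable f U"
  shows "separable (f \<circ> swap_xy) (swap_xy ` U)" "separable (f \<circ> swap_xz) (swap_xz ` U)"
proof -
  have cont: "continuous_on S swap_xy" "continuous_on S swap_xz" for S :: "(real \<times> real \<times> real) set"
    unfolding swap_xy_def swap_xz_def split_beta by (intro continuous_intros)+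
  have vim: "swap_xy ` U = swap_xy -` U" "swap_xz ` U = swap_xz -` U" by force+
  have op: "open (swap_xy ` U)" "open (swap_xz ` U)"
    unfolding vim using assms cont unfolding separable_def by (auto intro: open_vimage)
  have conn: "connected (swap_xy ` U)" "connected (swap_xz ` U)"
    using assms cont unfolding separable_def by (auto intro: connected_continuous_image)
  have "analytic3 f U" using assms unfolding separable_def by blast
  note analytic3_swap[OF this]
  then show "separable (f \<circ> swap_xy) (swap_xy ` U)" "separable (f \<circ> swap_xz) (swap_xz ` U)"
    using assms op conn unfolding separable_def by (simp_all add: partial_comp_swap)
qed

lemma analytic1_along_axes:
  assumes "analytic3 g U" "(x, y, z) \<in> U"
  shows "analytic1 (\<lambda>t. g (t, y, z)) x" "analytic1 (\<lambda>t. g (x, t, z)) y" "analytic1 (\<lambda>t. g (x, y, t)) z"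
  using analytic3_line[of g U "(0, y, z)" x "(1, 0, 0)"] analytic3_line[of g U "(x, 0, z)" y "(0, 1, 0)"]
    analytic3_line[of g U "(x, y, 0)" z "(0, 0, 1)"] assms by simp_all

text \<open>By separability the logarithmic derivative \<open>\<partial>\<^sub>x log (f\<^sub>x / f\<^sub>y) = \<partial>\<^sub>x log (f\<^sub>x / f\<^sub>z)\<close> depends
  locally only on \<open>x\<close>. Passing to logarithmic derivatives makes the separated factor single-valued
  on all of \<open>U\<close>.\<close>

lemma separable_factor:
  assumes "separable f U"
  shows "\<exists>h h1. \<forall>x y z. (x, y, z) \<in> U \<longrightarrow> analytic1 h x \<and> 0 < h1 x \<and> (h has_real_derivative h1 x) (at x) \<and>
    (h1 has_real_derivative h1 x * (partial_x (partial_x f) (x, y, z) / partial_x f (x, y, z)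
       - partial_y (partial_x f) (x, y, z) / partial_y f (x, y, z))) (at x)"
proof -
  note S = assms[unfolded separable_def]
  have U: "open U" "connected U" and f: "analytic3 f U" using S by auto
  have nz: "partial_x f p \<noteq> 0" "partial_y f p \<noteq> 0" "partial_z f p \<noteq> 0" if "p \<in> U" for p using S that by auto
  note an = analytic3_partials[OF f]
  have mix: "partial_x (partial_y f) p = partial_y (partial_x f) p" "partial_x (partial_z f) p = partial_z (partial_x f) p"
    if "p \<in> U" for p using analytic3_mixed[OF f that] by auto
  define \<phi> where "\<phi> p = partial_x (partial_x f) p / partial_x f p - partial_y (partial_x f) p / partial_y f p" for p
  have \<phi>y: "\<phi> p = partial_x (partial_x f) p / partial_x f p - partial_x (partial_y f) p / partial_y f p" if "p \<in> U" for p
    using mix[OF that] by (simp add: \<phi>_def)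
  \<comment> \<open>The third equation exchanges f_y for f_z, so \<phi> is the logarithmic
    derivative of f_x / f_z too. The first formula gives independence of \<open>z\<close>, the
    second independence of \<open>y\<close>.\<close>
  have \<phi>z: "\<phi> p = partial_x (partial_x f) p / partial_x f p - partial_x (partial_z f) p / partial_z f p" if "p \<in> U" for p
    using nz[OF that] S that by (simp add: \<phi>y field_simps)
  have "\<exists>g. \<forall>p\<in>U. analytic1 g (fst p) \<and> \<phi> p = g (fst p)"
  proof (rule function_of_analytic_coordinate[OF U])
    show "continuous_on U (fst :: real \<times> real \<times> real \<Rightarrow> real)" by (intro continuous_intros)
    show "\<exists>q\<in>ball p e. fst q \<noteq> fst p" if "0 < e" for p :: "real \<times> real \<times> real" and e
    proof (intro bexI)
      obtain x y z where p: "p = (x, y, z)" by (cases p)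
      show "(fst p + e / 2, snd p) \<in> ball p e" using that by (simp add: p dist_Pair_Pair dist_real_def)
    qed (use that in simp)
    fix p assume p: "p \<in> U"
    obtain x y z where xyz: "p = (x, y, z)" by (cases p)
    obtain e where e: "0 < e" "\<And>x' y' z'. \<bar>x' - x\<bar> < e \<Longrightarrow> \<bar>y' - y\<bar> < e \<Longrightarrow> \<bar>z' - z\<bar> < e \<Longrightarrow> (x', y', z') \<in> U"
      using open_real3_box[OF U(1) p[unfolded xyz]] by blast
    have local: "\<phi> (x', y', z') = \<phi> (x', y, z)" if q: "\<bar>x' - x\<bar> < e" "\<bar>y' - y\<bar> < e" "\<bar>z' - z\<bar> < e" for x' y' z'
    proof -
      have inU: "(u, v, w) \<in> U" if "u \<in> ball x e" "v \<in> ball y e" "w \<in> ball z e" for u v w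
        using e(2) that by (simp add: dist_real_def abs_minus_commute)
      have b: "x' \<in> ball x e" "y' \<in> ball y e" "z' \<in> ball z e" "y \<in> ball y e" "z \<in> ball z e"
        using q e(1) by (simp_all add: dist_real_def abs_minus_commute)
      have "\<phi> (x', y', z') = \<phi> (x', y', z)"
        unfolding \<phi>y[OF inU[OF b(1,2,3)]] \<phi>y[OF inU[OF b(1,2,5)]]
        by (rule log_derivative_of_ratio[where I = "ball x e" and K = "ball z e"
            and az = "\<lambda>u w. partial_z (partial_x f) (u, y', w)" and bz = "\<lambda>u w. partial_z (partial_y f) (u, y', w)"])
          (use inU b nz an S in \<open>auto intro: analytic3_deriv\<close>)
      also have "\<dots> = \<phi> (x', y, z)"
        unfolding \<phi>z[OF inU[OF b(1,2,5)]] \<phi>z[OF inU[OF b(1,4,5)]]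
        by (rule log_derivative_of_ratio[where I = "ball x e" and K = "ball y e"
            and az = "\<lambda>u w. partial_y (partial_x f) (u, w, z)" and bz = "\<lambda>u w. partial_y (partial_z f) (u, w, z)"])
          (use inU b nz an S in \<open>auto intro: analytic3_deriv\<close>)
      finally show ?thesis .
    qed
    have "\<forall>\<^sub>F q in nhds p. \<phi> q = \<phi> (fst q, y, z)"
      unfolding xyz by (rule eventually_nhds_real3[OF e(1)]) (unfold fst_conv, rule local)
    moreover have "analytic1 (\<lambda>t. \<phi> (t, y, z)) (fst p)"
      unfolding \<phi>_def xyz fst_conv
      by (intro analytic1_diff analytic1_divide analytic1_along_axes(1)[where U = U] an analytic3_partials)
        (use p nz xyz in auto)
    ultimately show "\<exists>g. analytic1 g (fst p) \<and> (\<forall>\<^sub>F q in nhds p. \<phi> q = g (fst q))"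
      by (intro exI[of _ "\<lambda>t. \<phi> (t, y, z)"] conjI)
  qed
  then obtain \<Phi> where \<Phi>: "\<And>p. p \<in> U \<Longrightarrow> analytic1 \<Phi> (fst p)" "\<And>p. p \<in> U \<Longrightarrow> \<phi> p = \<Phi> (fst p)" by blast
  have J: "open (fst ` U)" "connected (fst ` U)"
    by (rule open_image_fst[OF U(1)], rule connected_continuous_image[OF _ U(2)]) (intro continuous_intros)
  \<comment> \<open>A primitive \<open>H\<close> of \<open>\<Phi>\<close> is the logarithm of the
    derivative of \<open>h\<close>. Hence that derivative, \<open>exp (H t)\<close>, is positive and
    has logarithmic derivative \<open>\<Phi>\<close>.\<close>
  have "\<exists>H. \<forall>t\<in>fst ` U. (H has_real_derivative \<Phi> t) (at t) \<and> analytic1 H t"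
    by (rule analytic1_antiderivative[OF J]) (use \<Phi> in blast)
  then obtain H where H: "\<And>t. t \<in> fst ` U \<Longrightarrow> (H has_real_derivative \<Phi> t) (at t)" "\<And>t. t \<in> fst ` U \<Longrightarrow> analytic1 H t"
    by blast
  have "\<exists>h. \<forall>t\<in>fst ` U. (h has_real_derivative exp (H t)) (at t) \<and> analytic1 h t"
    using analytic1_compose[OF H(2) analytic1_exp] by (intro analytic1_antiderivative[OF J]) blast
  then obtain h where h: "\<And>t. t \<in> fst ` U \<Longrightarrow> (h has_real_derivative exp (H t)) (at t)" "\<And>t. t \<in> fst ` U \<Longrightarrow> analytic1 h t"
    by blast
  show ?thesis
  proof (rule exI[of _ h], rule exI[of _ "\<lambda>t. exp (H t)"], intro allI impI conjI)
    fix x y z assume p: "(x, y, z) \<in> U"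
    then have x: "x \<in> fst ` U" by force
    show "analytic1 h x" "(h has_real_derivative exp (H x)) (at x)" using h[OF x] by auto
    have "\<phi> (x, y, z) = \<Phi> x" using \<Phi>(2)[OF p] by simp
    then show "((\<lambda>t. exp (H t)) has_real_derivative exp (H x) * (partial_x (partial_x f) (x, y, z) / partial_x f (x, y, z)
       - partial_y (partial_x f) (x, y, z) / partial_y f (x, y, z))) (at x)"
      using DERIV_fun_exp[OF H(1)[OF x]] by (simp add: \<phi>_def)
    show "0 < exp (H x)" by simp
  qed
qed

text \<open>The chain rule along the curve (\<xi> t, t). It asks for the first partial derivative
  only at the point and for continuity of the second one there.\<close>

lemma DERIV_diagonal:
  fixes G :: "real \<Rightarrow> real \<Rightarrow> real"
  assumes e: "0 < e"
    and G1: "((\<lambda>x. G x t0) has_real_derivative a) (at (\<xi> t0))"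
    and G2: "\<And>x t. \<bar>x - \<xi> t0\<bar> < e \<Longrightarrow> \<bar>t - t0\<bar> < e \<Longrightarrow> ((\<lambda>t. G x t) has_real_derivative b x t) (at t)"
    and cont: "isCont (\<lambda>(x, t). b x t) (\<xi> t0, t0)"
    and \<xi>: "(\<xi> has_real_derivative d) (at t0)"
  shows "((\<lambda>t. G (\<xi> t) t) has_real_derivative a * d + b (\<xi> t0) t0) (at t0)"
proof -
  let ?X = "ball (\<xi> t0) e" and ?Y = "ball t0 e"
  have mem: "\<xi> t0 \<in> ?X" "t0 \<in> ?Y" using e by auto
  have "((\<lambda>(x, t). G x t) has_derivative (\<lambda>(tx, ty). a * tx + blinfun_mult_right (b (\<xi> t0) t0) ty)) (at (\<xi> t0, t0) within ?X \<times> ?Y)"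
  proof (rule has_derivative_partialsI[where fy = "\<lambda>x t. blinfun_mult_right (b x t)"])
    show "((\<lambda>x. G x t0) has_derivative (*) a) (at (\<xi> t0) within ?X)"
      using G1 unfolding has_field_derivative_def by (rule has_derivative_at_withinI)
    show "((\<lambda>t. G x t) has_derivative blinfun_apply (blinfun_mult_right (b x t))) (at t within ?Y)"
      if "x \<in> ?X" "t \<in> ?Y" for x t
      using G2[of x t] that unfolding has_field_derivative_def
      by (simp add: dist_real_def abs_minus_commute has_derivative_at_withinI)
    have "isCont (\<lambda>p. blinfun_mult_right ((\<lambda>(x, t). b x t) p)) (\<xi> t0, t0)"
      by (rule bounded_linear.isCont[OF bounded_linear_blinfun_mult_right cont])
    then show "continuous (at (\<xi> t0, t0) within ?X \<times> ?Y) (\<lambda>(x, t). blinfun_mult_right (b x t))"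
      by (simp add: continuous_at_imp_continuous_at_within case_prod_unfold)
  qed (use mem in auto)
  then have "((\<lambda>(x, t). G x t) has_derivative (\<lambda>(tx, ty). a * tx + b (\<xi> t0) t0 * ty)) (at (\<xi> t0, t0))"
    using mem by (subst (asm) at_within_open) (auto simp: open_Times)
  moreover have "((\<lambda>t. (\<xi> t, t)) has_derivative (\<lambda>u. (d * u, u))) (at t0)"
    using \<xi> unfolding has_field_derivative_def by (intro has_derivative_Pair has_derivative_ident)
  ultimately have "((\<lambda>t. (\<lambda>(x, t). G x t) (\<xi> t, t)) has_derivative (\<lambda>u. (\<lambda>(tx, ty). a * tx + b (\<xi> t0) t0 * ty) (d * u, u))) (at t0)"
    by (rule has_derivative_compose[rotated])
  then have "((\<lambda>t. G (\<xi> t) t) has_derivative (\<lambda>u. a * (d * u) + b (\<xi> t0) t0 * u)) (at t0)" by simp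
  then show ?thesis
    unfolding has_field_derivative_def by (rule has_derivative_eq_rhs) (simp add: fun_eq_iff algebra_simps)
qed

text \<open>The gradient of \<open>f\<close> is parallel to that of \<open>h x + k y + l z\<close>, so moving in a level set of the
  latter does not change \<open>f\<close>.\<close>

lemma locally_function_of_sum:
  assumes U: "open U" and f: "analytic3 f U" and p: "(x0, y0, z0) \<in> U"
    and h: "\<And>x y z. (x, y, z) \<in> U \<Longrightarrow> analytic1 h x \<and> h1 x \<noteq> 0 \<and> (h has_real_derivative h1 x) (at x)"
    and k: "\<And>x y z. (x, y, z) \<in> U \<Longrightarrow> (k has_real_derivative k1 y) (at y)"
    and l: "\<And>x y z. (x, y, z) \<in> U \<Longrightarrow> (l has_real_derivative l1 z) (at z)"
    and eqs: "\<And>x y z. (x, y, z) \<in> U \<Longrightarrow> partial_y f (x, y, z) * h1 x = partial_x f (x, y, z) * k1 y"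
      "\<And>x y z. (x, y, z) \<in> U \<Longrightarrow> partial_z f (x, y, z) * h1 x = partial_x f (x, y, z) * l1 z"
  shows "\<exists>g. analytic1 g (h x0 + k y0 + l z0) \<and> (\<forall>\<^sub>F (x, y, z) in nhds (x0, y0, z0). f (x, y, z) = g (h x + k y + l z))"
proof -
  obtain e where e: "0 < e" "\<And>x y z. \<bar>x - x0\<bar> < e \<Longrightarrow> \<bar>y - y0\<bar> < e \<Longrightarrow> \<bar>z - z0\<bar> < e \<Longrightarrow> (x, y, z) \<in> U"
    using open_real3_box[OF U p] by blast
  have "deriv h x0 = h1 x0" using h[OF p] DERIV_imp_deriv by blast
  then have hx: "analytic1 h x0" "deriv h x0 \<noteq> 0" using h[OF p] by auto
  obtain \<psi> where \<psi>: "analytic1 \<psi> (h x0)" "\<psi> (h x0) = x0"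
      "\<forall>\<^sub>F s in nhds (h x0). h (\<psi> s) = s" "\<forall>\<^sub>F s in nhds x0. \<psi> (h s) = s"
    by (rule analytic1_inverse_function[OF hx])
  have "\<forall>\<^sub>F s in at (h x0). \<psi> s \<in> ball x0 e"
    using analytic1_isCont[OF \<psi>(1)] e(1) unfolding isCont_def \<psi>(2) by (intro topological_tendstoD) auto
  then have "\<forall>\<^sub>F s in nhds (h x0). \<psi> s \<in> ball x0 e" using e(1) \<psi>(2) by (simp add: eventually_nhds_conv_at)
  moreover have "\<forall>\<^sub>F s in nhds (h x0). \<forall>\<^sub>F s in nhds s. h (\<psi> s) = s" using \<psi>(3) by (simp add: eventually_eventually)
  ultimately have "\<forall>\<^sub>F s in nhds (h x0). \<psi> s \<in> ball x0 e \<and> (\<forall>\<^sub>F s in nhds s. h (\<psi> s) = s) \<and> (\<psi> has_real_derivative deriv \<psi> s) (at s)"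
    using analytic1_deriv(2)[OF \<psi>(1)] by (intro eventually_conj)
  then obtain \<delta> where \<delta>: "0 < \<delta>" "\<And>s. \<bar>s - h x0\<bar> < \<delta> \<Longrightarrow> \<bar>\<psi> s - x0\<bar> < e"
      "\<And>s. \<bar>s - h x0\<bar> < \<delta> \<Longrightarrow> \<forall>\<^sub>F s in nhds s. h (\<psi> s) = s"
      "\<And>s. \<bar>s - h x0\<bar> < \<delta> \<Longrightarrow> (\<psi> has_real_derivative deriv \<psi> s) (at s)"
    unfolding eventually_nhds_real by (auto simp: dist_real_def abs_minus_commute)
  have \<psi>d: "h1 (\<psi> s) * deriv \<psi> s = 1" if s: "\<bar>s - h x0\<bar> < \<delta>" for s
  proof -
    have "(\<psi> s, y0, z0) \<in> U" using \<delta>(2)[OF s] e by simp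
    then have "(h has_real_derivative h1 (\<psi> s)) (at (\<psi> s))" using h by blast
    then have "((\<lambda>s. h (\<psi> s)) has_real_derivative h1 (\<psi> s) * deriv \<psi> s) (at s)" using \<delta>(4)[OF s] by (rule DERIV_chain2)
    moreover have "((\<lambda>s. h (\<psi> s)) has_real_derivative 1) (at s)"
      using \<delta>(3)[OF s] DERIV_ident by (subst DERIV_cong_ev[OF refl _ refl])
    ultimately show ?thesis by (rule DERIV_unique)
  qed
  \<comment> \<open>A fifth of \<delta>, because five terms vary in the argument of \<psi>.\<close>
  have close: "\<exists>d>0. \<forall>t. \<bar>t - t0\<bar> < d \<longrightarrow> \<bar>g t - g t0\<bar> < \<delta> / 5" if "(g has_real_derivative D) (at t0)" for g D t0
    using DERIV_isCont[OF that] \<delta>(1) unfolding continuous_at_eps_delta dist_real_def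
    by (metis zero_less_divide_iff zero_less_numeral)
  obtain d1 where d1: "0 < d1" "\<And>t. \<bar>t - x0\<bar> < d1 \<Longrightarrow> \<bar>h t - h x0\<bar> < \<delta> / 5" using close h[OF p] by blast
  obtain d2 where d2: "0 < d2" "\<And>t. \<bar>t - y0\<bar> < d2 \<Longrightarrow> \<bar>k t - k y0\<bar> < \<delta> / 5" using close k[OF p] by blast
  obtain d3 where d3: "0 < d3" "\<And>t. \<bar>t - z0\<bar> < d3 \<Longrightarrow> \<bar>l t - l z0\<bar> < \<delta> / 5" using close l[OF p] by blast
  obtain d4 where d4: "0 < d4" "\<And>t. \<bar>t - x0\<bar> < d4 \<Longrightarrow> \<psi> (h t) = t" using \<psi>(4) unfolding eventually_nhds_real by blast
  define d where "d = min e (min (min d1 d2) (min d3 d4))"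
  have d: "0 < d" using e d1 d2 d3 d4 by (simp add: d_def)
  \<comment> \<open>The first coordinate of the point above \<open>(v, w)\<close> on the level set
    of \<open>h x + k y + l z\<close> through \<open>(x, y, z)\<close>.\<close>
  define \<Xi> where "\<Xi> x y z v w = \<psi> (h x + k y + l z - k v - l w)" for x y z v w
  have arg: "\<bar>h x + k y + l z - k v - l w - h x0\<bar> < \<delta>"
    if "\<bar>x - x0\<bar> < d" "\<bar>y - y0\<bar> < d" "\<bar>z - z0\<bar> < d" "\<bar>v - y0\<bar> < d" "\<bar>w - z0\<bar> < d" for x y z v w
  proof -
    have "\<bar>h x - h x0\<bar> < \<delta> / 5" "\<bar>k y - k y0\<bar> < \<delta> / 5" "\<bar>k v - k y0\<bar> < \<delta> / 5" "\<bar>l z - l z0\<bar> < \<delta> / 5" "\<bar>l w - l z0\<bar> < \<delta> / 5"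
      by (rule d1(2) d2(2) d3(2), use that in \<open>simp add: d_def\<close>)+
    then show ?thesis by linarith
  qed
  have level: "f (x, y, z) = f (\<Xi> x y z y0 z0, y0, z0)"
    if q: "\<bar>x - x0\<bar> < d" "\<bar>y - y0\<bar> < d" "\<bar>z - z0\<bar> < d" for x y z
  proof -
    have inU: "(\<Xi> x y z v w, v, w) \<in> U" if "\<bar>v - y0\<bar> < d" "\<bar>w - z0\<bar> < d" for v w
      using \<delta>(2)[OF arg[OF q that]] that by (intro e(2)) (auto simp: \<Xi>_def d_def)
    have near: "\<exists>r>0. \<forall>u v w. \<bar>u - a\<bar> < r \<longrightarrow> \<bar>v - b\<bar> < r \<longrightarrow> \<bar>w - c\<bar> < r \<longrightarrow> (u, v, w) \<in> U" if "(a, b, c) \<in> U" for a b c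
      using open_real3_box[OF U that] by metis
    have dy: "((\<lambda>v. f (\<Xi> x y z v w, v, w)) has_real_derivative 0) (at v)" if vw: "\<bar>v - y0\<bar> < d" "\<bar>w - z0\<bar> < d" for v w
    proof -
      let ?q = "(\<Xi> x y z v w, v, w)"
      let ?D = "deriv \<psi> (h x + k y + l z - k v - l w)"
      have kv: "(k has_real_derivative k1 v) (at v)" using k[OF inU[OF vw]] .
      have \<Xi>': "((\<lambda>v. \<Xi> x y z v w) has_real_derivative ?D * - k1 v) (at v)"
        unfolding \<Xi>_def by (rule DERIV_chain2[where f = \<psi> and g = "\<lambda>v. h x + k y + l z - k v - l w", OF \<delta>(4)[OF arg[OF q vw]]]) (auto intro!: derivative_eq_intros kv)
      obtain r where r: "0 < r" "\<And>u v' w'. \<bar>u - \<Xi> x y z v w\<bar> < r \<Longrightarrow> \<bar>v' - v\<bar> < r \<Longrightarrow> \<bar>w' - w\<bar> < r \<Longrightarrow> (u, v', w') \<in> U"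
        using near[OF inU[OF vw]] by blast
      have "isCont (partial_y f \<circ> (\<lambda>p. (fst p, snd p, w))) (\<Xi> x y z v w, v)"
        by (rule continuous_at_compose) (use analytic3_continuous[OF analytic3_partials(2)[OF f] inU[OF vw]] in \<open>auto intro!: continuous_intros\<close>)
      then have "((\<lambda>v. f (\<Xi> x y z v w, v, w)) has_real_derivative partial_x f ?q * (?D * - k1 v) + partial_y f ?q) (at v)"
        using r inU[OF vw] \<Xi>'
        by (intro DERIV_diagonal[where b = "\<lambda>u v. partial_y f (u, v, w)" and e = r and G = "\<lambda>u v. f (u, v, w)"])
          (auto intro: analytic3_deriv[OF f] simp: o_def case_prod_unfold)
      moreover have "partial_y f ?q = partial_x f ?q * k1 v * ?D"
        using eqs(1)[OF inU[OF vw]] \<psi>d[OF arg[OF q vw]] unfolding \<Xi>_def by (metis mult.assoc mult.right_neutral)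
      ultimately show ?thesis by (simp add: algebra_simps)
    qed
    have dz: "((\<lambda>w. f (\<Xi> x y z v w, v, w)) has_real_derivative 0) (at w)" if vw: "\<bar>v - y0\<bar> < d" "\<bar>w - z0\<bar> < d" for v w
    proof -
      let ?q = "(\<Xi> x y z v w, v, w)"
      let ?D = "deriv \<psi> (h x + k y + l z - k v - l w)"
      have lw: "(l has_real_derivative l1 w) (at w)" using l[OF inU[OF vw]] .
      have \<Xi>': "((\<lambda>w. \<Xi> x y z v w) has_real_derivative ?D * - l1 w) (at w)"
        unfolding \<Xi>_def by (rule DERIV_chain2[where f = \<psi> and g = "\<lambda>w. h x + k y + l z - k v - l w", OF \<delta>(4)[OF arg[OF q vw]]]) (auto intro!: derivative_eq_intros lw)
      obtain r where r: "0 < r" "\<And>u v' w'. \<bar>u - \<Xi> x y z v w\<bar> < r \<Longrightarrow> \<bar>v' - v\<bar> < r \<Longrightarrow> \<bar>w' - w\<bar> < r \<Longrightarrow> (u, v', w') \<in> U"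
        using near[OF inU[OF vw]] by blast
      have "isCont (partial_z f \<circ> (\<lambda>p. (fst p, v, snd p))) (\<Xi> x y z v w, w)"
        by (rule continuous_at_compose) (use analytic3_continuous[OF analytic3_partials(3)[OF f] inU[OF vw]] in \<open>auto intro!: continuous_intros\<close>)
      then have "((\<lambda>w. f (\<Xi> x y z v w, v, w)) has_real_derivative partial_x f ?q * (?D * - l1 w) + partial_z f ?q) (at w)"
        using r inU[OF vw] \<Xi>'
        by (intro DERIV_diagonal[where b = "\<lambda>u w. partial_z f (u, v, w)" and e = r and G = "\<lambda>u w. f (u, v, w)"])
          (auto intro: analytic3_deriv[OF f] simp: o_def case_prod_unfold)
      moreover have "partial_z f ?q = partial_x f ?q * l1 w * ?D"
        using eqs(2)[OF inU[OF vw]] \<psi>d[OF arg[OF q vw]] unfolding \<Xi>_def by (metis mult.assoc mult.right_neutral)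
      ultimately show ?thesis by (simp add: algebra_simps)
    qed
    have const: "g t = g c" if g: "\<And>t. \<bar>t - c\<bar> < d \<Longrightarrow> (g has_real_derivative 0) (at t)" and t: "\<bar>t - c\<bar> < d"
      for g :: "real \<Rightarrow> real" and c t
    proof -
      have "\<exists>m. \<forall>t\<in>ball c d. g t = m"
        using g by (intro has_field_derivative_zero_constant) (auto simp: dist_real_def abs_minus_commute has_field_derivative_at_within)
      then obtain m where m: "\<And>t. t \<in> ball c d \<Longrightarrow> g t = m" by blast
      show ?thesis using m[of t] m[of c] t d by (simp add: dist_real_def abs_minus_commute)
    qed
    have "f (x, y, z) = f (\<Xi> x y z y z, y, z)" using d4(2)[of x] q(1) by (simp add: \<Xi>_def d_def)
    also have "\<dots> = f (\<Xi> x y z y0 z, y0, z)"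
      by (rule const[of y0 "\<lambda>v. f (\<Xi> x y z v z, v, z)" y]) (use dy q in auto)
    also have "\<dots> = f (\<Xi> x y z y0 z0, y0, z0)"
      by (rule const[of z0 "\<lambda>w. f (\<Xi> x y z y0 w, y0, w)" z]) (use dz q d in auto)
    finally show ?thesis .
  qed
  define g where "g s = f (\<psi> (s - (k y0 + l z0)), y0, z0)" for s
  have "analytic1 (\<lambda>s. \<psi> (s - (k y0 + l z0))) (h x0 + k y0 + l z0)"
    by (rule analytic1_compose[OF analytic1_diff[OF analytic1_ident analytic1_const]]) (use \<psi>(1) in \<open>simp add: algebra_simps\<close>)
  then have "analytic1 g (h x0 + k y0 + l z0)"
    unfolding g_def by (rule analytic1_compose[where \<phi> = "\<lambda>t. f (t, y0, z0)"])
      (use \<psi>(2) analytic1_along_axes(1)[OF f p] in \<open>simp add: algebra_simps\<close>)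
  moreover have "\<forall>\<^sub>F (x, y, z) in nhds (x0, y0, z0). f (x, y, z) = g (h x + k y + l z)"
    by (rule eventually_nhds_real3[OF d]) (unfold case_prod_conv, subst level, auto simp: \<Xi>_def g_def algebra_simps)
  ultimately show ?thesis by blast
qed

lemma DERIV_ratio_zero:
  fixes A B C D :: "real \<Rightarrow> real"
  assumes "(A has_real_derivative A') (at t)" "(C has_real_derivative C') (at t)"
    "(B has_real_derivative B') (at t)" "(D has_real_derivative D') (at t)"
    and nz: "A t \<noteq> 0" "C t \<noteq> 0" "B t \<noteq> 0" "D t \<noteq> 0" and eq: "A' / A t + C' / C t = B' / B t + D' / D t"
  shows "((\<lambda>t. A t * C t / (B t * D t)) has_real_derivative 0) (at t)"
proof -
  have "(A' * C t + C' * A t) * (B t * D t) = A t * C t * (B' * D t + D' * B t)"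
    using eq nz by (simp add: field_simps)
  then show ?thesis
    using DERIV_divide[OF DERIV_mult[OF assms(1,2)] DERIV_mult[OF assms(3,4)]] nz by simp
qed

text \<open>Swaps provide one factor for each variable. These determine the gradient direction up to
  two constants, which are put into \<open>k\<close> and \<open>l\<close>.\<close>

lemma separable_sum_form:
  assumes "separable f U"
  shows "\<exists>h k l h1 k1 l1. \<forall>x y z. (x, y, z) \<in> U \<longrightarrow> analytic1 h x \<and> analytic1 k y \<and> analytic1 l z \<and> h1 x \<noteq> 0 \<and>
    (h has_real_derivative h1 x) (at x) \<and> (k has_real_derivative k1 y) (at y) \<and> (l has_real_derivative l1 z) (at z) \<and>
    partial_y f (x, y, z) * h1 x = partial_x f (x, y, z) * k1 y \<and>
    partial_z f (x, y, z) * h1 x = partial_x f (x, y, z) * l1 z"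
proof (cases "U = {}")
  case False
  then obtain p0 where p0: "p0 \<in> U" by blast
  note S = assms[unfolded separable_def]
  have U: "open U" "connected U" and f: "analytic3 f U" using S by auto
  let ?a = "partial_x f" and ?b = "partial_y f" and ?c = "partial_z f"
  have nz: "?a p \<noteq> 0" "?b p \<noteq> 0" "?c p \<noteq> 0" if "p \<in> U" for p using S that by auto
  have mix: "partial_x ?b p = partial_y ?a p" "partial_x ?c p = partial_z ?a p" "partial_y ?c p = partial_z ?b p"
    if "p \<in> U" for p using analytic3_mixed[OF f that] by auto
  have eq: "?b p * partial_z ?a p = ?a p * partial_z ?b p" "?c p * partial_y ?a p = ?a p * partial_z ?b p" if "p \<in> U" for p
    using S that mix[OF that] by auto
  note an = analytic3_partials[OF f]
  obtain h h1 where h: "\<And>x y z. (x, y, z) \<in> U \<Longrightarrow> analytic1 h x \<and> 0 < h1 x \<and> (h has_real_derivative h1 x) (at x) \<and>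
      (h1 has_real_derivative h1 x * (partial_x ?a (x, y, z) / ?a (x, y, z) - partial_y ?a (x, y, z) / ?b (x, y, z))) (at x)"
    using separable_factor[OF assms] by (elim exE) blast
  obtain k k1 where k: "\<And>x y z. (x, y, z) \<in> U \<Longrightarrow> analytic1 k y \<and> 0 < k1 y \<and> (k has_real_derivative k1 y) (at y) \<and>
      (k1 has_real_derivative k1 y * (partial_y ?b (x, y, z) / ?b (x, y, z) - partial_x ?b (x, y, z) / ?a (x, y, z))) (at y)"
  proof -
    obtain k k1 where k: "\<forall>y x z. (y, x, z) \<in> swap_xy ` U \<longrightarrow> analytic1 k y \<and> 0 < k1 y \<and> (k has_real_derivative k1 y) (at y) \<and>
      (k1 has_real_derivative k1 y * (partial_y ?b (x, y, z) / ?b (x, y, z) - partial_x ?b (x, y, z) / ?a (x, y, z))) (at y)"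
      using separable_factor[OF separable_swap(1)[OF assms]] unfolding partial_comp_swap o_apply swap_simps by (elim exE)
    have "(y, x, z) \<in> swap_xy ` U" if "(x, y, z) \<in> U" for x y z using imageI[OF that, of swap_xy] by simp
    then show thesis using k by (intro that[of k k1]) blast
  qed
  obtain l l1 where l: "\<And>x y z. (x, y, z) \<in> U \<Longrightarrow> analytic1 l z \<and> 0 < l1 z \<and> (l has_real_derivative l1 z) (at z) \<and>
      (l1 has_real_derivative l1 z * (partial_z ?c (x, y, z) / ?c (x, y, z) - partial_y ?c (x, y, z) / ?b (x, y, z))) (at z)"
  proof -
    obtain l l1 where l: "\<forall>z y x. (z, y, x) \<in> swap_xz ` U \<longrightarrow> analytic1 l z \<and> 0 < l1 z \<and> (l has_real_derivative l1 z) (at z) \<and>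
      (l1 has_real_derivative l1 z * (partial_z ?c (x, y, z) / ?c (x, y, z) - partial_y ?c (x, y, z) / ?b (x, y, z))) (at z)"
      using separable_factor[OF separable_swap(2)[OF assms]] unfolding partial_comp_swap o_apply swap_simps by (elim exE)
    have "(z, y, x) \<in> swap_xz ` U" if "(x, y, z) \<in> U" for x y z using imageI[OF that, of swap_xz] by simp
    then show thesis using l by (intro that[of l l1]) blast
  qed
  have pos: "0 < h1 x" "0 < k1 y" "0 < l1 z" if "(x, y, z) \<in> U" for x y z using h k l that by auto
  have h': "(h1 has_real_derivative h1 x * (partial_x ?a (x, y, z) / ?a (x, y, z) - partial_y ?a (x, y, z) / ?b (x, y, z))) (at x)"
    and k': "(k1 has_real_derivative k1 y * (partial_y ?b (x, y, z) / ?b (x, y, z) - partial_y ?a (x, y, z) / ?a (x, y, z))) (at y)"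
    and l': "(l1 has_real_derivative l1 z * (partial_z ?c (x, y, z) / ?c (x, y, z) - partial_z ?b (x, y, z) / ?b (x, y, z))) (at z)"
    if "(x, y, z) \<in> U" for x y z using h[OF that] k[OF that] l[OF that] mix[OF that] by simp_all
  \<comment> \<open>In each variable, numerator and denominator have the same logarithmic
    derivative, so \<open>q1\<close> and \<open>q2\<close> are constant on the connected set
    \<open>U\<close>.\<close>
  define q1 where "q1 = (\<lambda>(x, y, z). ?a (x, y, z) * k1 y / (?b (x, y, z) * h1 x))"
  define q2 where "q2 = (\<lambda>(x, y, z). ?b (x, y, z) * l1 z / (?c (x, y, z) * k1 y))"
  have q1: "q1 p = q1 p0" if "p \<in> U" for p
  proof (rule constant_if_partials_zero[OF U _ _ _ that p0])
    fix x y z assume p: "(x, y, z) \<in> U"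
    note n = nz[OF p] pos[OF p]
    have e: "partial_z ?a (x, y, z) / ?a (x, y, z) = partial_z ?b (x, y, z) / ?b (x, y, z)"
      "partial_y ?a (x, y, z) / ?a (x, y, z) = partial_z ?b (x, y, z) / ?c (x, y, z)"
      "partial_z ?a (x, y, z) / ?c (x, y, z) = partial_y ?a (x, y, z) / ?b (x, y, z)"
      using n eq[OF p] by (simp_all add: field_simps)
    show "((\<lambda>t. q1 (t, y, z)) has_real_derivative 0) (at x)"
      unfolding q1_def case_prod_conv
      by (rule DERIV_ratio_zero[OF analytic3_deriv(1)[OF an(1) p] DERIV_const analytic3_deriv(1)[OF an(2) p] h'[OF p]])
        (use n e mix[OF p] in \<open>simp_all add: diff_divide_distrib\<close>)
    show "((\<lambda>t. q1 (x, t, z)) has_real_derivative 0) (at y)"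
      unfolding q1_def case_prod_conv
      by (rule DERIV_ratio_zero[OF analytic3_deriv(2)[OF an(1) p] k'[OF p] analytic3_deriv(2)[OF an(2) p] DERIV_const])
        (use n e mix[OF p] in \<open>simp_all add: diff_divide_distrib\<close>)
    show "((\<lambda>t. q1 (x, y, t)) has_real_derivative 0) (at z)"
      unfolding q1_def case_prod_conv
      by (rule DERIV_ratio_zero[OF analytic3_deriv(3)[OF an(1) p] DERIV_const analytic3_deriv(3)[OF an(2) p] DERIV_const])
        (use n e mix[OF p] in \<open>simp_all add: diff_divide_distrib\<close>)
  qed
  have q2: "q2 p = q2 p0" if "p \<in> U" for p
  proof (rule constant_if_partials_zero[OF U _ _ _ that p0])
    fix x y z assume p: "(x, y, z) \<in> U"
    note n = nz[OF p] pos[OF p]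
    have e: "partial_z ?a (x, y, z) / ?a (x, y, z) = partial_z ?b (x, y, z) / ?b (x, y, z)"
      "partial_y ?a (x, y, z) / ?a (x, y, z) = partial_z ?b (x, y, z) / ?c (x, y, z)"
      "partial_z ?a (x, y, z) / ?c (x, y, z) = partial_y ?a (x, y, z) / ?b (x, y, z)"
      using n eq[OF p] by (simp_all add: field_simps)
    show "((\<lambda>t. q2 (t, y, z)) has_real_derivative 0) (at x)"
      unfolding q2_def case_prod_conv
      by (rule DERIV_ratio_zero[OF analytic3_deriv(1)[OF an(2) p] DERIV_const analytic3_deriv(1)[OF an(3) p] DERIV_const])
        (use n e mix[OF p] in \<open>simp_all add: diff_divide_distrib\<close>)
    show "((\<lambda>t. q2 (x, t, z)) has_real_derivative 0) (at y)"
      unfolding q2_def case_prod_conv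
      by (rule DERIV_ratio_zero[OF analytic3_deriv(2)[OF an(2) p] DERIV_const analytic3_deriv(2)[OF an(3) p] k'[OF p]])
        (use n e mix[OF p] in \<open>simp_all add: diff_divide_distrib\<close>)
    show "((\<lambda>t. q2 (x, y, t)) has_real_derivative 0) (at z)"
      unfolding q2_def case_prod_conv
      by (rule DERIV_ratio_zero[OF analytic3_deriv(3)[OF an(2) p] l'[OF p] analytic3_deriv(3)[OF an(3) p] DERIV_const])
        (use n e mix[OF p] in \<open>simp_all add: diff_divide_distrib\<close>)
  qed
  obtain x0 y0 z0 where p0': "p0 = (x0, y0, z0)" by (cases p0)
  define c1 where "c1 = q1 p0"
  define c2 where "c2 = q2 p0"
  have c: "c1 \<noteq> 0" "c2 \<noteq> 0"
    using nz[OF p0] pos[OF p0[unfolded p0']] by (simp_all add: c1_def c2_def q1_def q2_def p0')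
  show ?thesis
  proof (rule exI[of _ h], rule exI[of _ "\<lambda>y. k y / c1"], rule exI[of _ "\<lambda>z. l z / (c1 * c2)"], rule exI[of _ h1],
      rule exI[of _ "\<lambda>y. k1 y / c1"], rule exI[of _ "\<lambda>z. l1 z / (c1 * c2)"], intro allI impI conjI)
    fix x y z assume p: "(x, y, z) \<in> U"
    show "analytic1 h x" "h1 x \<noteq> 0" "(h has_real_derivative h1 x) (at x)" using h[OF p] by auto
    show "analytic1 (\<lambda>y. k y / c1) y" "analytic1 (\<lambda>z. l z / (c1 * c2)) z"
      using k[OF p] l[OF p] c by (auto intro!: analytic1_divide analytic1_const)
    show "((\<lambda>y. k y / c1) has_real_derivative k1 y / c1) (at y)"
      using k[OF p] by (intro DERIV_cdivide) blast
    show "((\<lambda>z. l z / (c1 * c2)) has_real_derivative l1 z / (c1 * c2)) (at z)"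
      using l[OF p] by (intro DERIV_cdivide) blast
    have 1: "?a (x, y, z) * k1 y = c1 * (?b (x, y, z) * h1 x)"
      using q1[OF p] nz[OF p] pos[OF p] unfolding c1_def[symmetric] by (simp add: q1_def divide_eq_eq)
    have 2: "?b (x, y, z) * l1 z = c2 * (?c (x, y, z) * k1 y)"
      using q2[OF p] nz[OF p] pos[OF p] unfolding c2_def[symmetric] by (simp add: q2_def divide_eq_eq)
    show "?b (x, y, z) * h1 x = ?a (x, y, z) * (k1 y / c1)" using 1 c by (simp add: field_simps)
    have "?b (x, y, z) * (?a (x, y, z) * l1 z) = ?a (x, y, z) * k1 y * (c2 * ?c (x, y, z))" using 2 by (simp add: mult.commute mult.left_commute)
    also have "\<dots> = ?b (x, y, z) * (c1 * c2 * (?c (x, y, z) * h1 x))" unfolding 1 by (simp add: mult_ac)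
    finally have "?a (x, y, z) * l1 z = c1 * c2 * (?c (x, y, z) * h1 x)" using nz(2)[OF p] by simp
    then show "?c (x, y, z) * h1 x = ?a (x, y, z) * (l1 z / (c1 * c2))" using c by (simp add: field_simps)
  qed
qed simp

lemma separable_analytic_form:
  assumes "separable f U"
  shows "\<exists>g h k l :: real \<Rightarrow> real. \<forall>x y z. (x, y, z) \<in> U \<longrightarrow> analytic1 h x \<and> analytic1 k y \<and> analytic1 l z \<and>
    analytic1 g (h x + k y + l z) \<and> f (x, y, z) = g (h x + k y + l z)"
proof -
  have U: "open U" "connected U" and f: "analytic3 f U" using assms unfolding separable_def by auto
  obtain h k l h1 k1 l1 where w: "\<And>x y z. (x, y, z) \<in> U \<Longrightarrow> analytic1 h x \<and> analytic1 k y \<and> analytic1 l z \<and> h1 x \<noteq> 0 \<and>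
    (h has_real_derivative h1 x) (at x) \<and> (k has_real_derivative k1 y) (at y) \<and> (l has_real_derivative l1 z) (at z) \<and>
    partial_y f (x, y, z) * h1 x = partial_x f (x, y, z) * k1 y \<and>
    partial_z f (x, y, z) * h1 x = partial_x f (x, y, z) * l1 z"
    using separable_sum_form[OF assms] by (elim exE) blast
  let ?w = "\<lambda>(x, y, z). h x + k y + l z"
  have "\<exists>g. \<forall>p\<in>U. analytic1 g (?w p) \<and> f p = g (?w p)"
  proof (rule function_of_analytic_coordinate[OF U])
    have "isCont ?w p" if p: "p \<in> U" for p
    proof -
      obtain x y z where xyz: "p = (x, y, z)" by (cases p)
      have "isCont h x" "isCont k y" "isCont l z" using w[OF p[unfolded xyz]] DERIV_isCont by blast+
      moreover have "isCont (\<lambda>p. fst p) p" "isCont (\<lambda>p. fst (snd p)) p" "isCont (\<lambda>p. snd (snd p)) p"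
        by (intro continuous_fst continuous_snd continuous_ident)+
      ultimately have "isCont (\<lambda>p. h (fst p) + k (fst (snd p)) + l (snd (snd p))) p"
        unfolding xyz by (intro continuous_add) (rule isCont_o2, assumption, simp)+
      then show ?thesis by (simp only: case_prod_unfold)
    qed
    then show "continuous_on U ?w" by (simp add: continuous_at_imp_continuous_on)
    show "\<exists>q\<in>ball p e. ?w q \<noteq> ?w p" if e: "0 < e" "ball p e \<subseteq> U" for p e
    proof (rule ccontr)
      assume "\<not> ?thesis"
      then have c: "?w q = ?w p" if "q \<in> ball p e" for q using that by blast
      obtain x y z where xyz: "p = (x, y, z)" by (cases p)
      have p: "(x, y, z) \<in> U" using e xyz by auto
      have hx: "h t = h x" if t: "t \<in> ball x e" for t
      proof -
        have "(t, y, z) \<in> ball p e" using t by (simp add: xyz dist_Pair_Pair)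
        from c[OF this] show ?thesis by (simp add: xyz)
      qed
      have "\<forall>\<^sub>F t in nhds x. t \<in> ball x e" using e(1) by (intro eventually_nhds_in_open) auto
      then have "\<forall>\<^sub>F t in nhds x. h t = h x" by (rule eventually_mono) (rule hx)
      then have "(h has_real_derivative 0) (at x)" using DERIV_const by (subst DERIV_cong_ev[OF refl _ refl])
      then show False using w[OF p] DERIV_unique by blast
    qed
    fix p assume p: "p \<in> U"
    obtain x y z where xyz: "p = (x, y, z)" by (cases p)
    have "\<exists>g. analytic1 g (h x + k y + l z) \<and> (\<forall>\<^sub>F (x, y, z) in nhds (x, y, z). f (x, y, z) = g (h x + k y + l z))"
      by (rule locally_function_of_sum[OF U(1) f p[unfolded xyz], where ?h1.0 = h1 and ?k1.0 = k1 and ?l1.0 = l1])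
        (use w in blast)+
    then show "\<exists>g. analytic1 g (?w p) \<and> (\<forall>\<^sub>F q in nhds p. f q = g (?w q))"
      unfolding xyz by (simp add: case_prod_unfold)
  qed
  then obtain g where g: "\<And>p. p \<in> U \<Longrightarrow> analytic1 g (?w p) \<and> f p = g (?w p)" by blast
  show ?thesis
    by (rule exI[of _ g], rule exI[of _ h], rule exI[of _ k], rule exI[of _ l]) (use w g in fastforce)
qed

text \<open>Off the zeros of the partial derivatives the two equations and the symmetry of second
  derivatives give \<open>separable\<close> on every component.\<close>

lemma analytic_special_form_if:
  assumes \<Omega>: "open \<Omega>" and f: "real_analytic_on f \<Omega>"
    and eq: "\<And>p. p \<in> \<Omega> \<Longrightarrow> partial_y f p * partial_z (partial_x f) p = partial_x f p * partial_z (partial_y f) p"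
      "\<And>p. p \<in> \<Omega> \<Longrightarrow> partial_y f p * partial_z (partial_x f) p = partial_z f p * partial_y (partial_x f) p"
  shows "analytic_special_form f \<Omega>"
  unfolding analytic_special_form_def
proof (intro conjI f ballI)
  have f3: "analytic3 f \<Omega>" using f by (rule analytic3_if_real_analytic_on)
  let ?V = "\<Omega> - ({p. partial_x f p = 0} \<union> {p. partial_y f p = 0} \<union> {p. partial_z f p = 0})"
  fix U assume U: "U \<in> components ?V"
  have pre: "open (\<Omega> \<inter> g -` (- {0}))" if "analytic3 g \<Omega>" for g
    using analytic3_continuous[OF that] \<Omega>
    by (intro continuous_open_preimage) (auto simp: continuous_at_imp_continuous_on)
  have "?V = (\<Omega> \<inter> partial_x f -` (- {0})) \<inter> (\<Omega> \<inter> partial_y f -` (- {0})) \<inter> (\<Omega> \<inter> partial_z f -` (- {0}))" by blast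
  then have "open ?V" using pre[OF analytic3_partials(1)[OF f3]] pre[OF analytic3_partials(2)[OF f3]] pre[OF analytic3_partials(3)[OF f3]]
    by (metis open_Int)
  then have "open U" using U by (rule open_components)
  moreover have "connected U" using U by (rule in_components_connected)
  moreover have sub: "U \<subseteq> ?V" using U by (rule in_components_subset)
  moreover have "analytic3 f U" using f3 sub unfolding analytic3_def by blast
  ultimately have "separable f U"
    unfolding separable_def using eq analytic3_mixed[OF f3] by (auto simp: subset_iff)
  then obtain g h k l :: "real \<Rightarrow> real" where ghkl: "\<And>x y z. (x, y, z) \<in> U \<Longrightarrow> analytic1 h x \<and> analytic1 k y \<and> analytic1 l z \<and>
    analytic1 g (h x + k y + l z) \<and> f (x, y, z) = g (h x + k y + l z)"
    using separable_analytic_form[OF \<open>separable f U\<close>] by (elim exE) blast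
  show "\<exists>g h k l :: real \<Rightarrow> real. real_analytic_on h ((\<lambda>(x, y, z). x) ` U) \<and> real_analytic_on k ((\<lambda>(x, y, z). y) ` U) \<and>
      real_analytic_on l ((\<lambda>(x, y, z). z) ` U) \<and> real_analytic_on g ((\<lambda>(x, y, z). h x + k y + l z) ` U) \<and>
      (\<forall>(x, y, z) \<in> U. f (x, y, z) = g (h x + k y + l z))"
    by (rule exI[of _ g], rule exI[of _ h], rule exI[of _ k], rule exI[of _ l])
      (use ghkl in \<open>auto intro!: real_analytic_on_if_analytic1\<close>)
qed

subsection \<open>The dichotomy\<close>

lemma partial_difference_bound:
  fixes g :: "real \<times> real \<times> real \<Rightarrow> real"
  assumes I: "convex I" and J: "convex J"
    and D: "\<And>x y. x \<in> I \<Longrightarrow> y \<in> J \<Longrightarrow> ((\<lambda>t. g (t, y, z)) has_real_derivative gx x y) (at x)"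
      "\<And>x y. x \<in> I \<Longrightarrow> y \<in> J \<Longrightarrow> ((\<lambda>t. g (x, t, z)) has_real_derivative gy x y) (at y)"
    and bound: "\<And>x y. x \<in> I \<Longrightarrow> y \<in> J \<Longrightarrow> \<bar>gx x y - \<alpha>\<bar> \<le> \<kappa>" "\<And>x y. x \<in> I \<Longrightarrow> y \<in> J \<Longrightarrow> \<bar>gy x y - \<beta>\<bar> \<le> \<kappa>"
    and mem: "x \<in> I" "x' \<in> I" "y \<in> J" "y' \<in> J"
  shows "\<bar>g (x, y, z) - g (x', y', z) - (\<alpha> * (x - x') + \<beta> * (y - y'))\<bar> \<le> \<kappa> * (\<bar>x - x'\<bar> + \<bar>y - y'\<bar>)"
proof -
  have "norm ((\<lambda>t. g (t, y, z) - \<alpha> * t) x - (\<lambda>t. g (t, y, z) - \<alpha> * t) x') \<le> \<kappa> * norm (x - x')"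
  proof (rule field_differentiable_bound[where f = "\<lambda>t. g (t, y, z) - \<alpha> * t" and f' = "\<lambda>t. gx t y - \<alpha>", OF I _ _ mem(1,2)])
    show "((\<lambda>t. g (t, y, z) - \<alpha> * t) has_real_derivative gx t y - \<alpha>) (at t within I)" if "t \<in> I" for t
      by (intro has_field_derivative_at_within[OF DERIV_diff] D(1)[OF that mem(3)] DERIV_cmult_Id)
    show "norm (gx t y - \<alpha>) \<le> \<kappa>" if "t \<in> I" for t using bound(1)[OF that mem(3)] by simp
  qed
  moreover have "norm ((\<lambda>t. g (x', t, z) - \<beta> * t) y - (\<lambda>t. g (x', t, z) - \<beta> * t) y') \<le> \<kappa> * norm (y - y')"
  proof (rule field_differentiable_bound[where f = "\<lambda>t. g (x', t, z) - \<beta> * t" and f' = "\<lambda>t. gy x' t - \<beta>", OF J _ _ mem(3,4)])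
    show "((\<lambda>t. g (x', t, z) - \<beta> * t) has_real_derivative gy x' t - \<beta>) (at t within J)" if "t \<in> J" for t
      by (intro has_field_derivative_at_within[OF DERIV_diff] D(2)[OF mem(2) that] DERIV_cmult_Id)
    show "norm (gy x' t - \<beta>) \<le> \<kappa>" if "t \<in> J" for t using bound(2)[OF mem(2) that] by simp
  qed
  moreover have "g (x, y, z) - g (x', y', z) - (\<alpha> * (x - x') + \<beta> * (y - y')) =
      (g (x, y, z) - \<alpha> * x - (g (x', y, z) - \<alpha> * x')) + (g (x', y, z) - \<beta> * y - (g (x', y', z) - \<beta> * y'))"
    by (simp add: algebra_simps)
  ultimately show ?thesis by (simp add: distrib_left)
qed

text \<open>Cramer's rule bounds the vector by its two images. The constant is normalised to give
  \<open>2 * \<kappa>\<close>, so that a perturbation of the coefficients by \<kappa> still leaves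
  the bound \<kappa>.\<close>

lemma linear_map_lower_bound:
  fixes a b a' b' dx dy :: real
  assumes "b * a' - a * b' \<noteq> 0"
  defines "\<kappa> \<equiv> \<bar>b * a' - a * b'\<bar> / (8 * (\<bar>a\<bar> + \<bar>b\<bar> + \<bar>a'\<bar> + \<bar>b'\<bar>))"
  shows "0 < \<kappa>" "2 * \<kappa> * (\<bar>dx\<bar> + \<bar>dy\<bar>) \<le> \<bar>a * dx + b * dy\<bar> \<or> 2 * \<kappa> * (\<bar>dx\<bar> + \<bar>dy\<bar>) \<le> \<bar>a' * dx + b' * dy\<bar>"
proof -
  define N where "N = \<bar>a\<bar> + \<bar>b\<bar> + \<bar>a'\<bar> + \<bar>b'\<bar>"
  define e where "e = a * dx + b * dy"
  define e' where "e' = a' * dx + b' * dy"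
  let ?d = "b * a' - a * b'"
  have N: "0 < N" using assms(1) unfolding N_def by (cases "a = 0"; cases "b = 0") auto
  then show "0 < \<kappa>" using assms(1) unfolding \<kappa>_def N_def[symmetric] by simp
  have le: "\<bar>a\<bar> \<le> N" "\<bar>b\<bar> \<le> N" "\<bar>a'\<bar> \<le> N" "\<bar>b'\<bar> \<le> N" by (auto simp: N_def)
  have "\<bar>?d\<bar> * \<bar>dx\<bar> = \<bar>b * e' - b' * e\<bar>"
    unfolding abs_mult[symmetric] e_def e'_def by (simp add: algebra_simps)
  also have "\<dots> \<le> \<bar>b\<bar> * \<bar>e'\<bar> + \<bar>b'\<bar> * \<bar>e\<bar>" using abs_triangle_ineq4[of "b * e'" "b' * e"] by (simp add: abs_mult)
  also have "\<dots> \<le> N * \<bar>e'\<bar> + N * \<bar>e\<bar>" using le by (intro add_mono mult_right_mono) auto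
  finally have x: "\<bar>?d\<bar> * \<bar>dx\<bar> \<le> N * \<bar>e'\<bar> + N * \<bar>e\<bar>" .
  have "\<bar>?d\<bar> * \<bar>dy\<bar> = \<bar>a' * e - a * e'\<bar>"
    unfolding abs_mult[symmetric] e_def e'_def by (simp add: algebra_simps)
  also have "\<dots> \<le> \<bar>a'\<bar> * \<bar>e\<bar> + \<bar>a\<bar> * \<bar>e'\<bar>" using abs_triangle_ineq4[of "a' * e" "a * e'"] by (simp add: abs_mult)
  also have "\<dots> \<le> N * \<bar>e\<bar> + N * \<bar>e'\<bar>" using le by (intro add_mono mult_right_mono) auto
  finally have "\<bar>?d\<bar> * (\<bar>dx\<bar> + \<bar>dy\<bar>) \<le> N * (2 * \<bar>e\<bar> + 2 * \<bar>e'\<bar>)" using x by (simp add: distrib_left)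
  moreover have "\<bar>?d\<bar> = 8 * N * \<kappa>" using N unfolding \<kappa>_def N_def[symmetric] by simp
  ultimately have "N * (4 * \<kappa> * (\<bar>dx\<bar> + \<bar>dy\<bar>)) \<le> N * (\<bar>e\<bar> + \<bar>e'\<bar>)" by (simp add: algebra_simps)
  then have "4 * \<kappa> * (\<bar>dx\<bar> + \<bar>dy\<bar>) \<le> \<bar>e\<bar> + \<bar>e'\<bar>" using N by simp
  then show "2 * \<kappa> * (\<bar>dx\<bar> + \<bar>dy\<bar>) \<le> \<bar>a * dx + b * dy\<bar> \<or> 2 * \<kappa> * (\<bar>dx\<bar> + \<bar>dy\<bar>) \<le> \<bar>a' * dx + b' * dy\<bar>"
    unfolding e_def e'_def by linarith
qed

lemma compact_subset_content_pos:
  assumes "A \<in> sets borel" "0 < s" "0 < net_content s A"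
  obtains K where "compact K" "K \<subseteq> A" "0 < net_content s K"
proof -
  obtain t where t: "0 < t" "t < net_content s A" using dense[OF assms(3)] by blast
  have "\<exists>K. compact K \<and> K \<subseteq> A \<and> t \<le> net_content s K"
    by (rule capacitability[OF net_content_mono net_content_incseq net_content_outer_open[OF assms(2)] suslin_borel[OF assms(1)] t(2)])
  then show thesis using t(1) that by (meson order.strict_trans2)
qed

text \<open>Both conclusions are recorded for a compact subset of the image, since finite covers are
  needed. The strict \<open>v + 1 < \<tau>\<close> leaves room for the exponent lost in the energy
  estimate.\<close>

definition image_bounds :: "real \<Rightarrow> real set \<Rightarrow> bool" where
  "image_bounds \<tau> E \<longleftrightarrow> compact E \<and> (2 < \<tau> \<longrightarrow> 0 < emeasure lborel E) \<and>
     (\<forall>v. 0 < v \<longrightarrow> v < 1 \<longrightarrow> v + 1 < \<tau> \<longrightarrow> 0 < net_content v E)"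

lemma isCont_near:
  assumes "isCont g p" "0 < \<epsilon>" shows "\<forall>\<^sub>F q in nhds p. \<bar>g q - g p\<bar> \<le> (\<epsilon> :: real)"
proof -
  have "\<forall>\<^sub>F q in at p. g q \<in> ball (g p) \<epsilon>"
    using assms unfolding isCont_def by (intro topological_tendstoD) auto
  then have "\<forall>\<^sub>F q in nhds p. g q \<in> ball (g p) \<epsilon>" using assms(2) by (simp add: eventually_nhds_conv_at)
  then show ?thesis by eventually_elim (simp add: dist_real_def abs_minus_commute)
qed

text \<open>The condition at \<open>(x, y, z)\<close> says that \<open>(f\<^sub>x, f\<^sub>y)\<close> turns when \<open>z\<close> varies. So a difference vector
  in the \<open>(x, y)\<close>-plane cannot be almost orthogonal to both \<open>(f\<^sub>x, f\<^sub>y)\<close> and its \<open>z\<close>-derivative.\<close>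

lemma image_bounds_near_rotation_point:
  assumes \<Omega>: "open \<Omega>" and f: "analytic3 f \<Omega>" and p: "(x, y, z) \<in> \<Omega>"
    and rot: "partial_y f (x, y, z) * partial_z (partial_x f) (x, y, z) \<noteq> partial_x f (x, y, z) * partial_z (partial_y f) (x, y, z)"
    and borel: "A \<in> sets borel" "B \<in> sets borel" "C \<in> sets borel" and sub: "A \<subseteq> {0..1}" "B \<subseteq> {0..1}" "C \<subseteq> {0..1}"
    and s: "0 < s" "0 < t" "0 < u" "s + t \<le> 2"
    and dens: "\<And>r. 0 < r \<Longrightarrow> 0 < net_content s (A \<inter> ball x r)" "\<And>r. 0 < r \<Longrightarrow> 0 < net_content t (B \<inter> ball y r)"
      "\<And>r. 0 < r \<Longrightarrow> 0 < net_content u (C \<inter> ball z r)"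
  shows "\<exists>E \<subseteq> f ` (A \<times> B \<times> C). image_bounds (s + t + u) E"
proof -
  let ?p = "(x, y, z)"
  define a where "a = partial_x f ?p"
  define b where "b = partial_y f ?p"
  define a' where "a' = partial_x (partial_z f) ?p"
  define b' where "b' = partial_y (partial_z f) ?p"
  note an = analytic3_partials[OF f]
  note anz = analytic3_partials[OF an(3)]
  note anzz = analytic3_partials[OF anz(3)]
  \<comment> \<open>By symmetry of second derivatives \<open>a'\<close> and \<open>b'\<close> are
    the \<open>z\<close>-derivatives of f_x and f_y, so the turning condition is a nonzero
    determinant.\<close>
  have det: "b * a' - a * b' \<noteq> 0"
    using rot analytic3_mixed[OF f p] by (simp add: a_def b_def a'_def b'_def)
  define \<kappa> where "\<kappa> = \<bar>b * a' - a * b'\<bar> / (8 * (\<bar>a\<bar> + \<bar>b\<bar> + \<bar>a'\<bar> + \<bar>b'\<bar>))"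
  have \<kappa>: "0 < \<kappa>" "2 * \<kappa> * (\<bar>dx\<bar> + \<bar>dy\<bar>) \<le> \<bar>a * dx + b * dy\<bar> \<or> 2 * \<kappa> * (\<bar>dx\<bar> + \<bar>dy\<bar>) \<le> \<bar>a' * dx + b' * dy\<bar>" for dx dy
    unfolding \<kappa>_def by (rule linear_map_lower_bound[OF det])+
  have near: "\<forall>\<^sub>F q in nhds ?p. \<bar>g q - g ?p\<bar> \<le> \<epsilon>" if "analytic3 g \<Omega>" "0 < \<epsilon>" for g \<epsilon>
    using isCont_near[OF analytic3_continuous[OF that(1) p] that(2)] .
  have "\<forall>\<^sub>F q in nhds ?p. q \<in> \<Omega> \<and>
      (\<bar>partial_x f q - a\<bar> \<le> \<kappa> \<and> \<bar>partial_y f q - b\<bar> \<le> \<kappa>) \<and>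
      (\<bar>partial_x (partial_z f) q - a'\<bar> \<le> \<kappa> \<and> \<bar>partial_y (partial_z f) q - b'\<bar> \<le> \<kappa>) \<and>
      (\<bar>f q - f ?p\<bar> \<le> 1 \<and> \<bar>partial_z f q - partial_z f ?p\<bar> \<le> 1 \<and> \<bar>partial_z (partial_z f) q - partial_z (partial_z f) ?p\<bar> \<le> 1) \<and>
      (\<bar>partial_x (partial_z (partial_z f)) q - partial_x (partial_z (partial_z f)) ?p\<bar> \<le> 1 \<and>
       \<bar>partial_y (partial_z (partial_z f)) q - partial_y (partial_z (partial_z f)) ?p\<bar> \<le> 1)"
    unfolding a_def b_def a'_def b'_def
    by (intro eventually_conj near an anz anzz f \<kappa>(1) zero_less_one eventually_nhds_in_open[OF \<Omega> p])
  then obtain V where V: "open V" "?p \<in> V" and Vq: "\<And>q. q \<in> V \<Longrightarrow> q \<in> \<Omega> \<and>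
      (\<bar>partial_x f q - a\<bar> \<le> \<kappa> \<and> \<bar>partial_y f q - b\<bar> \<le> \<kappa>) \<and>
      (\<bar>partial_x (partial_z f) q - a'\<bar> \<le> \<kappa> \<and> \<bar>partial_y (partial_z f) q - b'\<bar> \<le> \<kappa>) \<and>
      (\<bar>f q - f ?p\<bar> \<le> 1 \<and> \<bar>partial_z f q - partial_z f ?p\<bar> \<le> 1 \<and> \<bar>partial_z (partial_z f) q - partial_z (partial_z f) ?p\<bar> \<le> 1) \<and>
      (\<bar>partial_x (partial_z (partial_z f)) q - partial_x (partial_z (partial_z f)) ?p\<bar> \<le> 1 \<and>
       \<bar>partial_y (partial_z (partial_z f)) q - partial_y (partial_z (partial_z f)) ?p\<bar> \<le> 1)"
    unfolding eventually_nhds by blast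
  have V_in: "q \<in> \<Omega>" and Va: "\<bar>partial_x f q - a\<bar> \<le> \<kappa>" and Vb: "\<bar>partial_y f q - b\<bar> \<le> \<kappa>"
    and Va': "\<bar>partial_x (partial_z f) q - a'\<bar> \<le> \<kappa>" and Vb': "\<bar>partial_y (partial_z f) q - b'\<bar> \<le> \<kappa>"
    and Vf: "\<bar>f q - f ?p\<bar> \<le> 1" and Vz: "\<bar>partial_z f q - partial_z f ?p\<bar> \<le> 1"
    and Vzz: "\<bar>partial_z (partial_z f) q - partial_z (partial_z f) ?p\<bar> \<le> 1"
    and Vzzx: "\<bar>partial_x (partial_z (partial_z f)) q - partial_x (partial_z (partial_z f)) ?p\<bar> \<le> 1"
    and Vzzy: "\<bar>partial_y (partial_z (partial_z f)) q - partial_y (partial_z (partial_z f)) ?p\<bar> \<le> 1" if "q \<in> V" for q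
    using Vq[OF that] by blast+
  obtain e0 where e0: "0 < e0" "\<And>x' y' z'. \<bar>x' - x\<bar> < e0 \<Longrightarrow> \<bar>y' - y\<bar> < e0 \<Longrightarrow> \<bar>z' - z\<bar> < e0 \<Longrightarrow> (x', y', z') \<in> V"
    using open_real3_box[OF V] by blast
  define e where "e = min e0 (1 / 4)"
  \<comment> \<open>The bound 1/4 keeps the taxi distances in the box of side \<open>2 * e\<close>
    below 1, as the dyadic kernel estimate requires.\<close>
  have e: "0 < e" "e \<le> e0" "e \<le> 1 / 4" using e0 by (auto simp: e_def)
  define K where "K = 1 + \<bar>partial_z f ?p\<bar> + \<bar>partial_z (partial_z f) ?p\<bar> + \<bar>partial_x (partial_z (partial_z f)) ?p\<bar>
    + \<bar>partial_y (partial_z (partial_z f)) ?p\<bar>"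
  let ?I = "ball x e" and ?J = "ball y e" and ?z1 = "z - e / 2" and ?z2 = "z + e / 2"
  have inV: "(x', y', z') \<in> V" if "x' \<in> ?I" "y' \<in> ?J" "z' \<in> {?z1..?z2}" for x' y' z'
    using that e by (intro e0(2)) (auto simp: dist_real_def abs_minus_commute)
  note in\<Omega> = V_in[OF inV]
  define F where "F w q = f (fst q, snd q, w)" for w and q :: "real \<times> real"
  define F1 where "F1 w q = partial_z f (fst q, snd q, w)" for w and q :: "real \<times> real"
  define F2 where "F2 w q = partial_z (partial_z f) (fst q, snd q, w)" for w and q :: "real \<times> real"
  note diffs = partial_difference_bound[OF convex_ball convex_ball]
  interpret phase F F1 F2 "?I \<times> ?J" taxi ?z1 ?z2 \<kappa> K 2
  proof
    show "?z1 < ?z2" "0 < \<kappa>" "0 \<le> K" "(0 :: real) \<le> 2" using e \<kappa> by (auto simp: K_def)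
    show "0 \<le> taxi q q'" for q q' by simp
    fix q w assume q: "q \<in> ?I \<times> ?J" and w: "w \<in> {?z1..?z2}"
    then have q': "fst q \<in> ?I" "snd q \<in> ?J" by auto
    show "((\<lambda>w. F w q) has_real_derivative F1 w q) (at w)" "((\<lambda>w. F1 w q) has_real_derivative F2 w q) (at w)"
      unfolding F_def F1_def F2_def using in\<Omega>[OF q' w] by (intro analytic3_deriv(3)[OF f] analytic3_deriv(3)[OF an(3)]; simp)+
    show "\<bar>F1 w q\<bar> \<le> K" "\<bar>F2 w q\<bar> \<le> K"
      using Vz[OF inV[OF q' w]] Vzz[OF inV[OF q' w]] unfolding F1_def F2_def K_def by linarith+
    fix q2 assume q2: "q2 \<in> ?I \<times> ?J"
    then have q2': "fst q2 \<in> ?I" "snd q2 \<in> ?J" by auto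
    show "\<bar>F w q - F w q2\<bar> \<le> 2" using Vf[OF inV[OF q' w]] Vf[OF inV[OF q2' w]] unfolding F_def by linarith
    have "\<bar>partial_z (partial_z f) (fst q, snd q, w) - partial_z (partial_z f) (fst q2, snd q2, w)
        - (0 * (fst q - fst q2) + 0 * (snd q - snd q2))\<bar> \<le> K * taxi q q2"
    proof (rule diffs)
      fix x' y' assume xy: "x' \<in> ?I" "y' \<in> ?J"
      note V' = inV[OF xy w]
      show "((\<lambda>t. partial_z (partial_z f) (t, y', w)) has_real_derivative partial_x (partial_z (partial_z f)) (x', y', w)) (at x')"
        "((\<lambda>t. partial_z (partial_z f) (x', t, w)) has_real_derivative partial_y (partial_z (partial_z f)) (x', y', w)) (at y')"
        using V_in[OF V'] by (intro analytic3_deriv[OF anz(3)]; blast)+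
      show "\<bar>partial_x (partial_z (partial_z f)) (x', y', w) - 0\<bar> \<le> K" "\<bar>partial_y (partial_z (partial_z f)) (x', y', w) - 0\<bar> \<le> K"
        using Vzzx[OF V'] Vzzy[OF V'] unfolding K_def by linarith+
    qed (use q' q2' in auto)
    then show "\<bar>F2 w q - F2 w q2\<bar> \<le> K * taxi q q2" by (simp add: F2_def)
  next
    fix q q2 assume q: "q \<in> ?I \<times> ?J" "q2 \<in> ?I \<times> ?J"
    then have q': "fst q \<in> ?I" "snd q \<in> ?J" "fst q2 \<in> ?I" "snd q2 \<in> ?J" by auto
    let ?dx = "fst q - fst q2" and ?dy = "snd q - snd q2"
    have d0: "\<bar>F w q - F w q2 - (a * ?dx + b * ?dy)\<bar> \<le> \<kappa> * taxi q q2" if w: "w \<in> {?z1..?z2}" for w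
      unfolding F_def
    proof (rule diffs)
      fix x' y' assume xy: "x' \<in> ?I" "y' \<in> ?J"
      note V' = inV[OF xy w]
      show "((\<lambda>t. f (t, y', w)) has_real_derivative partial_x f (x', y', w)) (at x')"
        "((\<lambda>t. f (x', t, w)) has_real_derivative partial_y f (x', y', w)) (at y')"
        using V_in[OF V'] by (intro analytic3_deriv[OF f]; blast)+
      show "\<bar>partial_x f (x', y', w) - a\<bar> \<le> \<kappa>" "\<bar>partial_y f (x', y', w) - b\<bar> \<le> \<kappa>" by (fact Va[OF V'] Vb[OF V'])+
    qed (use q' in auto)
    have d1: "\<bar>F1 w q - F1 w q2 - (a' * ?dx + b' * ?dy)\<bar> \<le> \<kappa> * taxi q q2" if w: "w \<in> {?z1..?z2}" for w
      unfolding F1_def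
    proof (rule diffs)
      fix x' y' assume xy: "x' \<in> ?I" "y' \<in> ?J"
      note V' = inV[OF xy w]
      show "((\<lambda>t. partial_z f (t, y', w)) has_real_derivative partial_x (partial_z f) (x', y', w)) (at x')"
        "((\<lambda>t. partial_z f (x', t, w)) has_real_derivative partial_y (partial_z f) (x', y', w)) (at y')"
        using V_in[OF V'] by (intro analytic3_deriv[OF an(3)]; blast)+
      show "\<bar>partial_x (partial_z f) (x', y', w) - a'\<bar> \<le> \<kappa>" "\<bar>partial_y (partial_z f) (x', y', w) - b'\<bar> \<le> \<kappa>" by (fact Va'[OF V'] Vb'[OF V'])+
    qed (use q' in auto)
    have "2 * (\<kappa> * taxi q q2) \<le> \<bar>a * ?dx + b * ?dy\<bar> \<or> 2 * (\<kappa> * taxi q q2) \<le> \<bar>a' * ?dx + b' * ?dy\<bar>"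
      using \<kappa>(2)[of ?dx ?dy] by (simp add: mult.assoc)
    moreover have abs_cases: "r \<le> v \<or> v \<le> - r" if "r \<le> \<bar>v\<bar>" for r v :: real using that by linarith
    ultimately consider "2 * (\<kappa> * taxi q q2) \<le> \<bar>a * ?dx + b * ?dy\<bar>" | "2 * (\<kappa> * taxi q q2) \<le> a' * ?dx + b' * ?dy"
      | "a' * ?dx + b' * ?dy \<le> - (2 * (\<kappa> * taxi q q2))"
      using abs_cases[of "2 * (\<kappa> * taxi q q2)" "a' * ?dx + b' * ?dy"] by blast
    then show "(\<forall>w\<in>{?z1..?z2}. \<kappa> * taxi q q2 \<le> \<bar>F w q - F w q2\<bar>) \<or>
      (\<forall>w\<in>{?z1..?z2}. \<kappa> * taxi q q2 \<le> F1 w q - F1 w q2) \<or> (\<forall>w\<in>{?z1..?z2}. F1 w q - F1 w q2 \<le> - (\<kappa> * taxi q q2))"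
    proof cases
      case 1
      have "r \<le> \<bar>v\<bar>" if "\<bar>v - m\<bar> \<le> r" "2 * r \<le> \<bar>m\<bar>" for r v m :: real using that by linarith
      from this[OF d0 1] show ?thesis by blast
    next
      case 2
      have "r \<le> v" if "\<bar>v - m\<bar> \<le> r" "2 * r \<le> m" for r v m :: real using that by linarith
      from this[OF d1 2] show ?thesis by blast
    next
      case 3
      have "v \<le> - r" if "\<bar>v - m\<bar> \<le> r" "m \<le> - (2 * r)" for r v m :: real using that by linarith
      from this[OF d1 3] show ?thesis by blast
    qed
  qed
  \<comment> \<open>With e / 8 the ball around \<open>z\<close> fits inside the interval shortened
    by \<eta> on the left and \<open>2 * \<eta>\<close> on the right.\<close>
  define \<eta> where "\<eta> = e / 8"
  have \<eta>: "0 < \<eta>" "ball z \<eta> \<subseteq> {?z1 + \<eta>..?z2 - 2 * \<eta>}"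
  proof -
    show "0 < \<eta>" using e(1) by (simp add: \<eta>_def)
    show "ball z \<eta> \<subseteq> {?z1 + \<eta>..?z2 - 2 * \<eta>}"
    proof
      fix w assume "w \<in> ball z \<eta>"
      then have "\<bar>z - w\<bar> < \<eta>" by (simp add: dist_real_def)
      then show "w \<in> {?z1 + \<eta>..?z2 - 2 * \<eta>}"
        using \<eta>_def unfolding atLeastAtMost_iff by (intro conjI; linarith)
    qed
  qed
  have bor: "A \<inter> ball x e \<in> sets borel" "B \<inter> ball y e \<in> sets borel" "C \<inter> ball z \<eta> \<in> sets borel" using borel by auto
  obtain X where X: "compact X" "X \<subseteq> A \<inter> ball x e" "0 < net_content s X"
    using compact_subset_content_pos[OF bor(1) s(1) dens(1)[OF e(1)]] .
  obtain Y where Y: "compact Y" "Y \<subseteq> B \<inter> ball y e" "0 < net_content t Y"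
    using compact_subset_content_pos[OF bor(2) s(2) dens(2)[OF e(1)]] .
  obtain Z where Z: "compact Z" "Z \<subseteq> C \<inter> ball z \<eta>" "0 < net_content u Z"
    using compact_subset_content_pos[OF bor(3) s(3) dens(3)[OF \<eta>(1)]] .
  have small: "taxi q q' \<le> 1" if "q \<in> ?I \<times> ?J" "q' \<in> ?I \<times> ?J" for q q'
  proof -
    have "\<bar>x - fst q\<bar> < e" "\<bar>y - snd q\<bar> < e" "\<bar>x - fst q'\<bar> < e" "\<bar>y - snd q'\<bar> < e"
      using that by (auto simp: mem_Times_iff dist_real_def)
    then show ?thesis using e(3) by linarith
  qed
  have cont: "continuous_on (X \<times> Y \<times> Z) f"
  proof (intro continuous_at_imp_continuous_on ballI)
    fix q assume "q \<in> X \<times> Y \<times> Z"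
    then show "isCont f q" using X(2) Y(2) Z(2) \<eta> by (intro analytic3_continuous[OF f]) (auto intro!: in\<Omega>)
  qed
  define E where "E = f ` (X \<times> Y \<times> Z)"
  have E: "compact E" unfolding E_def using X(1) Y(1) Z(1) by (intro compact_continuous_image[OF cont] compact_Times)
  have prem: "X \<subseteq> {0..1}" "Y \<subseteq> {0..1}" "Z \<subseteq> {0..1}" "X \<times> Y \<subseteq> ?I \<times> ?J" "Z \<subseteq> {?z1 + \<eta>..?z2 - 2 * \<eta>}"
    using X(2) Y(2) Z(2) sub \<eta>(2) by auto
  have mem: "F w (x', y') \<in> E" if "x' \<in> X" "y' \<in> Y" "w \<in> Z" for x' y' w using that by (auto simp: F_def E_def)
  have "0 < emeasure lborel E" if "2 < s + t + u"
    by (rule image_measure_positive[OF phase_axioms small \<eta>(1) s(4) prem(1) X(3) prem(2) Y(3) prem(3) Z(3) prem(4,5) E mem that])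
  moreover have "0 < net_content v E" if "0 < v" "v < 1" "v + 1 < s + t + u" for v
    by (rule image_content_positive[OF phase_axioms small \<eta>(1) s(4) prem(1) X(3) prem(2) Y(3) prem(3) Z(3) prem(4,5) E mem that])
  moreover have "E \<subseteq> f ` (A \<times> B \<times> C)" unfolding E_def using X(2) Y(2) Z(2) by (intro image_mono) auto
  ultimately show ?thesis using E unfolding image_bounds_def by blast
qed

section \<open>From identities on the three sets to identities on the whole region\<close>

lemma analytic1_zero_from_infinite:
  assumes \<phi>: "\<And>t. t \<in> {0..1} \<Longrightarrow> analytic1 \<phi> t" and A: "infinite A" "A \<subseteq> {0..1}" "\<And>t. t \<in> A \<Longrightarrow> \<phi> t = 0"
    and t: "t \<in> {0..1}"
  shows "\<phi> t = 0"
proof -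
  obtain t0 where t0: "t0 \<in> {0..1}" "t0 islimpt A"
    using Heine_Borel_imp_Bolzano_Weierstrass[OF compact_Icc A(1,2)] by blast
  have "t0 islimpt {s. \<phi> s = 0}" using t0(2) by (rule islimpt_subset) (use A(3) in blast)
  then show ?thesis using analytic1_identity[OF connected_Icc \<phi> t0(1) _ t] by blast
qed

text \<open>The one-variable identity theorem is applied in each coordinate in turn, which gives
  vanishing on the cube; analyticity along segments then spreads it over the connected
  region.\<close>

lemma vanishes_if_zero_on_infinite_box:
  fixes D :: "real \<times> real \<times> real \<Rightarrow> real"
  assumes \<Omega>: "open \<Omega>" "connected \<Omega>" and cube: "{0..1} \<times> {0..1} \<times> {0..1} \<subseteq> \<Omega>"
    and D: "\<And>q v t. q + t *\<^sub>R v \<in> \<Omega> \<Longrightarrow> analytic1 (\<lambda>t. D (q + t *\<^sub>R v)) t"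
    and inf: "infinite A" "infinite B" "infinite C" and sub: "A \<subseteq> {0..1}" "B \<subseteq> {0..1}" "C \<subseteq> {0..1}"
    and zero: "\<And>a b c. a \<in> A \<Longrightarrow> b \<in> B \<Longrightarrow> c \<in> C \<Longrightarrow> D (a, b, c) = 0"
    and p: "p \<in> \<Omega>"
  shows "D p = 0"
proof -
  have an: "analytic1 (\<lambda>t. D (t, b, c)) a" "analytic1 (\<lambda>t. D (a, t, c)) b" "analytic1 (\<lambda>t. D (a, b, t)) c"
    if "a \<in> {0..1}" "b \<in> {0..1}" "c \<in> {0..1}" for a b c
  proof -
    have "(a, b, c) \<in> \<Omega>" using cube that by blast
    then show "analytic1 (\<lambda>t. D (t, b, c)) a" "analytic1 (\<lambda>t. D (a, t, c)) b" "analytic1 (\<lambda>t. D (a, b, t)) c"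
      using D[of "(0, b, c)" a "(1, 0, 0)"] D[of "(a, 0, c)" b "(0, 1, 0)"] D[of "(a, b, 0)" c "(0, 0, 1)"] by simp_all
  qed
  have 1: "D (x, b, c) = 0" if "x \<in> {0..1}" "b \<in> B" "c \<in> C" for x b c
    by (rule analytic1_zero_from_infinite[where \<phi> = "\<lambda>t. D (t, b, c)", OF _ inf(1) sub(1) _ that(1)])
      (use an(1) zero subsetD[OF sub(2) that(2)] subsetD[OF sub(3) that(3)] that(2,3) in blast)+
  have 2: "D (x, y, c) = 0" if "x \<in> {0..1}" "y \<in> {0..1}" "c \<in> C" for x y c
    by (rule analytic1_zero_from_infinite[where \<phi> = "\<lambda>t. D (x, t, c)", OF _ inf(2) sub(2) _ that(2)])
      (use an(2) 1 that(1) subsetD[OF sub(3) that(3)] that(1,3) in blast)+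
  have 3: "D (x, y, z) = 0" if "x \<in> {0..1}" "y \<in> {0..1}" "z \<in> {0..1}" for x y z
    by (rule analytic1_zero_from_infinite[where \<phi> = "\<lambda>t. D (x, y, t)", OF _ inf(3) sub(3) _ that(3)])
      (use an(3) 2 that(1,2) that(1,2) in blast)+
  define W where "W = {p. \<forall>\<^sub>F q in nhds p. D q = 0}"
  have "open W"
    unfolding open_subopen[of W]
  proof
    fix p assume "p \<in> W"
    then have "\<forall>\<^sub>F q in nhds p. q \<in> W" by (simp add: W_def eventually_eventually)
    then show "\<exists>T. open T \<and> p \<in> T \<and> T \<subseteq> W" unfolding eventually_nhds by blast
  qed
  then have "openin (top_of_set \<Omega>) (\<Omega> \<inter> W)" by (simp add: openin_open_Int)
  moreover have "closedin (top_of_set \<Omega>) (\<Omega> \<inter> W)"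
    unfolding closedin_limpt
  proof (intro conjI allI impI)
    fix p assume p: "p islimpt \<Omega> \<inter> W \<and> p \<in> \<Omega>"
    obtain r where r: "0 < r" "ball p r \<subseteq> \<Omega>" using \<Omega>(1) p open_contains_ball by blast
    have "\<exists>q\<in>\<Omega> \<inter> W. q \<noteq> p \<and> dist q p < r" using p r(1) unfolding islimpt_approachable by blast
    then obtain q where q: "q \<in> W" "q \<in> ball p r" by (auto simp: dist_commute)
    have "D y = 0" if y: "y \<in> ball p r" for y
    proof -
      let ?\<phi> = "\<lambda>t. D (q + t *\<^sub>R (y - q))"
      have seg: "q + t *\<^sub>R (y - q) \<in> ball p r" if "t \<in> {0..1}" for t
        using convexD_alt[OF convex_ball q(2) y, of t] that by (simp add: algebra_simps)
      have "((\<lambda>t. q + t *\<^sub>R (y - q)) \<longlongrightarrow> q + 0 *\<^sub>R (y - q)) (nhds 0)"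
        by (intro tendsto_intros filterlim_ident)
      then have "filterlim (\<lambda>t. q + t *\<^sub>R (y - q)) (nhds q) (nhds (0 :: real))" by simp
      then have "\<forall>\<^sub>F t in nhds (0 :: real). ?\<phi> t = 0"
        using q(1) unfolding W_def mem_Collect_eq by (rule eventually_compose_filterlim[rotated])
      then obtain T where T: "open T" "0 \<in> T" "T \<subseteq> {t. ?\<phi> t = 0}" unfolding eventually_nhds by blast
      have "0 islimpt T" using interior_limit_point[of 0 T] T(1,2) by (simp add: interior_open)
      then have "0 islimpt {t. ?\<phi> t = 0}" using T(3) by (rule islimpt_subset)
      moreover have "analytic1 ?\<phi> t" if "t \<in> {0..1}" for t using seg[OF that] r(2) by (intro D) blast
      ultimately have "?\<phi> 1 = 0" by (intro analytic1_identity[of "{0..1}" ?\<phi> 0 1]) auto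
      then show ?thesis by simp
    qed
    then have "\<forall>\<^sub>F y in nhds p. D y = 0"
      using eventually_nhds_in_open[OF open_ball, of p p r] r(1) by (auto elim: eventually_mono)
    then show "p \<in> \<Omega> \<inter> W" using p by (simp add: W_def)
  qed simp
  moreover have "(1 / 2, 1 / 2, 1 / 2) \<in> \<Omega> \<inter> W"
  proof -
    have "\<forall>\<^sub>F q in nhds (1 / 2, 1 / 2, 1 / 2). D q = 0"
    proof (rule eventually_nhds_real3[of "1 / 2"])
      fix x y z :: real assume "\<bar>x - 1 / 2\<bar> < 1 / 2" "\<bar>y - 1 / 2\<bar> < 1 / 2" "\<bar>z - 1 / 2\<bar> < 1 / 2"
      then have "x \<in> {0..1}" "y \<in> {0..1}" "z \<in> {0..1}" unfolding atLeastAtMost_iff by linarith+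
      then show "D (x, y, z) = 0" by (rule 3)
    qed simp
    moreover have "(1 / 2, 1 / 2, 1 / 2) \<in> \<Omega>" using cube by (rule subsetD) simp
    ultimately show ?thesis by (simp add: W_def)
  qed
  ultimately have "\<Omega> \<inter> W = \<Omega>" using \<Omega>(2) unfolding connected_clopen by blast
  then have "p \<in> W" using p by blast
  then show ?thesis unfolding W_def by (auto dest: eventually_nhds_x_imp_x)
qed

text \<open>Every other point of \<open>A\<close> lies in a rational interval that meets
  \<open>A\<close> in content zero. There are countably many such intervals, and finite sets have
  content zero, so finitely many density points would make \<open>A\<close> null.\<close>

lemma infinite_density_points:
  assumes s: "0 < s" and A: "0 < net_content s A"
  shows "infinite {a \<in> A. \<forall>r>0. 0 < net_content s (A \<inter> ball a r)}" (is "infinite ?G")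
proof
  assume "finite ?G"
  then have G: "net_content s ?G = 0" by (rule net_content_finite[OF s])
  define I where "I = {q :: rat \<times> rat. net_content s (A \<inter> {of_rat (fst q)<..<of_rat (snd q)}) = 0}"
  have "countable I" by (rule countableI_type)
  then have "net_content s (\<Union>q\<in>I. A \<inter> {of_rat (fst q)<..<of_rat (snd q)}) = 0"
    by (rule net_content_countable_union_zero) (simp add: I_def)
  moreover have "A \<subseteq> (\<Union>q\<in>I. A \<inter> {of_rat (fst q)<..<of_rat (snd q)}) \<union> ?G"
  proof
    fix a assume a: "a \<in> A"
    show "a \<in> (\<Union>q\<in>I. A \<inter> {of_rat (fst q)<..<of_rat (snd q)}) \<union> ?G"
    proof (cases "a \<in> ?G")
      case False
      then obtain r where r: "0 < r" "net_content s (A \<inter> ball a r) = 0" using a by (auto simp: not_less)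
      obtain q1 where q1: "a - r < of_rat q1" "of_rat q1 < a" using of_rat_dense[of "a - r" a] r(1) by auto
      obtain q2 where q2: "a < of_rat q2" "of_rat q2 < a + r" using of_rat_dense[of a "a + r"] r(1) by auto
      have "net_content s (A \<inter> {of_rat q1<..<of_rat q2}) \<le> net_content s (A \<inter> ball a r)"
        using q1 q2 by (intro net_content_mono) (auto simp: dist_real_def)
      then have "(q1, q2) \<in> I" using r(2) by (simp add: I_def)
      then show ?thesis using a q1 q2 by (intro UnI1 UN_I[of "(q1, q2)"]) auto
    qed simp
  qed
  then have "net_content s A \<le> net_content s ((\<Union>q\<in>I. A \<inter> {of_rat (fst q)<..<of_rat (snd q)}) \<union> ?G)" by (rule net_content_mono)
  moreover note net_content_Un[of s "\<Union>q\<in>I. A \<inter> {of_rat (fst q)<..<of_rat (snd q)}" ?G]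
  ultimately have "net_content s A \<le> 0" using G by simp
  then show False using A by simp
qed

lemma image_bounds_if_not_special_form:
  assumes \<Omega>: "open \<Omega>" "connected \<Omega>" and cube: "{0..1} \<times> {0..1} \<times> {0..1} \<subseteq> \<Omega>"
    and f: "real_analytic_on f \<Omega>" and nonspecial: "\<not> analytic_special_form f \<Omega>"
    and borel: "A \<in> sets borel" "B \<in> sets borel" "C \<in> sets borel" and sub: "A \<subseteq> {0..1}" "B \<subseteq> {0..1}" "C \<subseteq> {0..1}"
    and s: "0 < s" "s \<le> 1" "0 < t" "t \<le> 1" "0 < u" "u \<le> 1"
    and pos: "0 < net_content s A" "0 < net_content t B" "0 < net_content u C"
  shows "\<exists>E \<subseteq> f ` (A \<times> B \<times> C). image_bounds (s + t + u) E"
proof -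
  have f3: "analytic3 f \<Omega>" using f by (rule analytic3_if_real_analytic_on)
  note an = analytic3_partials[OF f3]
  note an2 = analytic3_partials[OF an(1)] analytic3_partials[OF an(2)]
  let ?G = "\<lambda>s A. {a \<in> A. \<forall>r>0. 0 < net_content s (A \<inter> ball a r)}"
  \<comment> \<open>\<open>D1\<close> measures the turning of (f_x, f_y) in \<open>z\<close>,
    \<open>D2\<close> that of (f_z, f_y) in \<open>x\<close>. Together their vanishing on \<Omega>
    makes \<open>f\<close> a special form.\<close>
  define D1 where "D1 p = partial_y f p * partial_z (partial_x f) p - partial_x f p * partial_z (partial_y f) p" for p
  define D2 where "D2 p = partial_y f p * partial_z (partial_x f) p - partial_z f p * partial_y (partial_x f) p" for p
  have zero: "D p = 0" if "D = D1 \<or> D = D2" "\<And>a b c. a \<in> ?G s A \<Longrightarrow> b \<in> ?G t B \<Longrightarrow> c \<in> ?G u C \<Longrightarrow> D (a, b, c) = 0" "p \<in> \<Omega>" for D p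
  proof (rule vanishes_if_zero_on_infinite_box[OF \<Omega> cube])
    show "infinite (?G s A)" "infinite (?G t B)" "infinite (?G u C)" by (intro infinite_density_points s pos)+
    show "?G s A \<subseteq> {0..1}" "?G t B \<subseteq> {0..1}" "?G u C \<subseteq> {0..1}" using sub by auto
    show "D (a, b, c) = 0" if "a \<in> ?G s A" "b \<in> ?G t B" "c \<in> ?G u C" for a b c by (rule \<open>\<And>c b a. _ \<Longrightarrow> _ \<Longrightarrow> _ \<Longrightarrow> D (a, b, c) = 0\<close>[OF that])
    show "analytic1 (\<lambda>t. D (q + t *\<^sub>R v)) t" if "q + t *\<^sub>R v \<in> \<Omega>" for q v t
    proof -
      note lines = an[THEN analytic3_line, OF that] an2[THEN analytic3_line, OF that]
      have "analytic1 (\<lambda>t. D1 (q + t *\<^sub>R v)) t" "analytic1 (\<lambda>t. D2 (q + t *\<^sub>R v)) t"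
        unfolding D1_def D2_def by (intro analytic1_diff analytic1_mult lines)+
      then show ?thesis using \<open>D = D1 \<or> D = D2\<close> by blast
    qed
  qed (fact that(3))
  have "\<exists>D. (D = D1 \<or> D = D2) \<and> (\<exists>a\<in>?G s A. \<exists>b\<in>?G t B. \<exists>c\<in>?G u C. D (a, b, c) \<noteq> 0)"
  proof (rule ccontr)
    assume "\<not> ?thesis"
    then have "D1 (a, b, c) = 0" "D2 (a, b, c) = 0" if "a \<in> ?G s A" "b \<in> ?G t B" "c \<in> ?G u C" for a b c
      using that by blast+
    then have "D1 p = 0" "D2 p = 0" if "p \<in> \<Omega>" for p using zero[of D1 p] zero[of D2 p] that by blast+
    then have "analytic_special_form f \<Omega>"
      by (intro analytic_special_form_if[OF \<Omega>(1) f]) (auto simp: D1_def D2_def)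
    then show False using nonspecial by blast
  qed
  then obtain D a b c where D: "D = D1 \<or> D = D2" and abc: "a \<in> ?G s A" "b \<in> ?G t B" "c \<in> ?G u C" and nz: "D (a, b, c) \<noteq> 0"
    by (elim exE conjE bexE)
  have mem: "(a, b, c) \<in> \<Omega>" using abc sub cube by blast
  from D show ?thesis
  proof
    assume "D = D1"
    then have "partial_y f (a, b, c) * partial_z (partial_x f) (a, b, c) \<noteq> partial_x f (a, b, c) * partial_z (partial_y f) (a, b, c)"
      using nz by (simp add: D1_def)
    then show ?thesis
      by (rule image_bounds_near_rotation_point[OF \<Omega>(1) f3 mem _ borel sub]) (use s abc in auto)
  next
    \<comment> \<open>Swapping \<open>x\<close> and \<open>z\<close> turns this condition into that
      of the first case, with \<open>A\<close> and \<open>C\<close> exchanged.\<close>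
    assume "D = D2"
    then have rot: "partial_y (f \<circ> swap_xz) (c, b, a) * partial_z (partial_x (f \<circ> swap_xz)) (c, b, a) \<noteq>
      partial_x (f \<circ> swap_xz) (c, b, a) * partial_z (partial_y (f \<circ> swap_xz)) (c, b, a)"
      using nz analytic3_mixed[OF f3 mem] by (simp add: D2_def partial_comp_swap)
    have "swap_xz ` \<Omega> = swap_xz -` \<Omega>" by force
    moreover have "open (swap_xz -` \<Omega>)"
      unfolding swap_xz_def split_beta using \<Omega>(1) by (intro open_vimage continuous_intros)
    ultimately have op: "open (swap_xz ` \<Omega>)" by simp
    have mem': "(c, b, a) \<in> swap_xz ` \<Omega>" using imageI[OF mem, of swap_xz] by simp
    have "\<exists>E \<subseteq> (f \<circ> swap_xz) ` (C \<times> B \<times> A). image_bounds (u + t + s) E"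
      by (rule image_bounds_near_rotation_point[OF op analytic3_swap(2)[OF f3] mem' rot borel(3,2,1) sub(3,2,1)]) (use s abc in auto)
    moreover have "(f \<circ> swap_xz) ` (C \<times> B \<times> A) = f ` (A \<times> B \<times> C)" by (force simp: image_iff)
    ultimately show ?thesis by (simp add: add_ac)
  qed
qed

lemma exponents_below:
  fixes \<alpha> \<beta> \<gamma> \<tau> :: real
  assumes "0 < \<alpha>" "0 < \<beta>" "0 < \<gamma>" "\<tau> < \<alpha> + \<beta> + \<gamma>"
  obtains s t u where "0 < s" "s < \<alpha>" "0 < t" "t < \<beta>" "0 < u" "u < \<gamma>" "\<tau> < s + t + u"
proof -
  \<comment> \<open>A quarter of the gap, since the three exponents together lose
    \<open>3 * \<epsilon>\<close>.\<close>
  define \<epsilon> where "\<epsilon> = min (min (\<alpha> / 2) (\<beta> / 2)) (min (\<gamma> / 2) ((\<alpha> + \<beta> + \<gamma> - \<tau>) / 4))"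
  have "0 < \<epsilon>" using assms by (simp add: \<epsilon>_def)
  moreover have "\<epsilon> \<le> \<alpha> / 2" "\<epsilon> \<le> \<beta> / 2" "\<epsilon> \<le> \<gamma> / 2" "\<epsilon> \<le> (\<alpha> + \<beta> + \<gamma> - \<tau>) / 4"
    unfolding \<epsilon>_def by (simp_all only: min_le_iff_disj order_refl simp_thms)
  ultimately show ?thesis using assms by (intro that[of "\<alpha> - \<epsilon>" "\<beta> - \<epsilon>" "\<gamma> - \<epsilon>"]) auto
qed

theorem theorem1p8:
  fixes \<Omega> :: "(real \<times> real \<times> real) set"
    and f :: "real \<times> real \<times> real \<Rightarrow> real"
    and \<alpha> \<beta> \<gamma> :: real
  assumes "open \<Omega>" and "connected \<Omega>"
    and "{0..1} \<times> {0..1} \<times> {0..1} \<subseteq> \<Omega>"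
    and "\<alpha> \<in> {0<..1}" and "\<beta> \<in> {0<..1}" and "\<gamma> \<in> {0<..1}"
    and "real_analytic_on f \<Omega>"
    and "\<not> (\<forall>p\<in>\<Omega>. partial_x f p = 0)"
    and "\<not> (\<forall>p\<in>\<Omega>. partial_y f p = 0)"
    and "\<not> (\<forall>p\<in>\<Omega>. partial_z f p = 0)"
  shows "analytic_special_form f \<Omega> \<or>
    (\<forall>A B C. A \<in> sets borel \<and> B \<in> sets borel \<and> C \<in> sets borel \<and>
       A \<subseteq> {0..1} \<and> B \<subseteq> {0..1} \<and> C \<subseteq> {0..1} \<and>
       hausdorff_dim A = ereal \<alpha> \<and> hausdorff_dim B = ereal \<beta> \<and> hausdorff_dim C = ereal \<gamma> \<longrightarrow>
       (\<alpha> + \<beta> + \<gamma> \<le> 2 \<longrightarrow>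
          hausdorff_dim (f ` (A \<times> B \<times> C)) \<ge> ereal (max (\<alpha> + \<beta> + \<gamma> - 1) 0)) \<and>
       (\<alpha> + \<beta> + \<gamma> > 2 \<longrightarrow>
          emeasure lebesgue (f ` (A \<times> B \<times> C)) > 0))"
proof (cases "analytic_special_form f \<Omega>")
  case False
  have pos: "0 < \<alpha>" "\<alpha> \<le> 1" "0 < \<beta>" "\<beta> \<le> 1" "0 < \<gamma>" "\<gamma> \<le> 1" using assms(4-6) by auto
  show ?thesis
  proof (intro disjI2 allI impI; elim conjE)
    fix A B C :: "real set"
    assume borel: "A \<in> sets borel" "B \<in> sets borel" "C \<in> sets borel"
      and sub: "A \<subseteq> {0..1}" "B \<subseteq> {0..1}" "C \<subseteq> {0..1}"
      and dim: "hausdorff_dim A = ereal \<alpha>" "hausdorff_dim B = ereal \<beta>" "hausdorff_dim C = ereal \<gamma>"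
    let ?S = "f ` (A \<times> B \<times> C)"
    have bounds: "\<exists>E \<tau>'. E \<subseteq> ?S \<and> \<tau> < \<tau>' \<and> image_bounds \<tau>' E" if "\<tau> < \<alpha> + \<beta> + \<gamma>" for \<tau>
    proof -
      obtain s t u where stu: "0 < s" "s < \<alpha>" "0 < t" "t < \<beta>" "0 < u" "u < \<gamma>" "\<tau> < s + t + u"
        using exponents_below[OF pos(1,3,5) \<open>\<tau> < \<alpha> + \<beta> + \<gamma>\<close>] .
      have "\<exists>E \<subseteq> ?S. image_bounds (s + t + u) E"
        using stu pos dim
        by (intro image_bounds_if_not_special_form[OF assms(1-3,7) False borel sub]) (auto intro: net_content_pos_if_dim)
      then show ?thesis using stu(7) by blast
    qed
    show "(\<alpha> + \<beta> + \<gamma> \<le> 2 \<longrightarrow> hausdorff_dim ?S \<ge> ereal (max (\<alpha> + \<beta> + \<gamma> - 1) 0)) \<and>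
       (\<alpha> + \<beta> + \<gamma> > 2 \<longrightarrow> emeasure lebesgue ?S > 0)"
    proof (intro conjI impI)
      assume le: "\<alpha> + \<beta> + \<gamma> \<le> 2"
      show "hausdorff_dim ?S \<ge> ereal (max (\<alpha> + \<beta> + \<gamma> - 1) 0)"
        unfolding hausdorff_dim_def
      proof (rule Inf_greatest, clarify)
        fix v :: real assume v: "0 \<le> v" "hausdorff_measure v ?S = 0"
        show "ereal (max (\<alpha> + \<beta> + \<gamma> - 1) 0) \<le> ereal v"
        proof (rule ccontr)
          assume "\<not> ?thesis"
          then have v': "v + 1 < \<alpha> + \<beta> + \<gamma>" using v(1) by (simp add: max_def split: if_splits)
          show False
          proof (cases "v = 0")
            \<comment> \<open>The content comparison needs a positive exponent. For exponent 0
              nonemptiness of the image suffices.\<close>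
            case True
            have "A \<noteq> {}" "B \<noteq> {}" "C \<noteq> {}"
              using net_content_pos_if_dim[OF dim(1), of "\<alpha> / 2"] net_content_pos_if_dim[OF dim(2), of "\<beta> / 2"]
                net_content_pos_if_dim[OF dim(3), of "\<gamma> / 2"] pos net_content_finite[of _ "{}"] by force+
            then show False using hausdorff_measure_0_empty[of ?S] v(2) True by auto
          next
            case False
            then have v0: "0 < v" using v(1) by simp
            obtain E \<tau>' where E: "E \<subseteq> ?S" "v + 1 < \<tau>'" "image_bounds \<tau>' E" using bounds[OF v'] by blast
            have "0 < net_content v E" using E(2,3) v0 v' le unfolding image_bounds_def by auto
            also have "\<dots> \<le> net_content v ?S" using E(1) by (rule net_content_mono)
            also have "\<dots> = 0" using v0 v(2) by (rule net_content_zero_if_hausdorff_zero)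
            finally show False by simp
          qed
        qed
      qed
    next
      assume "\<alpha> + \<beta> + \<gamma> > 2"
      then obtain E \<tau>' where E: "E \<subseteq> ?S" "2 < \<tau>'" "image_bounds \<tau>' E" using bounds by blast
      have comp: "compact E" "0 < emeasure lborel E" using E unfolding image_bounds_def by auto
      have f3: "analytic3 f \<Omega>" using assms(7) by (rule analytic3_if_real_analytic_on)
      let ?Q = "{0..1} \<times> {0..1} \<times> {0..1} :: (real \<times> real \<times> real) set"
      have cont: "continuous_on ?Q f"
        using analytic3_continuous[OF f3] assms(3) by (intro continuous_at_imp_continuous_on) blast
      have "compact (f ` ?Q)" by (intro compact_continuous_image[OF cont] compact_Times compact_Icc)
      then have "emeasure lborel (f ` ?Q) < \<infinity>" "f ` ?Q \<in> sets borel"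
        using emeasure_bounded_finite[OF compact_imp_bounded] borel_compact by auto
      \<comment> \<open>Monotonicity of \<open>emeasure\<close> requires the larger set to be
        measurable, so the compact subset of positive measure alone does not suffice.\<close>
      moreover have "suslin ?S"
        using sub by (intro suslin_image[OF suslin_borel suslin_borel suslin_borel _ _ cont] borel closed_Times) auto
      moreover have "?S \<subseteq> f ` ?Q" using sub by (intro image_mono) auto
      ultimately have meas: "?S \<in> sets lebesgue" by (rule suslin_lebesgue_measurable[rotated 2])
      have "0 < emeasure lebesgue E" using comp borel_compact[OF comp(1)] by (simp add: emeasure_completion)
      also have "\<dots> \<le> emeasure lebesgue ?S" using E(1) meas by (rule emeasure_mono)
      finally show "emeasure lebesgue ?S > 0" .
    qed
  qed
qed simp

end
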